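(* Let $d\ge 1$. Let $W:\mathbb{R}^d\to\mathbb{R}\cup\{\infty\}$ be essentially convex (in particular $W$ satisfies (W0) and (W1)) with $W\ge 0$ on $\mathbb{R}^d$. Let $U:\mathbb{R}^d\to\mathbb{R}$ satisfy (U0), be continuous, and satisfy $\lim_{|\mathbf{x}|\to\infty}U(\mathbf{x})=U_\infty\in\mathbb{R}$. Let the underlying domain $D$ be one of the following: (i) $D=\mathbb{R}^d$; (ii) $D=[x_0,\infty)$ for some $x_0\in\mathbb{R}$, if $d=1$; (iii) $D=\{\mathbf{x}=(x_1,\dots,x_d)\in\mathbb{R}^d: x_d\ge \Phi(\hat{\mathbf{x}})\}$, where $\hat{\mathbf{x}}:=(x_1,\dots,x_{d-1})$ and $\Phi:\mathbb{R}^{d-1}\to\mathbb{R}$ is a continuous function, if $d\ge 2$. Assume there exists $\rho_\sharp\in\mathcal{M}(D)$ that is a compactly supported locally integrable function, such that $\mathrm{supp}\,\rho_\sharp=\bar{\mathcal{S}}$ for some open set $\mathcal{S}$ with $\partial\mathcal{S}$ having zero Lebesgue measure, $W*\rho_\sharp$ is continuous on $\mathbb{R}^d$, and $$\sup_{\mathcal{S}}V[\rho_\sharp]<U_\infty .$$ Then there exists a unique minimizer of $E_{W,U}$ in $\mathcal{M}(D)$, and this minimizer is compactly supported.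
   Context: $\mathcal{M}(\mathbb{R}^d)$ is the set of Borel probability measures on $\mathbb{R}^d$; for closed $D\subset\mathbb{R}^d$, $\mathcal{M}(D)$ is the set of those supported in $D$. A measure is called a locally integrable function if it has a locally integrable density with respect to Lebesgue measure. (W0): $W:\mathbb{R}^d\to\mathbb{R}\cup\{\infty\}$ is locally integrable, bounded from below and lower-semicontinuous, with $W(\mathbf{x})=W(-\mathbf{x})$. (W1): $W$ is continuous on $\mathbb{R}^d\setminus\{0\}$, $W(0)=\lim_{\mathbf{x}\to 0}W(\mathbf{x})\in\mathbb{R}\cup\{\infty\}$, and for any $R>0$ there are constants $C_1(R),C_2(R)$ with $\frac{1}{|B(\mathbf{x};\epsilon)|}\int_{B(\mathbf{x};\epsilon)}W(\mathbf{y})\,d\mathbf{y}\le C_1(R)+C_2(R)W(\mathbf{x})$ for all $|\mathbf{x}|<R$, $0<\epsilon<1$. (U0): $U:\mathbb{R}^d\to\mathbb{R}\cup\{\infty\}$ is locally integrable, bounded from below and lower-semicontinuous. Essentially convex: $W\in C^2(\mathbb{R}^d\setminus\{0\})$ satisfying (W0), (W1) is essentially convex if $\Delta W>0$ on $\mathbb{R}^d\setminus\{0\}$ and, for some $-d<b<\min\{2-d,0\}$ and $-d<a<\min\{2-d,0\}$, $|W|\lesssim|\mathbf{x}|^{b}$, $|\nabla W|\lesssim|\mathbf{x}|^{b-1}$, $|\Delta W|\lesssim|\mathbf{x}|^{b-2}$ for $0<|\mathbf{x}|<1$, and $|W|\lesssim|\mathbf{x}|^{a}$, $|\nabla W|\lesssim|\mathbf{x}|^{a-1}$,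 $|\Delta W|\lesssim|\mathbf{x}|^{a-2}$ for $|\mathbf{x}|\ge1$ (where $\lesssim$ means $\le$ up to a multiplicative constant). Energy: $E_{W,U}[\rho]=\frac12\int\int W(\mathbf{x}-\mathbf{y})\,d\rho(\mathbf{y})\,d\rho(\mathbf{x})+\int U(\mathbf{x})\,d\rho(\mathbf{x})\in\mathbb{R}\cup\{\infty\}$. Generated potential: $V[\rho]=W*\rho+U$, where $(W*\rho)(\mathbf{x})=\int W(\mathbf{x}-\mathbf{y})\,d\rho(\mathbf{y})$. *)

theory Defs
  imports "HOL-Probability.Probability"
begin

(* Integral of a function with values in [-oo,oo]. It is the usual integral whenever the negative
   part has finite integral, e.g. for functions bounded from below and finite measures. *)
definition eintegral :: "'a measure \<Rightarrow> ('a \<Rightarrow> ereal) \<Rightarrow> ereal" where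
  "eintegral M f =
     enn2ereal (\<integral>\<^sup>+ x. e2ennreal (f x) \<partial>M) - enn2ereal (\<integral>\<^sup>+ x. e2ennreal (- f x) \<partial>M)"

definition locally_integrable :: "('a::euclidean_space \<Rightarrow> ereal) \<Rightarrow> bool" where
  "locally_integrable f \<longleftrightarrow> f \<in> borel_measurable borel \<and>
     (\<forall>K. compact K \<longrightarrow> (\<integral>\<^sup>+ x\<in>K. e2ennreal \<bar>f x\<bar> \<partial>lborel) < \<infinity>)"

definition lower_semicontinuous :: "('a::topological_space \<Rightarrow> ereal) \<Rightarrow> bool" where
  "lower_semicontinuous f \<longleftrightarrow> (\<forall>x. f x \<le> Liminf (at x) f)"

(* The real lower bound excludes the value -oo, so f maps into \<real> together with +oo. *)
definition bounded_from_below :: "('a \<Rightarrow> ereal) \<Rightarrow> bool" where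
  "bounded_from_below f \<longleftrightarrow> (\<exists>m::real. \<forall>x. ereal m \<le> f x)"

definition U0 :: "('a::euclidean_space \<Rightarrow> ereal) \<Rightarrow> bool" where
  "U0 U \<longleftrightarrow> locally_integrable U \<and> bounded_from_below U \<and> lower_semicontinuous U"

definition W0 :: "('a::euclidean_space \<Rightarrow> ereal) \<Rightarrow> bool" where
  "W0 W \<longleftrightarrow> locally_integrable W \<and> bounded_from_below W \<and> lower_semicontinuous W \<and>
     (\<forall>x. W x = W (- x))"

definition W1 :: "('a::euclidean_space \<Rightarrow> ereal) \<Rightarrow> bool" where
  "W1 W \<longleftrightarrow> continuous_on (- {0}) W \<and> (W \<longlongrightarrow> W 0) (at 0) \<and>
     (\<forall>R>0. \<exists>C1 C2 :: real. \<forall>x \<epsilon>. norm x < R \<longrightarrow> 0 < \<epsilon> \<longrightarrow> \<epsilon> < 1 \<longrightarrow>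
        eintegral (restrict_space lborel (ball x \<epsilon>)) W / ereal (measure lborel (ball x \<epsilon>))
          \<le> ereal C1 + ereal C2 * W x)"

definition partial_deriv :: "'n::finite \<Rightarrow> (real^'n \<Rightarrow> real) \<Rightarrow> real^'n \<Rightarrow> real" where
  "partial_deriv i f x = frechet_derivative f (at x) (axis i 1)"

definition gradient :: "(real^'n::finite \<Rightarrow> real) \<Rightarrow> real^'n \<Rightarrow> real^'n" where
  "gradient f x = (\<chi> i. partial_deriv i f x)"

definition laplacian :: "(real^'n::finite \<Rightarrow> real) \<Rightarrow> real^'n \<Rightarrow> real" where
  "laplacian f x = (\<Sum>i\<in>UNIV. partial_deriv i (partial_deriv i f) x)"

(* Meaningful for open S only. *)
definition C2_on :: "(real^'n::finite) set \<Rightarrow> (real^'n \<Rightarrow> real) \<Rightarrow> bool" where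
  "C2_on S f \<longleftrightarrow> f differentiable_on S \<and> (\<forall>i. partial_deriv i f differentiable_on S) \<and>
     (\<forall>i j. continuous_on S (partial_deriv j (partial_deriv i f)))"

definition power_bounds :: "(real^'n::finite) set \<Rightarrow> real \<Rightarrow> (real^'n \<Rightarrow> real) \<Rightarrow> bool" where
  "power_bounds S p w \<longleftrightarrow> (\<exists>C::real. \<forall>x\<in>S.
     \<bar>w x\<bar> \<le> C * norm x powr p \<and>
     norm (gradient w x) \<le> C * norm x powr (p - 1) \<and>
     \<bar>laplacian w x\<bar> \<le> C * norm x powr (p - 2))"

definition essentially_convex :: "(real^'n::finite \<Rightarrow> ereal) \<Rightarrow> bool" where
  "essentially_convex W \<longleftrightarrow> W0 W \<and> W1 W \<and>
     (\<exists>w :: real^'n \<Rightarrow> real.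
        (\<forall>x. x \<noteq> 0 \<longrightarrow> W x = ereal (w x)) \<and>
        C2_on (- {0}) w \<and>
        (\<forall>x. x \<noteq> 0 \<longrightarrow> laplacian w x > 0) \<and>
        (\<exists>b. - real CARD('n) < b \<and> b < min (2 - real CARD('n)) 0 \<and>
             power_bounds {x. 0 < norm x \<and> norm x < 1} b w) \<and>
        (\<exists>a. - real CARD('n) < a \<and> a < min (2 - real CARD('n)) 0 \<and>
             power_bounds {x. 1 \<le> norm x} a w))"

definition measure_support :: "'a::topological_space measure \<Rightarrow> 'a set" where
  "measure_support \<rho> = {x. \<forall>A. open A \<longrightarrow> x \<in> A \<longrightarrow> emeasure \<rho> A > 0}"

definition prob_measures_on :: "'a::topological_space set \<Rightarrow> 'a measure set" where
  "prob_measures_on D = {\<rho>. prob_space \<rho> \<and> sets \<rho> = sets borel \<and> measure_support \<rho> \<subseteq> D}"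

definition is_locally_integrable_function :: "'a::euclidean_space measure \<Rightarrow> bool" where
  "is_locally_integrable_function \<rho> \<longleftrightarrow> (\<exists>f :: 'a \<Rightarrow> real. (\<forall>x. 0 \<le> f x) \<and>
     locally_integrable (\<lambda>x. ereal (f x)) \<and> \<rho> = density lborel (\<lambda>x. ennreal (f x)))"

definition potential_conv :: "('a::euclidean_space \<Rightarrow> ereal) \<Rightarrow> 'a measure \<Rightarrow> 'a \<Rightarrow> ereal" where
  "potential_conv W \<rho> x = eintegral \<rho> (\<lambda>y. W (x - y))"

definition generated_potential ::
  "('a::euclidean_space \<Rightarrow> ereal) \<Rightarrow> ('a \<Rightarrow> ereal) \<Rightarrow> 'a measure \<Rightarrow> 'a \<Rightarrow> ereal" where
  "generated_potential W U \<rho> x = potential_conv W \<rho> x + U x"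

definition energy ::
  "('a::euclidean_space \<Rightarrow> ereal) \<Rightarrow> ('a \<Rightarrow> ereal) \<Rightarrow> 'a measure \<Rightarrow> ereal" where
  "energy W U \<rho> =
     ereal (1 / 2) * eintegral \<rho> (\<lambda>x. eintegral \<rho> (\<lambda>y. W (x - y))) + eintegral \<rho> U"

definition is_energy_minimizer ::
  "('a::euclidean_space \<Rightarrow> ereal) \<Rightarrow> ('a \<Rightarrow> ereal) \<Rightarrow> 'a set \<Rightarrow> 'a measure \<Rightarrow> bool" where
  "is_energy_minimizer W U D \<rho> \<longleftrightarrow> \<rho> \<in> prob_measures_on D \<and>
     (\<forall>\<sigma>\<in>prob_measures_on D. energy W U \<rho> \<le> energy W U \<sigma>)"

(* The coordinate index d. *)
definition last_index :: "'n::{finite,linorder}" where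
  "last_index = Max UNIV"

(* The space \<real>^(d-1) of all but the last coordinate is represented by real functions on
   UNIV - {last_index} (extended by undefined) with the product topology. *)
definition hat :: "real^'n::{finite,linorder} \<Rightarrow> 'n \<Rightarrow> real" where
  "hat x = restrict (\<lambda>i. x $ i) (UNIV - {last_index})"

definition hat_space :: "('n::{finite,linorder} \<Rightarrow> real) topology" where
  "hat_space = product_topology (\<lambda>_. euclideanreal) (UNIV - {last_index})"

definition half_line_domain :: "(real^'n::{finite,linorder}) set \<Rightarrow> bool" where
  "half_line_domain D \<longleftrightarrow> CARD('n) = 1 \<and> (\<exists>x\<^sub>0::real. D = {x. x $ last_index \<ge> x\<^sub>0})"

definition epigraph_domain :: "(real^'n::{finite,linorder}) set \<Rightarrow> bool" where
  "epigraph_domain D \<longleftrightarrow> CARD('n) \<ge> 2 \<and>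
     (\<exists>\<Phi>. continuous_map hat_space euclideanreal \<Phi> \<and> D = {x. x $ last_index \<ge> \<Phi> (hat x)})"

end

theory Submission
  imports Defs
begin

text \<open>
The interaction energy is \<open>mutual k \<mu> \<mu> / 2\<close> for a nonnegative kernel k, and two facts about k carry the proof.

The first fact concerns boundedness of minimizers. Let \<mu> be a minimizer on a domain containing the support K of the reference measure \<rho>, and let C be the mean of its generated potential V. No competitor gives V a smaller mean, so V = C holds almost everywhere and U <= C there. To see that C lies strictly below the value of U at infinity, test with an equilibrium measure \<eta> of K. Its potential is a constant L on K up to small errors, and at most L everywhere, by the maximum principle, which holds since k has positive Laplacian off the origin. By symmetry of the interaction, the mean over \<eta> of the potential of \<mu> is at most L, whereas the mean over \<eta> of the potential of \<rho> is L. Therefore C is at most the mean over \<eta> of the potential generated by \<rho> and U, and this is below the value at infinity by assumption on K. So \<mu> lives on a set where U is bounded away from its limit, that is, in a ball independent of the domain (\<open>minimizers_uniformly_bounded\<close>). Equilibrium measures are replaced by approximate ones with bounded densities, obtained from a finite-dimensional complementarity problem (\<open>approximate_equilibrium\<close>).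

Existence follows. Minimizers exist on the parts of D in large balls, by weak compactness and lower semicontinuity (\<open>energy_minimizer_on_compact_exists\<close>); since they all live in one fixed ball, a single one is optimal among boundedly supported measures, and truncation extends this to all measures.

The second fact is strict positive definiteness, which gives uniqueness (\<open>interaction_strictly_positive_definite\<close>). Let \<open>k\<^sub>s\<close> be the convolution of k with the heat kernel at time s. The time derivative of \<open>k\<^sub>s\<close> falls on the heat kernel as a Laplacian; Green's identity moves it to k, after the second difference of the heat kernel has removed the contribution of the origin. So \<open>k\<^sub>s - k\<^sub>T\<close> for s < T is a superposition, with weights given by the positive function \<open>\<Delta>k\<close>, of second differences \<open>2 h(x) - h(x - z) - h(x + z)\<close> of Gaussians h. Each of these is of positive type, being the autocorrelation of a difference of two Gaussians. The energy of \<mu> - \<nu> with respect to \<open>k\<^sub>s\<close> is therefore nonnegative and decreasing in s; if it vanishes for all s, then Gaussian averages of \<mu> - \<nu> along a sequence of widths tending to zero are periodic, hence zero, and \<mu> = \<nu>. Finally s tends to 0: Fatou's lemma treats the mixed energy, and the control of ball averages of the kernel by its point values dominates the self-energies.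
\<close>

section \<open>Weak compactness of probability measures on a compact set\<close>

text \<open>
The first nonzero digit outweighs the tail: the remaining terms add up to at most half of the first one. Hence close values of the series force equal initial digits.
\<close>

lemma ternary_series_first_term_dominates:
  fixes d :: "nat => real"
  assumes le: "!!j. \<bar>d j\<bar> <= 1" and zero: "!!j. j < k ==> d j = 0" and dk: "\<bar>d k\<bar> = 1"
  shows "(1/3)^(Suc k) <= \<bar>\<Sum>j. 2 * (1/3)^(Suc j) * d j\<bar>"
proof -
  have geo: "(%j. 2 * (1/3::real)^(Suc (j + n))) sums ((1/3)^n)" for n
  proof -
    have "(%j. (2 * (1/3::real)^(Suc n)) * (1/3)^j) sums ((2 * (1/3)^(Suc n)) * (1 / (1 - 1/3)))"
      by (intro sums_mult geometric_sums) auto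
    thus ?thesis by (simp add: power_add mult_ac)
  qed
  have summ: "summable (%j. 2 * (1/3::real)^(Suc j) * d j)"
  proof (rule summable_comparison_test[of _ "%j. 2 * (1/3::real)^(Suc j)"])
    show "\<exists>N. \<forall>n\<ge>N. norm (2 * (1/3)^(Suc n) * d n) <= 2 * (1/3::real)^(Suc n)"
      using le by (auto simp: abs_mult intro!: exI[of _ 0] mult_left_le)
    show "summable (%j. 2 * (1/3::real)^(Suc j))" using sums_summable[OF geo[of 0]] by simp
  qed
  have split: "(\<Sum>j. 2 * (1/3)^(Suc j) * d j)
      = (\<Sum>j. 2 * (1/3)^(Suc (j + Suc k)) * d (j + Suc k)) + 2 * (1/3)^(Suc k) * d k"
    by (subst suminf_split_initial_segment[OF summ, of "Suc k"]) (simp add: zero)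
  have summ2: "summable (%j. \<bar>2 * (1/3)^(Suc (j + Suc k)) * d (j + Suc k)\<bar>)"
    by (rule summable_comparison_test[OF _ sums_summable[OF geo[of "Suc k"]]])
       (use le in \<open>auto simp: abs_mult intro!: exI[of _ 0] mult_left_le\<close>)
  have "\<bar>\<Sum>j. 2 * (1/3)^(Suc (j + Suc k)) * d (j + Suc k)\<bar>
      <= (\<Sum>j. \<bar>2 * (1/3)^(Suc (j + Suc k)) * d (j + Suc k)\<bar>)"
    by (rule summable_rabs[OF summ2])
  also have "\<dots> <= (\<Sum>j. 2 * (1/3)^(Suc (j + Suc k)))"
    by (rule suminf_le[OF _ summ2 sums_summable[OF geo[of "Suc k"]]])
       (use le in \<open>auto simp: abs_mult intro!: mult_left_le\<close>)
  also have "\<dots> = (1/3)^(Suc k)" using geo[of "Suc k"] by (simp add: sums_iff)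
  finally have tail: "\<bar>\<Sum>j. 2 * (1/3)^(Suc (j + Suc k)) * d (j + Suc k)\<bar> <= (1/3)^(Suc k)" .
  have "\<bar>2 * (1/3)^(Suc k) * d k\<bar> = 2 * (1/3::real)^(Suc k)" using dk by (simp add: abs_mult)
  with tail split show ?thesis by linarith
qed

text \<open>
The digits of the code of a point record to which balls of a countable family of finite covers with shrinking radii the point belongs. By the preceding estimate the code is injective on K with uniformly continuous inverse, although it is itself merely measurable. It reduces weak compactness on K to weak compactness on the line.
\<close>

lemma compact_ternary_code:
  fixes K :: "'a::euclidean_space set"
  assumes "compact K"
  obtains c :: "'a => real" where "c \<in> borel_measurable borel" "!!x. 0 <= c x & c x <= 1"
    "!!\<epsilon>. \<epsilon> > 0 ==> \<exists>\<delta>>0. \<forall>x\<in>K. \<forall>y\<in>K. \<bar>c x - c y\<bar> < \<delta> --> dist x y < \<epsilon>"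
proof -
  have tb: "\<forall>e>0. \<exists>F. finite F & K \<subseteq> (\<Union>x\<in>F. ball x e)"
    using compact_eq_totally_bounded[of K] assms by blast
  have "\<exists>F. finite F & K \<subseteq> (\<Union>x\<in>F. ball x (1 / real (Suc m)))" for m
  proof -
    have "0 < 1 / real (Suc m)" by simp
    with tb show ?thesis by blast
  qed
  then obtain F where F: "!!m. finite (F m)" "!!m. K \<subseteq> (\<Union>x\<in>F m. ball x (1 / real (Suc m)))" by metis
  define \<B> where "\<B> = insert {} (\<Union>m. (%x. ball x (1 / real (Suc m))) ` F m)"
  have "countable \<B>" unfolding \<B>_def
    by (rule countable_insert, rule countable_UN[OF countableI_type], rule countable_image, rule countable_finite, rule F)
  have "\<B> ~= {}" by (simp add: \<B>_def)
  define B where "B = from_nat_into \<B>"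
  have rB: "range B = \<B>" unfolding B_def using \<open>countable \<B>\<close> \<open>\<B> ~= {}\<close> by (simp add: range_from_nat_into)
  have B_open: "open (B k)" for k
  proof -
    have "B k \<in> \<B>" using rB by blast
    thus ?thesis unfolding \<B>_def by auto
  qed
  have B_meas[measurable]: "B k \<in> sets borel" for k using B_open by simp
  define a where "a x k = (indicator (B k) x :: real)" for x k
  define c where "c x = (\<Sum>k. 2 * (1/3)^(Suc k) * a x k)" for x
  have geo: "(%j. 2 * (1/3::real)^(Suc j)) sums 1"
    using sums_mult[OF geometric_sums[of "1/3::real"], of "2/3"] by (simp add: mult_ac)
  have summ: "summable (%k. 2 * (1/3)^(Suc k) * a x k)" for x
    by (rule summable_comparison_test[OF _ sums_summable[OF geo]])
       (auto simp: abs_mult a_def intro!: exI[of _ 0] mult_left_le)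
  have meas: "c \<in> borel_measurable borel"
    unfolding c_def a_def by measurable
  have range01: "0 <= c x & c x <= 1" for x
  proof
    show "0 <= c x" unfolding c_def by (intro suminf_nonneg summ) (auto simp: a_def)
    have "c x <= (\<Sum>k. 2 * (1/3)^(Suc k))" unfolding c_def
      by (intro suminf_le summ sums_summable[OF geo]) (auto simp: a_def indicator_def)
    thus "c x <= 1" using geo by (simp add: sums_iff)
  qed
  have agree: "x \<in> B k \<longleftrightarrow> y \<in> B k" if "\<bar>c x - c y\<bar> < (1/3)^(Suc n)" "k <= n" for x y k n
  proof (rule ccontr)
    assume "\<not> (x \<in> B k \<longleftrightarrow> y \<in> B k)"
    hence ex: "\<exists>k\<le>n. a x k ~= a y k" using that(2) by (auto simp: a_def indicator_def)
    define m where "m = (LEAST k. a x k ~= a y k)"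
    have m: "a x m ~= a y m" "m <= n" "!!j. j < m ==> a x j = a y j"
    proof -
      show "a x m ~= a y m" unfolding m_def using ex LeastI_ex[of "%k. a x k ~= a y k"] by blast
      obtain i where i: "i <= n" "a x i ~= a y i" using ex by blast
      have "m <= i" unfolding m_def by (rule Least_le) (rule i)
      with i show "m <= n" by simp
      show "a x j = a y j" if "j < m" for j using not_less_Least that unfolding m_def by blast
    qed
    have "(1/3)^(Suc m) <= \<bar>\<Sum>j. 2 * (1/3)^(Suc j) * (a x j - a y j)\<bar>"
      using m by (intro ternary_series_first_term_dominates) (auto simp: a_def indicator_def split: if_splits)
    also have "(\<Sum>j. 2 * (1/3)^(Suc j) * (a x j - a y j)) = c x - c y"
      by (simp only: c_def suminf_diff[OF summ summ] right_diff_distrib)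
    finally have "(1/3)^(Suc m) < (1/3::real)^(Suc n)" using that(1) by linarith
    moreover have "(1/3::real)^(Suc n) <= (1/3)^(Suc m)" using m(2) by (intro power_decreasing) auto
    ultimately show False by linarith
  qed
  have "\<exists>\<delta>>0. \<forall>x\<in>K. \<forall>y\<in>K. \<bar>c x - c y\<bar> < \<delta> --> dist x y < \<epsilon>" if "\<epsilon> > 0" for \<epsilon>
  proof -
    obtain m where m: "2 / real (Suc m) < \<epsilon>"
      using reals_Archimedean[of "\<epsilon>/2"] \<open>\<epsilon> > 0\<close> by (auto simp: field_simps)
    define G where "G = (%x. ball x (1 / real (Suc m))) ` F m"
    have "finite G" "G \<subseteq> range B" unfolding G_def rB \<B>_def using F(1) by auto
    then obtain N where N: "finite N" "G = B ` N" by (meson finite_subset_image)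
    obtain n where n: "!!k. k \<in> N ==> k <= n" using N(1) by (metis Max_ge)
    show ?thesis
    proof (intro exI[of _ "(1/3)^(Suc n)"] conjI ballI impI)
      fix x y assume xy: "x \<in> K" "y \<in> K" and lt: "\<bar>c x - c y\<bar> < (1/3)^(Suc n)"
      obtain z where z: "z \<in> F m" "x \<in> ball z (1 / real (Suc m))" using F(2) xy by blast
      hence "ball z (1 / real (Suc m)) \<in> G" by (auto simp: G_def)
      then obtain k where k: "k \<in> N" "ball z (1 / real (Suc m)) = B k" using N by auto
      have "y \<in> ball z (1 / real (Suc m))" using agree[OF lt n[OF k(1)]] z(2) unfolding k(2) by blast
      hence "dist x y < 1 / real (Suc m) + 1 / real (Suc m)"
        using z dist_triangle3[of x y z] by (auto simp: )
      thus "dist x y < \<epsilon>" using m by simp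
    qed simp
  qed
  with meas range01 show thesis by (intro that) auto
qed

text \<open>
The images of the measures under the code live on a bounded interval, so a subsequence converges weakly on the line. The uniformly continuous inverse of the code extends to the closure of the set of codes and carries the limit back to K.
\<close>

theorem weak_compactness_on_compact:
  fixes K :: "'a::euclidean_space set" and \<mu> :: "nat => 'a measure"
  assumes K: "compact K" and prob: "!!n. prob_space (\<mu> n)" and sets: "!!n. sets (\<mu> n) = sets borel"
    and conc: "!!n. AE x in \<mu> n. x \<in> K"
  obtains r \<nu> where "strict_mono (r::nat => nat)" "prob_space \<nu>" "sets \<nu> = sets borel" "AE x in \<nu>. x \<in> K"
    "!!f::'a => real. continuous_on K f ==> f \<in> borel_measurable borel ==> (%n. \<integral>x. f x \<partial>\<mu> (r n)) \<longlonglongrightarrow> (\<integral>x. f x \<partial>\<nu>)"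
proof -
  have K_ne: "K ~= {}"
  proof
    assume "K = {}"
    hence "AE x in \<mu> 0. False" using conc[of 0] by simp
    thus False using prob_space.AE_False[OF prob[of 0]] by simp
  qed
  then obtain k0 where k0: "k0 \<in> K" by blast
  obtain c :: "'a => real" where c_meas[measurable]: "c \<in> borel_measurable borel" and c01: "!!x. 0 <= c x & c x <= 1"
    and c_inv: "!!\<epsilon>. \<epsilon> > 0 ==> \<exists>\<delta>>0. \<forall>x\<in>K. \<forall>y\<in>K. \<bar>c x - c y\<bar> < \<delta> --> dist x y < \<epsilon>"
    using compact_ternary_code[OF K] by blast
  have inj: "inj_on c K"
  proof (rule inj_onI, rule ccontr)
    fix x y assume "x \<in> K" "y \<in> K" "c x = c y" "x ~= y"
    thus False using c_inv[of "dist x y"] by force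
  qed
  define h where "h = inv_into K c"
  have hc: "h (c x) = x" if "x \<in> K" for x using that inj by (simp add: h_def)
  have uc: "uniformly_continuous_on (c ` K) h"
    unfolding uniformly_continuous_on_def
  proof (intro allI impI)
    fix \<epsilon> :: real assume "\<epsilon> > 0"
    then obtain \<delta> where "\<delta> > 0" "\<forall>x\<in>K. \<forall>y\<in>K. \<bar>c x - c y\<bar> < \<delta> --> dist x y < \<epsilon>" using c_inv by blast
    thus "\<exists>d>0. \<forall>x\<in>c ` K. \<forall>x'\<in>c ` K. dist x' x < d --> dist (h x') (h x) < \<epsilon>"
      by (intro exI[of _ \<delta>]) (auto simp: hc dist_real_def)
  qed
  obtain g where g: "uniformly_continuous_on (closure (c ` K)) g" "!!t. t \<in> c ` K ==> h t = g t"
    by (rule uniformly_continuous_on_extension_on_closure[OF uc]) (rule that, assumption, blast)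
  define T where "T = closure (c ` K)"
  have T_closed: "closed T" and T_ne: "T ~= {}" using K_ne by (auto simp: T_def)
  have T_meas[measurable]: "T \<in> sets borel" using T_closed by simp
  have g_cont: "continuous_on T g" using g(1) by (simp add: T_def uniformly_continuous_imp_continuous)
  have gc: "g (c x) = x" if "x \<in> K" for x using g(2)[of "c x"] hc that by simp
  have g_K: "g t \<in> K" if "t \<in> T" for t
  proof -
    have "g ` closure (c ` K) \<subseteq> closure (g ` c ` K)"
    proof (rule image_closure_subset)
      show "g ` c ` K \<subseteq> closure (g ` c ` K)" by (rule closure_subset)
    qed (use g_cont T_def in auto)
    also have "g ` c ` K = K" using gc by force
    finally show ?thesis using that K T_def by (auto simp: compact_imp_closed)
  qed
  define \<nu>\<^sub>n where "\<nu>\<^sub>n n = distr (\<mu> n) borel c" for n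
  have c_meas': "c \<in> borel_measurable (\<mu> n)" for n using c_meas measurable_cong_sets[OF sets refl] by blast
  have rd: "real_distribution (\<nu>\<^sub>n n)" for n
    unfolding \<nu>\<^sub>n_def using prob_space.real_distribution_distr[OF prob c_meas'] .
  have "tight \<nu>\<^sub>n" unfolding tight_def
  proof (intro conjI allI impI rd)
    fix \<epsilon> :: real assume "\<epsilon> > 0"
    have "measure (\<nu>\<^sub>n n) {-1<..1} = 1" for n
    proof -
      have *: "c -` {-1<..1} \<inter> space (\<mu> n) = space (\<mu> n)" using c01 by (force simp: )
      show ?thesis unfolding \<nu>\<^sub>n_def
        by (subst measure_distr[OF c_meas']) (use * prob_space.prob_space[OF prob] in auto)
    qed
    thus "\<exists>a b. a < b & (\<forall>n. 1 - \<epsilon> < measure (\<nu>\<^sub>n n) {a<..b})"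
      using \<open>\<epsilon> > 0\<close> by (intro exI[of _ "-1"] exI[of _ 1]) auto
  qed
  from tight_imp_convergent_subsubsequence[OF this strict_mono_id]
  obtain r \<eta> where r: "strict_mono r" and \<eta>: "real_distribution \<eta>" and "weak_conv_m (\<nu>\<^sub>n \<circ> id \<circ> r) \<eta>" by blast
  hence wc: "weak_conv_m (%n. \<nu>\<^sub>n (r n)) \<eta>" by (simp add: comp_def)
  interpret \<eta>: real_distribution \<eta> by fact
  have conv: "(%n. \<integral>t. F t \<partial>\<nu>\<^sub>n (r n)) \<longlonglongrightarrow> (\<integral>t. F t \<partial>\<eta>)"
    if "continuous_on UNIV F" "!!t. \<bar>F t\<bar> <= B" for F :: "real => real" and B
    using weak_conv_imp_integral_bdd_continuous_conv[OF rd \<eta> wc, of F B] that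
    by (auto simp: continuous_on_eq_continuous_at)
  have \<nu>n_int: "(\<integral>t. F t \<partial>\<nu>\<^sub>n n) = (\<integral>x. F (c x) \<partial>\<mu> n)" if "F \<in> borel_measurable borel" for F :: "real => real" and n
    unfolding \<nu>\<^sub>n_def by (rule integral_distr[OF c_meas' that])
  \<comment> \<open>The limit does not charge the complement of the closed set of codes.\<close>
  have \<eta>_T: "AE t in \<eta>. t \<in> T"
  proof -
    define F where "F t = min 1 (infdist t T)" for t
    have F_cont: "continuous_on UNIV F" unfolding F_def by (intro continuous_intros)
    have F_meas[measurable]: "F \<in> borel_measurable borel" using F_cont by (rule borel_measurable_continuous_onI)
    have F_bd: "\<bar>F t\<bar> <= 1" "0 <= F t" for t unfolding F_def using infdist_nonneg[of t T] by (auto simp: min_def)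
    have "(\<integral>t. F t \<partial>\<nu>\<^sub>n (r n)) = 0" for n
    proof -
      have "(\<integral>x. F (c x) \<partial>\<mu> (r n)) = (\<integral>x. 0 \<partial>\<mu> (r n))"
      proof (rule integral_cong_AE)
        show "AE x in \<mu> (r n). F (c x) = 0"
          using conc[of "r n"]
        proof eventually_elim
          case (elim x)
          hence "c x \<in> T" using closure_subset[of "c ` K"] by (auto simp: T_def)
          thus ?case by (simp add: F_def)
        qed
      qed (use c_meas' in \<open>auto intro: measurable_compose[OF _ F_meas]\<close>)
      thus ?thesis by (simp add: \<nu>n_int)
    qed
    hence "(%n::nat. 0::real) \<longlonglongrightarrow> (\<integral>t. F t \<partial>\<eta>)" using conv[OF F_cont F_bd(1)] by simp
    hence "(\<integral>t. F t \<partial>\<eta>) = 0" using LIMSEQ_unique tendsto_const by metis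
    moreover have "integrable \<eta> F"
      by (rule \<eta>.integrable_const_bound[of _ 1]) (use F_bd in auto)
    ultimately have "AE t in \<eta>. F t = 0"
      using integral_nonneg_eq_0_iff_AE[of \<eta> F] F_bd(2) by auto
    thus ?thesis
    proof eventually_elim
      case (elim t)
      hence "infdist t T = 0" by (auto simp: F_def min_def split: if_splits)
      thus ?case using in_closed_iff_infdist_zero[OF T_closed T_ne] by simp
    qed
  qed
  define G where "G t = (if t \<in> T then g t else k0)" for t
  have G_meas[measurable]: "G \<in> borel_measurable borel" unfolding G_def
    by (rule borel_measurable_continuous_on_if[OF T_meas g_cont]) auto
  have G_K: "G t \<in> K" for t using g_K k0 by (auto simp: G_def)
  have G_meas': "G \<in> borel_measurable \<eta>" using G_meas by (simp add: measurable_def)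
  define \<nu> where "\<nu> = distr \<eta> borel G"
  have "prob_space \<nu>" unfolding \<nu>_def by (rule \<eta>.prob_space_distr[OF G_meas'])
  moreover have "sets \<nu> = sets borel" by (simp add: \<nu>_def)
  moreover have "AE x in \<nu>. x \<in> K"
    unfolding \<nu>_def by (subst AE_distr_iff[OF G_meas']) (use G_K K in \<open>auto simp: compact_imp_closed\<close>)
  moreover have "(%n. \<integral>x. f x \<partial>\<mu> (r n)) \<longlonglongrightarrow> (\<integral>x. f x \<partial>\<nu>)"
    if f: "continuous_on K f" and f_meas[measurable]: "f \<in> borel_measurable borel" for f :: "'a => real"
  proof -
    have "bounded (f ` K)" using compact_continuous_image[OF f K] compact_imp_bounded by blast
    then obtain B where B: "!!x. x \<in> K ==> \<bar>f x\<bar> <= B" by (auto simp: bounded_iff)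
    have B0: "0 <= B" using B[OF k0] by linarith
    have fg: "continuous_on T (%t. f (g t))"
      using continuous_on_compose2[OF f g_cont] g_K by blast
    obtain F where F: "continuous_on UNIV F" "!!t. t \<in> T ==> F t = f (g t)" "!!t. norm (F t) <= B"
      by (rule Tietze[OF fg, of UNIV B]) (use T_closed B g_K B0 in auto)
    have F_meas[measurable]: "F \<in> borel_measurable borel" using F(1) by (rule borel_measurable_continuous_onI)
    have 1: "(\<integral>x. f x \<partial>\<mu> n) = (\<integral>t. F t \<partial>\<nu>\<^sub>n n)" for n
    proof -
      have "(\<integral>x. f x \<partial>\<mu> n) = (\<integral>x. F (c x) \<partial>\<mu> n)"
      proof (rule integral_cong_AE)
        show "f \<in> borel_measurable (\<mu> n)" using f_meas measurable_cong_sets[OF sets refl] by blast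
        show "(%x. F (c x)) \<in> borel_measurable (\<mu> n)" by (rule measurable_compose[OF c_meas' F_meas])
        show "AE x in \<mu> n. f x = F (c x)" using conc[of n]
        proof eventually_elim
          case (elim x)
          hence "c x \<in> T" using closure_subset[of "c ` K"] by (auto simp: T_def)
          thus ?case using F(2) gc[OF elim] by simp
        qed
      qed
      thus ?thesis by (simp add: \<nu>n_int)
    qed
    have 2: "(\<integral>x. f x \<partial>\<nu>) = (\<integral>t. F t \<partial>\<eta>)"
    proof -
      have "(\<integral>x. f x \<partial>\<nu>) = (\<integral>t. f (G t) \<partial>\<eta>)" unfolding \<nu>_def by (rule integral_distr[OF G_meas' f_meas])
      also have "\<dots> = (\<integral>t. F t \<partial>\<eta>)"
      proof (rule integral_cong_AE)
        show "(%t. f (G t)) \<in> borel_measurable \<eta>" by (rule measurable_compose[OF G_meas' f_meas])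
        show "AE t in \<eta>. f (G t) = F t" using \<eta>_T by eventually_elim (auto simp: G_def F(2))
      qed auto
      finally show ?thesis .
    qed
    show ?thesis unfolding 1 2 by (rule conv[OF F(1)]) (use F(3) in auto)
  qed
  ultimately show thesis using r by (intro that) auto
qed

section \<open>Potentials and mutual energies\<close>

text \<open>
Energies are built from kernels with values in the extended nonnegative reals, so that no integrability has to be tracked: the potential k * \<mu>, and below the mutual energy of two measures.
\<close>

definition pot :: "('a::euclidean_space => ennreal) => 'a measure => 'a => ennreal" where
  "pot k \<mu> x = (\<integral>\<^sup>+y. k (x - y) \<partial>\<mu>)"

definition mutual :: "('a::euclidean_space => ennreal) => 'a measure => 'a measure => ennreal" where
  "mutual k \<mu> \<nu> = (\<integral>\<^sup>+x. pot k \<mu> x \<partial>\<nu>)"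

definition borel_prob :: "'a::topological_space measure => bool" where
  "borel_prob \<mu> \<longleftrightarrow> prob_space \<mu> & sets \<mu> = sets borel"

lemma borel_probD: "borel_prob \<mu> ==> prob_space \<mu>" "borel_prob \<mu> ==> sets \<mu> = sets borel"
  "borel_prob \<mu> ==> sigma_finite_measure \<mu>" "borel_prob \<mu> ==> space \<mu> = UNIV"
  by (auto simp: borel_prob_def prob_space_imp_sigma_finite dest: sets_eq_imp_space_eq)

lemma borel_prob_meas: "borel_prob \<mu> ==> f \<in> borel_measurable borel ==> f \<in> borel_measurable \<mu>"
  using measurable_cong_sets[OF borel_probD(2) refl] by blast

lemma pot_measurable:
  fixes k :: "'a::euclidean_space => ennreal"
  assumes [measurable]: "k \<in> borel_measurable borel" and "sigma_finite_measure \<mu>" and [measurable_cong]: "sets \<mu> = sets borel"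
  shows "pot k \<mu> \<in> borel_measurable borel"
proof -
  interpret sigma_finite_measure \<mu> by fact
  have "(%x. \<integral>\<^sup>+y. k (x - y) \<partial>\<mu>) \<in> borel_measurable borel" by measurable
  thus ?thesis by (simp add: pot_def[abs_def])
qed

lemma mutual_sym:
  fixes k :: "'a::euclidean_space => ennreal"
  assumes [measurable]: "k \<in> borel_measurable borel" and even: "!!x. k (- x) = k x"
    and "sigma_finite_measure \<mu>" and [measurable_cong]: "sets \<mu> = sets borel"
    and "sigma_finite_measure \<nu>" and [measurable_cong]: "sets \<nu> = sets borel"
  shows "mutual k \<mu> \<nu> = mutual k \<nu> \<mu>"
proof -
  interpret pair_sigma_finite \<mu> \<nu> using assms by (simp add: pair_sigma_finite_def)
  have eq: "k (x - y) = k (y - x)" for x y using even[of "x - y"] by simp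
  have "mutual k \<mu> \<nu> = (\<integral>\<^sup>+x. \<integral>\<^sup>+y. k (x - y) \<partial>\<mu> \<partial>\<nu>)" by (simp add: mutual_def pot_def)
  also have "\<dots> = (\<integral>\<^sup>+y. \<integral>\<^sup>+x. k (x - y) \<partial>\<nu> \<partial>\<mu>)"
    by (rule Fubini'[of "%y x. k (x - y)"]) measurable
  also have "\<dots> = mutual k \<nu> \<mu>" by (simp add: mutual_def pot_def eq)
  finally show ?thesis .
qed

section \<open>Mixtures\<close>

text \<open>
The convex combination (1 - t) \<mu> + t \<nu>, written as a two-stage random choice, which makes all integrals against it instances of the integral of a monadic bind.
\<close>

definition mixture :: "real => 'a::topological_space measure => 'a measure => 'a measure" where
  "mixture t \<mu> \<nu> = measure_pmf (bernoulli_pmf t) \<bind> (%b. if b then \<nu> else \<mu>)"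

lemma mixture_kernel:
  assumes "borel_prob \<mu>" "borel_prob \<nu>"
  shows "(%b. if b then \<nu> else \<mu>) \<in> measure_pmf (bernoulli_pmf t) \<rightarrow>\<^sub>M subprob_algebra borel"
  using assms by (auto simp: space_subprob_algebra borel_prob_def prob_space_imp_subprob_space)

lemma nn_integral_mixture:
  assumes "borel_prob \<mu>" "borel_prob \<nu>" "0 <= t" "t <= 1" "f \<in> borel_measurable borel"
  shows "(\<integral>\<^sup>+x. f x \<partial>mixture t \<mu> \<nu>) = ennreal (1 - t) * (\<integral>\<^sup>+x. f x \<partial>\<mu>) + ennreal t * (\<integral>\<^sup>+x. f x \<partial>\<nu>)"
  unfolding mixture_def using assms
  by (subst nn_integral_bind[OF assms(5) mixture_kernel[OF assms(1,2)]]) (auto simp: mult.commute add.commute)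

lemma sets_mixture: "borel_prob \<mu> ==> borel_prob \<nu> ==> sets (mixture t \<mu> \<nu>) = sets borel"
  unfolding mixture_def by (rule sets_bind) (auto simp: borel_prob_def)

lemma emeasure_mixture:
  assumes "borel_prob \<mu>" "borel_prob \<nu>" "0 <= t" "t <= 1" "A \<in> sets borel"
  shows "emeasure (mixture t \<mu> \<nu>) A = ennreal (1 - t) * emeasure \<mu> A + ennreal t * emeasure \<nu> A"
  using nn_integral_mixture[OF assms(1-4), of "indicator A"] assms
  by (simp add: sets_mixture borel_probD(2))

lemma borel_prob_mixture:
  assumes "borel_prob \<mu>" "borel_prob \<nu>" "0 <= t" "t <= 1"
  shows "borel_prob (mixture t \<mu> \<nu>)"
  unfolding borel_prob_def
proof
  show s: "sets (mixture t \<mu> \<nu>) = sets borel" using assms by (simp add: sets_mixture)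
  have "emeasure (mixture t \<mu> \<nu>) UNIV = ennreal (1 - t) + ennreal t"
    using emeasure_mixture[OF assms, of UNIV] assms(1,2)
    by (metis borel_probD(1,4) mult.right_neutral prob_space.emeasure_space_1 sets.top space_borel)
  also have "\<dots> = 1" using assms by (simp flip: ennreal_plus)
  finally show "prob_space (mixture t \<mu> \<nu>)"
    using sets_eq_imp_space_eq[OF s] by (intro prob_spaceI) simp
qed

lemma AE_mixture:
  assumes "borel_prob \<mu>" "borel_prob \<nu>" "0 <= t" "t <= 1" "A \<in> sets borel"
    "AE x in \<mu>. x \<in> A" "AE x in \<nu>. x \<in> A"
  shows "AE x in mixture t \<mu> \<nu>. x \<in> A"
proof (rule AE_I[of _ _ "- A"])
  have "emeasure \<mu> (- A) = 0" "emeasure \<nu> (- A) = 0"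
    using AE_iff_measurable[of "-A" \<mu> "%x. x \<in> A"] AE_iff_measurable[of "-A" \<nu> "%x. x \<in> A"] assms
    by (auto simp: borel_probD)
  thus "emeasure (mixture t \<mu> \<nu>) (- A) = 0" using assms by (subst emeasure_mixture) auto
qed (use assms in \<open>auto simp: sets_mixture\<close>)

lemma integral_mixture:
  fixes f :: "'a::topological_space => real"
  assumes "borel_prob \<mu>" "borel_prob \<nu>" "0 <= t" "t <= 1" "f \<in> borel_measurable borel" and bd: "!!x. \<bar>f x\<bar> <= B"
  shows "(\<integral>x. f x \<partial>mixture t \<mu> \<nu>) = (1 - t) * (\<integral>x. f x \<partial>\<mu>) + t * (\<integral>x. f x \<partial>\<nu>)"
proof -
  \<comment> \<open>Shift the bounded integrand so that it becomes nonnegative.\<close>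
  have key: "ennreal ((\<integral>x. f x \<partial>\<mu>) + B) = (\<integral>\<^sup>+x. ennreal (f x + B) \<partial>\<mu>)" "0 <= (\<integral>x. f x \<partial>\<mu>) + B"
    if m: "borel_prob \<mu>" for \<mu>
  proof -
    interpret prob_space \<mu> using m by (rule borel_probD)
    have fm: "f \<in> borel_measurable \<mu>" using borel_prob_meas[OF m assms(5)] .
    have i: "integrable \<mu> f" by (rule integrable_const_bound[of _ B]) (use bd fm in auto)
    have pos: "0 <= f x + B" for x using bd[of x] by linarith
    have eq: "(\<integral>x. f x + B \<partial>\<mu>) = (\<integral>x. f x \<partial>\<mu>) + B" using i by (simp add: prob_space)
    show "ennreal ((\<integral>x. f x \<partial>\<mu>) + B) = (\<integral>\<^sup>+x. ennreal (f x + B) \<partial>\<mu>)"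
      using nn_integral_eq_integral[of \<mu> "%x. f x + B"] i pos eq by simp
    show "0 <= (\<integral>x. f x \<partial>\<mu>) + B" unfolding eq[symmetric] by (rule Bochner_Integration.integral_nonneg) (rule pos)
  qed
  have [measurable]: "f \<in> borel_measurable borel" by fact
  have bp: "borel_prob (mixture t \<mu> \<nu>)" using assms borel_prob_mixture by blast
  have "ennreal ((\<integral>x. f x \<partial>mixture t \<mu> \<nu>) + B) = ennreal (1 - t) * (\<integral>\<^sup>+x. ennreal (f x + B) \<partial>\<mu>) + ennreal t * (\<integral>\<^sup>+x. ennreal (f x + B) \<partial>\<nu>)"
    by (subst key(1)[OF bp], rule nn_integral_mixture[OF assms(1-4)]) measurable
  also have "\<dots> = ennreal ((1 - t) * ((\<integral>x. f x \<partial>\<mu>) + B) + t * ((\<integral>x. f x \<partial>\<nu>) + B))"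
    unfolding key(1)[OF assms(1), symmetric] key(1)[OF assms(2), symmetric] using assms(3,4) key(2)[OF assms(1)] key(2)[OF assms(2)]
    by (simp add: ennreal_mult)
  finally have "(\<integral>x. f x \<partial>mixture t \<mu> \<nu>) + B = (1 - t) * ((\<integral>x. f x \<partial>\<mu>) + B) + t * ((\<integral>x. f x \<partial>\<nu>) + B)"
    by (subst (asm) ennreal_inj) (use key(2)[OF bp] key(2)[OF assms(1)] key(2)[OF assms(2)] assms(3,4) in auto)
  thus ?thesis by (simp add: algebra_simps)
qed

lemma mutual_mixture_left:
  fixes k :: "'a::euclidean_space => ennreal"
  assumes k[measurable]: "k \<in> borel_measurable borel" and m: "borel_prob \<mu>" "borel_prob \<nu>" "0 <= t" "t <= 1" "borel_prob \<sigma>"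
  shows "mutual k (mixture t \<mu> \<nu>) \<sigma> = ennreal (1 - t) * mutual k \<mu> \<sigma> + ennreal t * mutual k \<nu> \<sigma>"
proof -
  have "pot k \<mu> \<in> borel_measurable \<sigma>" "pot k \<nu> \<in> borel_measurable \<sigma>"
    using m by (auto intro!: borel_prob_meas[OF m(5)] pot_measurable[OF k] dest: borel_probD)
  moreover have "pot k (mixture t \<mu> \<nu>) x = ennreal (1 - t) * pot k \<mu> x + ennreal t * pot k \<nu> x" for x
    unfolding pot_def by (rule nn_integral_mixture[OF m(1-4)]) measurable
  ultimately show ?thesis by (simp add: mutual_def nn_integral_add nn_integral_cmult)
qed

lemma mutual_mixture:
  fixes k :: "'a::euclidean_space => ennreal"
  assumes k: "k \<in> borel_measurable borel" and even: "!!x. k (- x) = k x"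
    and m: "borel_prob \<mu>" "borel_prob \<nu>" "0 <= t" "t <= 1"
  shows "mutual k (mixture t \<mu> \<nu>) (mixture t \<mu> \<nu>) =
    ennreal ((1 - t)^2) * mutual k \<mu> \<mu> + ennreal (2 * t * (1 - t)) * mutual k \<mu> \<nu> + ennreal (t^2) * mutual k \<nu> \<nu>"
proof -
  have bp: "borel_prob (mixture t \<mu> \<nu>)" using m by (rule borel_prob_mixture)
  have sym: "mutual k \<alpha> \<beta> = mutual k \<beta> \<alpha>" if "borel_prob \<alpha>" "borel_prob \<beta>" for \<alpha> \<beta>
    using that by (intro mutual_sym k even borel_probD)
  have "mutual k (mixture t \<mu> \<nu>) (mixture t \<mu> \<nu>) =
      ennreal (1 - t) * (ennreal (1 - t) * mutual k \<mu> \<mu> + ennreal t * mutual k \<nu> \<mu>) +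
      ennreal t * (ennreal (1 - t) * mutual k \<mu> \<nu> + ennreal t * mutual k \<nu> \<nu>)"
    by (simp only: mutual_mixture_left[OF k m bp] sym[OF m(1) bp] sym[OF m(2) bp] mutual_mixture_left[OF k m m(1)] mutual_mixture_left[OF k m m(2)])
  also have "\<dots> = ennreal (1 - t) * ennreal (1 - t) * mutual k \<mu> \<mu> +
      (ennreal (1 - t) * ennreal t + ennreal t * ennreal (1 - t)) * mutual k \<mu> \<nu> + ennreal t * ennreal t * mutual k \<nu> \<nu>"
    unfolding sym[OF m(2,1)] by (simp add: algebra_simps)
  also have "ennreal (1 - t) * ennreal (1 - t) = ennreal ((1 - t)^2)"
    using m by (auto simp: power2_eq_square ennreal_mult')
  also have "ennreal t * ennreal t = ennreal (t^2)"
    using m by (auto simp: power2_eq_square ennreal_mult')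
  also have "ennreal (1 - t) * ennreal t + ennreal t * ennreal (1 - t) = ennreal (2 * t * (1 - t))"
    using m by (simp flip: ennreal_mult' ennreal_plus)
  finally show ?thesis .
qed

section \<open>Existence of energy minimizers on compact sets\<close>

definition ext_energy :: "('a::euclidean_space => ennreal) => ('a => real) => 'a measure => ereal" where
  "ext_energy k U \<mu> = ereal (1/2) * enn2ereal (mutual k \<mu> \<mu>) + ereal (\<integral>x. U x \<partial>\<mu>)"

text \<open>
The potentials of the measures converge pointwise and are equicontinuous, hence converge uniformly on K; this allows both arguments of the double integral to move at once.
\<close>

lemma weak_convergence_product:
  fixes g :: "'a::euclidean_space => real" and K :: "'a set"
  assumes K: "compact K" and g: "continuous_on UNIV g"
    and m: "!!n. borel_prob (\<mu> n)" "!!n. AE x in \<mu> n. x \<in> K" "borel_prob \<nu>" "AE x in \<nu>. x \<in> K"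
    and conv: "!!f::'a => real. continuous_on K f ==> f \<in> borel_measurable borel ==> (%n. \<integral>x. f x \<partial>\<mu> n) \<longlonglongrightarrow> (\<integral>x. f x \<partial>\<nu>)"
    and bd: "!!x. \<bar>g x\<bar> <= B"
  shows "(%n. \<integral>x. \<integral>y. g (x - y) \<partial>\<mu> n \<partial>\<mu> n) \<longlonglongrightarrow> (\<integral>x. \<integral>y. g (x - y) \<partial>\<nu> \<partial>\<nu>)"
proof -
  define F where "F \<sigma> x = (\<integral>y. g (x - y) \<partial>\<sigma>)" for \<sigma> x
  have gm[measurable]: "g \<in> borel_measurable borel" using g by (rule borel_measurable_continuous_onI)
  have gi: "integrable \<sigma> (%y. g (x - y))" if "borel_prob \<sigma>" for \<sigma> x
  proof -
    interpret prob_space \<sigma> using that by (rule borel_probD)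
    show ?thesis
      by (rule integrable_const_bound[of _ B]) (use bd in \<open>auto intro!: borel_prob_meas[OF that]\<close>)
  qed
  have F_bd: "\<bar>F \<sigma> x\<bar> <= B" if "borel_prob \<sigma>" for \<sigma> x
  proof -
    interpret prob_space \<sigma> using that by (rule borel_probD)
    have "\<bar>F \<sigma> x\<bar> <= (\<integral>y. \<bar>g (x - y)\<bar> \<partial>\<sigma>)" unfolding F_def by (rule integral_abs_bound)
    also have "\<dots> <= (\<integral>y. B \<partial>\<sigma>)" using gi[OF that, of x] bd by (intro integral_mono) auto
    finally show ?thesis by (simp add: prob_space)
  qed
  have equi: "\<exists>\<delta>>0. \<forall>\<sigma>. borel_prob \<sigma> --> (AE y in \<sigma>. y \<in> K) --> (\<forall>x\<in>K. \<forall>x'\<in>K. dist x x' < \<delta> --> \<bar>F \<sigma> x - F \<sigma> x'\<bar> <= \<epsilon>)"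
    if "\<epsilon> > 0" for \<epsilon>
  proof -
    define KK where "KK = (%(x,y). x - y) ` (K \<times> K)"
    have "compact KK" unfolding KK_def using K
      by (intro compact_continuous_image compact_Times) (auto simp: case_prod_unfold intro!: continuous_intros)
    hence "uniformly_continuous_on KK g" using g by (intro compact_uniformly_continuous) (auto intro: continuous_on_subset)
    then obtain \<delta> where \<delta>: "\<delta> > 0" "!!u v. u \<in> KK ==> v \<in> KK ==> dist v u < \<delta> ==> dist (g v) (g u) < \<epsilon>"
      using \<open>\<epsilon> > 0\<close> unfolding uniformly_continuous_on_def by metis
    show ?thesis
    proof (intro exI[of _ \<delta>] conjI allI impI ballI \<delta>(1))
      fix \<sigma> x x' assume \<sigma>: "borel_prob \<sigma>" "AE y in \<sigma>. y \<in> K" and x: "x \<in> K" "x' \<in> K" "dist x x' < \<delta>"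
      interpret prob_space \<sigma> using \<sigma>(1) by (rule borel_probD)
      have "\<bar>F \<sigma> x - F \<sigma> x'\<bar> = \<bar>\<integral>y. g (x - y) - g (x' - y) \<partial>\<sigma>\<bar>"
        unfolding F_def using gi[OF \<sigma>(1)] by simp
      also have "\<dots> <= (\<integral>y. \<bar>g (x - y) - g (x' - y)\<bar> \<partial>\<sigma>)" by (rule integral_abs_bound)
      also have "\<dots> <= (\<integral>y. \<epsilon> \<partial>\<sigma>)"
      proof (rule integral_mono_AE)
        show "AE y in \<sigma>. \<bar>g (x - y) - g (x' - y)\<bar> <= \<epsilon>" using \<sigma>(2)
        proof eventually_elim
          case (elim y)
          have "x - y \<in> KK" "x' - y \<in> KK" unfolding KK_def using elim x by force+
          moreover have "dist (x - y) (x' - y) < \<delta>" using x(3) by (simp add: dist_norm)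
          ultimately show ?case using \<delta>(2) by (force simp: dist_real_def)
        qed
      qed (use gi[OF \<sigma>(1)] in auto)
      finally show "\<bar>F \<sigma> x - F \<sigma> x'\<bar> <= \<epsilon>" by (simp add: prob_space)
    qed
  qed
  have F_meas: "F \<sigma> \<in> borel_measurable borel" if "borel_prob \<sigma>" for \<sigma>
  proof -
    interpret prob_space \<sigma> using that by (rule borel_probD)
    have [measurable_cong]: "sets \<sigma> = sets borel" using that by (rule borel_probD)
    have "(%x. \<integral>y. g (x - y) \<partial>\<sigma>) \<in> borel_measurable borel" by measurable
    thus ?thesis by (simp add: F_def[abs_def])
  qed
  have F_cont: "continuous_on K (F \<nu>)"
    unfolding continuous_on_iff
  proof (intro ballI allI impI)
    fix x and \<epsilon> :: real assume "x \<in> K" "\<epsilon> > 0"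
    then obtain \<delta> where "\<delta> > 0" "\<forall>x\<in>K. \<forall>x'\<in>K. dist x x' < \<delta> --> \<bar>F \<nu> x - F \<nu> x'\<bar> <= \<epsilon>/2"
      using equi[of "\<epsilon>/2"] m by auto
    thus "\<exists>d>0. \<forall>x'\<in>K. dist x' x < d --> dist (F \<nu> x') (F \<nu> x) < \<epsilon>"
      using \<open>x \<in> K\<close> \<open>\<epsilon> > 0\<close> by (intro exI[of _ \<delta>]) (fastforce simp: dist_real_def)
  qed
  have F_ptw: "(%n. F (\<mu> n) x) \<longlonglongrightarrow> F \<nu> x" for x
    unfolding F_def by (rule conv) (auto intro!: continuous_intros continuous_on_subset[OF g] continuous_on_compose2[OF g])
  have F_int: "integrable \<sigma> (F \<tau>)" if "borel_prob \<sigma>" "borel_prob \<tau>" for \<sigma> \<tau>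
  proof -
    interpret prob_space \<sigma> using that(1) by (rule borel_probD)
    show ?thesis by (rule integrable_const_bound[of _ B]) (use F_bd that F_meas in \<open>auto intro!: borel_prob_meas[OF that(1)]\<close>)
  qed
  \<comment> \<open>Equicontinuity upgrades the pointwise convergence of the potentials to uniform convergence on K.\<close>
  have unif: "eventually (%n. \<forall>x\<in>K. \<bar>F (\<mu> n) x - F \<nu> x\<bar> <= \<epsilon>) sequentially" if "\<epsilon> > 0" for \<epsilon>
  proof -
    obtain \<delta> where \<delta>: "\<delta> > 0" "!!\<sigma> x x'. borel_prob \<sigma> ==> (AE y in \<sigma>. y \<in> K) ==> x\<in>K ==> x'\<in>K ==> dist x x' < \<delta> ==> \<bar>F \<sigma> x - F \<sigma> x'\<bar> <= \<epsilon>/3"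
      using equi[of "\<epsilon>/3"] \<open>\<epsilon> > 0\<close> by auto
    have "K \<subseteq> (\<Union>x\<in>K. ball x \<delta>)" using \<delta>(1) by auto
    then obtain N where N: "N \<subseteq> K" "finite N" "K \<subseteq> (\<Union>x\<in>N. ball x \<delta>)"
      using compactE_image[OF K, of K "%x. ball x \<delta>"] by (metis open_ball)
    have "eventually (%n. \<forall>x\<in>N. \<bar>F (\<mu> n) x - F \<nu> x\<bar> < \<epsilon>/3) sequentially"
    proof (intro eventually_ball_finite N(2) ballI)
      fix x assume "x \<in> N"
      show "eventually (%n. \<bar>F (\<mu> n) x - F \<nu> x\<bar> < \<epsilon>/3) sequentially"
        using tendstoD[OF F_ptw[of x], of "\<epsilon>/3"] \<open>\<epsilon> > 0\<close> by (simp add: dist_real_def)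
    qed
    thus ?thesis
    proof eventually_elim
      case (elim n)
      show ?case
      proof
        fix x assume "x \<in> K"
        then obtain z where z: "z \<in> N" "dist x z < \<delta>" using N(3) by (auto simp: dist_commute)
        have "\<bar>F (\<mu> n) x - F (\<mu> n) z\<bar> <= \<epsilon>/3" "\<bar>F \<nu> x - F \<nu> z\<bar> <= \<epsilon>/3" "\<bar>F (\<mu> n) z - F \<nu> z\<bar> < \<epsilon>/3"
          using \<delta>(2) z \<open>x \<in> K\<close> N(1) m elim by auto
        thus "\<bar>F (\<mu> n) x - F \<nu> x\<bar> <= \<epsilon>" by linarith
      qed
    qed
  qed
  have "(%n. (\<integral>x. F (\<mu> n) x \<partial>\<mu> n) - (\<integral>x. F \<nu> x \<partial>\<mu> n)) \<longlonglongrightarrow> 0"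
  proof (rule LIMSEQ_I)
    fix \<epsilon> :: real assume "\<epsilon> > 0"
    hence "eventually (%n. \<forall>x\<in>K. \<bar>F (\<mu> n) x - F \<nu> x\<bar> <= \<epsilon>/2) sequentially"
      using unif[of "\<epsilon>/2"] by simp
    hence "eventually (%n. norm ((\<integral>x. F (\<mu> n) x \<partial>\<mu> n) - (\<integral>x. F \<nu> x \<partial>\<mu> n) - 0) < \<epsilon>) sequentially"
    proof eventually_elim
      case (elim n)
      interpret prob_space "\<mu> n" using m by (intro borel_probD)
      have "\<bar>(\<integral>x. F (\<mu> n) x \<partial>\<mu> n) - (\<integral>x. F \<nu> x \<partial>\<mu> n)\<bar> = \<bar>\<integral>x. F (\<mu> n) x - F \<nu> x \<partial>\<mu> n\<bar>"
        using F_int m by simp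
      also have "\<dots> <= (\<integral>x. \<bar>F (\<mu> n) x - F \<nu> x\<bar> \<partial>\<mu> n)" by (rule integral_abs_bound)
      also have "\<dots> <= (\<integral>x. \<epsilon>/2 \<partial>\<mu> n)"
      proof (rule integral_mono_AE)
        show "AE x in \<mu> n. \<bar>F (\<mu> n) x - F \<nu> x\<bar> <= \<epsilon>/2" using m(2)[of n] by eventually_elim (use elim in auto)
      qed (use F_int m in auto)
      finally show ?case using \<open>\<epsilon> > 0\<close> by (simp add: prob_space)
    qed
    thus "\<exists>no. \<forall>n\<ge>no. norm ((\<integral>x. F (\<mu> n) x \<partial>\<mu> n) - (\<integral>x. F \<nu> x \<partial>\<mu> n) - 0) < \<epsilon>"
      by (simp add: eventually_sequentially)
  qed
  moreover have "(%n. (\<integral>x. F \<nu> x \<partial>\<mu> n)) \<longlonglongrightarrow> (\<integral>x. F \<nu> x \<partial>\<nu>)"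
    by (rule conv[OF F_cont F_meas[OF m(3)]])
  ultimately have "(%n. ((\<integral>x. F (\<mu> n) x \<partial>\<mu> n) - (\<integral>x. F \<nu> x \<partial>\<mu> n)) + (\<integral>x. F \<nu> x \<partial>\<mu> n)) \<longlonglongrightarrow> 0 + (\<integral>x. F \<nu> x \<partial>\<nu>)"
    by (rule tendsto_add)
  thus ?thesis by (simp add: F_def)
qed

lemma mutual_bounded_kernel:
  fixes g :: "'a::euclidean_space => real"
  assumes [measurable]: "g \<in> borel_measurable borel" and g: "!!x. 0 <= g x" "!!x. g x <= B"
    and m: "borel_prob \<mu>" "borel_prob \<nu>"
  shows "mutual (%x. ennreal (g x)) \<mu> \<nu> = ennreal (\<integral>x. \<integral>y. g (x - y) \<partial>\<mu> \<partial>\<nu>)"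
proof -
  interpret \<mu>: prob_space \<mu> using m(1) by (rule borel_probD)
  interpret \<nu>: prob_space \<nu> using m(2) by (rule borel_probD)
  have [measurable_cong]: "sets \<mu> = sets borel" "sets \<nu> = sets borel" using m by (auto dest: borel_probD)
  have i: "integrable \<mu> (%y. g (x - y))" for x
    by (rule \<mu>.integrable_const_bound[of _ B]) (use g in auto)
  have p: "pot (%x. ennreal (g x)) \<mu> x = ennreal (\<integral>y. g (x - y) \<partial>\<mu>)" for x
    unfolding pot_def by (rule nn_integral_eq_integral[OF i]) (use g in auto)
  have le: "(\<integral>y. g (x - y) \<partial>\<mu>) <= B" for x
  proof -
    have "(\<integral>y. g (x - y) \<partial>\<mu>) <= (\<integral>y. B \<partial>\<mu>)" by (rule integral_mono[OF i]) (use g in auto)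
    thus ?thesis by (simp add: \<mu>.prob_space)
  qed
  have nn: "0 <= (\<integral>y. g (x - y) \<partial>\<mu>)" for x by (rule Bochner_Integration.integral_nonneg) (rule g)
  have "integrable \<nu> (%x. \<integral>y. g (x - y) \<partial>\<mu>)"
    by (rule \<nu>.integrable_const_bound[of _ B]) (use le nn in auto)
  thus ?thesis unfolding mutual_def p by (rule nn_integral_eq_integral) (use nn in auto)
qed

text \<open>
A continuous kernel that may take the value infinity is the supremum of bounded continuous ones, for which energies are ordinary double integrals.
\<close>

definition truncate :: "real => ('a => ennreal) => 'a => real" where
  "truncate L k x = enn2real (min (k x) (ennreal L))"

lemma ennreal_truncate: "ennreal (truncate L k x) = min (k x) (ennreal L)"
  unfolding truncate_def by (simp add: min_def ennreal_enn2real_if top_unique split: if_splits)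

lemma truncate_bounds: "0 <= truncate L k x" "0 <= L ==> truncate L k x <= L"
proof -
  show "0 <= truncate L k x" by (simp add: truncate_def)
  assume "0 <= L"
  have "ennreal (truncate L k x) <= ennreal L" by (simp add: ennreal_truncate)
  thus "truncate L k x <= L" using \<open>0 <= L\<close> by simp
qed

lemma truncate_continuous:
  fixes k :: "'a::euclidean_space => ennreal"
  assumes "continuous_on UNIV k" shows "continuous_on UNIV (truncate L k)"
proof -
  have "isCont (truncate L k) x" for x
  proof -
    have "(k \<longlongrightarrow> k x) (at x)" using assms by (simp add: continuous_on_eq_continuous_at isCont_def)
    hence "((%x. min (k x) (ennreal L)) \<longlongrightarrow> ennreal (truncate L k x)) (at x)"
      unfolding ennreal_truncate by (intro tendsto_min tendsto_const)
    from tendsto_enn2real[OF this truncate_bounds(1)] show ?thesis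
      by (simp add: isCont_def truncate_def[abs_def])
  qed
  thus ?thesis by (simp add: continuous_on_eq_continuous_at)
qed

lemma SUP_truncate: "(SUP n::nat. ennreal (truncate (real n) k x)) = k x"
proof (rule antisym)
  show "(SUP n::nat. ennreal (truncate (real n) k x)) <= k x"
    by (rule SUP_least) (simp add: ennreal_truncate)
  show "k x <= (SUP n::nat. ennreal (truncate (real n) k x))"
  proof (rule ccontr)
    let ?s = "SUP n::nat. ennreal (truncate (real n) k x)"
    assume "\<not> k x <= ?s"
    hence lt: "?s < k x" by simp
    hence "?s < \<top>" using top.not_eq_extremum by fastforce
    then obtain n :: nat where n: "?s < of_nat n" using ennreal_Ex_less_of_nat by blast
    have "min (k x) (of_nat n) <= ?s"
      by (rule SUP_upper2[of n]) (auto simp: ennreal_truncate ennreal_of_nat_eq_real_of_nat)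
    thus False using lt n by (auto simp: min_def split: if_splits)
  qed
qed

lemma mutual_SUP_truncate:
  fixes k :: "'a::euclidean_space => ennreal"
  assumes [measurable]: "k \<in> borel_measurable borel" and m: "borel_prob \<mu>" "borel_prob \<nu>"
  shows "mutual k \<mu> \<nu> = (SUP n::nat. mutual (%x. ennreal (truncate (real n) k x)) \<mu> \<nu>)"
proof -
  interpret \<mu>: prob_space \<mu> using m(1) by (rule borel_probD)
  have [measurable_cong]: "sets \<mu> = sets borel" "sets \<nu> = sets borel" using m by (auto dest: borel_probD)
  have [measurable]: "(%x. ennreal (truncate L k x)) \<in> borel_measurable borel" for L
    unfolding ennreal_truncate by measurable
  have mono: "ennreal (truncate (real n) k x) <= ennreal (truncate (real m) k x)" if "n <= m" for n m x
    unfolding ennreal_truncate using that by (auto simp: min_def intro: ennreal_leI order_trans)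
  have pot_eq: "pot k \<mu> x = (SUP n::nat. pot (%x. ennreal (truncate (real n) k x)) \<mu> x)" for x
    unfolding pot_def
    by (subst nn_integral_monotone_convergence_SUP[symmetric])
       (auto simp: incseq_def le_fun_def SUP_truncate intro: mono)
  have "pot (%x. ennreal (truncate (real n) k x)) \<mu> \<in> borel_measurable \<nu>" for n
    by (rule borel_prob_meas[OF m(2)], rule pot_measurable) (use m(1) in \<open>auto dest: borel_probD\<close>)
  moreover have "incseq (%n::nat. pot (%x. ennreal (truncate (real n) k x)) \<mu>)"
    unfolding incseq_def le_fun_def pot_def by (auto intro!: nn_integral_mono mono)
  ultimately have "(\<integral>\<^sup>+x. (SUP n::nat. pot (%x. ennreal (truncate (real n) k x)) \<mu> x) \<partial>\<nu>)
      = (SUP n::nat. \<integral>\<^sup>+x. pot (%x. ennreal (truncate (real n) k x)) \<mu> x \<partial>\<nu>)"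
    by (intro nn_integral_monotone_convergence_SUP)
  thus ?thesis by (simp add: mutual_def pot_eq)
qed

lemma ext_energy_real:
  assumes "mutual k \<mu> \<mu> < \<infinity>"
  shows "ext_energy k U \<mu> = ereal (enn2real (mutual k \<mu> \<mu>) / 2 + (\<integral>x. U x \<partial>\<mu>))"
proof -
  have "enn2ereal (mutual k \<mu> \<mu>) = ereal (enn2real (mutual k \<mu> \<mu>))"
    using assms by (metis enn2ereal_ennreal enn2real_nonneg ennreal_enn2real infinity_ennreal_def)
  thus ?thesis by (simp add: ext_energy_def)
qed

lemma ext_energy_infinite: "mutual k \<mu> \<mu> = \<infinity> ==> ext_energy k U \<mu> = \<infinity>"
  by (simp add: ext_energy_def)

text \<open>
The direct method: a minimizing sequence has a weakly convergent subsequence, the energy of every truncated kernel is weakly continuous, and a supremum of continuous functionals is lower semicontinuous.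
\<close>

theorem energy_minimizer_on_compact_exists:
  fixes k :: "'a::euclidean_space => ennreal" and U :: "'a => real"
  assumes K: "compact K" "K ~= {}" and k: "continuous_on UNIV k" and U: "continuous_on UNIV U"
  shows "\<exists>\<mu>. borel_prob \<mu> & (AE x in \<mu>. x \<in> K) \<and>
    (\<forall>\<sigma>. borel_prob \<sigma> --> (AE x in \<sigma>. x \<in> K) --> ext_energy k U \<mu> <= ext_energy k U \<sigma>)"
proof -
  define \<A> where "\<A> = {\<sigma>::'a measure. borel_prob \<sigma> & (AE x in \<sigma>. x \<in> K)}"
  have km[measurable]: "k \<in> borel_measurable borel" using k by (rule borel_measurable_continuous_onI)
  have Um[measurable]: "U \<in> borel_measurable borel" using U by (rule borel_measurable_continuous_onI)
  obtain x0 where x0: "x0 \<in> K" using K by blast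
  have Km[measurable]: "K \<in> sets borel" using K by (simp add: compact_imp_closed)
  have "AE x in return borel x0. x \<in> K" by (subst AE_return) (use x0 in auto)
  hence "return borel x0 \<in> \<A>" unfolding \<A>_def borel_prob_def
    by (simp add: prob_space_return)
  hence ne: "ext_energy k U ` \<A> ~= {}" by blast
  define I where "I = Inf (ext_energy k U ` \<A>)"
  obtain e where e: "!!n. e n \<in> ext_energy k U ` \<A>" "e \<longlonglongrightarrow> I"
    using Inf_as_limit[OF ne] unfolding I_def by blast
  have "\<forall>n. \<exists>\<sigma>. \<sigma> \<in> \<A> & e n = ext_energy k U \<sigma>" using e(1) by blast
  then obtain \<mu> where \<mu>: "!!n. \<mu> n \<in> \<A>" "!!n. e n = ext_energy k U (\<mu> n)" by metis
  have bp: "borel_prob (\<mu> n)" "AE x in \<mu> n. x \<in> K" for n using \<mu>(1) by (auto simp: \<A>_def)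
  obtain r \<nu> where r: "strict_mono (r::nat => nat)" and \<nu>: "prob_space \<nu>" "sets \<nu> = sets borel" "AE x in \<nu>. x \<in> K"
    and conv: "!!f::'a => real. continuous_on K f ==> f \<in> borel_measurable borel ==> (%n. \<integral>x. f x \<partial>\<mu> (r n)) \<longlonglongrightarrow> (\<integral>x. f x \<partial>\<nu>)"
    by (rule weak_compactness_on_compact[OF K(1) borel_probD(1)[OF bp(1)] borel_probD(2)[OF bp(1)] bp(2)]) (rule that)
  have \<nu>p: "borel_prob \<nu>" using \<nu> by (simp add: borel_prob_def)
  define T where "T L \<sigma> = (\<integral>x. \<integral>y. truncate L k (x - y) \<partial>\<sigma> \<partial>\<sigma>)" for L and \<sigma> :: "'a measure"
  have tm: "truncate L k \<in> borel_measurable borel" for L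
    by (rule borel_measurable_continuous_onI[OF truncate_continuous[OF k]])
  have T: "mutual (%x. ennreal (truncate L k x)) \<sigma> \<sigma> = ennreal (T L \<sigma>)" if "borel_prob \<sigma>" "0 <= L" for L \<sigma>
    unfolding T_def by (rule mutual_bounded_kernel[OF tm truncate_bounds(1) truncate_bounds(2)[OF that(2)] that(1) that(1)])
  have T0: "0 <= T L \<sigma>" for L \<sigma> unfolding T_def by (intro Bochner_Integration.integral_nonneg truncate_bounds)
  have mono: "T L \<sigma> <= enn2ereal (mutual k \<sigma> \<sigma>)" if "borel_prob \<sigma>" "0 <= L" for L \<sigma>
  proof -
    have "ennreal (T L \<sigma>) <= mutual k \<sigma> \<sigma>"
      unfolding T[OF that, symmetric] mutual_def pot_def
      by (intro nn_integral_mono) (simp add: ennreal_truncate)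
    thus ?thesis using T0[of L \<sigma>] by (metis enn2ereal_ennreal less_eq_ennreal.rep_eq)
  qed
  have step: "ereal (T L \<nu> / 2 + (\<integral>x. U x \<partial>\<nu>)) <= I" if L: "0 <= L" for L
  proof (rule LIMSEQ_le)
    have "(%n. T L (\<mu> (r n)) / 2 + (\<integral>x. U x \<partial>\<mu> (r n))) \<longlonglongrightarrow> T L \<nu> / 2 + (\<integral>x. U x \<partial>\<nu>)"
    proof (intro tendsto_add tendsto_divide tendsto_const)
      show "(%n. T L (\<mu> (r n))) \<longlonglongrightarrow> T L \<nu>" unfolding T_def
        by (rule weak_convergence_product[OF K(1) truncate_continuous[OF k] bp \<nu>p \<nu>(3) conv, where B=L])
           (use truncate_bounds[of L k] L in \<open>auto simp: abs_of_nonneg\<close>)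
      show "(%n. \<integral>x. U x \<partial>\<mu> (r n)) \<longlonglongrightarrow> (\<integral>x. U x \<partial>\<nu>)"
        by (rule conv[OF continuous_on_subset[OF U] Um]) simp
    qed simp
    thus "(%n. ereal (T L (\<mu> (r n)) / 2 + (\<integral>x. U x \<partial>\<mu> (r n)))) \<longlonglongrightarrow> ereal (T L \<nu> / 2 + (\<integral>x. U x \<partial>\<nu>))"
      by simp
    show "(%n. e (r n)) \<longlonglongrightarrow> I" using LIMSEQ_subseq_LIMSEQ[OF e(2) r] by (simp add: comp_def)
    have "ereal (T L (\<mu> (r n)) / 2 + (\<integral>x. U x \<partial>\<mu> (r n))) <= e (r n)" for n
    proof -
      have "ereal (1/2) * ereal (T L (\<mu> (r n))) <= ereal (1/2) * enn2ereal (mutual k (\<mu> (r n)) (\<mu> (r n)))"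
        by (rule ereal_mult_left_mono) (use mono[OF bp(1) L] in auto)
      hence "ereal (1/2) * ereal (T L (\<mu> (r n))) + ereal (\<integral>x. U x \<partial>\<mu> (r n)) <= e (r n)"
        unfolding \<mu>(2) ext_energy_def by (rule add_right_mono)
      thus ?thesis by simp
    qed
    thus "\<exists>N. \<forall>n\<ge>N. ereal (T L (\<mu> (r n)) / 2 + (\<integral>x. U x \<partial>\<mu> (r n))) <= e (r n)" by blast
  qed
  have "ext_energy k U \<nu> <= I"
  proof (cases I)
    case PInf thus ?thesis by simp
  next
    case MInf thus ?thesis using step[of 0] by simp
  next
    case (real i)
    have bd: "T L \<nu> <= 2 * (i - (\<integral>x. U x \<partial>\<nu>))" if "0 <= L" for L using step[OF that] real by simp
    have "mutual k \<nu> \<nu> <= ennreal (2 * (i - (\<integral>x. U x \<partial>\<nu>)))"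
      unfolding mutual_SUP_truncate[OF km \<nu>p \<nu>p] by (rule SUP_least, subst T[OF \<nu>p], simp, rule ennreal_leI, rule bd, simp)
    moreover have "0 <= 2 * (i - (\<integral>x. U x \<partial>\<nu>))" using bd[of 0] T0[of 0 \<nu>] by linarith
    ultimately have fin: "mutual k \<nu> \<nu> < \<infinity>" and "enn2real (mutual k \<nu> \<nu>) <= 2 * (i - (\<integral>x. U x \<partial>\<nu>))"
      by (auto simp: enn2real_leI le_less_trans[OF _ ennreal_less_top])
    thus ?thesis unfolding ext_energy_real[OF fin] real by simp
  qed
  moreover have "I <= ext_energy k U \<sigma>" if "\<sigma> \<in> \<A>" for \<sigma> unfolding I_def using that by (intro Inf_lower) blast
  ultimately show ?thesis using \<nu>p \<nu>(3) by (intro exI[of _ \<nu>]) (auto simp: \<A>_def intro: order_trans)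
qed

section \<open>First variation\<close>

text \<open>
The energy of the mixtures of \<mu> and \<sigma> is a quadratic polynomial of t with a minimum at 0; its derivative there is the difference of the two sides.
\<close>

lemma minimizer_first_variation:
  fixes k :: "'a::euclidean_space => ennreal" and U :: "'a => real"
  assumes k: "k \<in> borel_measurable borel" and even: "!!x. k (- x) = k x"
    and U: "U \<in> borel_measurable borel" "!!x. \<bar>U x\<bar> <= B"
    and m: "borel_prob \<mu>" "borel_prob \<sigma>" and fin: "mutual k \<mu> \<mu> < \<infinity>" "mutual k \<sigma> \<sigma> < \<infinity>" "mutual k \<mu> \<sigma> < \<infinity>"
    and min: "!!t. 0 < t ==> t < 1 ==> ext_energy k U \<mu> <= ext_energy k U (mixture t \<mu> \<sigma>)"
  shows "enn2real (mutual k \<mu> \<mu>) + (\<integral>x. U x \<partial>\<mu>) <= enn2real (mutual k \<mu> \<sigma>) + (\<integral>x. U x \<partial>\<sigma>)"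
proof -
  define a b c u v where "a = enn2real (mutual k \<mu> \<mu>)" and "b = enn2real (mutual k \<mu> \<sigma>)"
    and "c = enn2real (mutual k \<sigma> \<sigma>)" and "u = (\<integral>x. U x \<partial>\<mu>)" and "v = (\<integral>x. U x \<partial>\<sigma>)"
  have eqs: "mutual k \<mu> \<mu> = ennreal a" "mutual k \<mu> \<sigma> = ennreal b" "mutual k \<sigma> \<sigma> = ennreal c"
    using fin by (auto simp: a_def b_def c_def)
  have pos: "0 <= a" "0 <= b" "0 <= c" by (auto simp: a_def b_def c_def)
  have ineq: "0 <= (b - a + v - u) + t * ((a + c) / 2 - b)" if t: "0 < t" "t < 1" for t
  proof -
    have mm: "mutual k (mixture t \<mu> \<sigma>) (mixture t \<mu> \<sigma>) = ennreal ((1 - t)^2 * a + 2 * t * (1 - t) * b + t^2 * c)"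
      using t pos by (subst mutual_mixture[OF k even m]) (auto simp: eqs ennreal_mult)
    have nn: "0 <= (1 - t)^2 * a + 2 * t * (1 - t) * b + t^2 * c" using t pos by simp
    have "ereal (a / 2 + u) <= ereal (((1 - t)^2 * a + 2 * t * (1 - t) * b + t^2 * c) / 2 + ((1 - t) * u + t * v))"
      using min[OF t] ext_energy_real[OF fin(1), of U] ext_energy_real[of k "mixture t \<mu> \<sigma>" U]
        integral_mixture[OF m _ _ U, of t] t mm nn by (simp add: a_def u_def v_def)
    moreover have "(((1 - t)^2 * a + 2 * t * (1 - t) * b + t^2 * c) / 2 + ((1 - t) * u + t * v)) - (a / 2 + u)
        = t * ((b - a + v - u) + t * ((a + c) / 2 - b))"
      by (simp add: field_simps power2_eq_square)
    ultimately have "0 <= t * ((b - a + v - u) + t * ((a + c) / 2 - b))" by simp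
    thus ?thesis using t by (simp add: zero_le_mult_iff)
  qed
  have "((%t. (b - a + v - u) + t * ((a + c) / 2 - b)) \<longlongrightarrow> (b - a + v - u) + 0 * ((a + c) / 2 - b)) (at_right 0)"
    by (intro tendsto_intros)
  moreover have "eventually (%t. 0 <= (b - a + v - u) + t * ((a + c) / 2 - b)) (at_right (0::real))"
    using eventually_at_right_real[of 0 1] by (rule eventually_mono) (use ineq in auto)
  ultimately have "0 <= (b - a + v - u) + 0 * ((a + c) / 2 - b)"
    by (intro tendsto_lowerbound) auto
  thus ?thesis by (simp add: a_def b_def u_def v_def)
qed

text \<open>
Let V = k * \<mu> + U. The right-hand side C is the mean of V under \<mu>, and by the first variation no competitor gives V a smaller mean. Conditioning \<mu> on V < C would produce such a competitor, so V = C almost everywhere; since the kernel is nonnegative, U is at most V.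
\<close>

lemma minimizer_external_potential_bound:
  fixes k :: "'a::euclidean_space => ennreal" and U :: "'a => real"
  assumes k[measurable]: "k \<in> borel_measurable borel" and even: "!!x. k (- x) = k x"
    and U[measurable]: "U \<in> borel_measurable borel" and bd: "!!x. \<bar>U x\<bar> <= B" and D: "D \<in> sets borel"
    and m: "borel_prob \<mu>" "AE x in \<mu>. x \<in> D" and fin: "mutual k \<mu> \<mu> < \<infinity>"
    and min: "!!\<sigma>. borel_prob \<sigma> ==> AE x in \<sigma>. x \<in> D ==> ext_energy k U \<mu> <= ext_energy k U \<sigma>"
  shows "AE x in \<mu>. U x <= enn2real (mutual k \<mu> \<mu>) + (\<integral>x. U x \<partial>\<mu>)"
proof -
  interpret prob_space \<mu> using m(1) by (rule borel_probD)
  have [measurable_cong]: "sets \<mu> = sets borel" using m(1) by (rule borel_probD)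
  have space: "space \<mu> = UNIV" using m(1) by (rule borel_probD)
  define C where "C = enn2real (mutual k \<mu> \<mu>) + (\<integral>x. U x \<partial>\<mu>)"
  define p where "p x = enn2real (pot k \<mu> x)" for x
  have pm[measurable]: "pot k \<mu> \<in> borel_measurable borel" using m(1) by (intro pot_measurable) (auto dest: borel_probD)
  have [measurable]: "p \<in> borel_measurable borel" unfolding p_def by measurable
  have p0: "0 <= p x" for x by (simp add: p_def)
  have "AE x in \<mu>. pot k \<mu> x ~= \<infinity>" by (rule nn_integral_PInf_AE) (use fin in \<open>auto simp: mutual_def\<close>)
  hence pp: "AE x in \<mu>. pot k \<mu> x = ennreal (p x)"
    by eventually_elim (simp add: p_def less_top)
  have "(\<integral>\<^sup>+x. ennreal (p x) \<partial>\<mu>) = mutual k \<mu> \<mu>" unfolding mutual_def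
    by (rule nn_integral_cong_AE) (use pp in eventually_elim, auto)
  hence pi: "integrable \<mu> p" and pint: "(\<integral>x. p x \<partial>\<mu>) = enn2real (mutual k \<mu> \<mu>)"
    using fin p0 by (auto intro!: integrableI_nonneg simp: integral_eq_nn_integral)
  have Ui: "integrable \<mu> U" by (rule integrable_const_bound[of _ B]) (use bd in auto)
  define V where "V x = p x + U x" for x
  have Vi: "integrable \<mu> V" unfolding V_def using pi Ui by auto
  have VC: "(\<integral>x. V x \<partial>\<mu>) = C" unfolding V_def C_def using pi Ui pint by simp
  have sub: "C * prob A <= (\<integral>x. V x * indicator A x \<partial>\<mu>)" if A[measurable]: "A \<in> sets borel" for A
  proof (cases "prob A = 0")
    case True
    hence "AE x in \<mu>. x \<notin> A" by (simp add: prob_eq_0 space A)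
    hence "AE x in \<mu>. V x * indicator A x = 0" by eventually_elim simp
    hence "(\<integral>x. V x * indicator A x \<partial>\<mu>) = 0" by (rule integral_eq_zero_AE)
    thus ?thesis using True by simp
  next
    case False
    define \<sigma> where "\<sigma> = uniform_measure \<mu> A"
    have pA: "prob A > 0" using False measure_nonneg[of \<mu> A] by linarith
    have eA: "emeasure \<mu> A = ennreal (prob A)" by (simp add: emeasure_eq_measure)
    have bp: "borel_prob \<sigma>" unfolding borel_prob_def \<sigma>_def
      using pA by (auto intro!: prob_space_uniform_measure simp: eA borel_probD(2)[OF m(1)])
    have nni: "(\<integral>\<^sup>+x. f x \<partial>\<sigma>) = (\<integral>\<^sup>+x. f x * indicator A x \<partial>\<mu>) / ennreal (prob A)" if "f \<in> borel_measurable borel" for f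
      unfolding \<sigma>_def by (subst nn_integral_uniform_measure) (use that in \<open>auto simp: eA\<close>)
    have le: "(\<integral>\<^sup>+x. f x \<partial>\<sigma>) <= (\<integral>\<^sup>+x. f x \<partial>\<mu>) / ennreal (prob A)" if "f \<in> borel_measurable borel" for f
      unfolding nni[OF that] by (intro divide_right_mono_ennreal nn_integral_mono) (auto simp: indicator_def)
    have lt: "x / ennreal (prob A) < \<infinity>" if "x < \<infinity>" for x
    proof -
      have "x / ennreal (prob A) ~= \<top>" using that pA by (auto simp: ennreal_divide_eq_top_iff)
      thus ?thesis by (simp add: less_top)
    qed
    have AED: "AE x in \<sigma>. x \<in> D"
      unfolding \<sigma>_def by (rule AE_uniform_measureI) (use m(2) in \<open>auto elim: eventually_mono\<close>)
    have mus: "mutual k \<mu> \<sigma> < \<infinity>"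
      unfolding mutual_def by (rule le_less_trans[OF le[OF pm] lt]) (use fin in \<open>simp add: mutual_def\<close>)
    have "pot k \<sigma> x <= pot k \<mu> x / ennreal (prob A)" for x unfolding pot_def by (rule le) measurable
    hence "mutual k \<sigma> \<sigma> <= (\<integral>\<^sup>+x. pot k \<mu> x / ennreal (prob A) \<partial>\<sigma>)"
      unfolding mutual_def by (intro nn_integral_mono)
    also have "\<dots> = mutual k \<mu> \<sigma> / ennreal (prob A)" unfolding mutual_def
      by (rule nn_integral_divide) (rule borel_prob_meas[OF bp pm])
    finally have ss: "mutual k \<sigma> \<sigma> < \<infinity>" using lt[OF mus] by (rule le_less_trans)
    have fv: "C <= enn2real (mutual k \<mu> \<sigma>) + (\<integral>x. U x \<partial>\<sigma>)" unfolding C_def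
    proof (rule minimizer_first_variation[OF k even U bd m(1) bp fin ss mus])
      fix t :: real assume t: "0 < t" "t < 1"
      show "ext_energy k U \<mu> <= ext_energy k U (mixture t \<mu> \<sigma>)"
        using t m bp AED D by (intro min borel_prob_mixture AE_mixture) auto
    qed
    have 1: "enn2real (mutual k \<mu> \<sigma>) = (\<integral>x. p x * indicator A x \<partial>\<mu>) / prob A"
    proof -
      have "(\<integral>\<^sup>+x. pot k \<mu> x * indicator A x \<partial>\<mu>) = (\<integral>\<^sup>+x. ennreal (p x * indicator A x) \<partial>\<mu>)"
        by (rule nn_integral_cong_AE) (use pp in eventually_elim, auto simp: indicator_def)
      also have "\<dots> = ennreal (\<integral>x. p x * indicator A x \<partial>\<mu>)"
        by (rule nn_integral_eq_integral) (use pi p0 in \<open>auto intro!: integrable_real_mult_indicator\<close>)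
      finally have "mutual k \<mu> \<sigma> = ennreal (\<integral>x. p x * indicator A x \<partial>\<mu>) / ennreal (prob A)"
        unfolding mutual_def nni[OF pm] by simp
      also have "\<dots> = ennreal ((\<integral>x. p x * indicator A x \<partial>\<mu>) / prob A)"
        by (rule divide_ennreal) (use pA p0 in \<open>auto intro!: Bochner_Integration.integral_nonneg\<close>)
      finally show ?thesis using pA p0 by (simp add: Bochner_Integration.integral_nonneg)
    qed
    have 2: "(\<integral>x. U x \<partial>\<sigma>) = (\<integral>x. U x * indicator A x \<partial>\<mu>) / prob A"
    proof -
      have "indicator A x / ennreal (prob A) = ennreal (indicator A x / prob A)" for x
        using pA by (simp add: indicator_def divide_ennreal[of 1, simplified])
      hence "\<sigma> = density \<mu> (%x. ennreal (indicator A x / prob A))"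
        unfolding \<sigma>_def uniform_measure_def eA by simp
      hence "(\<integral>x. U x \<partial>\<sigma>) = (\<integral>x. (indicator A x / prob A) *\<^sub>R U x \<partial>\<mu>)"
        by (simp add: integral_density)
      also have "\<dots> = (\<integral>x. (U x * indicator A x) / prob A \<partial>\<mu>)"
        by (rule Bochner_Integration.integral_cong) auto
      finally show ?thesis by simp
    qed
    have "(\<integral>x. V x * indicator A x \<partial>\<mu>) = (\<integral>x. p x * indicator A x \<partial>\<mu>) + (\<integral>x. U x * indicator A x \<partial>\<mu>)"
      unfolding V_def distrib_right using pi Ui
      by (intro Bochner_Integration.integral_add) (auto intro!: integrable_real_mult_indicator)
    thus ?thesis using fv pA unfolding 1 2 by (simp add: field_simps)
  qed
  define A where "A = {x. C < U x}"
  have Am[measurable]: "A \<in> sets borel" unfolding A_def by measurable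
  have "prob A = 0"
  proof (rule ccontr)
    assume "prob A ~= 0"
    have VA: "integrable \<mu> (%x. V x * indicator A x)" "integrable \<mu> (%x. V x * indicator (- A) x)"
      using Vi by (auto intro!: integrable_real_mult_indicator)
    have CA: "integrable \<mu> (%x. C * indicator A x)"
      by (rule integrable_const_bound[of _ "\<bar>C\<bar>"]) (auto simp: indicator_def)
    have "C = (\<integral>x. V x * indicator A x + V x * indicator (- A) x \<partial>\<mu>)" unfolding VC[symmetric]
      by (rule Bochner_Integration.integral_cong) (auto simp: indicator_def)
    also have "\<dots> = (\<integral>x. V x * indicator A x \<partial>\<mu>) + (\<integral>x. V x * indicator (- A) x \<partial>\<mu>)" using VA by simp
    also have "\<dots> >= (\<integral>x. V x * indicator A x \<partial>\<mu>) + C * prob (- A)" using sub[of "- A"] by simp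
    finally have "(\<integral>x. V x * indicator A x \<partial>\<mu>) <= C * (1 - prob (- A))" by (simp add: algebra_simps)
    also have "1 - prob (- A) = prob A" using prob_compl[of A] by (simp add: space Compl_eq_Diff_UNIV)
    finally have le: "(\<integral>x. V x * indicator A x \<partial>\<mu>) <= (\<integral>x. C * indicator A x \<partial>\<mu>)" by (simp add: space)
    have "(\<integral>x. (V x - C) * indicator A x \<partial>\<mu>) <= 0" using le VA CA by (simp add: left_diff_distrib)
    moreover have "integrable \<mu> (%x. (V x - C) * indicator A x)" using VA CA by (simp add: left_diff_distrib)
    moreover have nn: "0 <= (V x - C) * indicator A x" for x using p0[of x] by (auto simp: A_def V_def indicator_def)
    ultimately have "AE x in \<mu>. (V x - C) * indicator A x = 0"
      using integral_nonneg_eq_0_iff_AE[of \<mu> "%x. (V x - C) * indicator A x"]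
      by (metis (no_types, lifting) AE_I2 Bochner_Integration.integral_nonneg order_antisym)
    hence "AE x in \<mu>. x \<notin> A"
    proof eventually_elim
      case (elim x) thus ?case using p0[of x] by (auto simp: A_def V_def indicator_def)
    qed
    thus False using \<open>prob A ~= 0\<close> by (simp add: prob_eq_0 space Am)
  qed
  hence "AE x in \<mu>. x \<notin> A" by (simp add: prob_eq_0 space Am)
  thus ?thesis by eventually_elim (auto simp: A_def C_def)
qed

section \<open>Approximate equilibrium densities\<close>

lemma nn_integral_lborel_reflect:
  fixes f :: "'a::euclidean_space => ennreal"
  assumes [measurable]: "f \<in> borel_measurable borel"
  shows "(\<integral>\<^sup>+y. f (x - y) \<partial>lborel) = (\<integral>\<^sup>+y. f y \<partial>lborel)"
proof -
  have "(\<integral>\<^sup>+y. f y \<partial>lborel) = (\<integral>\<^sup>+y. f y \<partial>density (distr lborel borel (%y. x + (-1) *\<^sub>R y)) (%_. ennreal (\<bar>-1\<bar>^DIM('a))))"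
    by (subst lborel_affine[of "-1" x]) auto
  also have "\<dots> = (\<integral>\<^sup>+y. f (x - y) \<partial>lborel)"
    by (simp add: nn_integral_density nn_integral_distr)
  finally show ?thesis ..
qed

text \<open>
The vector c minimizes the quadratic function \<Phi> over a box. Variations in single coordinates give the complementarity conditions; as the entries are nonnegative, the regularizing term keeps the minimizer off the upper faces.
\<close>

lemma linear_complementarity:
  fixes a :: "nat => nat => real" and m :: "nat => real"
  assumes I: "finite I" and a: "!!i j. 0 <= a i j" "!!i j. a i j = a j i"
    and m: "!!i. i \<in> I ==> 0 < m i" and s: "0 < s"
  shows "\<exists>c. \<forall>i\<in>I. 0 <= c i & c i <= 1 / s & m i <= (\<Sum>j\<in>I. a i j * c j) + s * m i * c i \<and>
    (0 < c i --> (\<Sum>j\<in>I. a i j * c j) + s * m i * c i = m i)"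
proof -
  define \<Phi> where "\<Phi> c = (\<Sum>i\<in>I. \<Sum>j\<in>I. a i j * (c i * c j)) / 2 + (\<Sum>i\<in>I. s * m i * (c i)^2 / 2 - m i * c i)" for c :: "nat => real"
  define S where "S = (PiE UNIV (%_. {0..2/s}) :: (nat => real) set)"
  have "compact S" unfolding S_def compactin_euclidean_iff[symmetric] euclidean_product_topology[symmetric]
    by (simp add: compactin_PiE)
  moreover have "S ~= {}" unfolding S_def using s by (auto simp: PiE_eq_empty_iff)
  moreover have "continuous_on S \<Phi>" unfolding \<Phi>_def
    by (intro continuous_intros continuous_on_subset[OF continuous_on_product_coordinates]) auto
  ultimately obtain c where c: "c \<in> S" "!!x. x \<in> S ==> \<Phi> c <= \<Phi> x"
    using continuous_attains_inf by metis
  have cS: "0 <= c i & c i <= 2 / s" for i using c(1) by (auto simp: S_def PiE_def Pi_def)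
  define G where "G i = (\<Sum>j\<in>I. a i j * c j) + s * m i * c i - m i" for i
  have expand: "\<Phi> (c(i := c i + t)) = \<Phi> c + t * G i + t^2 * ((a i i + s * m i) / 2)" if i: "i \<in> I" for i t
  proof -
    define d where "d j = (if j = i then 1 else 0 :: real)" for j
    have upd: "c(i := c i + t) = (%j. c j + t * d j)" by (auto simp: d_def fun_eq_iff)
    have sd: "(\<Sum>j\<in>I. f j * d j) = f i" for f :: "nat => real"
      using i I by (simp add: d_def if_distrib cong: if_cong)
    have dd: "d j ^ 2 = d j" for j by (simp add: d_def)
    have "(\<Sum>k\<in>I. \<Sum>j\<in>I. a k j * ((c k + t * d k) * (c j + t * d j)))
      = (\<Sum>k\<in>I. \<Sum>j\<in>I. a k j * (c k * c j)) + t * (\<Sum>k\<in>I. (\<Sum>j\<in>I. a k j * c j) * d k)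
        + t * (\<Sum>k\<in>I. c k * (\<Sum>j\<in>I. a k j * d j)) + t^2 * (\<Sum>k\<in>I. (\<Sum>j\<in>I. a k j * d j) * d k)"
      by (simp add: algebra_simps sum.distrib sum_distrib_left sum_distrib_right power2_eq_square)
    also have "(\<Sum>k\<in>I. (\<Sum>j\<in>I. a k j * c j) * d k) = (\<Sum>j\<in>I. a i j * c j)" by (rule sd)
    also have "(\<Sum>k\<in>I. c k * (\<Sum>j\<in>I. a k j * d j)) = (\<Sum>j\<in>I. a i j * c j)"
      unfolding sd by (intro sum.cong refl) (metis a(2) mult.commute)
    also have "(\<Sum>k\<in>I. (\<Sum>j\<in>I. a k j * d j) * d k) = a i i" by (simp add: sd)
    finally have 1: "(\<Sum>k\<in>I. \<Sum>j\<in>I. a k j * ((c k + t * d k) * (c j + t * d j)))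
      = (\<Sum>k\<in>I. \<Sum>j\<in>I. a k j * (c k * c j)) + 2 * t * (\<Sum>j\<in>I. a i j * c j) + t^2 * a i i" by simp
    have "(\<Sum>k\<in>I. s * m k * (c k + t * d k)^2 / 2 - m k * (c k + t * d k))
      = (\<Sum>k\<in>I. (s * m k * (c k)^2 / 2 - m k * c k) + (t * (s * m k * c k - m k)) * d k + (t^2 * (s * m k / 2)) * d k ^ 2)"
      by (intro sum.cong refl) (simp add: field_simps power2_eq_square)
    also have "\<dots> = (\<Sum>k\<in>I. s * m k * (c k)^2 / 2 - m k * c k) + t * (s * m i * c i - m i) + t^2 * (s * m i / 2)"
      unfolding dd sum.distrib sd ..
    finally show ?thesis unfolding upd \<Phi>_def G_def 1 by (simp add: algebra_simps add_divide_distrib)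
  qed
  have inS: "c(i := c i + t) \<in> S" if "0 <= c i + t" "c i + t <= 2 / s" for i t
    using cS that by (auto simp: S_def PiE_def Pi_def)
  have lin: "0 <= t * G i + t^2 * ((a i i + s * m i) / 2)" if "i \<in> I" "0 <= c i + t" "c i + t <= 2 / s" for i t
    using c(2)[OF inS[OF that(2,3)]] expand[OF that(1), of t] by linarith
  have up: "0 <= G i" if i: "i \<in> I" "c i < 2 / s" for i
  proof (rule ccontr)
    assume "\<not> 0 <= G i"
    define q where "q = (a i i + s * m i) / 2"
    have q: "q > 0" unfolding q_def using a(1)[of i i] m[OF i(1)] s by (simp add: add_nonneg_pos)
    define t where "t = min (2 / s - c i) (- G i / (2 * q))"
    have t: "0 < t" "t <= 2 / s - c i" "t <= - G i / (2 * q)"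
      unfolding t_def using i(2) \<open>\<not> 0 <= G i\<close> q by (auto simp: divide_neg_pos)
    have "0 <= c i + t" "c i + t <= 2 / s" using t cS[of i] by linarith+
    from lin[OF i(1) this, folded q_def] have "0 <= t * (G i + t * q)" by (simp add: distrib_left power2_eq_square mult.assoc)
    hence "0 <= G i + t * q" using t(1) by (simp add: zero_le_mult_iff)
    moreover have "t * q <= - G i / 2" using t(3) q by (simp add: field_simps)
    ultimately show False using \<open>\<not> 0 <= G i\<close> by linarith
  qed
  have down: "G i <= 0" if i: "i \<in> I" "0 < c i" for i
  proof (rule ccontr)
    assume "\<not> G i <= 0"
    define q where "q = (a i i + s * m i) / 2"
    have q: "q > 0" unfolding q_def using a(1)[of i i] m[OF i(1)] s by (simp add: add_nonneg_pos)
    define t where "t = min (c i) (G i / (2 * q))"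
    have t: "0 < t" "t <= c i" "t <= G i / (2 * q)"
      unfolding t_def using i(2) \<open>\<not> G i <= 0\<close> q by (auto simp: divide_pos_pos)
    have "0 <= c i + - t" "c i + - t <= 2 / s" using t cS[of i] by linarith+
    from lin[OF i(1) this, folded q_def] have "0 <= t * (t * q - G i)" by (simp add: right_diff_distrib power2_eq_square mult.assoc)
    hence "0 <= t * q - G i" using t(1) by (simp add: zero_le_mult_iff)
    moreover have "t * q <= G i / 2" using t(3) q by (simp add: field_simps)
    ultimately show False using \<open>\<not> G i <= 0\<close> by linarith
  qed
  have sum0: "0 <= (\<Sum>j\<in>I. a i j * c j)" for i using a cS by (intro sum_nonneg mult_nonneg_nonneg) auto
  have le: "c i <= 1 / s" if "i \<in> I" for i
  proof (rule ccontr)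
    assume c1: "\<not> c i <= 1 / s"
    hence "0 < c i" using cS[of i] s by (smt (verit) zero_less_divide_1_iff)
    hence "G i <= 0" using down that by blast
    moreover have "1 < s * c i" using c1 s by (simp add: field_simps)
    hence "m i < s * m i * c i" using m[OF that] by (simp add: mult_ac)
    ultimately show False using sum0[of i] unfolding G_def by linarith
  qed
  show ?thesis
  proof (intro exI[of _ c] ballI conjI impI)
    fix i assume i: "i \<in> I"
    show "0 <= c i" using cS by blast
    show "c i <= 1 / s" by (rule le[OF i])
    have "1 / s < 2 / s" using s by (simp add: divide_strict_right_mono)
    hence g: "0 <= G i" using up[OF i] le[OF i] by linarith
    thus "m i <= (\<Sum>j\<in>I. a i j * c j) + s * m i * c i" by (simp add: G_def)
    assume "0 < c i"
    thus "(\<Sum>j\<in>I. a i j * c j) + s * m i * c i = m i" using g down[OF i] by (simp add: G_def)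
  qed
qed

lemma cball_borel[measurable]: "cball (a::'a::euclidean_space) r \<in> sets borel"
  by simp

text \<open>
Bounded densities suffice as test measures, and their potentials are continuous, which makes the maximum principle elementary.
\<close>

definition density_on :: "real => 'a::euclidean_space set => ('a => real) => bool" where
  "density_on B K h \<longleftrightarrow> h \<in> borel_measurable borel & (\<forall>x. 0 <= h x & h x <= B) & (\<forall>x. x \<notin> K --> h x = 0)"

abbreviation dens :: "('a::euclidean_space => real) => 'a measure" where
  "dens h \<equiv> density lborel (%x. ennreal (h x))"

lemma density_onD:
  assumes "density_on B K h"
  shows "h \<in> borel_measurable borel" "0 <= h x" "h x <= B" "x \<notin> K ==> h x = 0" "0 <= B"
proof -
  show "h \<in> borel_measurable borel" "0 <= h x" "h x <= B" "x \<notin> K ==> h x = 0"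
    using assms by (simp_all add: density_on_def)
  thus "0 <= B" by linarith
qed

lemma pot_dens:
  fixes k :: "'a::euclidean_space => ennreal"
  assumes [measurable]: "k \<in> borel_measurable borel" "h \<in> borel_measurable borel"
  shows "pot k (dens h) x = (\<integral>\<^sup>+y. ennreal (h y) * k (x - y) \<partial>lborel)"
  unfolding pot_def by (subst nn_integral_density) auto

locale kernel_base =
  fixes k :: "'a::euclidean_space => ennreal"
  assumes k_cont: "continuous_on UNIV k"
    and k_even: "k (- x) = k x"
    and k_loc_int: "(\<integral>\<^sup>+x\<in>cball 0 R. k x \<partial>lborel) < \<infinity>"
    and k_vanish: "(k \<longlongrightarrow> 0) at_infinity"
    and k_nontriv: "(\<integral>\<^sup>+x\<in>cball 0 1. k x \<partial>lborel) > 0"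
begin

lemma k_meas[measurable]: "k \<in> borel_measurable borel"
  using k_cont by (rule borel_measurable_continuous_onI)

lemma pot_dens_bound:
  assumes h: "density_on B K h" and K: "K \<subseteq> cball 0 R1" and x: "norm x <= R"
  shows "pot k (dens h) x <= ennreal B * (\<integral>\<^sup>+z\<in>cball 0 (R + R1). k z \<partial>lborel)"
proof -
  have [measurable]: "h \<in> borel_measurable borel" using h by (rule density_onD)
  have "pot k (dens h) x = (\<integral>\<^sup>+y. ennreal (h y) * k (x - y) \<partial>lborel)" by (rule pot_dens) measurable
  also have "\<dots> <= (\<integral>\<^sup>+y. ennreal B * (k (x - y) * indicator (cball 0 (R + R1)) (x - y)) \<partial>lborel)"
  proof (rule nn_integral_mono)
    fix y
    show "ennreal (h y) * k (x - y) <= ennreal B * (k (x - y) * indicator (cball 0 (R + R1)) (x - y))"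
    proof (cases "y \<in> K")
      case True
      hence "norm y <= R1" using K by auto
      hence "x - y \<in> cball 0 (R + R1)" using x norm_triangle_ineq4[of x y] by simp
      thus ?thesis using density_onD(3)[OF h, of y] by (auto intro!: mult_right_mono ennreal_leI)
    qed (simp add: density_onD(4)[OF h])
  qed
  also have "\<dots> = ennreal B * (\<integral>\<^sup>+y. (k (x - y) * indicator (cball 0 (R + R1)) (x - y)) \<partial>lborel)"
  proof (rule nn_integral_cmult)
    have "(%z. k z * indicator (cball 0 (R + R1)) z) \<in> borel_measurable borel" by measurable
    from measurable_compose[OF _ this, of "%y. x - y" lborel]
    show "(%y. k (x - y) * indicator (cball 0 (R + R1)) (x - y)) \<in> borel_measurable lborel" by simp
  qed
  also have "(\<integral>\<^sup>+y. (k (x - y) * indicator (cball 0 (R + R1)) (x - y)) \<partial>lborel) = (\<integral>\<^sup>+z\<in>cball 0 (R + R1). k z \<partial>lborel)"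
    by (rule nn_integral_lborel_reflect) measurable
  finally show ?thesis .
qed

lemma pot_dens_finite:
  assumes h: "density_on B K h" and K: "bounded K"
  shows "pot k (dens h) x < \<infinity>"
proof -
  obtain R1 where "K \<subseteq> cball 0 R1" using K by (force simp: bounded_iff)
  from pot_dens_bound[OF h this order_refl] 
  show ?thesis
    by (rule le_less_trans) (use k_loc_int[of "norm x + R1"] in \<open>simp add: ennreal_mult_less_top\<close>)
qed

lemma truncation_error:
  assumes "\<epsilon> > 0"
  shows "\<exists>n::nat. (\<integral>\<^sup>+z\<in>cball 0 R. k z - ennreal (truncate (real n) k z) \<partial>lborel) <= ennreal \<epsilon>"
proof -
  let ?t = "%n z. ennreal (truncate (real n) k z) * indicator (cball 0 R) z"
  have tm[measurable]: "(%z. ennreal (truncate L k z)) \<in> borel_measurable borel" for L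
    unfolding ennreal_truncate by measurable
  have mono: "ennreal (truncate (real n) k x) <= ennreal (truncate (real m) k x)" if "n <= m" for n m x
    unfolding ennreal_truncate using that by (auto simp: min_def intro: ennreal_leI order_trans)
  have "(\<integral>\<^sup>+z\<in>cball 0 R. k z \<partial>lborel) = (\<integral>\<^sup>+z. (SUP n. ?t n z) \<partial>lborel)"
    by (rule nn_integral_cong) (auto simp: SUP_truncate indicator_def)
  also have "\<dots> = (SUP n. \<integral>\<^sup>+z. ?t n z \<partial>lborel)"
    by (rule nn_integral_monotone_convergence_SUP) (auto simp: incseq_def le_fun_def indicator_def intro: mono)
  finally have eq: "(\<integral>\<^sup>+z\<in>cball 0 R. k z \<partial>lborel) = (SUP n. \<integral>\<^sup>+z. ?t n z \<partial>lborel)" .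
  have le: "(\<integral>\<^sup>+z. ?t n z \<partial>lborel) <= (\<integral>\<^sup>+z\<in>cball 0 R. k z \<partial>lborel)" for n
    by (rule nn_integral_mono) (auto simp: ennreal_truncate indicator_def)
  have ex: "\<exists>n. (\<integral>\<^sup>+z\<in>cball 0 R. k z \<partial>lborel) <= (\<integral>\<^sup>+z. ?t n z \<partial>lborel) + ennreal \<epsilon>"
  proof (rule ccontr)
    let ?J = "\<integral>\<^sup>+z\<in>cball 0 R. k z \<partial>lborel"
    assume "\<nexists>n. ?J <= (\<integral>\<^sup>+z. ?t n z \<partial>lborel) + ennreal \<epsilon>"
    hence "(\<integral>\<^sup>+z. ?t n z \<partial>lborel) + ennreal \<epsilon> <= ?J" for n by (meson linear)
    hence "(SUP n. (\<integral>\<^sup>+z. ?t n z \<partial>lborel) + ennreal \<epsilon>) <= ?J" by (intro SUP_least)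
    hence "?J + ennreal \<epsilon> <= ?J" unfolding eq by (subst (asm) ennreal_SUP_add_left) auto
    thus False using k_loc_int[of R] \<open>\<epsilon> > 0\<close>
      by (metis add.right_neutral ennreal_add_left_cancel_le ennreal_eq_0_iff infinity_ennreal_def
          leD less_irrefl not_less zero_less_iff_neq_zero)
  qed
  then obtain n where n: "(\<integral>\<^sup>+z\<in>cball 0 R. k z \<partial>lborel) <= (\<integral>\<^sup>+z. ?t n z \<partial>lborel) + ennreal \<epsilon>" by blast
  have "(\<integral>\<^sup>+z\<in>cball 0 R. k z - ennreal (truncate (real n) k z) \<partial>lborel)
      = (\<integral>\<^sup>+z. k z * indicator (cball 0 R) z - ?t n z \<partial>lborel)"
    by (rule nn_integral_cong) (auto simp: indicator_def)
  also have "\<dots> = (\<integral>\<^sup>+z\<in>cball 0 R. k z \<partial>lborel) - (\<integral>\<^sup>+z. ?t n z \<partial>lborel)"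
    by (rule nn_integral_diff) (use le[of n] k_loc_int[of R] in \<open>auto simp: ennreal_truncate indicator_def top_unique\<close>)
  also have "\<dots> <= ennreal \<epsilon>" using n k_loc_int[of R] by (auto simp: ennreal_minus_le_iff add.commute)
  finally show ?thesis by blast
qed

text \<open>
Uniform over all densities with the given bound: the part of the kernel above a high truncation has small integral, and the truncated kernel is uniformly continuous on bounded sets.
\<close>

lemma pot_dens_equicontinuous:
  assumes K: "compact K" and "\<epsilon> > 0" "B >= 0"
  shows "\<exists>\<delta>>0. \<forall>h x x'. density_on B K h --> norm x <= R --> norm x' <= R --> dist x x' < \<delta> -->
    pot k (dens h) x <= pot k (dens h) x' + ennreal \<epsilon>"
proof -
  obtain R1 where R1: "K \<subseteq> cball 0 R1" using compact_imp_bounded[OF K] by (force simp: bounded_iff)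
  define Q where "Q = (cball 0 (R + R1) :: 'a set)"
  have Km: "K \<in> sets lborel" "emeasure lborel K < \<infinity>" using K emeasure_bounded_finite[OF compact_imp_bounded[OF K]] by (auto simp: compact_imp_closed)
  define mK where "mK = measure lborel K"
  have mK: "emeasure lborel K = ennreal mK" "0 <= mK" using Km by (auto simp: mK_def emeasure_eq_ennreal_measure)
  define \<epsilon>1 where "\<epsilon>1 = \<epsilon> / (2 * (B + 1))"
  have \<epsilon>1: "\<epsilon>1 > 0" "B * \<epsilon>1 <= \<epsilon> / 2" using assms by (auto simp: \<epsilon>1_def field_simps)
  define \<epsilon>2 where "\<epsilon>2 = \<epsilon> / (2 * (B * mK + 1))"
  have Bm: "0 <= B * mK" using assms mK by simp
  have \<epsilon>2: "\<epsilon>2 > 0" "\<epsilon>2 * (B * mK) <= \<epsilon> / 2" using assms Bm by (auto simp: \<epsilon>2_def field_simps)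
  obtain n where n: "(\<integral>\<^sup>+z\<in>Q. k z - ennreal (truncate (real n) k z) \<partial>lborel) <= ennreal \<epsilon>1"
    using truncation_error[OF \<epsilon>1(1), of "R + R1"] unfolding Q_def by blast
  define g where "g = truncate (real n) k"
  have gc: "continuous_on UNIV g" unfolding g_def by (rule truncate_continuous[OF k_cont])
  have gm[measurable]: "g \<in> borel_measurable borel" using gc by (rule borel_measurable_continuous_onI)
  have g0: "0 <= g z" for z by (simp add: g_def truncate_bounds)
  have gk: "ennreal (g z) <= k z" for z by (simp add: g_def ennreal_truncate)
  have "uniformly_continuous_on Q g"
    by (rule compact_uniformly_continuous) (auto simp: Q_def intro: continuous_on_subset[OF gc])
  then obtain \<delta> where \<delta>: "\<delta> > 0" "!!u v. u \<in> Q ==> v \<in> Q ==> dist v u < \<delta> ==> dist (g v) (g u) < \<epsilon>2"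
    using \<epsilon>2(1) unfolding uniformly_continuous_on_def by metis
  show ?thesis
  proof (intro exI[of _ \<delta>] conjI allI impI \<delta>(1))
    fix h :: "'a => real" and x x' :: 'a
    assume h: "density_on B K h" and x: "norm x <= R" "norm x' <= R" "dist x x' < \<delta>"
    have hm[measurable]: "h \<in> borel_measurable borel" using h by (rule density_onD)
    have Q: "x - y \<in> Q" "x' - y \<in> Q" if "y \<in> K" for y
    proof -
      have "norm y <= R1" using R1 that by auto
      thus "x - y \<in> Q" "x' - y \<in> Q" using x norm_triangle_ineq4[of x y] norm_triangle_ineq4[of x' y] by (auto simp: Q_def)
    qed
    have ptw: "ennreal (h y) * k (x - y) <= ennreal (h y) * k (x' - y) + ennreal (\<epsilon>2 * B) * indicator K y
        + ennreal B * ((k (x - y) - ennreal (g (x - y))) * indicator Q (x - y))" for y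
    proof (cases "y \<in> K")
      case True
      have hy: "0 <= h y" "h y <= B" using density_onD[OF h] by auto
      have "dist (x - y) (x' - y) < \<delta>" using x(3) by (simp add: dist_norm)
      hence "g (x - y) <= g (x' - y) + \<epsilon>2" using \<delta>(2)[OF Q(2,1)[OF True]] by (auto simp: dist_real_def)
      hence "ennreal (g (x - y)) <= ennreal (g (x' - y)) + ennreal \<epsilon>2"
        using g0 \<epsilon>2(1) by (metis ennreal_leI ennreal_plus less_imp_le)
      also have "\<dots> <= k (x' - y) + ennreal \<epsilon>2" by (intro add_right_mono gk)
      finally have *: "ennreal (g (x - y)) <= k (x' - y) + ennreal \<epsilon>2" .
      have "k (x - y) = ennreal (g (x - y)) + (k (x - y) - ennreal (g (x - y)))" using gk by (simp add: add_diff_inverse_ennreal)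
      also have "\<dots> <= k (x' - y) + ennreal \<epsilon>2 + (k (x - y) - ennreal (g (x - y)))" by (intro add_right_mono *)
      finally have "ennreal (h y) * k (x - y) <= ennreal (h y) * (k (x' - y) + ennreal \<epsilon>2 + (k (x - y) - ennreal (g (x - y))))"
        by (rule mult_left_mono) simp
      also have "\<dots> = ennreal (h y) * k (x' - y) + ennreal (h y) * ennreal \<epsilon>2 + ennreal (h y) * (k (x - y) - ennreal (g (x - y)))"
        by (simp add: distrib_left)
      also have "\<dots> <= ennreal (h y) * k (x' - y) + ennreal (\<epsilon>2 * B) + ennreal B * (k (x - y) - ennreal (g (x - y)))"
        using hy \<epsilon>2(1) by (intro add_mono order_refl mult_right_mono ennreal_leI) (auto simp: mult.commute mult_left_mono simp flip: ennreal_mult')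
      finally show ?thesis using True Q[OF True] by simp
    qed (simp add: density_onD(4)[OF h])
    have "pot k (dens h) x <= (\<integral>\<^sup>+y. ennreal (h y) * k (x' - y) + ennreal (\<epsilon>2 * B) * indicator K y
        + ennreal B * ((k (x - y) - ennreal (g (x - y))) * indicator Q (x - y)) \<partial>lborel)"
      by (subst pot_dens) (auto intro!: nn_integral_mono ptw)
    also have "\<dots> = pot k (dens h) x' + ennreal (\<epsilon>2 * B) * emeasure lborel K
        + ennreal B * (\<integral>\<^sup>+y. (k (x - y) - ennreal (g (x - y))) * indicator Q (x - y) \<partial>lborel)"
      using Km by (simp add: pot_dens nn_integral_add nn_integral_cmult Q_def)
    also have "(\<integral>\<^sup>+y. (k (x - y) - ennreal (g (x - y))) * indicator Q (x - y) \<partial>lborel) = (\<integral>\<^sup>+z\<in>Q. k z - ennreal (g z) \<partial>lborel)"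
      by (rule nn_integral_lborel_reflect) (simp add: Q_def)
    also have "pot k (dens h) x' + ennreal (\<epsilon>2 * B) * emeasure lborel K + ennreal B * \<dots>
        <= pot k (dens h) x' + ennreal (\<epsilon> / 2) + ennreal (\<epsilon> / 2)"
    proof (intro add_mono order_refl)
      show "ennreal (\<epsilon>2 * B) * emeasure lborel K <= ennreal (\<epsilon> / 2)"
        using \<epsilon>2 mK assms by (simp add: mult_ac flip: ennreal_mult')
      have "ennreal B * (\<integral>\<^sup>+z\<in>Q. k z - ennreal (g z) \<partial>lborel) <= ennreal B * ennreal \<epsilon>1"
        unfolding g_def by (intro mult_left_mono n) simp
      also have "\<dots> <= ennreal (\<epsilon> / 2)" using \<epsilon>1 assms by (simp flip: ennreal_mult')
      finally show "ennreal B * (\<integral>\<^sup>+z\<in>Q. k z - ennreal (g z) \<partial>lborel) <= ennreal (\<epsilon> / 2)" .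
    qed
    also have "\<dots> = pot k (dens h) x' + ennreal \<epsilon>" using \<open>\<epsilon> > 0\<close> by (simp add: add.assoc flip: ennreal_plus)
    finally show "pot k (dens h) x <= pot k (dens h) x' + ennreal \<epsilon>" .
  qed
qed

lemma pot_dens_vanish:
  assumes h: "density_on B K h" and K: "compact K" and "\<epsilon> > 0"
  shows "\<exists>R. \<forall>x. R <= norm x --> pot k (dens h) x <= ennreal \<epsilon>"
proof -
  obtain R1 where R1: "K \<subseteq> cball 0 R1" using compact_imp_bounded[OF K] by (force simp: bounded_iff)
  have Km: "K \<in> sets lborel" "emeasure lborel K < \<infinity>"
    using K emeasure_bounded_finite[OF compact_imp_bounded[OF K]] by (auto simp: compact_imp_closed)
  define mK where "mK = measure lborel K"
  have mK: "emeasure lborel K = ennreal mK" "0 <= mK" using Km by (auto simp: mK_def emeasure_eq_ennreal_measure)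
  have B0: "0 <= B" using h by (rule density_onD)
  define \<epsilon>1 where "\<epsilon>1 = \<epsilon> / (B * mK + 1)"
  have Bm: "0 <= B * mK" using B0 mK by simp
  have \<epsilon>1: "\<epsilon>1 > 0" "\<epsilon>1 * (B * mK) <= \<epsilon>" using assms Bm by (auto simp: \<epsilon>1_def field_simps)
  have "eventually (%z. k z < ennreal \<epsilon>1) at_infinity" using \<epsilon>1(1) by (intro order_tendstoD[OF k_vanish]) simp
  then obtain R2 where R2: "!!z. R2 <= norm z ==> k z < ennreal \<epsilon>1" by (auto simp: eventually_at_infinity)
  have hm[measurable]: "h \<in> borel_measurable borel" using h by (rule density_onD)
  show ?thesis
  proof (intro exI[of _ "R1 + R2"] allI impI)
    fix x :: 'a assume x: "R1 + R2 <= norm x"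
    have "pot k (dens h) x <= (\<integral>\<^sup>+y. ennreal (B * \<epsilon>1) * indicator K y \<partial>lborel)"
    proof (subst pot_dens, measurable, rule nn_integral_mono)
      fix y
      show "ennreal (h y) * k (x - y) <= ennreal (B * \<epsilon>1) * indicator K y"
      proof (cases "y \<in> K")
        case True
        hence "norm y <= R1" using R1 by auto
        hence "R2 <= norm (x - y)" using x norm_triangle_ineq2[of x y] by linarith
        hence "k (x - y) <= ennreal \<epsilon>1" using R2 by (simp add: less_imp_le)
        hence "ennreal (h y) * k (x - y) <= ennreal B * ennreal \<epsilon>1"
          using density_onD(3)[OF h, of y] by (intro mult_mono ennreal_leI) auto
        thus ?thesis using True B0 by (simp add: ennreal_mult')
      qed (simp add: density_onD(4)[OF h])
    qed
    also have "\<dots> = ennreal (B * \<epsilon>1 * mK)" using Km mK B0 \<epsilon>1(1) by (simp add: nn_integral_cmult flip: ennreal_mult')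
    also have "\<dots> <= ennreal \<epsilon>" using \<epsilon>1(2) by (intro ennreal_leI) (simp add: mult_ac)
    finally show "pot k (dens h) x <= ennreal \<epsilon>" .
  qed
qed

end

text \<open>
The hypothesis is the maximum principle in its weakest form: the potential of a density has no positive global maximum outside of a compact set that carries the density. For a kernel with positive Laplacian off the origin it follows from second differences.
\<close>

locale kernel = kernel_base +
  assumes no_max: "[|compact P; density_on B P h; x0 \<notin> P; !!x. pot k (dens h) x <= pot k (dens h) x0|]
      ==> pot k (dens h) x0 = 0"
begin

text \<open>
The potential is continuous and vanishes at infinity, so it attains its supremum; by the assumption on the kernel a positive maximum must lie in P.
\<close>

lemma maximum_principle:
  assumes h: "density_on B P h" and P: "compact P" and c: "0 <= c" and le: "!!x. x \<in> P ==> pot k (dens h) x <= ennreal c"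
  shows "pot k (dens h) x <= ennreal c"
proof (rule ccontr)
  assume "\<not> pot k (dens h) x <= ennreal c"
  define u where "u y = enn2real (pot k (dens h) y)" for y
  have eu: "pot k (dens h) y = ennreal (u y)" for y
    using pot_dens_finite[OF h compact_imp_bounded[OF P], of y] by (simp add: u_def)
  have u0: "0 <= u y" for y by (simp add: u_def)
  have ux: "c < u x" using \<open>\<not> pot k (dens h) x <= ennreal c\<close> c unfolding eu by (simp add: not_le ennreal_less_iff)
  hence "u x / 2 > 0" using c by simp
  from pot_dens_vanish[OF h P this] obtain R0 where R0: "!!y. R0 <= norm y ==> u y <= u x / 2"
    using c ux unfolding eu by (auto simp: ennreal_le_iff)
  define R where "R = max R0 (norm x)"
  have "continuous_on (cball 0 R) u"
    unfolding continuous_on_iff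
  proof (intro ballI allI impI)
    fix y \<epsilon> assume y: "y \<in> cball (0::'a) R" and \<epsilon>: "(0::real) < \<epsilon>"
    obtain \<delta> where \<delta>: "\<delta> > 0" "!!x x'. norm x <= R ==> norm x' <= R ==> dist x x' < \<delta> ==>
        pot k (dens h) x <= pot k (dens h) x' + ennreal (\<epsilon> / 2)"
      using pot_dens_equicontinuous[OF P, of "\<epsilon>/2" B R] \<epsilon> density_onD(5)[OF h] h by auto
    have le: "u z <= u z' + \<epsilon> / 2" if "norm z <= R" "norm z' <= R" "dist z z' < \<delta>" for z z'
      using \<delta>(2)[OF that] u0 \<epsilon> unfolding eu by (simp flip: ennreal_plus)
    show "\<exists>d>0. \<forall>x'\<in>cball 0 R. dist x' y < d --> dist (u x') (u y) < \<epsilon>"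
    proof (intro exI[of _ \<delta>] conjI ballI impI \<delta>(1))
      fix x' assume "x' \<in> cball (0::'a) R" "dist x' y < \<delta>"
      hence "u x' <= u y + \<epsilon> / 2" "u y <= u x' + \<epsilon> / 2" using le[of x' y] le[of y x'] y by (auto simp: dist_commute)
      thus "dist (u x') (u y) < \<epsilon>" using \<epsilon> by (auto simp: dist_real_def)
    qed
  qed
  moreover have "cball (0::'a) R ~= {}" using norm_ge_zero[of x] by (auto simp: R_def)
  ultimately obtain x0 where x0: "x0 \<in> cball 0 R" "!!y. y \<in> cball 0 R ==> u y <= u x0"
    using continuous_attains_sup[of "cball (0::'a) R" u] by auto
  have xx0: "u x <= u x0" by (rule x0(2)) (simp add: R_def)
  have max: "u y <= u x0" for y
  proof (cases "norm y <= R")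
    case False
    hence "u y <= u x / 2" by (intro R0) (simp add: R_def)
    thus ?thesis using xx0 ux c by linarith
  qed (use x0(2) in simp)
  have "x0 \<notin> P" using le[of x0] xx0 ux c unfolding eu by auto
  hence "pot k (dens h) x0 = 0" using max by (intro no_max[OF P h]) (auto simp: eu ennreal_leI)
  thus False using xx0 ux c unfolding eu by (simp add: u0)
qed

text \<open>
Integrate the bound on the potential over a neighbourhood of K of width one. Each unit of mass in K contributes at least the integral of the kernel over the unit ball.
\<close>

lemma mass_bound:
  assumes K: "bounded K"
  shows "\<exists>M\<ge>0. \<forall>B h. density_on B K h --> (\<forall>x. pot k (dens h) x <= 2) --> (\<integral>\<^sup>+y. ennreal (h y) \<partial>lborel) <= ennreal M"
proof -
  obtain R where R: "K \<subseteq> cball 0 R" using K by (force simp: bounded_iff)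
  define j where "j = (\<integral>\<^sup>+z\<in>cball 0 1. k z \<partial>lborel)"
  have j: "j > 0" "j < \<infinity>" unfolding j_def using k_nontriv k_loc_int by auto
  define m where "m = measure lborel (cball (0::'a) (R + 1))"
  have m: "emeasure lborel (cball (0::'a) (R + 1)) = ennreal m" "0 <= m"
    unfolding m_def using emeasure_bounded_finite[OF bounded_cball, of "0::'a" "R + 1"]
    by (simp_all add: emeasure_eq_ennreal_measure less_top[symmetric])
  show ?thesis
  proof (intro exI[of _ "2 * m / enn2real j"] conjI allI impI)
    show "0 <= 2 * m / enn2real j" using m by simp
    fix B h assume h: "density_on B K h" and le: "\<forall>x. pot k (dens h) x <= 2"
    have hm[measurable]: "h \<in> borel_measurable borel" using h by (rule density_onD)
    have "ennreal (h y) * j <= ennreal (h y) * (\<integral>\<^sup>+x. indicator (cball 0 (R + 1)) x * k (x - y) \<partial>lborel)" for y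
    proof (cases "y \<in> K")
      case True
      have "j = (\<integral>\<^sup>+x. indicator (cball 0 1) (y - x) * k (y - x) \<partial>lborel)" unfolding j_def
        by (subst nn_integral_lborel_reflect[symmetric, of _ y]) (auto simp: mult.commute)
      also have "\<dots> <= (\<integral>\<^sup>+x. indicator (cball 0 (R + 1)) x * k (x - y) \<partial>lborel)"
      proof (rule nn_integral_mono)
        fix x
        have "norm y <= R" using True R by auto
        hence "norm (y - x) <= 1 ==> norm x <= R + 1" using norm_triangle_ineq3[of y x] by linarith
        moreover have "k (y - x) = k (x - y)" using k_even[of "x - y"] by simp
        ultimately show "indicator (cball 0 1) (y - x) * k (y - x) <= indicator (cball 0 (R + 1)) x * k (x - y)"
          by (auto simp: indicator_def)
      qed
      finally show ?thesis by (rule mult_left_mono) simp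
    qed (simp add: density_onD(4)[OF h])
    hence "(\<integral>\<^sup>+y. ennreal (h y) * j \<partial>lborel) <= (\<integral>\<^sup>+y. ennreal (h y) * (\<integral>\<^sup>+x. indicator (cball 0 (R + 1)) x * k (x - y) \<partial>lborel) \<partial>lborel)"
      by (intro nn_integral_mono)
    also have "\<dots> = (\<integral>\<^sup>+y. (\<integral>\<^sup>+x. ennreal (h y) * (indicator (cball 0 (R + 1)) x * k (x - y)) \<partial>lborel) \<partial>lborel)"
      by (intro nn_integral_cong nn_integral_cmult[symmetric]) measurable
    also have "\<dots> = (\<integral>\<^sup>+x. (\<integral>\<^sup>+y. ennreal (h y) * (indicator (cball 0 (R + 1)) x * k (x - y)) \<partial>lborel) \<partial>lborel)"
      by (rule lborel_pair.Fubini'[of "%x y. ennreal (h y) * (indicator (cball 0 (R + 1)) x * k (x - y))"]) measurable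
    also have "\<dots> = (\<integral>\<^sup>+x. indicator (cball 0 (R + 1)) x * pot k (dens h) x \<partial>lborel)"
      by (intro nn_integral_cong) (simp add: pot_dens nn_integral_cmult[symmetric] mult_ac)
    also have "\<dots> <= (\<integral>\<^sup>+x. 2 * indicator (cball (0::'a) (R + 1)) x \<partial>lborel)"
      by (rule nn_integral_mono) (use le in \<open>auto simp: indicator_def\<close>)
    also have "\<dots> = 2 * ennreal m" using m by (simp add: nn_integral_cmult)
    finally have "(\<integral>\<^sup>+y. ennreal (h y) \<partial>lborel) * j <= 2 * ennreal m" by (simp add: nn_integral_multc)
    hence "(\<integral>\<^sup>+y. ennreal (h y) \<partial>lborel) * j / j <= 2 * ennreal m / j"
      by (rule divide_right_mono_ennreal)
    moreover have "(\<integral>\<^sup>+y. ennreal (h y) \<partial>lborel) * j / j = (\<integral>\<^sup>+y. ennreal (h y) \<partial>lborel)"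
      using j by (intro mult_divide_eq_ennreal) auto
    ultimately have "(\<integral>\<^sup>+y. ennreal (h y) \<partial>lborel) <= 2 * ennreal m / j" by simp
    also have "\<dots> = ennreal (2 * m / enn2real j)"
    proof -
      have "2 * ennreal m = ennreal (2 * m)" using m(2) by (simp add: ennreal_mult')
      moreover have "j = ennreal (enn2real j)" "0 < enn2real j" using j by (auto simp: enn2real_positive_iff)
      ultimately show ?thesis using m(2) by (metis divide_ennreal mult_nonneg_nonneg zero_le_numeral)
    qed
    finally show "(\<integral>\<^sup>+y. ennreal (h y) \<partial>lborel) <= ennreal (2 * m / enn2real j)" .
  qed
qed

lemma finite_small_partition:
  fixes K :: "'a set"
  assumes K: "compact K" and "\<delta> > 0"
  shows "\<exists>(n::nat) Q. (\<forall>i. Q i \<in> sets borel) & K = (\<Union>i<n. Q i) & disjoint_family Q \<and>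
    (\<forall>i x y. x \<in> Q i --> y \<in> Q i --> dist x y < \<delta>)"
proof -
  have "K \<subseteq> (\<Union>x\<in>K. ball x (\<delta>/2))" using \<open>\<delta> > 0\<close> by auto
  then obtain N where N: "N \<subseteq> K" "finite N" "K \<subseteq> (\<Union>x\<in>N. ball x (\<delta>/2))"
    using compactE_image[OF K, of K "%x. ball x (\<delta>/2)"] by (metis open_ball)
  obtain z :: "nat => 'a" where z: "N = z ` {..<card N}"
    using N(2) by (metis bij_betw_imp_surj_on ex_bij_betw_nat_finite lessThan_atLeast0)
  define A where "A i = (if i < card N then K \<inter> ball (z i) (\<delta>/2) else {})" for i
  have A: "A i \<in> sets borel" for i unfolding A_def using K by (auto simp: compact_imp_closed)
  define Q where "Q = disjointed A"
  have sub: "Q i \<subseteq> A i" for i unfolding Q_def by (rule disjointed_subset)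
  show ?thesis
  proof (intro exI[of _ Q] exI[of _ "card N"] conjI allI impI)
    show "Q i \<in> sets borel" for i
      unfolding Q_def disjointed_def by (rule sets.Diff[OF A]) (rule sets.finite_UN[OF _ A], simp)
    show "disjoint_family Q" unfolding Q_def by (rule disjoint_family_disjointed)
    have "(\<Union>i<card N. Q i) = (\<Union>i. Q i)" using sub by (fastforce simp: A_def split: if_splits)
    also have "\<dots> = (\<Union>i. A i)" unfolding Q_def by (rule UN_disjointed_eq)
    also have "\<dots> = K" using N(3) unfolding A_def by (subst (asm) z) (auto split: if_splits)
    finally show "K = (\<Union>i<card N. Q i)" ..
    show "dist x y < \<delta>" if "x \<in> Q i" "y \<in> Q i" for i x y
    proof -
      have "dist (z i) x < \<delta>/2" "dist (z i) y < \<delta>/2" using that sub[of i] by (auto simp: A_def split: if_splits)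
      thus ?thesis using dist_triangle3[of x y "z i"] by linarith
    qed
  qed
qed

text \<open>
Look for a density that is constant on the cells of a fine partition of K. Averaging the equilibrium condition over cells turns it into a complementarity problem with a symmetric nonnegative matrix; the regularization s h bounds the density by 1 / s. Equicontinuity passes from cell averages back to points, and P is a compact set carrying the cells of positive charge.
\<close>

lemma discretised_equilibrium:
  assumes K: "compact K" and s: "s > 0" and \<kappa>: "\<kappa> > 0"
  obtains h P where "density_on (1 / s) P h" "compact P" "P \<subseteq> K"
    "!!x. x \<in> P ==> pot k (dens h) x <= ennreal (1 + \<kappa>)"
    "AE x in lborel. x \<in> K --> 1 <= pot k (dens h) x + ennreal (s * h x) + ennreal \<kappa>"
proof -
  obtain R where R: "K \<subseteq> cball 0 R" using compact_imp_bounded[OF K] by (force simp: bounded_iff)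
  obtain \<delta> where \<delta>: "\<delta> > 0" "!!h x x'. density_on (1/s) K h ==> norm x <= R ==> norm x' <= R ==> dist x x' < \<delta> ==>
      pot k (dens h) x <= pot k (dens h) x' + ennreal (\<kappa>/2)"
    using pot_dens_equicontinuous[OF K, of "\<kappa>/2" "1/s" R] s \<kappa> by auto
  obtain n :: nat and Q :: "nat => 'a set" where Qm[measurable]: "!!i. Q i \<in> sets borel" and KQ: "K = (\<Union>i<n. Q i)" and disj: "disjoint_family Q"
    and Qd: "!!i x y. x \<in> Q i ==> y \<in> Q i ==> dist x y < \<delta>"
    using finite_small_partition[OF K \<delta>(1)] by metis
  have QK: "Q i \<subseteq> K" if "i < n" for i using KQ that by blast
  have QR: "norm x <= R" if "i < n" "x \<in> Q i" for i x using QK[OF that(1)] that(2) R by auto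
  define m where "m i = measure lborel (Q i)" for i
  have em: "emeasure lborel (Q i) = ennreal (m i)" if "i < n" for i
  proof -
    have "bounded (Q i)" using QK[OF that] compact_imp_bounded[OF K] bounded_subset by blast
    from emeasure_bounded_finite[OF this] show ?thesis unfolding m_def
      by (simp add: emeasure_eq_ennreal_measure less_top[symmetric])
  qed
  have m0: "0 <= m i" for i by (simp add: m_def)
  define I where "I = {i. i < n & 0 < m i}"
  have I: "finite I" "!!i. i \<in> I ==> i < n" by (auto simp: I_def)
  define pQ where "pQ j x = (\<integral>\<^sup>+y. indicator (Q j) y * k (x - y) \<partial>lborel)" for j x
  have pQm[measurable]: "pQ j \<in> borel_measurable borel" for j unfolding pQ_def by measurable
  define A where "A i j = (\<integral>\<^sup>+x. indicator (Q i) x * pQ j x \<partial>lborel)" for i j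
  have pot_ind: "pot k (dens (indicator (Q j))) x = pQ j x" for j x
    unfolding pQ_def by (subst pot_dens) (simp_all add: ennreal_indicator)
  have A_fin: "A i j < \<infinity>" if ij: "i < n" "j < n" for i j
  proof -
    have d: "density_on 1 K (indicator (Q j))" using QK[OF ij(2)] by (auto simp: density_on_def indicator_def)
    have "pQ j x <= 1 * (\<integral>\<^sup>+z\<in>cball 0 (R + R). k z \<partial>lborel)" if "x \<in> Q i" for x
      using pot_dens_bound[OF d R QR[OF ij(1) that]] unfolding pot_ind by simp
    hence "A i j <= (\<integral>\<^sup>+x. (\<integral>\<^sup>+z\<in>cball 0 (R + R). k z \<partial>lborel) * indicator (Q i) x \<partial>lborel)"
      unfolding A_def by (intro nn_integral_mono) (auto simp: indicator_def)
    also have "\<dots> = (\<integral>\<^sup>+z\<in>cball 0 (R + R). k z \<partial>lborel) * ennreal (m i)" by (simp add: nn_integral_cmult em[OF ij(1)])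
    also have "\<dots> < \<infinity>" using k_loc_int[of "R + R"] by (simp add: ennreal_mult_less_top)
    finally show ?thesis .
  qed
  have A_sym: "A i j = A j i" for i j
  proof -
    have "A i j = (\<integral>\<^sup>+x. \<integral>\<^sup>+y. indicator (Q i) x * (indicator (Q j) y * k (x - y)) \<partial>lborel \<partial>lborel)"
      unfolding A_def pQ_def by (intro nn_integral_cong nn_integral_cmult[symmetric]) measurable
    also have "\<dots> = (\<integral>\<^sup>+y. \<integral>\<^sup>+x. indicator (Q i) x * (indicator (Q j) y * k (x - y)) \<partial>lborel \<partial>lborel)"
      by (rule lborel_pair.Fubini'[of "%y x. indicator (Q i) x * (indicator (Q j) y * k (x - y))"]) measurable
    also have "\<dots> = (\<integral>\<^sup>+y. \<integral>\<^sup>+x. indicator (Q j) y * (indicator (Q i) x * k (y - x)) \<partial>lborel \<partial>lborel)"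
    proof (intro nn_integral_cong)
      fix x y
      show "indicator (Q i) x * (indicator (Q j) y * k (x - y)) = indicator (Q j) y * (indicator (Q i) x * k (y - x))"
        using k_even[of "x - y"] by (simp add: mult_ac)
    qed
    also have "\<dots> = A j i"
      unfolding A_def pQ_def by (intro nn_integral_cong nn_integral_cmult) measurable
    finally show ?thesis .
  qed
  define a where "a i j = enn2real (A i j)" for i j
  have Aa: "A i j = ennreal (a i j)" if "i < n" "j < n" for i j using A_fin[OF that] by (simp add: a_def)
  have "\<exists>c. \<forall>i\<in>I. 0 <= c i & c i <= 1 / s & m i <= (\<Sum>j\<in>I. a i j * c j) + s * m i * c i \<and>
    (0 < c i --> (\<Sum>j\<in>I. a i j * c j) + s * m i * c i = m i)"
    by (rule linear_complementarity[OF I(1)]) (use s A_sym in \<open>auto simp: a_def I_def\<close>)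
  then obtain c where c: "!!i. i \<in> I ==> 0 <= c i" "!!i. i \<in> I ==> c i <= 1 / s"
    "!!i. i \<in> I ==> m i <= (\<Sum>j\<in>I. a i j * c j) + s * m i * c i"
    "!!i. i \<in> I ==> 0 < c i ==> (\<Sum>j\<in>I. a i j * c j) + s * m i * c i = m i"
    by blast
  define h where "h x = (\<Sum>i\<in>I. c i * indicator (Q i) x)" for x
  have h_in: "h x = c i" if "i \<in> I" "x \<in> Q i" for i x
  proof -
    have ind: "indicator (Q j) x = (if j = i then 1 else 0 :: real)" for j
      using disj that(2) by (auto simp: disjoint_family_on_def indicator_def)
    have "h x = (\<Sum>j\<in>I. if j = i then c i else 0)"
      unfolding h_def by (rule sum.cong[OF refl]) (simp add: ind)
    thus ?thesis using that(1) I(1) by simp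
  qed
  have h_out: "h x = 0" if "!!i. i \<in> I ==> x \<in> Q i ==> c i = 0" for x
    unfolding h_def by (rule sum.neutral) (use that in \<open>auto simp: indicator_def\<close>)
  have hK: "density_on (1 / s) K h" unfolding density_on_def
  proof (intro conjI allI impI)
    show "h \<in> borel_measurable borel" unfolding h_def by measurable
    show "0 <= h x" for x unfolding h_def using c(1) by (intro sum_nonneg) auto
    show "h x <= 1 / s" for x
    proof (cases "\<exists>i\<in>I. x \<in> Q i")
      case True
      then obtain i where "i \<in> I" "x \<in> Q i" by blast
      thus ?thesis using h_in[of i x] c(2)[of i] by simp
    next
      case False hence "h x = 0" by (intro h_out) auto
      thus ?thesis using s by simp
    qed
    show "h x = 0" if "x \<notin> K" for x by (rule h_out) (use that KQ I(2) in auto)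
  qed
  have hm[measurable]: "h \<in> borel_measurable borel" using hK by (rule density_onD)
  have pot_h: "pot k (dens h) x = (\<Sum>j\<in>I. ennreal (c j) * pQ j x)" for x
  proof -
    have "ennreal (h y) = (\<Sum>j\<in>I. ennreal (c j) * indicator (Q j) y)" for y
    proof -
      have "ennreal (h y) = (\<Sum>j\<in>I. ennreal (c j * indicator (Q j) y))"
        unfolding h_def using c(1) by (intro sum_ennreal[symmetric]) auto
      also have "\<dots> = (\<Sum>j\<in>I. ennreal (c j) * indicator (Q j) y)"
        by (intro sum.cong) (auto simp: indicator_def)
      finally show ?thesis .
    qed
    hence "pot k (dens h) x = (\<integral>\<^sup>+y. (\<Sum>j\<in>I. ennreal (c j) * (indicator (Q j) y * k (x - y))) \<partial>lborel)"
      by (subst pot_dens) (auto simp: sum_distrib_right mult.assoc)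
    also have "\<dots> = (\<Sum>j\<in>I. \<integral>\<^sup>+y. ennreal (c j) * (indicator (Q j) y * k (x - y)) \<partial>lborel)"
      by (rule nn_integral_sum) measurable
    also have "\<dots> = (\<Sum>j\<in>I. ennreal (c j) * pQ j x)"
      unfolding pQ_def by (intro sum.cong refl nn_integral_cmult) measurable
    finally show ?thesis .
  qed
  have avg: "(\<integral>\<^sup>+x. indicator (Q i) x * pot k (dens h) x \<partial>lborel) = ennreal (\<Sum>j\<in>I. a i j * c j)" if i: "i < n" for i
  proof -
    have "(\<integral>\<^sup>+x. indicator (Q i) x * pot k (dens h) x \<partial>lborel) = (\<integral>\<^sup>+x. (\<Sum>j\<in>I. ennreal (c j) * (indicator (Q i) x * pQ j x)) \<partial>lborel)"
      unfolding pot_h sum_distrib_left by (intro nn_integral_cong sum.cong) (auto simp: mult_ac)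
    also have "\<dots> = (\<Sum>j\<in>I. \<integral>\<^sup>+x. ennreal (c j) * (indicator (Q i) x * pQ j x) \<partial>lborel)"
      by (rule nn_integral_sum) measurable
    also have "\<dots> = (\<Sum>j\<in>I. ennreal (c j) * A i j)"
      unfolding A_def by (intro sum.cong refl nn_integral_cmult) measurable
    also have "\<dots> = (\<Sum>j\<in>I. ennreal (a i j * c j))"
      using Aa[OF i I(2)] c(1) by (intro sum.cong refl) (simp add: ennreal_mult' a_def mult.commute)
    also have "\<dots> = ennreal (\<Sum>j\<in>I. a i j * c j)"
      using c(1) by (intro sum_ennreal) (auto simp: a_def)
    finally show ?thesis .
  qed
  define u where "u x = enn2real (pot k (dens h) x)" for x
  have eu: "pot k (dens h) x = ennreal (u x)" for x
    using pot_dens_finite[OF hK compact_imp_bounded[OF K], of x] by (simp add: u_def)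
  have u0: "0 <= u x" for x by (simp add: u_def)
  have osc: "u x <= u x' + \<kappa>/2" if "norm x <= R" "norm x' <= R" "dist x x' < \<delta>" for x x'
    using \<delta>(2)[OF hK that] u0 \<kappa> unfolding eu by (simp flip: ennreal_plus)
  have mass: "(\<integral>\<^sup>+x. indicator (Q i) x * ennreal t \<partial>lborel) = ennreal (t * m i)" if "i < n" "0 <= t" for i t
  proof -
    have "(\<integral>\<^sup>+x. indicator (Q i) x * ennreal t \<partial>lborel) = emeasure lborel (Q i) * ennreal t"
      by (simp add: nn_integral_multc)
    thus ?thesis using that em[OF that(1)] by (simp add: ennreal_mult' mult.commute)
  qed
  have sum0: "0 <= (\<Sum>j\<in>I. a i j * c j)" for i using c(1) by (intro sum_nonneg) (auto simp: a_def)
  have lo: "u x * m i <= (\<Sum>j\<in>I. a i j * c j) + \<kappa>/2 * m i" if i: "i < n" and x: "x \<in> Q i" for i x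
  proof -
    have "(\<integral>\<^sup>+x'. indicator (Q i) x' * ennreal (u x) \<partial>lborel) <= (\<integral>\<^sup>+x'. indicator (Q i) x' * pot k (dens h) x' + indicator (Q i) x' * ennreal (\<kappa>/2) \<partial>lborel)"
    proof (rule nn_integral_mono)
      fix x'
      have "x' \<in> Q i ==> u x <= u x' + \<kappa>/2" using osc[of x x'] QR[OF i x] QR[OF i, of x'] Qd[OF x, of x'] by simp
      thus "indicator (Q i) x' * ennreal (u x) <= indicator (Q i) x' * pot k (dens h) x' + indicator (Q i) x' * ennreal (\<kappa>/2)"
        using u0 \<kappa> unfolding eu by (auto simp: indicator_def ennreal_leI simp flip: ennreal_plus)
    qed
    also have "\<dots> = (\<integral>\<^sup>+x'. indicator (Q i) x' * pot k (dens h) x' \<partial>lborel) + (\<integral>\<^sup>+x'. indicator (Q i) x' * ennreal (\<kappa>/2) \<partial>lborel)"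
      unfolding pot_h by (rule nn_integral_add) measurable
    finally have "ennreal (u x * m i) <= ennreal ((\<Sum>j\<in>I. a i j * c j) + \<kappa>/2 * m i)"
      using u0[of x] \<kappa> sum0[of i] m0[of i] unfolding avg[OF i] by (simp add: mass[OF i])
    thus ?thesis using sum0[of i] \<kappa> m0[of i] by (subst (asm) ennreal_le_iff) auto
  qed
  have up: "(\<Sum>j\<in>I. a i j * c j) <= u x * m i + \<kappa>/2 * m i" if i: "i < n" and x: "x \<in> Q i" for i x
  proof -
    have "(\<integral>\<^sup>+x'. indicator (Q i) x' * pot k (dens h) x' \<partial>lborel) <= (\<integral>\<^sup>+x'. indicator (Q i) x' * ennreal (u x + \<kappa>/2) \<partial>lborel)"
    proof (rule nn_integral_mono)
      fix x'
      have "x' \<in> Q i ==> u x' <= u x + \<kappa>/2" using osc[of x' x] QR[OF i x] QR[OF i, of x'] Qd[OF _ x, of x'] by simp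
      thus "indicator (Q i) x' * pot k (dens h) x' <= indicator (Q i) x' * ennreal (u x + \<kappa>/2)"
        unfolding eu by (cases "x' \<in> Q i") (simp_all add: ennreal_leI del: ennreal_plus)
    qed
    also have "\<dots> = ennreal ((u x + \<kappa>/2) * m i)" by (rule mass[OF i]) (use u0[of x] \<kappa> in simp)
    finally have "ennreal (\<Sum>j\<in>I. a i j * c j) <= ennreal ((u x + \<kappa>/2) * m i)"
      unfolding avg[OF i] .
    thus ?thesis using u0[of x] \<kappa> m0[of i] by (subst (asm) ennreal_le_iff) (auto simp: distrib_right)
  qed
  define J where "J = {i \<in> I. 0 < c i}"
  define P where "P = closure (\<Union>i\<in>J. Q i)"
  have JK: "(\<Union>i\<in>J. Q i) \<subseteq> K" using QK I(2) by (auto simp: J_def)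
  have PK: "P \<subseteq> K" unfolding P_def using JK K by (simp add: closure_minimal compact_imp_closed)
  have onJ: "u x <= 1 + \<kappa>/2" if "i \<in> J" "x \<in> Q i" for i x
  proof -
    have i: "i \<in> I" "0 < c i" using that by (auto simp: J_def)
    have "u x * m i <= (m i - s * m i * c i) + \<kappa>/2 * m i" using lo[OF I(2)[OF i(1)] that(2)] c(4)[OF i] by linarith
    also have "\<dots> <= (1 + \<kappa>/2) * m i"
      using mult_nonneg_nonneg[of "s * m i" "c i"] s i(2) m0[of i] by (simp add: distrib_right)
    finally show ?thesis using i(1) by (simp add: I_def)
  qed
  show thesis
  proof (rule that[of P h])
    show "compact P" using compact_Int_closed[OF K, of P] PK by (simp add: P_def Int_absorb1)
    show "P \<subseteq> K" by (rule PK)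
    show "density_on (1 / s) P h" unfolding density_on_def
    proof (intro conjI allI impI)
      fix x assume "x \<notin> P"
      hence out: "x \<notin> Q i" if "i \<in> J" for i
        using closure_subset[of "\<Union>i\<in>J. Q i"] that by (auto simp: P_def)
      show "h x = 0"
      proof (rule h_out)
        fix i assume "i \<in> I" "x \<in> Q i"
        hence "i \<notin> J" using out by blast
        thus "c i = 0" using c(1)[OF \<open>i \<in> I\<close>] \<open>i \<in> I\<close> by (simp add: J_def)
      qed
    qed (use density_onD[OF hK] in auto)
    show "pot k (dens h) x <= ennreal (1 + \<kappa>)" if "x \<in> P" for x
    proof -
      obtain x' where x': "x' \<in> (\<Union>i\<in>J. Q i)" "dist x' x < \<delta>"
        using \<open>x \<in> P\<close> \<delta>(1) unfolding P_def closure_approachable by blast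
      have "x \<in> cball 0 R" "x' \<in> cball 0 R" using R PK JK that x'(1) by blast+
      hence "norm x <= R" "norm x' <= R" by simp_all
      hence "u x <= u x' + \<kappa>/2" using x'(2) by (intro osc) (auto simp: dist_commute)
      also have "u x' <= 1 + \<kappa>/2" using onJ x'(1) by blast
      finally show ?thesis unfolding eu by (intro ennreal_leI) simp
    qed
    have "AE x in lborel. \<forall>i\<in>{..<n} - I. x \<notin> Q i"
    proof (subst AE_finite_all, simp, intro ballI)
      fix i assume "i \<in> {..<n} - I"
      hence "i < n" "m i = 0" by (auto simp: I_def m_def not_less measure_le_0_iff)
      hence "emeasure lborel (Q i) = 0" using em by simp
      thus "AE x in lborel. x \<notin> Q i" by (intro AE_not_in) (auto simp: null_sets_def)
    qed
    thus "AE x in lborel. x \<in> K --> 1 <= pot k (dens h) x + ennreal (s * h x) + ennreal \<kappa>"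
    proof eventually_elim
      case (elim x)
      show ?case
      proof
        assume "x \<in> K"
        then obtain i where i: "i < n" "x \<in> Q i" using KQ by blast
        hence iI: "i \<in> I" using elim by blast
        have "m i <= u x * m i + \<kappa>/2 * m i + s * m i * c i" using c(3)[OF iI] up[OF i] by linarith
        hence "m i * 1 <= m i * (u x + \<kappa>/2 + s * c i)" by (simp add: algebra_simps)
        hence "1 <= u x + \<kappa>/2 + s * c i" using iI by (simp add: I_def)
        hence "1 <= u x + s * h x + \<kappa>" unfolding h_in[OF iI i(2)] using \<kappa> by linarith
        hence "ennreal 1 <= ennreal (u x + s * h x + \<kappa>)" by (rule ennreal_leI)
        also have "\<dots> = pot k (dens h) x + ennreal (s * h x) + ennreal \<kappa>"
          unfolding eu using u0[of x] s \<kappa> density_onD(2)[OF hK, of x] by simp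
        finally show "1 <= pot k (dens h) x + ennreal (s * h x) + ennreal \<kappa>" by simp
      qed
    qed
  qed
qed

text \<open>
A substitute for the equilibrium measure of K: a density with potential at most 1 up to \<kappa> everywhere, and at least 1 up to \<kappa> in the mean with respect to f. The upper bound on P spreads to all points by the maximum principle. The regularization s h in the lower bound is harmless when integrated against a truncation of f, because the mass of h is bounded independently of s.
\<close>

theorem approximate_equilibrium:
  assumes K: "compact K" and f[measurable]: "f \<in> borel_measurable borel" and f1: "(\<integral>\<^sup>+x\<in>K. ennreal (f x) \<partial>lborel) = 1"
    and \<kappa>: "0 < \<kappa>" "\<kappa> <= 1"
  obtains h B where "density_on B K h" "!!x. pot k (dens h) x <= ennreal (1 + \<kappa>)"
    "1 <= (\<integral>\<^sup>+x. pot k (dens h) x * ennreal (f x) \<partial>lborel) + ennreal \<kappa>"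
proof -
  have [measurable]: "K \<in> sets borel" using K by (simp add: compact_imp_closed)
  obtain M where M: "M >= 0" "!!B h. density_on B K h ==> (!!x. pot k (dens h) x <= 2) ==> (\<integral>\<^sup>+y. ennreal (h y) \<partial>lborel) <= ennreal M"
    using mass_bound[OF compact_imp_bounded[OF K]] by metis
  define fn where "fn n x = min (ennreal (f x)) (of_nat n) * indicator K x" for n :: nat and x
  have fnm[measurable]: "fn n \<in> borel_measurable borel" for n unfolding fn_def by measurable
  have SUPf: "(SUP n. fn n x) = ennreal (f x) * indicator K x" for x
  proof (rule antisym)
    show "(SUP n. fn n x) <= ennreal (f x) * indicator K x" by (rule SUP_least) (auto simp: fn_def indicator_def)
    obtain n :: nat where "f x <= real n" using real_arch_simple by blast
    hence "ennreal (f x) <= of_nat n" by (simp add: ennreal_of_nat_eq_real_of_nat ennreal_leI)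
    hence "ennreal (f x) * indicator K x = fn n x" by (simp add: fn_def min_def)
    also have "\<dots> <= (SUP n. fn n x)" by (rule SUP_upper) simp
    finally show "ennreal (f x) * indicator K x <= (SUP n. fn n x)" .
  qed
  have inc: "incseq fn" unfolding incseq_def le_fun_def fn_def
    by (auto simp: indicator_def min_def intro: order_trans)
  have "(SUP n. \<integral>\<^sup>+x. fn n x \<partial>lborel) = 1"
    using nn_integral_monotone_convergence_SUP[of fn lborel, OF inc] f1 by (simp add: SUPf)
  moreover have "1 - ennreal (\<kappa>/4) < 1" using \<kappa> by (simp add: ennreal_minus ennreal_less_iff flip: ennreal_1)
  ultimately obtain N where N: "1 - ennreal (\<kappa>/4) < (\<integral>\<^sup>+x. fn N x \<partial>lborel)"
    unfolding less_SUP_iff by (metis less_SUP_iff)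
  have N1: "1 <= (\<integral>\<^sup>+x. fn N x \<partial>lborel) + ennreal (\<kappa>/4)"
    using less_imp_le[OF N] by (simp add: ennreal_minus_le_iff add.commute)
  have fnle: "(\<integral>\<^sup>+x. fn N x \<partial>lborel) <= 1"
    unfolding f1[symmetric] by (rule nn_integral_mono) (auto simp: fn_def indicator_def)
  define s where "s = \<kappa> / (4 * (real N * M + 1))"
  have NM: "0 <= real N * M" using M(1) by simp
  have s: "s > 0" "s * (real N * M) <= \<kappa>/4" using \<kappa> NM by (auto simp: s_def field_simps)
  obtain h P where h: "density_on (1 / s) P h" and P: "compact P" "P \<subseteq> K"
    and le: "!!x. x \<in> P ==> pot k (dens h) x <= ennreal (1 + \<kappa>/4)"
    and ge: "AE x in lborel. x \<in> K --> 1 <= pot k (dens h) x + ennreal (s * h x) + ennreal (\<kappa>/4)"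
  proof -
    have "\<kappa>/4 > 0" using \<kappa> by simp
    show ?thesis by (rule discretised_equilibrium[OF K s(1) \<open>\<kappa>/4 > 0\<close>]) (rule that)
  qed
  have hK: "density_on (1 / s) K h" using h P(2) by (auto simp: density_on_def)
  have hm[measurable]: "h \<in> borel_measurable borel" using h by (rule density_onD)
  have max: "pot k (dens h) x <= ennreal (1 + \<kappa>/4)" for x
    by (rule maximum_principle[OF h P(1) _ le]) (use \<kappa> in auto)
  have "pot k (dens h) x <= 2" for x
  proof -
    have "ennreal (1 + \<kappa>/4) <= ennreal 2" using \<kappa> by (intro ennreal_leI) simp
    thus ?thesis using max[of x] by simp
  qed
  hence mass: "(\<integral>\<^sup>+y. ennreal (h y) \<partial>lborel) <= ennreal M" by (rule M(2)[OF hK])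
  have pm[measurable]: "pot k (dens h) \<in> borel_measurable borel"
    unfolding pot_dens[OF k_meas hm, abs_def] by measurable
  have "(\<integral>\<^sup>+x. fn N x \<partial>lborel) <= (\<integral>\<^sup>+x. pot k (dens h) x * ennreal (f x) + ennreal (s * real N) * ennreal (h x) + ennreal (\<kappa>/4) * fn N x \<partial>lborel)"
  proof (rule nn_integral_mono_AE, use ge in eventually_elim)
    case (elim x)
    show ?case
    proof (cases "x \<in> K")
      case True
      hence "fn N x * 1 <= fn N x * (pot k (dens h) x + ennreal (s * h x) + ennreal (\<kappa>/4))"
        using elim by (intro mult_left_mono) auto
      also have "\<dots> = fn N x * pot k (dens h) x + fn N x * ennreal (s * h x) + fn N x * ennreal (\<kappa>/4)"
        by (simp add: distrib_left)
      also have "\<dots> <= pot k (dens h) x * ennreal (f x) + ennreal (s * real N) * ennreal (h x) + ennreal (\<kappa>/4) * fn N x"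
      proof (intro add_mono)
        have "fn N x <= ennreal (f x)" "fn N x <= ennreal (real N)"
          using True by (auto simp: fn_def ennreal_of_nat_eq_real_of_nat)
        show "fn N x * pot k (dens h) x <= pot k (dens h) x * ennreal (f x)"
          using \<open>fn N x <= ennreal (f x)\<close> by (subst (2) mult.commute) (rule mult_right_mono, simp_all)
        have "fn N x * ennreal (s * h x) <= ennreal (real N) * ennreal (s * h x)"
          using \<open>fn N x <= ennreal (real N)\<close> by (rule mult_right_mono) simp
        also have "\<dots> = ennreal (s * real N) * ennreal (h x)"
          using s(1) density_onD(2)[OF h, of x] by (simp add: mult_ac flip: ennreal_mult')
        finally show "fn N x * ennreal (s * h x) <= ennreal (s * real N) * ennreal (h x)" .
      qed (simp add: mult.commute)
      finally show ?thesis by simp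
    qed (simp add: fn_def)
  qed
  also have "\<dots> = (\<integral>\<^sup>+x. pot k (dens h) x * ennreal (f x) \<partial>lborel) + ennreal (s * real N) * (\<integral>\<^sup>+x. ennreal (h x) \<partial>lborel)
      + ennreal (\<kappa>/4) * (\<integral>\<^sup>+x. fn N x \<partial>lborel)"
    by (simp add: nn_integral_add nn_integral_cmult)
  also have "\<dots> <= (\<integral>\<^sup>+x. pot k (dens h) x * ennreal (f x) \<partial>lborel) + ennreal (\<kappa>/4) + ennreal (\<kappa>/4)"
  proof (intro add_mono order_refl)
    have "ennreal (s * real N) * (\<integral>\<^sup>+x. ennreal (h x) \<partial>lborel) <= ennreal (s * real N) * ennreal M"
      by (intro mult_left_mono mass) simp
    also have "\<dots> = ennreal (s * (real N * M))" using s(1) M(1) by (simp add: mult.assoc flip: ennreal_mult')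
    also have "\<dots> <= ennreal (\<kappa>/4)" using s(2) by (rule ennreal_leI)
    finally show "ennreal (s * real N) * (\<integral>\<^sup>+x. ennreal (h x) \<partial>lborel) <= ennreal (\<kappa>/4)" .
    have "ennreal (\<kappa>/4) * (\<integral>\<^sup>+x. fn N x \<partial>lborel) <= ennreal (\<kappa>/4) * 1" by (rule mult_left_mono[OF fnle]) simp
    thus "ennreal (\<kappa>/4) * (\<integral>\<^sup>+x. fn N x \<partial>lborel) <= ennreal (\<kappa>/4)" by simp
  qed
  finally have "1 <= (\<integral>\<^sup>+x. pot k (dens h) x * ennreal (f x) \<partial>lborel) + ennreal (\<kappa>/4) + ennreal (\<kappa>/4) + ennreal (\<kappa>/4)"
    using N1 by (meson add_right_mono order_trans)
  also have "\<dots> <= (\<integral>\<^sup>+x. pot k (dens h) x * ennreal (f x) \<partial>lborel) + ennreal \<kappa>"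
    using \<kappa> by (simp add: add.assoc add_left_mono ennreal_leI flip: ennreal_plus)
  finally have fin: "1 <= (\<integral>\<^sup>+x. pot k (dens h) x * ennreal (f x) \<partial>lborel) + ennreal \<kappa>" .
  show thesis
  proof (rule that[OF hK _ fin])
    show "pot k (dens h) x <= ennreal (1 + \<kappa>)" for x using max[of x] \<kappa> by (auto intro: order_trans ennreal_leI)
  qed
qed

end

section \<open>Kernels with positive Laplacian off the origin\<close>

text \<open>
Partial derivatives as derivatives along coordinate lines, which is all that second differences and integration by parts need.
\<close>

definition has_pd :: "'n::finite => (real^'n => real) => real => real^'n => bool" where
  "has_pd i F D x \<longleftrightarrow> ((%t. F (x + t *\<^sub>R axis i 1)) has_real_derivative D) (at 0)"

lemma has_pd_line:
  assumes "has_pd i F D (x + t *\<^sub>R axis i 1)"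
  shows "((%t. F (x + t *\<^sub>R axis i 1)) has_real_derivative D) (at t)"
proof -
  have "(%s. F (x + t *\<^sub>R axis i 1 + s *\<^sub>R axis i 1)) = (%s. F (x + (t + s) *\<^sub>R axis i 1))"
    by (simp add: scaleR_left_distrib add.assoc)
  thus ?thesis using assms DERIV_shift[of "%t. F (x + t *\<^sub>R axis i 1)" D 0 t]
    by (simp add: has_pd_def add.commute)
qed

lemma differentiable_has_pd:
  assumes "F differentiable (at x)"
  shows "has_pd i F (partial_deriv i F x) x"
proof -
  have F: "(F has_derivative frechet_derivative F (at x)) (at x)" using assms by (simp add: frechet_derivative_works)
  have l: "((%t::real. x + t *\<^sub>R axis i 1) has_derivative (%t. t *\<^sub>R axis i 1)) (at 0)"
    by (auto intro!: derivative_eq_intros)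
  have "((%t. F (x + t *\<^sub>R axis i 1)) has_derivative (%t. frechet_derivative F (at x) (t *\<^sub>R axis i 1))) (at 0)"
    using has_derivative_compose[OF l, of F "frechet_derivative F (at x)"] F by simp
  moreover have "frechet_derivative F (at x) (t *\<^sub>R axis i 1) = t * partial_deriv i F x" for t
    unfolding partial_deriv_def using linear_scale[OF has_derivative_linear[OF F]] by simp
  moreover have "(*) (partial_deriv i F x) = (%t. t * partial_deriv i F x)" by (simp add: fun_eq_iff mult.commute)
  ultimately show ?thesis unfolding has_pd_def has_field_derivative_def by (simp only:)
qed

lemma second_difference_bound:
  fixes f :: "real => real"
  assumes h: "0 < h" and d1: "!!t. \<bar>t\<bar> <= h ==> (f has_real_derivative f' t) (at t)"
    and d2: "!!t. \<bar>t\<bar> <= h ==> (f' has_real_derivative f'' t) (at t)"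
  shows "(!!t. \<bar>t\<bar> <= h ==> m <= f'' t) ==> m * h^2 <= f h + f (- h) - 2 * f 0"
    and "(!!t. \<bar>t\<bar> <= h ==> f'' t <= M) ==> f h + f (- h) - 2 * f 0 <= M * h^2"
proof -
  define D where "D g g' g'' n = (if n = 0 then g else if n = Suc 0 then g' else g'')" for g g' g'' :: "real => real" and n :: nat
  have "\<exists>t>0. t < h & f h = (\<Sum>m<2. D f f' f'' m 0 / fact m * h ^ m) + D f f' f'' 2 t / fact 2 * h ^ 2"
    by (rule Maclaurin[OF h]) (use d1 d2 in \<open>auto simp: D_def less_Suc_eq numeral_2_eq_2\<close>)
  then obtain s where s: "0 < s" "s < h" "f h = f 0 + f' 0 * h + f'' s / 2 * h^2"
    by (auto simp: D_def numeral_2_eq_2)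
  define g where "g t = f (- t)" for t
  have "\<exists>t>0. t < h & g h = (\<Sum>m<2. D g (%t. - f' (-t)) (%t. f'' (- t)) m 0 / fact m * h ^ m) + D g (%t. - f' (-t)) (%t. f'' (- t)) 2 t / fact 2 * h ^ 2"
  proof (rule Maclaurin[OF h])
    have "(g has_real_derivative - f' (-t)) (at t)" if "\<bar>t\<bar> <= h" for t
      unfolding g_def DERIV_mirror[symmetric] using d1[of "-t"] that by simp
    moreover have "((%t. - f' (- t)) has_real_derivative f'' (-t)) (at t)" if "\<bar>t\<bar> <= h" for t
      using DERIV_minus[OF DERIV_mirror[THEN iffD1, OF d2[of "-t"]]] that by simp
    ultimately show "\<forall>m t. m < 2 & 0 <= t & t <= h --> ((D g (%t. - f' (-t)) (%t. f'' (- t)) m) has_real_derivative D g (%t. - f' (-t)) (%t. f'' (- t)) (Suc m) t) (at t)"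
      by (auto simp: D_def less_Suc_eq numeral_2_eq_2)
  qed (auto simp: D_def)
  then obtain r where r: "0 < r" "r < h" "f (- h) = f 0 - f' 0 * h + f'' (- r) / 2 * h^2"
    by (auto simp: D_def numeral_2_eq_2 g_def)
  have eq: "f h + f (- h) - 2 * f 0 = (f'' s + f'' (- r)) / 2 * h^2"
    using s(3) r(3) by (simp add: field_simps)
  show "m * h^2 <= f h + f (- h) - 2 * f 0" if "!!t. \<bar>t\<bar> <= h ==> m <= f'' t"
    unfolding eq using that[of s] that[of "- r"] s r by (intro mult_right_mono) auto
  show "f h + f (- h) - 2 * f 0 <= M * h^2" if "!!t. \<bar>t\<bar> <= h ==> f'' t <= M"
    unfolding eq using that[of s] that[of "- r"] s r by (intro mult_right_mono) auto
qed

locale subharmonic_off_0 =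
  fixes w :: "real^'n::finite => real"
  assumes C2: "C2_on (- {0}) w" and lap_pos: "x ~= 0 ==> laplacian w x > 0"
begin

lemma open_off_0: "open (- {0::real^'n})"
  by (simp add: open_Compl)

lemma w_pd: "x ~= 0 ==> has_pd i w (partial_deriv i w x) x"
  using C2 open_off_0 by (intro differentiable_has_pd) (auto simp: C2_on_def differentiable_on_eq_differentiable_at)

lemma pd_w_pd: "x ~= 0 ==> has_pd j (partial_deriv i w) (partial_deriv j (partial_deriv i w) x) x"
  using C2 open_off_0 by (intro differentiable_has_pd) (auto simp: C2_on_def differentiable_on_eq_differentiable_at)

lemma w_cont: "continuous_on (- {0}) w"
  using C2 by (auto simp: C2_on_def differentiable_imp_continuous_on)

lemma pd_w_cont: "continuous_on (- {0}) (partial_deriv i w)"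
  using C2 by (auto simp: C2_on_def differentiable_imp_continuous_on)

lemma ppd_w_cont: "continuous_on (- {0}) (partial_deriv j (partial_deriv i w))"
  using C2 by (auto simp: C2_on_def)

lemma lap_cont: "continuous_on (- {0}) (laplacian w)"
  unfolding laplacian_def[abs_def] by (intro continuous_on_sum ppd_w_cont)

text \<open>
A second-order Taylor expansion along the coordinate lines, uniform on the compact set Z, on a neighbourhood of which the second derivatives are uniformly continuous.
\<close>

lemma second_difference_positive:
  assumes Z: "compact Z" "0 \<notin> Z" and \<delta>: "\<delta> > 0"
  obtains h c where "0 < h" "h <= \<delta>" "0 < c"
    "!!z i. z \<in> Z ==> z + h *\<^sub>R axis i 1 ~= 0 & z - h *\<^sub>R axis i 1 ~= 0"
    "!!z. z \<in> Z ==> c <= (\<Sum>i\<in>UNIV. w (z + h *\<^sub>R axis i 1) + w (z - h *\<^sub>R axis i 1) - 2 * w z)"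
proof (cases "Z = {}")
  case True thus thesis using \<delta> by (intro that[of \<delta> 1]) auto
next
  case False
  obtain \<rho> where \<rho>: "\<rho> > 0" "!!z. z \<in> Z ==> \<rho> <= norm z"
    using separate_point_closed[of Z 0] Z by (auto simp: compact_imp_closed)
  define Y where "Y = {z + v | z v. z \<in> Z & v \<in> cball 0 (\<rho>/2)}"
  have Yc: "compact Y" unfolding Y_def by (rule compact_sums[OF Z(1) compact_cball])
  have Y0: "y ~= 0" if "y \<in> Y" for y
  proof
    assume "y = 0"
    then obtain z v where "z + v = 0" "z \<in> Z" "norm v <= \<rho>/2" using \<open>y \<in> Y\<close> by (auto simp: Y_def)
    hence "norm z = norm v" by (metis add_eq_0_iff norm_minus_cancel)
    thus False using \<rho>(2)[OF \<open>z \<in> Z\<close>] \<open>norm v <= \<rho>/2\<close> \<rho>(1) by linarith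
  qed
  hence Ysub: "Y \<subseteq> - {0}" by blast
  have ZY: "Z \<subseteq> Y"
  proof
    fix z assume "z \<in> Z" thus "z \<in> Y" unfolding Y_def using \<rho>(1) by (intro CollectI exI[of _ z] exI[of _ 0]) auto
  qed
  obtain z0 where z0: "z0 \<in> Z" "!!z. z \<in> Z ==> laplacian w z0 <= laplacian w z"
    using continuous_attains_inf[OF Z(1) False continuous_on_subset[OF lap_cont]] Z(2) by (metis (no_types, lifting) ComplI singletonD subsetI)
  define c where "c = laplacian w z0"
  have c: "c > 0" unfolding c_def using z0(1) Z(2) by (intro lap_pos) auto
  define n where "n = real CARD('n)"
  have n: "n >= 1" unfolding n_def by (simp add: Suc_leI)
  have "\<exists>d>0. \<forall>x\<in>Y. \<forall>x'\<in>Y. dist x' x < d -->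
      dist (partial_deriv i (partial_deriv i w) x') (partial_deriv i (partial_deriv i w) x) < c / (2 * n)" for i
  proof -
    have "uniformly_continuous_on Y (partial_deriv i (partial_deriv i w))"
      by (rule compact_uniformly_continuous[OF continuous_on_subset[OF ppd_w_cont Ysub] Yc])
    moreover have "0 < c / (2 * n)" using c n by simp
    ultimately show ?thesis unfolding uniformly_continuous_on_def by blast
  qed
  then obtain d where d: "!!i. d i > 0" "!!i x x'. x \<in> Y ==> x' \<in> Y ==> dist x' x < d i ==>
      dist (partial_deriv i (partial_deriv i w) x') (partial_deriv i (partial_deriv i w) x) < c / (2 * n)" by metis
  define h where "h = min (min \<delta> (\<rho>/2)) (Min (range d) / 2)"
  have dmin: "0 < Min (range d)" "!!i. Min (range d) <= d i" using d(1) by auto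
  have h: "0 < h" "h <= \<delta>" "h <= \<rho>/2" unfolding h_def using \<delta> \<rho>(1) dmin(1) by auto
  have hd: "h < d i" for i unfolding h_def using dmin(1) dmin(2)[of i] by linarith
  have na: "norm (t *\<^sub>R (axis i 1 :: real^'n)) = \<bar>t\<bar>" for i t by (simp add: norm_axis_1)
  have inY: "z + t *\<^sub>R axis i 1 \<in> Y" if "z \<in> Z" "\<bar>t\<bar> <= h" for z t i
    unfolding Y_def using that h(3) na[of t i] by (intro CollectI exI[of _ z] exI[of _ "t *\<^sub>R axis i 1"]) auto
  show thesis
  proof (rule that[OF h(1,2), of "h^2 * (c / 2)"])
    show "0 < h^2 * (c / 2)" using h c by simp
    show "z + h *\<^sub>R axis i 1 ~= 0 & z - h *\<^sub>R axis i 1 ~= 0" if "z \<in> Z" for z i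
      using Y0[OF inY[OF that, of h i]] Y0[OF inY[OF that, of "- h" i]] h(1) by simp
    fix z assume z: "z \<in> Z"
    have each: "(partial_deriv i (partial_deriv i w) z - c / (2 * n)) * h^2 <= w (z + h *\<^sub>R axis i 1) + w (z - h *\<^sub>R axis i 1) - 2 * w z" for i
    proof -
      let ?e = "axis i 1 :: real^'n"
      have "(partial_deriv i (partial_deriv i w) z - c / (2 * n)) * h^2
          <= w (z + h *\<^sub>R ?e) + w (z + (- h) *\<^sub>R ?e) - 2 * w (z + 0 *\<^sub>R ?e)"
      proof (rule second_difference_bound(1)[OF h(1), where f="%t. w (z + t *\<^sub>R ?e)" and f'="%t. partial_deriv i w (z + t *\<^sub>R ?e)"
            and f''="%t. partial_deriv i (partial_deriv i w) (z + t *\<^sub>R ?e)"])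
        fix t assume t: "\<bar>t\<bar> <= h"
        note nz = Y0[OF inY[OF z t]]
        show "((%t. w (z + t *\<^sub>R ?e)) has_real_derivative partial_deriv i w (z + t *\<^sub>R ?e)) (at t)"
          by (rule has_pd_line[OF w_pd[OF nz]])
        show "((%t. partial_deriv i w (z + t *\<^sub>R ?e)) has_real_derivative partial_deriv i (partial_deriv i w) (z + t *\<^sub>R ?e)) (at t)"
          by (rule has_pd_line[OF pd_w_pd[OF nz]])
        have "dist (z + t *\<^sub>R ?e) z < d i" using t hd[of i] na[of t i] by (simp add: dist_norm)
        from d(2)[OF _ inY[OF z t] this] ZY z
        show "partial_deriv i (partial_deriv i w) z - c / (2 * n) <= partial_deriv i (partial_deriv i w) (z + t *\<^sub>R ?e)"
          by (auto simp: dist_real_def)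
      qed
      thus ?thesis by simp
    qed
    have "h^2 * (c / 2) <= h^2 * (laplacian w z - c / 2)" using z0(2)[OF z] h(1) by (intro mult_left_mono) (auto simp: c_def)
    also have "laplacian w z - c / 2 = (\<Sum>i\<in>UNIV. partial_deriv i (partial_deriv i w) z - c / (2 * n))"
      using n by (simp add: laplacian_def sum_subtractf n_def)
    also have "h^2 * \<dots> = (\<Sum>i\<in>UNIV. (partial_deriv i (partial_deriv i w) z - c / (2 * n)) * h^2)"
      by (simp add: sum_distrib_left mult.commute)
    also have "\<dots> <= (\<Sum>i\<in>UNIV. w (z + h *\<^sub>R axis i 1) + w (z - h *\<^sub>R axis i 1) - 2 * w z)" by (rule sum_mono) (rule each)
    finally show "h^2 * (c / 2) <= (\<Sum>i\<in>UNIV. w (z + h *\<^sub>R axis i 1) + w (z - h *\<^sub>R axis i 1) - 2 * w z)" .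
  qed
qed

text \<open>
Averaging the potential over the points x0 \<plusminus> h e_i increases it by a definite multiple of the mass of \<eta>, since the points of x0 - P stay away from the origin. At a maximum this mass must be zero.
\<close>

lemma potential_no_exterior_maximum:
  fixes k :: "real^'n => ennreal"
  assumes km[measurable]: "k \<in> borel_measurable borel" and kw: "!!x. x ~= 0 ==> k x = ennreal (w x)" and w0: "!!x. x ~= 0 ==> 0 <= w x"
    and fin: "pot k (dens \<eta>) x0 < \<infinity>"
    and P: "compact P" and \<eta>: "density_on B P \<eta>" and x0: "x0 \<notin> P" and max: "!!x. pot k (dens \<eta>) x <= pot k (dens \<eta>) x0"
  shows "pot k (dens \<eta>) x0 = 0"
proof -
  have \<eta>m[measurable]: "\<eta> \<in> borel_measurable borel" using \<eta> by (rule density_onD)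
  define Z where "Z = (%y. x0 - y) ` P"
  have Z: "compact Z" "0 \<notin> Z" unfolding Z_def using P x0 by (auto intro!: compact_continuous_image continuous_intros)
  obtain h c where h: "0 < h" and c: "0 < c"
    and nz: "!!z i. z \<in> Z ==> z + h *\<^sub>R axis i 1 ~= 0 & z - h *\<^sub>R axis i 1 ~= 0"
    and sd: "!!z. z \<in> Z ==> c <= (\<Sum>i\<in>UNIV. w (z + h *\<^sub>R axis i 1) + w (z - h *\<^sub>R axis i 1) - 2 * w z)"
    by (rule second_difference_positive[OF Z zero_less_one]) (rule that)
  let ?e = "%i. h *\<^sub>R axis i 1 :: real^'n"
  have ptw: "(\<Sum>i\<in>(UNIV::'n set). 2 * (ennreal (\<eta> y) * k (x0 - y))) + ennreal c * ennreal (\<eta> y)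
      <= (\<Sum>i\<in>UNIV. ennreal (\<eta> y) * k (x0 + ?e i - y) + ennreal (\<eta> y) * k (x0 - ?e i - y))" for y
  proof (cases "y \<in> P")
    case True
    hence zZ: "x0 - y \<in> Z" by (auto simp: Z_def)
    define z where "z = x0 - y"
    have z: "z \<in> Z" "z ~= 0" using zZ Z(2) by (auto simp: z_def)
    have pos: "0 <= w z" "0 <= w (z + ?e i)" "0 <= w (z - ?e i)" for i using w0 nz z by auto
    have sh: "x0 + ?e i - y = z + ?e i" "x0 - ?e i - y = z - ?e i" for i by (auto simp: z_def)
    have "(\<Sum>i\<in>(UNIV::'n set). 2 * k z) + ennreal c = ennreal ((\<Sum>i\<in>(UNIV::'n set). 2 * w z) + c)"
      using pos c kw[OF z(2)] by (simp add: ennreal_mult' ennreal_of_nat_eq_real_of_nat flip: ennreal_numeral)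
    also have "\<dots> <= ennreal (\<Sum>i\<in>UNIV. w (z + ?e i) + w (z - ?e i))"
      using sd[OF z(1)] by (intro ennreal_leI) (simp add: sum_subtractf sum.distrib)
    also have "\<dots> = (\<Sum>i\<in>UNIV. k (z + ?e i) + k (z - ?e i))"
      using pos nz[OF z(1)] kw by (simp add: sum_ennreal flip: ennreal_plus)
    finally have "ennreal (\<eta> y) * ((\<Sum>i\<in>(UNIV::'n set). 2 * k z) + ennreal c) <= ennreal (\<eta> y) * (\<Sum>i\<in>UNIV. k (z + ?e i) + k (z - ?e i))"
      by (rule mult_left_mono) simp
    thus ?thesis unfolding sh by (simp add: z_def[symmetric] distrib_left sum_distrib_left mult_ac)
  qed (simp add: density_onD(4)[OF \<eta>])
  let ?p = "pot k (dens \<eta>) x0"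
  have "(\<Sum>i\<in>(UNIV::'n set). 2 * ?p) + ennreal c * (\<integral>\<^sup>+y. ennreal (\<eta> y) \<partial>lborel)
      = (\<integral>\<^sup>+y. (\<Sum>i\<in>(UNIV::'n set). 2 * (ennreal (\<eta> y) * k (x0 - y))) + ennreal c * ennreal (\<eta> y) \<partial>lborel)"
    by (simp add: pot_dens nn_integral_add nn_integral_cmult del: sum_constant) (simp add: nn_integral_sum nn_integral_cmult del: sum_constant)
  also have "\<dots> <= (\<integral>\<^sup>+y. (\<Sum>i\<in>UNIV. ennreal (\<eta> y) * k (x0 + ?e i - y) + ennreal (\<eta> y) * k (x0 - ?e i - y)) \<partial>lborel)"
    by (rule nn_integral_mono) (rule ptw)
  also have "\<dots> = (\<Sum>i\<in>UNIV. pot k (dens \<eta>) (x0 + ?e i) + pot k (dens \<eta>) (x0 - ?e i))"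
    by (simp add: pot_dens nn_integral_sum nn_integral_add)
  also have "\<dots> <= (\<Sum>i\<in>(UNIV::'n set). ?p + ?p)" by (intro sum_mono add_mono max)
  also have "\<dots> = (\<Sum>i\<in>(UNIV::'n set). 2 * ?p) + 0" by (simp add: mult_2)
  finally have "ennreal c * (\<integral>\<^sup>+y. ennreal (\<eta> y) \<partial>lborel) <= 0"
    using fin by (subst (asm) ennreal_add_left_cancel_le) (auto simp: ennreal_mult_eq_top_iff top_unique)
  hence "(\<integral>\<^sup>+y. ennreal (\<eta> y) \<partial>lborel) = 0" using c by simp
  hence "AE y in lborel. ennreal (\<eta> y) = 0" by (subst (asm) nn_integral_0_iff_AE) auto
  hence "(\<integral>\<^sup>+y. ennreal (\<eta> y) * k (x0 - y) \<partial>lborel) = 0"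
    by (subst nn_integral_0_iff_AE) (auto elim: eventually_mono)
  thus ?thesis by (simp add: pot_dens)
qed

text \<open>
If k vanished near the origin, so would the Laplacian of w at nearby points, against its positivity.
\<close>

lemma not_locally_zero:
  fixes k :: "real^'n => ennreal"
  assumes km[measurable]: "k \<in> borel_measurable borel" and kc: "continuous_on UNIV k" and kw: "!!x. x ~= 0 ==> k x = ennreal (w x)" and w0: "!!x. x ~= 0 ==> 0 <= w x"
  shows "(\<integral>\<^sup>+x\<in>cball 0 1. k x \<partial>lborel) > 0"
proof (rule ccontr)
  assume "\<not> ?thesis"
  hence "AE x in lborel. k x * indicator (cball 0 1) x = 0" by (subst (asm) zero_less_iff_neq_zero) (simp add: nn_integral_0_iff_AE)
  hence ae: "AE x in lborel. x \<in> ball 0 1 --> k x = 0" by eventually_elim auto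
  have zero: "k x = 0" if x: "x \<in> ball 0 1" for x
  proof (rule ccontr)
    assume "k x ~= 0"
    have "open ({x. k x ~= 0} \<inter> ball 0 1)"
      by (intro open_Int open_Collect_neq kc continuous_intros) auto
    moreover have "x \<in> {x. k x ~= 0} \<inter> ball 0 1" using x \<open>k x ~= 0\<close> by simp
    ultimately have "\<not> negligible ({x. k x ~= 0} \<inter> ball 0 1)"
      by (intro open_not_negligible) auto
    moreover have "{x. k x ~= 0} \<inter> ball 0 1 \<in> null_sets lborel"
      using ae \<open>open ({x. k x ~= 0} \<inter> ball 0 1)\<close> by (subst AE_iff_null_sets) (auto elim: eventually_mono)
    ultimately show False by (metis negligible_iff_null_sets null_sets_completionI)
  qed
  obtain i :: 'n where True by simp
  define z where "z = (1/2) *\<^sub>R (axis i 1 :: real^'n)"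
  have z: "compact {z}" "0 \<notin> {z}" "norm z = 1/2" by (auto simp: z_def norm_axis_1 axis_eq_0_iff)
  obtain h c where h: "0 < h" "h <= 1/4" and c: "0 < c"
    and nz: "!!y i. y \<in> {z} ==> y + h *\<^sub>R axis i 1 ~= 0 & y - h *\<^sub>R axis i 1 ~= 0"
    and sd: "!!y. y \<in> {z} ==> c <= (\<Sum>i\<in>UNIV. w (y + h *\<^sub>R axis i 1) + w (y - h *\<^sub>R axis i 1) - 2 * w y)"
    by (rule second_difference_positive[OF z(1,2), of "1/4"]) (simp, rule that)
  have wz: "w x = 0" if "x ~= 0" "norm x < 1" for x using kw[OF that(1)] zero[of x] w0[OF that(1)] that(2) by simp
  have n4: "norm (h *\<^sub>R (axis j 1 :: real^'n)) <= 1/4" for j using h by (simp add: norm_axis_1)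
  have "norm (z + h *\<^sub>R axis j 1) < 1" "norm (z - h *\<^sub>R axis j 1) < 1" for j
    using norm_triangle_ineq[of z "h *\<^sub>R axis j 1"] norm_triangle_ineq4[of z "h *\<^sub>R axis j 1"] z(3) n4[of j] by linarith+
  hence "w (z + h *\<^sub>R axis j 1) = 0" "w (z - h *\<^sub>R axis j 1) = 0" for j using nz wz by auto
  moreover have "w z = 0" using z by (intro wz) auto
  ultimately show False using sd[of z] c by simp
qed

end

section \<open>Integrability of powers of the norm\<close>

lemma term_le_suminf_ennreal: "(f :: nat => ennreal) k <= (\<Sum>i. f i)"
  using sum_le_suminf[of f "{k}"] by (simp add: summableI)

lemma nn_integral_norm_powr_near_0:
  assumes p: "- real DIM('a::euclidean_space) < p"
  shows "(\<integral>\<^sup>+x. ennreal (norm (x::'a) powr p) * indicator {x. 0 < norm x & norm x < 1} x \<partial>lborel) < \<infinity>"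
proof (cases "0 <= p")
  case True
  have "(\<integral>\<^sup>+x. ennreal (norm (x::'a) powr p) * indicator {x. 0 < norm x & norm x < 1} x \<partial>lborel)
      <= (\<integral>\<^sup>+x. indicator (ball (0::'a) 1) x \<partial>lborel)"
  proof (rule nn_integral_mono)
    fix x :: 'a
    have "norm x < 1 ==> norm x powr p <= 1" using True by (intro powr_le1) auto
    thus "ennreal (norm x powr p) * indicator {x. 0 < norm x & norm x < 1} x <= indicator (ball 0 1) x"
      by (auto simp: indicator_def ennreal_le_1)
  qed
  also have "\<dots> < \<infinity>" by (simp add: emeasure_ball)
  finally show ?thesis .
next
  case False
  define n where "n = DIM('a)"
  define \<omega> where "\<omega> = unit_ball_vol n"
  have \<omega>: "\<omega> >= 0" by (simp add: \<omega>_def)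
  define r where "r = 2 powr (- p) * (1/2) ^ n"
  have r: "0 <= r" "r < 1"
  proof -
    have "r = 2 powr (- p) * 2 powr (- real n)" by (simp add: r_def powr_minus powr_realpow power_one_over inverse_eq_divide)
    also have "\<dots> = 2 powr (- p - real n)" by (simp add: powr_add[symmetric])
    also have "\<dots> < 2 powr 0" using p by (intro powr_less_mono) (auto simp: n_def)
    finally show "r < 1" by simp
  qed (simp add: r_def)
  define c :: "nat => real" where "c k = 2 powr (- p) * (2 powr (- p)) ^ k" for k
  have ball_meas[measurable]: "ball (0::'a) t \<in> sets borel" for t by simp
  have c0: "0 <= c k" for k by (simp add: c_def)
  have ptw: "ennreal (norm x powr p) * indicator {x. 0 < norm x & norm x < 1} x
      <= (\<Sum>k. ennreal (c k) * indicator (ball 0 ((1/2)^k)) x)" for x :: 'a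
  proof (cases "0 < norm x & norm x < 1")
    case True
    define k where "k = (LEAST k. (1/2) ^ Suc k <= norm x)"
    obtain k' where "(1/2::real) ^ k' < norm x" using real_arch_pow_inv[of "norm x" "1/2"] True by auto
    moreover have "(1/2::real) ^ Suc k' <= (1/2) ^ k'" by simp
    ultimately have ex: "\<exists>k. (1/2) ^ Suc k <= norm x" by (meson less_imp_le order_trans)
    have k1: "(1/2) ^ Suc k <= norm x" unfolding k_def by (rule LeastI_ex[OF ex])
    have k2: "norm x < (1/2) ^ k"
    proof (cases k)
      case 0 thus ?thesis using True by simp
    next
      case (Suc j)
      hence "\<not> (1/2) ^ Suc j <= norm x" using not_less_Least[of j "%k. (1/2) ^ Suc k <= norm x"] k_def by simp
      thus ?thesis using Suc by simp
    qed
    have "norm x powr p <= ((1/2) ^ Suc k) powr p" using k1 False by (intro powr_mono2') auto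
    also have "\<dots> = c k"
    proof -
      have "((1/2::real) ^ Suc k) powr p = (2 powr (- p)) ^ Suc k"
        by (simp add: powr_realpow[symmetric] powr_powr powr_divide powr_minus powr_mult mult.commute
              power_one_over inverse_eq_divide del: power_Suc)
      thus ?thesis by (simp add: c_def)
    qed
    finally have "norm x powr p <= c k" .
    hence "ennreal (norm x powr p) * indicator {x. 0 < norm x & norm x < 1} x <= ennreal (c k) * indicator (ball 0 ((1/2)^k)) x"
      using k2 True by (simp add: ennreal_leI)
    also have "\<dots> <= (\<Sum>k. ennreal (c k) * indicator (ball 0 ((1/2)^k)) x)"
      by (rule term_le_suminf_ennreal)
    finally show ?thesis .
  qed simp
  have "(\<integral>\<^sup>+x. ennreal (norm (x::'a) powr p) * indicator {x. 0 < norm x & norm x < 1} x \<partial>lborel)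
      <= (\<integral>\<^sup>+x. (\<Sum>k. ennreal (c k) * indicator (ball (0::'a) ((1/2)^k)) x) \<partial>lborel)"
    by (rule nn_integral_mono) (rule ptw)
  also have "\<dots> = (\<Sum>k. \<integral>\<^sup>+x. ennreal (c k) * indicator (ball (0::'a) ((1/2)^k)) x \<partial>lborel)"
    by (rule nn_integral_suminf) measurable
  also have "\<dots> = (\<Sum>k. ennreal (c k) * emeasure lborel (ball (0::'a) ((1/2)^k)))"
    by (rule suminf_cong) (rule nn_integral_cmult_indicator, simp)
  also have "\<dots> = (\<Sum>k. ennreal (2 powr (- p) * \<omega> * r ^ k))"
  proof (rule suminf_cong)
    fix k
    have "c k * (\<omega> * ((1/2)^k)^n) = 2 powr (- p) * \<omega> * r ^ k"
    proof -
      have "((1/2::real)^k)^n = ((1/2)^n)^k" by (metis power_mult mult.commute)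
      thus ?thesis by (simp only: c_def r_def power_mult_distrib mult_ac)
    qed
    thus "ennreal (c k) * emeasure lborel (ball (0::'a) ((1/2)^k)) = ennreal (2 powr (- p) * \<omega> * r ^ k)"
    proof -
      have "emeasure lborel (ball (0::'a) ((1/2)^k)) = ennreal (\<omega> * ((1/2)^k)^n)" by (simp add: emeasure_ball n_def \<omega>_def)
      thus ?thesis using \<open>c k * (\<omega> * ((1/2)^k)^n) = 2 powr (- p) * \<omega> * r ^ k\<close> ennreal_mult'[OF c0[of k]] by metis
    qed
  qed
  also have "\<dots> < \<infinity>"
  proof -
    have "summable (%k. 2 powr (- p) * \<omega> * r ^ k)" using r by (intro summable_mult summable_geometric) auto
    thus ?thesis using \<omega> r by (subst suminf_ennreal2) auto
  qed
  finally show ?thesis .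
qed

lemma nn_integral_norm_powr_at_infinity:
  assumes p: "p < - real DIM('a::euclidean_space)"
  shows "(\<integral>\<^sup>+x. ennreal (norm (x::'a) powr p) * indicator {x. 1 <= norm x} x \<partial>lborel) < \<infinity>"
proof -
  define n where "n = DIM('a)"
  define \<omega> where "\<omega> = unit_ball_vol n"
  have \<omega>: "\<omega> >= 0" by (simp add: \<omega>_def)
  define r where "r = 2 powr p * 2 ^ n"
  have r: "0 <= r" "r < 1"
  proof -
    have "r = 2 powr (p + real n)" by (simp add: r_def powr_add powr_realpow)
    also have "\<dots> < 2 powr 0" using p by (intro powr_less_mono) (auto simp: n_def)
    finally show "r < 1" by simp
  qed (simp add: r_def)
  define c :: "nat => real" where "c k = (2 powr p) ^ k" for k
  have ball_meas[measurable]: "ball (0::'a) t \<in> sets borel" for t by simp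
  have c0: "0 <= c k" for k by (simp add: c_def)
  have p0: "p < 0" using p by (meson less_trans neg_less_0_iff_less of_nat_0_less_iff DIM_positive)
  have ptw: "ennreal (norm x powr p) * indicator {x. 1 <= norm x} x
      <= (\<Sum>k. ennreal (c k) * indicator (ball 0 (2 ^ Suc k)) x)" for x :: 'a
  proof (cases "1 <= norm x")
    case True
    define k where "k = (LEAST k. norm x < 2 ^ Suc k)"
    obtain k' where "norm x < 2 ^ k'" using real_arch_pow[of 2 "norm x"] by auto
    moreover have "(2::real) ^ k' <= 2 ^ Suc k'" by simp
    ultimately have ex: "\<exists>k. norm x < 2 ^ Suc k" by (meson less_le_trans)
    have k2: "norm x < 2 ^ Suc k" unfolding k_def by (rule LeastI_ex[OF ex])
    have k1: "2 ^ k <= norm x"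
    proof (cases k)
      case 0 thus ?thesis using True by simp
    next
      case (Suc j)
      hence "\<not> norm x < 2 ^ Suc j" using not_less_Least[of j "%k. norm x < 2 ^ Suc k"] k_def by simp
      thus ?thesis using Suc by simp
    qed
    have "norm x powr p <= (2 ^ k) powr p" using k1 p0 by (intro powr_mono2') auto
    also have "\<dots> = c k"
      by (simp add: c_def powr_realpow[symmetric] powr_powr mult.commute)
    finally have "norm x powr p <= c k" .
    hence "ennreal (norm x powr p) * indicator {x. 1 <= norm x} x <= ennreal (c k) * indicator (ball 0 (2 ^ Suc k)) x"
      using k2 True by (simp add: ennreal_leI)
    also have "\<dots> <= (\<Sum>k. ennreal (c k) * indicator (ball 0 (2 ^ Suc k)) x)"
      by (rule term_le_suminf_ennreal)
    finally show ?thesis .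
  qed simp
  have "(\<integral>\<^sup>+x. ennreal (norm (x::'a) powr p) * indicator {x. 1 <= norm x} x \<partial>lborel)
      <= (\<integral>\<^sup>+x. (\<Sum>k. ennreal (c k) * indicator (ball (0::'a) (2 ^ Suc k)) x) \<partial>lborel)"
    by (rule nn_integral_mono) (rule ptw)
  also have "\<dots> = (\<Sum>k. \<integral>\<^sup>+x. ennreal (c k) * indicator (ball (0::'a) (2 ^ Suc k)) x \<partial>lborel)"
    by (rule nn_integral_suminf) measurable
  also have "\<dots> = (\<Sum>k. ennreal (c k) * emeasure lborel (ball (0::'a) (2 ^ Suc k)))"
    by (rule suminf_cong) (rule nn_integral_cmult_indicator, simp)
  also have "\<dots> = (\<Sum>k. ennreal (2 ^ n * \<omega> * r ^ k))"
  proof (rule suminf_cong)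
    fix k
    have "((2::real) ^ Suc k) ^ n = 2 ^ n * (2 ^ n) ^ k"
    proof -
      have "((2::real)^k)^n = (2^n)^k" by (metis power_mult mult.commute)
      thus ?thesis by (simp only: power_Suc power_mult_distrib)
    qed
    hence "c k * (\<omega> * (2 ^ Suc k)^n) = 2 ^ n * \<omega> * r ^ k"
      by (simp only: c_def r_def power_mult_distrib mult_ac)
    thus "ennreal (c k) * emeasure lborel (ball (0::'a) (2 ^ Suc k)) = ennreal (2 ^ n * \<omega> * r ^ k)"
    proof -
      have "emeasure lborel (ball (0::'a) (2 ^ Suc k)) = ennreal (\<omega> * (2 ^ Suc k)^n)"
        by (subst emeasure_ball) (simp_all add: n_def \<omega>_def)
      thus ?thesis using \<open>c k * (\<omega> * (2 ^ Suc k)^n) = 2 ^ n * \<omega> * r ^ k\<close> ennreal_mult'[OF c0[of k]] by metis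
    qed
  qed
  also have "\<dots> < \<infinity>"
  proof -
    have "summable (%k. 2 ^ n * \<omega> * r ^ k)" using r by (intro summable_mult summable_geometric) auto
    thus ?thesis using \<omega> r by (subst suminf_ennreal2) auto
  qed
  finally show ?thesis .
qed

text \<open>
The majorant used for all dominated integrals: the near exponent governs the unit ball, the far exponent its complement.
\<close>

definition two_powers :: "real => real => real^'n::finite => real" where
  "two_powers p q z = (if z = 0 then 0 else if norm z < 1 then norm z powr p else norm z powr q)"

lemma integrable_two_powers:
  assumes "- real CARD('n::finite) < p" "q < - real CARD('n)"
  shows "integrable lborel (two_powers p q :: real^'n => real)"
proof (rule integrableI_nonneg)
  show "two_powers p q \<in> borel_measurable lborel" unfolding two_powers_def[abs_def] by measurable
  show "AE x in lborel. 0 <= two_powers p q x" by (simp add: two_powers_def)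
  have "(\<integral>\<^sup>+x. ennreal (two_powers p q (x::real^'n)) \<partial>lborel)
    = (\<integral>\<^sup>+x. ennreal (norm (x::real^'n) powr p) * indicator {x. 0 < norm x & norm x < 1} x
        + ennreal (norm x powr q) * indicator {x. 1 <= norm x} x \<partial>lborel)"
    by (rule nn_integral_cong) (auto simp: two_powers_def indicator_def)
  also have "\<dots> = (\<integral>\<^sup>+x. ennreal (norm (x::real^'n) powr p) * indicator {x. 0 < norm x & norm x < 1} x \<partial>lborel)
      + (\<integral>\<^sup>+x. ennreal (norm (x::real^'n) powr q) * indicator {x. 1 <= norm x} x \<partial>lborel)"
    by (rule nn_integral_add) measurable
  also have "\<dots> < \<infinity>"
    using nn_integral_norm_powr_near_0[of p, where 'a="real^'n"] nn_integral_norm_powr_at_infinity[of q, where 'a="real^'n"] assms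
    by (simp add: less_top)
  finally show "(\<integral>\<^sup>+x. ennreal (two_powers p q (x::real^'n)) \<partial>lborel) < \<infinity>" .
qed

section \<open>Integration by parts\<close>

lemma lborel_integral_translate:
  fixes F :: "'a::euclidean_space => real"
  shows "(\<integral>x. F (x + a) \<partial>lborel) = (\<integral>x. F x \<partial>lborel)"
    and "integrable lborel F ==> integrable lborel (%x. F (x + a))"
proof -
  have "(%x::'a. x + a) = (+) a" by (auto simp: add.commute)
  hence "lborel = distr lborel borel (%x::'a. x + a)" by (simp only: lborel_distr_plus)
  hence d: "distr lborel lborel (%x::'a. x + a) = lborel" by (metis distr_cong sets_lborel)
  show "integrable lborel F ==> integrable lborel (%x. F (x + a))"
    using integrable_distr[of "%x. x + a" lborel lborel F] unfolding d by simp
  show "(\<integral>x. F (x + a) \<partial>lborel) = (\<integral>x. F x \<partial>lborel)"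
  proof (cases "F \<in> borel_measurable lborel")
    case True thus ?thesis using integral_distr[of "%x. x + a" lborel lborel F] unfolding d by simp
  next
    case False
    hence "\<not> integrable lborel F" by (auto dest: borel_measurable_integrable)
    moreover have "\<not> integrable lborel (%x. F (x + a))"
    proof
      assume "integrable lborel (%x. F (x + a))"
      hence "(%x. F (x + a)) \<in> borel_measurable borel" by (auto dest: borel_measurable_integrable)
      from measurable_compose[OF _ this, of "%x. x - a" borel] have "F \<in> borel_measurable borel" by simp
      thus False using False by simp
    qed
    ultimately show ?thesis by (simp add: not_integrable_integral_eq)
  qed
qed

text \<open>
Fubini reduces this to one variable, where the integral of a derivative of an integrable function over the line vanishes.
\<close>

lemma integral_pd_zero:
  fixes F :: "real^'n::finite => real"
  assumes pd: "!!x. has_pd i F (F' x) x" and F: "continuous_on UNIV F" and F': "continuous_on UNIV F'"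
    and supp: "!!x. R < norm x ==> F x = 0" "!!x. R < norm x ==> F' x = 0"
  shows "integrable lborel F'" "(\<integral>x. F' x \<partial>lborel) = 0"
proof -
  let ?e = "axis i 1 :: real^'n"
  have int: "integrable lborel f" if "continuous_on UNIV f" "!!x. R < norm x ==> f x = 0" for f :: "real^'n => real"
  proof -
    have "integrable lborel (%x. indicator (cball 0 R) x *\<^sub>R f x)"
      by (rule borel_integrable_compact) (auto intro: continuous_on_subset[OF that(1)])
    moreover have "(%x. indicator (cball 0 R) x *\<^sub>R f x) = f"
      using that(2) by (force simp: indicator_def)
    ultimately show ?thesis by simp
  qed
  show iF': "integrable lborel F'" by (rule int[OF F' supp(2)])
  have iF: "integrable lborel F" by (rule int[OF F supp(1)])
  have [measurable]: "F \<in> borel_measurable borel" "F' \<in> borel_measurable borel"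
    using F F' by (auto intro: borel_measurable_continuous_onI)
  have "bounded (F' ` cball 0 R)"
    by (intro compact_imp_bounded compact_continuous_image continuous_on_subset[OF F']) auto
  then obtain M where "\<forall>x\<in>cball 0 R. \<bar>F' x\<bar> <= M" by (auto simp: bounded_iff)
  hence M: "\<bar>F' x\<bar> <= M" if "x \<in> cball 0 R" for x using that by blast
  have Mall: "\<bar>F' x\<bar> <= max M 0" for x using M[of x] supp(2)[of x] by (cases "norm x <= R") auto
  define h where "h m = 1 / real (Suc m)" for m
  have h: "0 < h m" "h m <= 1" for m by (auto simp: h_def)
  have h0: "h \<longlonglongrightarrow> 0" unfolding h_def by (rule LIMSEQ_Suc[OF lim_1_over_n])
  define g where "g m x = (F (x + h m *\<^sub>R ?e) - F x) / h m" for m x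
  have "(%m. \<integral>x. g m x \<partial>lborel) \<longlonglongrightarrow> (\<integral>x. F' x \<partial>lborel)"
  proof (rule integral_dominated_convergence)
    show "F' \<in> borel_measurable lborel" "!!m. g m \<in> borel_measurable lborel" unfolding g_def by measurable
    show "integrable lborel (%x. max M 0 * indicator (cball (0::real^'n) (R + 1)) x)"
      using emeasure_bounded_finite[OF bounded_cball, of "0::real^'n" "R + 1"]
      by (intro integrable_mult_right integrable_real_indicator) auto
    show "AE x in lborel. (%m. g m x) \<longlonglongrightarrow> F' x"
    proof (rule AE_I2)
      fix x
      have "(%t. (F (x + (0 + t) *\<^sub>R ?e) - F (x + 0 *\<^sub>R ?e)) / t) \<midarrow>0\<rightarrow> F' x"
        using pd[of x] unfolding has_pd_def DERIV_def .
      moreover have "filterlim h (at 0) sequentially"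
        unfolding filterlim_at using h0 h by (auto intro!: always_eventually simp: less_imp_neq[THEN not_sym])
      ultimately have "(%m. (F (x + (0 + h m) *\<^sub>R ?e) - F (x + 0 *\<^sub>R ?e)) / h m) \<longlonglongrightarrow> F' x"
        by (rule filterlim_compose)
      thus "(%m. g m x) \<longlonglongrightarrow> F' x" by (simp add: g_def)
    qed
    show "AE x in lborel. norm (g m x) <= max M 0 * indicator (cball 0 (R + 1)) x" for m
    proof (rule AE_I2)
      fix x
      show "norm (g m x) <= max M 0 * indicator (cball 0 (R + 1)) x"
      proof (cases "norm x <= R + 1")
        case True
        have "\<exists>z>0. z < h m & F (x + h m *\<^sub>R ?e) - F (x + 0 *\<^sub>R ?e) = (h m - 0) * F' (x + z *\<^sub>R ?e)"
          by (rule MVT2[OF h(1), of m "%t. F (x + t *\<^sub>R ?e)" "%t. F' (x + t *\<^sub>R ?e)"]) (rule has_pd_line[OF pd])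
        then obtain z where "F (x + h m *\<^sub>R ?e) - F x = h m * F' (x + z *\<^sub>R ?e)" by auto
        hence "g m x = F' (x + z *\<^sub>R ?e)" using h(1)[of m] by (simp add: g_def)
        thus ?thesis using Mall[of "x + z *\<^sub>R ?e"] True by simp
      next
        case False
        have "norm (h m *\<^sub>R ?e) <= 1" using h[of m] by (simp add: norm_axis_1)
        hence "R < norm (x + h m *\<^sub>R ?e)" using False norm_diff_ineq[of x "h m *\<^sub>R ?e"] by linarith
        thus ?thesis using False supp(1)[of x] supp(1)[of "x + h m *\<^sub>R ?e"] by (simp add: g_def)
      qed
    qed
  qed
  moreover have "(\<integral>x. g m x \<partial>lborel) = 0" for m
    unfolding g_def using iF lborel_integral_translate[of F "h m *\<^sub>R ?e"] by simp
  ultimately have "(%m::nat. 0::real) \<longlonglongrightarrow> (\<integral>x. F' x \<partial>lborel)" by simp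
  thus "(\<integral>x. F' x \<partial>lborel) = 0" by (simp add: LIMSEQ_const_iff)
qed

text \<open>
A function with continuous first derivative that glues constants is enough for the cutoffs; composing this one with itself gives a step from 0 to 1.
\<close>

definition pos_sq :: "real => real" where "pos_sq t = (max 0 t)^2"

lemma pos_sq_deriv: "(pos_sq has_real_derivative 2 * max 0 t) (at t)"
proof -
  consider "t < 0" | "t = 0" | "t > 0" by linarith
  thus ?thesis
  proof cases
    case 1
    have "((%_. 0) has_real_derivative 2 * max 0 t) (at t)" using 1 by (auto intro!: derivative_eq_intros)
    thus ?thesis
      by (rule has_field_derivative_transform_within_open[of _ _ _ "{..<0}"]) (use 1 in \<open>auto simp: pos_sq_def\<close>)
  next
    case 3
    have "((%t. t^2) has_real_derivative 2 * max 0 t) (at t)" using 3 by (auto intro!: derivative_eq_intros)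
    thus ?thesis
      by (rule has_field_derivative_transform_within_open[of _ _ _ "{0<..}"]) (use 3 in \<open>auto simp: pos_sq_def\<close>)
  next
    case 2
    have "(%s. (pos_sq (0 + s) - pos_sq 0) / s) \<midarrow>0\<rightarrow> 0"
    proof (rule Lim_null_comparison[of _ "%s. \<bar>s\<bar>"])
      have "norm ((pos_sq (0 + s) - pos_sq 0) / s) <= \<bar>s\<bar>" for s
        by (cases "s <= 0") (auto simp: pos_sq_def power2_eq_square)
      thus "\<forall>\<^sub>F s in at 0. norm ((pos_sq (0 + s) - pos_sq 0) / s) <= \<bar>s\<bar>" by simp
      show "((%s::real. \<bar>s\<bar>) \<longlongrightarrow> 0) (at 0)" by (auto intro!: tendsto_eq_intros)
    qed
    thus ?thesis using 2 by (simp add: DERIV_def)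
  qed
qed

definition smooth_step :: "real => real" where "smooth_step t = 1 - pos_sq (1 - pos_sq (t - 1))"
definition smooth_step' :: "real => real" where "smooth_step' t = 4 * max 0 (1 - pos_sq (t - 1)) * max 0 (t - 1)"

lemma smooth_step_deriv: "(smooth_step has_real_derivative smooth_step' t) (at t)"
proof -
  have "((%t. t - 1) has_real_derivative 1) (at t)" by (auto intro!: derivative_eq_intros)
  from DERIV_diff[OF DERIV_const DERIV_chain2[OF pos_sq_deriv this]]
  have 1: "((%t. 1 - pos_sq (t - 1)) has_real_derivative - (2 * max 0 (t - 1))) (at t)" by simp
  show ?thesis unfolding smooth_step_def[abs_def] smooth_step'_def
    by (rule DERIV_cong[OF DERIV_diff[OF DERIV_const DERIV_chain2[OF pos_sq_deriv 1]]]) simp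
qed

lemma smooth_step_simps:
  "t <= 1 ==> smooth_step t = 0" "2 <= t ==> smooth_step t = 1"
  "t <= 1 ==> smooth_step' t = 0" "2 <= t ==> smooth_step' t = 0"
  "0 <= smooth_step t" "smooth_step t <= 1" "0 <= smooth_step' t" "smooth_step' t <= 4"
proof -
  have p0: "0 <= pos_sq s" for s by (simp add: pos_sq_def)
  have p1: "s <= 1 ==> pos_sq s <= 1" for s by (simp add: pos_sq_def power_le_one)
  have p2: "2 <= t ==> 1 <= pos_sq (t - 1)" by (simp add: pos_sq_def)
  show "t <= 1 ==> smooth_step t = 0" "t <= 1 ==> smooth_step' t = 0"
    by (auto simp: smooth_step_def smooth_step'_def pos_sq_def)
  show "2 <= t ==> smooth_step t = 1" "2 <= t ==> smooth_step' t = 0"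
    using p2 by (auto simp: smooth_step_def smooth_step'_def pos_sq_def[of "1 - pos_sq (t - 1)"])
  show "0 <= smooth_step t" "smooth_step t <= 1"
    using p0 p1[of "1 - pos_sq (t - 1)"] by (auto simp: smooth_step_def)
  show "0 <= smooth_step' t" by (simp add: smooth_step'_def)
  show "smooth_step' t <= 4"
  proof (cases "t <= 2")
    case True
    have "max 0 (1 - pos_sq (t - 1)) * max 0 (t - 1) <= 1 * 1" using p0[of "t - 1"] True by (intro mult_mono) auto
    thus ?thesis by (simp add: smooth_step'_def)
  next
    case False thus ?thesis using p2 by (simp add: smooth_step'_def)
  qed
qed

lemma smooth_step_cont: "continuous_on UNIV smooth_step" "continuous_on UNIV smooth_step'"
proof -
  show "continuous_on UNIV smooth_step" by (rule DERIV_continuous_on[of _ _ smooth_step']) (use smooth_step_deriv in \<open>auto intro: has_field_derivative_at_within\<close>)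
  show "continuous_on UNIV smooth_step'" unfolding smooth_step'_def[abs_def] pos_sq_def by (intro continuous_intros)
qed

text \<open>
Vanishes for |z| <= 1/m and for |z| large compared with m, and equals 1 in between, so that it removes both the singularity and infinity.
\<close>

definition cutoff :: "real => real^'n::finite => real" where
  "cutoff m z = smooth_step (m^2 * (norm z)^2) * (1 - smooth_step ((norm z)^2 / m^2))"

definition cutoff' :: "real => 'n => real^'n::finite => real" where
  "cutoff' m i z = smooth_step' (m^2 * (norm z)^2) * (m^2 * (2 * z $ i)) * (1 - smooth_step ((norm z)^2 / m^2))
     - smooth_step (m^2 * (norm z)^2) * (smooth_step' ((norm z)^2 / m^2) * (2 * z $ i / m^2))"

lemma norm_sq_line: "((%t. (norm (x + t *\<^sub>R axis i 1 :: real^'n::finite))^2) has_real_derivative 2 * (x $ i)) (at 0)"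
proof -
  have eq: "(norm (x + t *\<^sub>R axis i 1 :: real^'n))^2 = (norm x)^2 + 2 * t * (x $ i) + t^2" for t
  proof -
    have "(norm (x + t *\<^sub>R axis i 1 :: real^'n))^2 = x \<bullet> x + 2 * t * (x \<bullet> axis i 1) + t^2 * (axis i (1::real) \<bullet> axis i 1)"
      unfolding power2_norm_eq_inner by (simp add: inner_add inner_commute power2_eq_square algebra_simps)
    thus ?thesis by (simp add: power2_norm_eq_inner inner_axis inner_axis_axis)
  qed
  show ?thesis unfolding eq by (auto intro!: derivative_eq_intros)
qed

lemma cutoff_pd: "has_pd i (cutoff m) (cutoff' m i z) z"
proof -
  have s1: "((%t. smooth_step (m^2 * (norm (z + t *\<^sub>R axis i 1))^2)) has_real_derivative
      smooth_step' (m^2 * (norm z)^2) * (m^2 * (2 * z $ i))) (at 0)"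
    using DERIV_chain2[OF smooth_step_deriv DERIV_cmult[OF norm_sq_line[of z i], of "m^2"]] by simp
  have s2: "((%t. smooth_step ((norm (z + t *\<^sub>R axis i 1))^2 / m^2)) has_real_derivative
      smooth_step' ((norm z)^2 / m^2) * (2 * z $ i / m^2)) (at 0)"
    using DERIV_chain2[OF smooth_step_deriv DERIV_cdivide[OF norm_sq_line[of z i], of "m^2"]] by simp
  show ?thesis unfolding has_pd_def cutoff_def[abs_def] cutoff'_def
    by (rule DERIV_cong[OF DERIV_mult'[OF s1 DERIV_diff[OF DERIV_const s2]]]) (simp add: algebra_simps)
qed

lemma cutoff_cont:
  fixes i :: "'n::finite"
  shows "continuous_on UNIV (cutoff m :: real^'n => real)" "continuous_on UNIV (cutoff' m i)"
proof -
  have c1: "continuous_on UNIV (%z::real^'n. f (m^2 * (norm z)^2))" if "continuous_on UNIV f" for f :: "real => real"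
    by (rule continuous_on_compose2[OF that]) (auto intro!: continuous_intros)
  have c2: "continuous_on UNIV (%z::real^'n. f ((norm z)^2 / m^2))" if "continuous_on UNIV f" for f :: "real => real"
    unfolding divide_inverse by (rule continuous_on_compose2[OF that]) (auto intro!: continuous_intros)
  note c = c1[OF smooth_step_cont(1)] c1[OF smooth_step_cont(2)] c2[OF smooth_step_cont(1)] c2[OF smooth_step_cont(2)]
  have zi: "continuous_on UNIV (%z::real^'n. 2 * z $ i / m^2)"
    unfolding divide_inverse by (intro continuous_intros)
  show "continuous_on UNIV (cutoff m :: real^'n => real)" unfolding cutoff_def[abs_def] by (intro continuous_on_mult continuous_on_diff continuous_on_const c)
  show "continuous_on UNIV (cutoff' m i)" unfolding cutoff'_def[abs_def]
    by (intro continuous_on_mult continuous_on_diff continuous_on_const c zi) (intro continuous_intros)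
qed

lemma cutoff_bounds: "0 <= cutoff m z" "cutoff m z <= 1"
  unfolding cutoff_def
  by (rule mult_nonneg_nonneg, use smooth_step_simps(5,6) in auto, rule mult_le_one, use smooth_step_simps(5,6) in auto)

lemma cutoff_near_0:
  assumes "m > 0" "norm z <= 1 / m" shows "cutoff m z = 0" "cutoff' m i z = 0"
proof -
  have "m * norm z <= 1" using assms by (simp add: field_simps)
  hence "(m * norm z)^2 <= 1" using assms by (intro power_le_one) auto
  hence "m^2 * (norm z)^2 <= 1" by (simp add: power_mult_distrib)
  thus "cutoff m z = 0" "cutoff' m i z = 0" by (simp_all add: cutoff_def cutoff'_def smooth_step_simps)
qed

lemma cutoff_far:
  assumes "m > 0" "2 * m < norm z" shows "cutoff m z = 0" "cutoff' m i z = 0"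
proof -
  have "(2 * m)^2 <= (norm z)^2" using assms by (intro power_mono) auto
  hence "2 <= (norm z)^2 / m^2" using assms by (simp add: field_simps) (smt (verit) zero_less_power)
  thus "cutoff m z = 0" "cutoff' m i z = 0" by (simp_all add: cutoff_def cutoff'_def smooth_step_simps)
qed

lemma cutoff_stable:
  assumes "m > 0" "2 / m <= norm z" "norm z <= m" shows "cutoff m z = 1" "cutoff' m i z = 0"
proof -
  have "2 <= m * norm z" using assms by (simp add: field_simps)
  hence "2^2 <= (m * norm z)^2" by (intro power_mono) auto
  hence 1: "2 <= m^2 * (norm z)^2" by (simp add: power_mult_distrib)
  have "(norm z)^2 <= m^2" using assms by (intro power_mono) auto
  hence 2: "(norm z)^2 / m^2 <= 1" using assms by (simp add: field_simps)
  show "cutoff m z = 1" "cutoff' m i z = 0" using 1 2 by (simp_all add: cutoff_def cutoff'_def smooth_step_simps)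
qed

text \<open>
The bound is scale invariant, so the error terms of the integration by parts are dominated uniformly in m.
\<close>

lemma cutoff'_bound:
  assumes m: "m > 0" and z: "z ~= 0"
  shows "\<bar>cutoff' m i z\<bar> <= 32 / norm z"
proof -
  have zi: "\<bar>z $ i\<bar> <= norm z" by (rule component_le_norm_cart)
  have nz: "norm z > 0" using z by simp
  let ?A = "smooth_step' (m^2 * (norm z)^2) * (m^2 * (2 * z $ i)) * (1 - smooth_step ((norm z)^2 / m^2))"
  let ?B = "smooth_step (m^2 * (norm z)^2) * (smooth_step' ((norm z)^2 / m^2) * (2 * z $ i / m^2))"
  have A: "\<bar>?A\<bar> <= 16 / norm z"
  proof (cases "2 <= m^2 * (norm z)^2")
    case True thus ?thesis using nz by (simp add: smooth_step_simps)
  next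
    case False
    hence le: "m^2 * norm z <= 2 / norm z" using nz by (simp add: field_simps power2_eq_square)
    have "\<bar>?A\<bar> = smooth_step' (m^2 * (norm z)^2) * (m^2 * (2 * \<bar>z $ i\<bar>)) * (1 - smooth_step ((norm z)^2 / m^2))"
      using smooth_step_simps(6)[of "(norm z)^2 / m^2"] smooth_step_simps(7) by (simp add: abs_mult)
    also have "\<dots> <= 4 * (m^2 * (2 * norm z)) * 1"
      using smooth_step_simps(5,6,7,8) zi by (intro mult_mono mult_nonneg_nonneg) auto
    also have "\<dots> <= 16 / norm z" using le by simp
    finally show ?thesis .
  qed
  have B: "\<bar>?B\<bar> <= 16 / norm z"
  proof (cases "2 <= (norm z)^2 / m^2")
    case True thus ?thesis using nz by (simp add: smooth_step_simps)
  next
    case False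
    hence le: "norm z / m^2 <= 2 / norm z" using nz m by (simp add: field_simps power2_eq_square)
    have "\<bar>?B\<bar> = smooth_step (m^2 * (norm z)^2) * (smooth_step' ((norm z)^2 / m^2) * (2 * \<bar>z $ i\<bar> / m^2))"
      using smooth_step_simps(5,7) by (simp add: abs_mult)
    also have "\<dots> <= 1 * (4 * (2 * norm z / m^2))"
      using smooth_step_simps(5,6,7,8) zi by (intro mult_mono divide_right_mono mult_nonneg_nonneg) auto
    also have "\<dots> <= 16 / norm z" using le by simp
    finally show ?thesis .
  qed
  have "\<bar>cutoff' m i z\<bar> <= \<bar>?A\<bar> + \<bar>?B\<bar>" unfolding cutoff'_def by (rule abs_triangle_ineq4)
  thus ?thesis using A B by simp
qed

lemma has_pd_cong:
  assumes "has_pd i G D x" "open S" "x \<in> S" "!!y. y \<in> S ==> F y = G y"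
  shows "has_pd i F D x"
  unfolding has_pd_def
proof (rule has_field_derivative_transform_within_open[OF assms(1)[unfolded has_pd_def]])
  show "open ((%t. x + t *\<^sub>R axis i 1) -` S)" using assms(2) by (intro open_vimage continuous_intros)
qed (use assms in auto)

lemma has_pd_mult:
  assumes "has_pd i F D x" "has_pd i G E x"
  shows "has_pd i (%y. F y * G y) (D * G x + F x * E) x"
  using DERIV_mult[OF assms[unfolded has_pd_def]] unfolding has_pd_def by (simp add: mult.commute add.commute)

lemma has_pd_diff:
  assumes "has_pd i F D x" "has_pd i G E x"
  shows "has_pd i (%y. F y - G y) (D - E) x"
  using DERIV_diff[OF assms[unfolded has_pd_def]] unfolding has_pd_def by simp

lemma has_pd_const: "has_pd i (%y. c) 0 x"
  unfolding has_pd_def by simp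

lemma borel_measurable_off_0:
  fixes f :: "'a::euclidean_space => real"
  assumes "continuous_on (- {0}) f"
  shows "f \<in> borel_measurable borel"
proof -
  have "(%x. if x \<in> - {0} then f x else f 0) \<in> borel_measurable borel"
    by (rule borel_measurable_continuous_on_if[OF _ assms]) auto
  moreover have "(%x. if x \<in> - {0} then f x else f 0) = f" by auto
  ultimately show ?thesis by simp
qed

text \<open>
The growth conditions near the origin and at infinity. The exponent p makes w locally integrable, while q makes the product of the Laplacian of w with a bounded function integrable at infinity.
\<close>

locale singular_kernel = subharmonic_off_0 w for w :: "real^'n::finite => real" +
  fixes p q C :: real
  assumes p: "- real CARD('n) < p" and q: "q < 2 - real CARD('n)" "q < 0" and C: "0 <= C"
    and near: "!!z. 0 < norm z ==> norm z < 1 ==> \<bar>w z\<bar> <= C * norm z powr p"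
      "!!z i. 0 < norm z ==> norm z < 1 ==> \<bar>partial_deriv i w z\<bar> <= C * norm z powr (p - 1)"
      "!!z. 0 < norm z ==> norm z < 1 ==> \<bar>laplacian w z\<bar> <= C * norm z powr (p - 2)"
    and far: "!!z. 1 <= norm z ==> \<bar>w z\<bar> <= C * norm z powr q"
      "!!z i. 1 <= norm z ==> \<bar>partial_deriv i w z\<bar> <= C * norm z powr (q - 1)"
      "!!z. 1 <= norm z ==> \<bar>laplacian w z\<bar> <= C * norm z powr (q - 2)"
begin

abbreviation "tp \<equiv> (two_powers p (q - 2) :: real^'n => real)"

lemma tp_integrable: "integrable lborel tp"
  using p q by (intro integrable_two_powers) auto

lemma w_measurable[measurable]: "w \<in> borel_measurable borel"
  by (rule borel_measurable_off_0[OF w_cont])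

lemma laplacian_measurable[measurable]: "laplacian w \<in> borel_measurable borel"
  by (rule borel_measurable_off_0[OF lap_cont])

text \<open>
All terms of Green's identity have the same majorant, because a test function that vanishes to second order at the origin compensates the two derivatives on w.
\<close>

lemma product_bounds:
  fixes z :: "real^'n"
  assumes z: "z ~= 0" and A: "0 <= A"
    and n: "norm z < 1 ==> \<bar>P\<bar> <= A * (norm z)^2" "norm z < 1 ==> \<bar>G\<bar> <= A * norm z" "norm z < 1 ==> \<bar>L\<bar> <= A"
    and f: "1 <= norm z ==> \<bar>P\<bar> <= A" "1 <= norm z ==> \<bar>G\<bar> <= A / norm z" "1 <= norm z ==> \<bar>L\<bar> <= A / (norm z)^2"
  shows "\<bar>w z * L\<bar> <= C * A * tp z" "\<bar>laplacian w z * P\<bar> <= C * A * tp z"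
    "\<bar>w z * G - P * partial_deriv i w z\<bar> / norm z <= 2 * C * A * tp z"
proof -
  define r where "r = norm z"
  have r: "0 < r" using z by (simp add: r_def)
  have pw: "r powr (s - 1) = r powr s / r" "r powr (s - 2) = r powr s / r^2" for s
    using r by (simp_all add: powr_diff powr_numeral)
  have "\<bar>w z * L\<bar> <= C * A * tp z & \<bar>laplacian w z * P\<bar> <= C * A * tp z & \<bar>w z * G\<bar> / r <= C * A * tp z & \<bar>P * partial_deriv i w z\<bar> / r <= C * A * tp z"
  proof (cases "r < 1")
    case True
    hence tpz: "tp z = r powr p" using z by (simp add: two_powers_def r_def)
    note w = near(1)[of z, folded r_def, OF r True] near(2)[of z i, folded r_def, OF r True] near(3)[of z, folded r_def, OF r True]
    note b = n[folded r_def, OF True]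
    have 1: "\<bar>w z\<bar> * \<bar>L\<bar> <= (C * r powr p) * A" using w(1) b(3) A C by (intro mult_mono) auto
    have 2: "\<bar>laplacian w z\<bar> * \<bar>P\<bar> <= (C * r powr (p - 2)) * (A * r^2)" using w(3) b(1) A C by (intro mult_mono) auto
    have 3: "\<bar>w z\<bar> * \<bar>G\<bar> <= (C * r powr p) * (A * r)" using w(1) b(2) A C by (intro mult_mono) auto
    have 4: "\<bar>P\<bar> * \<bar>partial_deriv i w z\<bar> <= (A * r^2) * (C * r powr (p - 1))" using w(2) b(1) A C by (intro mult_mono) auto
    have "(C * r powr (p - 2)) * (A * r^2) = C * A * r powr p" using r by (simp add: pw)
    moreover have "(C * r powr p) * (A * r) / r = C * A * r powr p" using r by simp
    moreover have "(A * r^2) * (C * r powr (p - 1)) / r = C * A * r powr p" using r by (simp add: pw power2_eq_square)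
    ultimately show ?thesis unfolding tpz abs_mult
      using 1 2 divide_right_mono[OF 3, of r] divide_right_mono[OF 4, of r] r by (auto simp: mult_ac)
  next
    case False
    hence r1: "1 <= r" by simp
    hence tpz: "tp z = r powr (q - 2)" using z by (simp add: two_powers_def r_def)
    note w = far(1)[of z, folded r_def, OF r1] far(2)[of z i, folded r_def, OF r1] far(3)[of z, folded r_def, OF r1]
    note b = f[folded r_def, OF r1]
    have 1: "\<bar>w z\<bar> * \<bar>L\<bar> <= (C * r powr q) * (A / r^2)" using w(1) b(3) A C r by (intro mult_mono) auto
    have 2: "\<bar>laplacian w z\<bar> * \<bar>P\<bar> <= (C * r powr (q - 2)) * A" using w(3) b(1) A C by (intro mult_mono) auto
    have 3: "\<bar>w z\<bar> * \<bar>G\<bar> <= (C * r powr q) * (A / r)" using w(1) b(2) A C r by (intro mult_mono) auto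
    have 4: "\<bar>P\<bar> * \<bar>partial_deriv i w z\<bar> <= A * (C * r powr (q - 1))" using w(2) b(1) A C by (intro mult_mono) auto
    have "(C * r powr q) * (A / r^2) = C * A * r powr (q - 2)" by (simp add: pw)
    moreover have "(C * r powr q) * (A / r) / r = C * A * r powr (q - 2)" by (simp add: pw power2_eq_square)
    moreover have "A * (C * r powr (q - 1)) / r = C * A * r powr (q - 2)" by (simp add: pw power2_eq_square)
    ultimately show ?thesis unfolding tpz abs_mult
      using 1 2 divide_right_mono[OF 3, of r] divide_right_mono[OF 4, of r] r by (auto simp: mult_ac)
  qed
  note this[unfolded r_def]
  moreover have "\<bar>w z * G - P * partial_deriv i w z\<bar> / norm z <= \<bar>w z * G\<bar> / norm z + \<bar>P * partial_deriv i w z\<bar> / norm z"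
    using abs_triangle_ineq4[of "w z * G" "P * partial_deriv i w z"] z by (simp add: divide_right_mono flip: add_divide_distrib)
  ultimately show "\<bar>w z * L\<bar> <= C * A * tp z" "\<bar>laplacian w z * P\<bar> <= C * A * tp z"
    "\<bar>w z * G - P * partial_deriv i w z\<bar> / norm z <= 2 * C * A * tp z" by linarith+
qed

text \<open>
Green's identity on all of space for test functions vanishing to second order at the origin. The divergence of the cut-off field has integral zero, and the terms with derivatives of the cutoff disappear in the limit by dominated convergence. Vanishing to second order is what avoids any contribution of the singularity, whose distributional Laplacian at the origin is not controlled.
\<close>

theorem laplacian_integration_by_parts:
  fixes \<psi> :: "real^'n => real"
  assumes pd: "!!i z. has_pd i \<psi> (\<psi>1 i z) z" "!!i z. has_pd i (\<psi>1 i) (\<psi>2 i z) z"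
    and cont: "continuous_on UNIV \<psi>" "!!i. continuous_on UNIV (\<psi>1 i)" "!!i. continuous_on UNIV (\<psi>2 i)" and A: "0 <= A"
    and n: "!!z. norm z < 1 ==> \<bar>\<psi> z\<bar> <= A * (norm z)^2" "!!i z. norm z < 1 ==> \<bar>\<psi>1 i z\<bar> <= A * norm z"
      "!!z. norm z < 1 ==> \<bar>\<Sum>i\<in>UNIV. \<psi>2 i z\<bar> <= A"
    and f: "!!z. 1 <= norm z ==> \<bar>\<psi> z\<bar> <= A" "!!i z. 1 <= norm z ==> \<bar>\<psi>1 i z\<bar> <= A / norm z"
      "!!z. 1 <= norm z ==> \<bar>\<Sum>i\<in>UNIV. \<psi>2 i z\<bar> <= A / (norm z)^2"
  shows "integrable lborel (%z. w z * (\<Sum>i\<in>UNIV. \<psi>2 i z))" "integrable lborel (%z. laplacian w z * \<psi> z)"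
    "(\<integral>z. w z * (\<Sum>i\<in>UNIV. \<psi>2 i z) \<partial>lborel) = (\<integral>z. laplacian w z * \<psi> z \<partial>lborel)"
proof -
  define L where "L z = (\<Sum>i\<in>UNIV. \<psi>2 i z)" for z
  have [measurable]: "\<psi> \<in> borel_measurable borel" "\<psi>1 i \<in> borel_measurable borel" "\<psi>2 i \<in> borel_measurable borel" for i
    using cont by (auto intro: borel_measurable_continuous_onI)
  have Lm[measurable]: "L \<in> borel_measurable borel" unfolding L_def by measurable
  have [measurable]: "partial_deriv i w \<in> borel_measurable borel" for i by (rule borel_measurable_off_0[OF pd_w_cont])
  have [measurable]: "partial_deriv i (partial_deriv i w) \<in> borel_measurable borel" for i by (rule borel_measurable_off_0[OF ppd_w_cont])
  have bd: "\<bar>w z * L z\<bar> <= C * A * tp z" "\<bar>laplacian w z * \<psi> z\<bar> <= C * A * tp z"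
    "\<bar>w z * \<psi>1 i z - \<psi> z * partial_deriv i w z\<bar> / norm z <= 2 * C * A * tp z" if "z ~= 0" for z i
    using product_bounds(1,2)[OF that A, where P="\<psi> z" and G="\<psi>1 i z" and L="L z"]
      product_bounds(3)[OF that A, where P="\<psi> z" and G="\<psi>1 i z" and L="L z" and i=i] n f unfolding L_def by auto
  have off0: "AE z in lborel. z ~= (0::real^'n)" by (rule AE_lborel_singleton)
  have CAtp: "integrable lborel (%z. c * tp z)" for c using tp_integrable by simp
  have i1: "integrable lborel (%z. w z * L z)"
    by (rule Bochner_Integration.integrable_bound[OF CAtp[of "C * A"]])
       (measurable, use off0 in eventually_elim, use bd(1) in \<open>force simp: order_trans[OF _ abs_ge_self]\<close>)
  have i2: "integrable lborel (%z. laplacian w z * \<psi> z)"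
    by (rule Bochner_Integration.integrable_bound[OF CAtp[of "C * A"]])
       (measurable, use off0 in eventually_elim, use bd(2) in \<open>force simp: order_trans[OF _ abs_ge_self]\<close>)
  define F where "F m i z = cutoff m z * (w z * \<psi>1 i z - \<psi> z * partial_deriv i w z)" for m i z
  define D where "D m i z = cutoff' m i z * (w z * \<psi>1 i z - \<psi> z * partial_deriv i w z)
    + cutoff m z * (w z * \<psi>2 i z - \<psi> z * partial_deriv i (partial_deriv i w) z)" for m i z
  have Dint: "integrable lborel (D m i)" "(\<integral>z. D m i z \<partial>lborel) = 0" if m: "m > 0" for m i
  proof -
    have opn: "open (ball (0::real^'n) (1/m))" "open (- {0::real^'n})" "- {0} \<union> ball (0::real^'n) (1/m) = UNIV" using m by auto
    have cut0: "cutoff m z = 0" "cutoff' m i z = 0" if "z \<in> ball 0 (1/m)" for z i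
      using that cutoff_near_0[OF m, of z] by auto
    have zero: "F m i z = 0" "D m i z = 0" if "z \<in> ball 0 (1/m)" for z i
      using cut0[OF that] by (auto simp: F_def D_def)
    have hp: "has_pd i (F m i) (D m i z) z" for z
    proof (cases "z = 0")
      case True
      have "has_pd i (F m i) 0 z"
        by (rule has_pd_cong[OF has_pd_const[of i 0] opn(1)]) (use True m zero(1) in auto)
      moreover have "D m i z = 0" using zero(2)[of z i] True m by simp
      ultimately show ?thesis by simp
    next
      case False
      have "has_pd i (%z. w z * \<psi>1 i z - \<psi> z * partial_deriv i w z)
          ((partial_deriv i w z * \<psi>1 i z + w z * \<psi>2 i z) - (\<psi>1 i z * partial_deriv i w z + \<psi> z * partial_deriv i (partial_deriv i w) z)) z"
        by (intro has_pd_diff has_pd_mult w_pd pd_w_pd pd False)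
      from has_pd_mult[OF cutoff_pd this, of m] show ?thesis
        unfolding F_def[abs_def] D_def by (simp add: algebra_simps)
    qed
    have c1: "continuous_on (- {0}) (F m i)" unfolding F_def[abs_def]
      by (intro continuous_intros w_cont pd_w_cont continuous_on_subset[OF cont(1)] continuous_on_subset[OF cont(2)] continuous_on_subset[OF cutoff_cont(1)]) auto
    have c2: "continuous_on (- {0}) (D m i)" unfolding D_def[abs_def]
      by (intro continuous_intros w_cont pd_w_cont ppd_w_cont continuous_on_subset[OF cont(1)] continuous_on_subset[OF cont(2)] continuous_on_subset[OF cont(3)] continuous_on_subset[OF cutoff_cont(1)] continuous_on_subset[OF cutoff_cont(2)]) auto
    have c3: "continuous_on (ball 0 (1/m)) (F m i)" "continuous_on (ball 0 (1/m)) (D m i)"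
      using zero by (auto intro: continuous_on_eq[OF continuous_on_const[of _ 0]])
    have cF: "continuous_on UNIV (F m i)" using continuous_on_open_Un[OF opn(2,1) c1 c3(1)] opn(3) by simp
    have cD: "continuous_on UNIV (D m i)" using continuous_on_open_Un[OF opn(2,1) c2 c3(2)] opn(3) by simp
    have s1: "F m i z = 0" if "2 * m < norm z" for z using cutoff_far[OF m that] by (simp add: F_def)
    have s2: "D m i z = 0" if "2 * m < norm z" for z using cutoff_far[OF m that] by (simp add: D_def)
    show "integrable lborel (D m i)" "(\<integral>z. D m i z \<partial>lborel) = 0"
      using integral_pd_zero[OF hp cF cD s1 s2] by auto
  qed
  define m where "m j = real (Suc j)" for j
  have m: "0 < m j" for j by (simp add: m_def)
  define G where "G j z = (\<Sum>i\<in>UNIV. D (m j) i z)" for j z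
  have G_eq: "G j z = (\<Sum>i\<in>UNIV. cutoff' (m j) i z * (w z * \<psi>1 i z - \<psi> z * partial_deriv i w z))
      + cutoff (m j) z * (w z * L z - laplacian w z * \<psi> z)" for j z
    unfolding G_def D_def sum.distrib sum_distrib_left[symmetric] L_def laplacian_def
    by (simp add: sum_subtractf sum_distrib_left mult.commute)
  have [measurable]: "G j \<in> borel_measurable borel" for j
    unfolding G_def using Dint(1)[OF m] by (auto intro!: borel_measurable_sum dest: borel_measurable_integrable)
  have G0: "(\<integral>z. G j z \<partial>lborel) = 0" for j
    unfolding G_def using Dint[OF m] by simp
  define K where "K = real CARD('n) * (32 * (2 * C * A)) + 2 * (C * A)"
  have "(%j. \<integral>z. G j z \<partial>lborel) \<longlonglongrightarrow> (\<integral>z. w z * L z - laplacian w z * \<psi> z \<partial>lborel)"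
  proof (rule integral_dominated_convergence)
    show "integrable lborel (%z. K * tp z)" by (rule CAtp)
    show "AE z in lborel. (%j. G j z) \<longlonglongrightarrow> w z * L z - laplacian w z * \<psi> z"
      using off0
    proof eventually_elim
      case (elim z)
      obtain N :: nat where N: "max (2 / norm z) (norm z) <= real N" using real_arch_simple by blast
      have "G j z = w z * L z - laplacian w z * \<psi> z" if "N <= j" for j
      proof -
        have mj: "real N <= m j" using that by (simp add: m_def)
        hence "norm z <= m j" "2 / norm z <= m j" using N by auto
        hence "2 / m j <= norm z" using elim m[of j] by (simp add: field_simps)
        from cutoff_stable[OF m this \<open>norm z <= m j\<close>] show ?thesis unfolding G_eq by simp
      qed
      thus ?case by (intro tendsto_eventually) (auto simp: eventually_sequentially)
    qed
    show "AE z in lborel. norm (G j z) <= K * tp z" for j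
      using off0
    proof eventually_elim
      case (elim z)
      have "norm (G j z) <= (\<Sum>i\<in>UNIV. \<bar>cutoff' (m j) i z * (w z * \<psi>1 i z - \<psi> z * partial_deriv i w z)\<bar>)
          + \<bar>cutoff (m j) z * (w z * L z - laplacian w z * \<psi> z)\<bar>"
        unfolding G_eq real_norm_def by (rule order_trans[OF abs_triangle_ineq add_right_mono[OF sum_abs]])
      also have "(\<Sum>i\<in>UNIV. \<bar>cutoff' (m j) i z * (w z * \<psi>1 i z - \<psi> z * partial_deriv i w z)\<bar>) <= (\<Sum>i\<in>(UNIV::'n set). 32 * (2 * C * A * tp z))"
      proof (rule sum_mono)
        fix i
        have "\<bar>cutoff' (m j) i z * (w z * \<psi>1 i z - \<psi> z * partial_deriv i w z)\<bar> <= (32 / norm z) * \<bar>w z * \<psi>1 i z - \<psi> z * partial_deriv i w z\<bar>"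
          unfolding abs_mult by (intro mult_right_mono cutoff'_bound m elim) simp
        also have "\<dots> = 32 * (\<bar>w z * \<psi>1 i z - \<psi> z * partial_deriv i w z\<bar> / norm z)" by simp
        also have "\<dots> <= 32 * (2 * C * A * tp z)" by (intro mult_left_mono bd(3) elim) simp
        finally show "\<bar>cutoff' (m j) i z * (w z * \<psi>1 i z - \<psi> z * partial_deriv i w z)\<bar> <= 32 * (2 * C * A * tp z)" .
      qed
      also have "\<bar>cutoff (m j) z * (w z * L z - laplacian w z * \<psi> z)\<bar> <= 1 * \<bar>w z * L z - laplacian w z * \<psi> z\<bar>"
        unfolding abs_mult by (intro mult_right_mono) (use cutoff_bounds[of "m j" z] in auto)
      also have "\<bar>w z * L z - laplacian w z * \<psi> z\<bar> <= C * A * tp z + C * A * tp z"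
        using bd(1)[OF elim] bd(2)[OF elim] by linarith
      finally show ?case by (simp add: K_def algebra_simps)
    qed
  qed measurable
  hence "(%j::nat. 0::real) \<longlonglongrightarrow> (\<integral>z. w z * L z - laplacian w z * \<psi> z \<partial>lborel)" unfolding G0 .
  hence "(\<integral>z. w z * L z - laplacian w z * \<psi> z \<partial>lborel) = 0" by (simp add: LIMSEQ_const_iff)
  thus "(\<integral>z. w z * (\<Sum>i\<in>UNIV. \<psi>2 i z) \<partial>lborel) = (\<integral>z. laplacian w z * \<psi> z \<partial>lborel)"
    using i1 i2 by (simp add: L_def)
  show "integrable lborel (%z. w z * (\<Sum>i\<in>UNIV. \<psi>2 i z))" using i1 by (simp add: L_def)
  show "integrable lborel (%z. laplacian w z * \<psi> z)" by (rule i2)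
qed

end

section \<open>The heat kernel\<close>

text \<open>
The heat kernel without the factor (2\<pi>)^(-n/2); it solves the equation with time derivative half of the Laplacian.
\<close>

definition heat :: "real => real^'n::finite => real" where
  "heat s y = s powr (- real CARD('n) / 2) * exp (- ((norm y)^2) / (2 * s))"

definition heat1 :: "real => 'n => real^'n::finite => real" where
  "heat1 s i y = - (y $ i / s) * heat s y"

definition heat2 :: "real => 'n => real^'n::finite => real" where
  "heat2 s i y = ((y $ i)^2 / s^2 - 1 / s) * heat s y"

definition heat_lap :: "real => real^'n::finite => real" where
  "heat_lap s y = ((norm y)^2 / s^2 - real CARD('n) / s) * heat s y"

lemma heat_nonneg: "0 <= heat s y"
  by (simp add: heat_def)

lemma heat_minus: "heat s (- y) = heat s y"
  by (simp add: heat_def)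

lemma heat_lap_minus: "heat_lap s (- y) = heat_lap s y"
  by (simp add: heat_lap_def heat_minus)

lemma heat_measurable[measurable]:
  "(%x. heat (f x) (g x)) \<in> borel_measurable M" "(%x. heat_lap (f x) (g x)) \<in> borel_measurable M"
  if [measurable]: "f \<in> borel_measurable M" "g \<in> borel_measurable M"
  unfolding heat_def heat_lap_def by measurable

lemma sum_heat2: "(\<Sum>i\<in>UNIV. heat2 s i y) = heat_lap s y"
proof -
  have "(norm y)^2 = (\<Sum>i\<in>UNIV. (y $ i)^2)" unfolding power2_norm_eq_inner inner_vec_def by (simp add: power2_eq_square)
  thus ?thesis unfolding heat2_def heat_lap_def sum_distrib_right[symmetric]
    by (simp add: sum_subtractf sum_divide_distrib)
qed

lemma heat_line:
  assumes s: "s > 0"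
  shows "((%t. heat s (y + t *\<^sub>R v)) has_real_derivative - ((y + t *\<^sub>R v) \<bullet> v / s) * heat s (y + t *\<^sub>R v)) (at t)"
proof -
  have eq: "(norm (y + t *\<^sub>R v))^2 = y \<bullet> y + 2 * t * (y \<bullet> v) + t^2 * (v \<bullet> v)" for t
    unfolding power2_norm_eq_inner by (simp add: inner_add inner_commute power2_eq_square algebra_simps)
  have "((%t. - (y \<bullet> y + 2 * t * (y \<bullet> v) + t^2 * (v \<bullet> v)) / (2 * s)) has_real_derivative - ((y + t *\<^sub>R v) \<bullet> v / s)) (at t)"
    using s by (auto intro!: derivative_eq_intros simp: inner_add field_simps)
  hence "((%t. - ((norm (y + t *\<^sub>R v))^2) / (2 * s)) has_real_derivative - ((y + t *\<^sub>R v) \<bullet> v / s)) (at t)"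
    unfolding eq .
  from DERIV_cmult[OF DERIV_chain2[OF DERIV_exp this], of "s powr (- real CARD('a) / 2)"]
  show ?thesis unfolding heat_def by (simp add: mult_ac)
qed

lemma heat_line2:
  assumes s: "s > 0"
  shows "((%t. - ((y + t *\<^sub>R v) \<bullet> v / s) * heat s (y + t *\<^sub>R v)) has_real_derivative
    (((y + t *\<^sub>R v) \<bullet> v)^2 / s^2 - v \<bullet> v / s) * heat s (y + t *\<^sub>R v)) (at t)"
proof -
  have "((%t. - ((y + t *\<^sub>R v) \<bullet> v / s)) has_real_derivative - (v \<bullet> v / s)) (at t)"
    using s by (auto intro!: derivative_eq_intros simp: inner_add)
  from DERIV_mult[OF this heat_line[OF s]] show ?thesis
    by (rule DERIV_cong) (use s in \<open>simp add: field_simps power2_eq_square\<close>)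
qed

lemma heat1_line:
  assumes s: "s > 0"
  shows "((%t. heat1 s i (y + t *\<^sub>R v)) has_real_derivative
    ((y + t *\<^sub>R v) $ i * ((y + t *\<^sub>R v) \<bullet> v) / s^2 - v $ i / s) * heat s (y + t *\<^sub>R v)) (at t)"
proof -
  have "((%t. - ((y + t *\<^sub>R v) $ i / s)) has_real_derivative - (v $ i / s)) (at t)"
    using s by (auto intro!: derivative_eq_intros)
  from DERIV_mult[OF this heat_line[OF s]] show ?thesis unfolding heat1_def
    by (rule DERIV_cong) (use s in \<open>simp add: field_simps power2_eq_square\<close>)
qed

lemma heat_pd: "s > 0 ==> has_pd i (heat s) (heat1 s i y) y" "s > 0 ==> has_pd i (heat1 s i) (heat2 s i y) y"
  using heat_line[of s y "axis i 1" 0] heat1_line[of s i y "axis i 1" 0]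
  by (auto simp: has_pd_def heat1_def heat2_def inner_axis power2_eq_square)

lemma heat_cont: "s > 0 ==> continuous_on UNIV (heat s)" "s > 0 ==> continuous_on UNIV (heat1 s i)" "s > 0 ==> continuous_on UNIV (heat2 s i)"
  unfolding heat1_def[abs_def] heat2_def[abs_def] heat_def[abs_def] by (intro continuous_intros; simp)+

text \<open>
The heat equation.
\<close>

lemma heat_time_derivative:
  assumes s: "s > 0"
  shows "((%s. heat s y) has_real_derivative heat_lap s y / 2) (at s)"
proof -
  have 1: "((%s. s powr (- real CARD('a) / 2)) has_real_derivative (- real CARD('a) / 2) * s powr (- real CARD('a) / 2 - 1)) (at s)"
    using s by (auto intro!: derivative_eq_intros)
  have 2: "((%s. exp (- ((norm y)^2) / (2 * s))) has_real_derivative exp (- ((norm y)^2) / (2 * s)) * ((norm y)^2 / (2 * s^2))) (at s)"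
    using s by (auto intro!: derivative_eq_intros simp: field_simps power2_eq_square)
  have p: "s powr (- real CARD('a) / 2 - 1) = s powr (- real CARD('a) / 2) / s" using s by (simp add: powr_diff)
  show ?thesis using DERIV_mult[OF 1 2] unfolding heat_def[abs_def] heat_lap_def heat_def p
    by (rule DERIV_cong) (use s in \<open>simp add: field_simps power2_eq_square\<close>)
qed

lemma heat_decay:
  assumes "0 < \<epsilon>"
  obtains B where "0 <= B" "!!s (y::real^'n::finite). \<epsilon> <= s ==> s <= T ==> (1 + (norm y)^2)^2 * heat s y <= B"
proof (rule that)
  let ?M = "\<epsilon> powr (- real CARD('n) / 2)"
  show "0 <= ?M * (2 * (1 + 8 * T^2))" by simp
  fix s and y :: "real^'n"
  assume s: "\<epsilon> <= s" "s <= T"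
  hence s0: "0 < s" using assms by simp
  define u where "u = (norm y)^2 / (2 * s)"
  have u: "0 <= u" "(norm y)^2 = 2 * s * u" using s0 by (auto simp: u_def)
  have "u^2 / 2 <= exp u" using exp_lower_Taylor_quadratic[OF u(1)] u(1) by linarith
  hence e2: "u^2 * exp (- u) <= 2" by (simp add: exp_minus field_simps)
  have e1: "exp (- u) <= 1" using u(1) by simp
  have "(1 + (norm y)^2)^2 * exp (- u) <= (2 * (1 + (2 * s * u)^2)) * exp (- u)"
    unfolding u(2) using sum_squares_bound[of 1 "2 * s * u"] by (intro mult_right_mono) (simp_all add: power2_sum)
  also have "\<dots> = 2 * exp (- u) + 8 * s^2 * (u^2 * exp (- u))" by (simp add: algebra_simps power_mult_distrib)
  also have "\<dots> <= 2 * 1 + 8 * s^2 * 2" by (intro add_mono mult_left_mono e1 e2) auto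
  also have "\<dots> <= 2 * (1 + 8 * T^2)" using s s0 power_mono[of s T 2] by simp
  finally have le: "(1 + (norm y)^2)^2 * exp (- u) <= 2 * (1 + 8 * T^2)" .
  have "s powr (- real CARD('n) / 2) <= ?M" using s assms by (intro powr_mono2') auto
  hence "s powr (- real CARD('n) / 2) * ((1 + (norm y)^2)^2 * exp (- u)) <= ?M * (2 * (1 + 8 * T^2))"
    by (intro mult_mono le) auto
  thus "(1 + (norm y)^2)^2 * heat s y <= ?M * (2 * (1 + 8 * T^2))" unfolding heat_def u_def by (simp add: mult_ac)
qed

text \<open>
The negative second difference of the heat kernel in direction z. As a function of z it is even and vanishes to second order at 0, so it can be paired with the Laplacian of w; as a function of x it is of positive type.
\<close>

definition heat_diff :: "real => real^'n::finite => real^'n => real" where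
  "heat_diff s x z = 2 * heat s x - heat s (x - z) - heat s (x + z)"

lemma one_plus_norm_sq_shift:
  fixes x z :: "'a::real_inner"
  shows "1 + (norm z)^2 <= 2 * (1 + (norm x)^2) * (1 + (norm (x - z))^2)"
proof -
  have "norm z <= norm x + norm (x - z)" using norm_triangle_sub[of z x] by (simp add: norm_minus_commute add.commute)
  hence "(norm z)^2 <= (norm x + norm (x - z))^2" by (intro power_mono) auto
  also have "\<dots> <= 2 * (norm x)^2 + 2 * (norm (x - z))^2"
    using sum_squares_bound[of "norm x" "norm (x - z)"] by (simp add: power2_sum)
  finally have "1 + (norm z)^2 <= 2 + 2 * (norm x)^2 + 2 * (norm (x - z))^2" by simp
  also have "\<dots> <= 2 * (1 + (norm x)^2) * (1 + (norm (x - z))^2)" by (simp add: algebra_simps)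
  finally show ?thesis .
qed

text \<open>
Decay and difference estimates that are uniform for times in a compact interval of positive numbers.
\<close>

lemma heat_uniform_bounds:
  assumes \<epsilon>: "0 < \<epsilon>"
  obtains B where "0 <= B"
    "!!s (y::real^'n::finite). \<epsilon> <= s ==> s <= T ==> heat s y * (1 + (norm y)^2) <= B"
    "!!s (y::real^'n) i. \<epsilon> <= s ==> s <= T ==> \<bar>heat1 s i y\<bar> * (1 + (norm y)^2) <= B"
    "!!s (y::real^'n). \<epsilon> <= s ==> s <= T ==> \<bar>heat_lap s y\<bar> * (1 + (norm y)^2) <= B"
    "!!s (x::real^'n) z. \<epsilon> <= s ==> s <= T ==> \<bar>heat_diff s x z\<bar> <= B * (norm z)^2"
    "!!s (x::real^'n) z. \<epsilon> <= s ==> s <= T ==> \<bar>heat_diff s x z\<bar> <= B"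
    "!!s (x::real^'n) z i. \<epsilon> <= s ==> s <= T ==> \<bar>heat1 s i (x - z) - heat1 s i (x + z)\<bar> <= B * norm z"
proof -
  obtain B0 where B0: "0 <= B0" "!!s (y::real^'n). \<epsilon> <= s ==> s <= T ==> (1 + (norm y)^2)^2 * heat s y <= B0"
    using heat_decay[OF \<epsilon>] by metis
  define n where "n = real CARD('n)"
  have n: "1 <= n" unfolding n_def by (simp add: Suc_leI)
  define e where "e = 1 / \<epsilon> + 1 / \<epsilon>^2"
  have e: "0 < e" using \<epsilon> by (simp add: e_def add_pos_pos)
  define B where "B = (4 + 2 * n * e) * B0"
  have inv: "1 / s <= 1 / \<epsilon>" "1 / s^2 <= 1 / \<epsilon>^2" if "\<epsilon> <= s" for s
    using that \<epsilon> by (auto intro!: divide_left_mono power_mono)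
  have h0: "heat s y <= B0" and h1: "heat s y * (1 + (norm y)^2) <= B0" if s: "\<epsilon> <= s" "s <= T" for s and y :: "real^'n"
  proof -
    define g where "g = 1 + (norm y)^2"
    have g: "1 <= g" by (simp add: g_def)
    have gg: "g <= g^2" using g by (simp add: power2_eq_square)
    have "heat s y * g <= heat s y * g^2" by (intro mult_left_mono gg heat_nonneg)
    also have "\<dots> <= B0" using B0(2)[OF s, of y] by (simp add: g_def mult.commute)
    finally have 1: "heat s y * g <= B0" .
    show "heat s y * (1 + (norm y)^2) <= B0" using 1 by (simp add: g_def)
    have "heat s y * 1 <= heat s y * g" by (intro mult_left_mono g heat_nonneg)
    thus "heat s y <= B0" using 1 by simp
  qed
  \<comment> \<open>All the bounds below follow from this one: a coefficient of at most quadratic growth.\<close>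
  have coef: "\<bar>a\<bar> * heat s y * (1 + (norm y)^2) <= K * B0"
    if s: "\<epsilon> <= s" "s <= T" and a: "\<bar>a\<bar> <= K * (1 + (norm y)^2)" and K: "0 <= K" for a K s and y :: "real^'n"
  proof -
    have "\<bar>a\<bar> * heat s y * (1 + (norm y)^2) <= (K * (1 + (norm y)^2)) * heat s y * (1 + (norm y)^2)"
      by (intro mult_right_mono a heat_nonneg) auto
    also have "\<dots> = K * ((1 + (norm y)^2)^2 * heat s y)" by (simp add: power2_eq_square mult_ac)
    also have "\<dots> <= K * B0" by (intro mult_left_mono B0(2) s K)
    finally show ?thesis .
  qed
  have coef': "\<bar>a\<bar> * heat s y <= K * B0"
    if s: "\<epsilon> <= s" "s <= T" and a: "\<bar>a\<bar> <= K * (1 + (norm y)^2)" and K: "0 <= K" for a K s and y :: "real^'n"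
  proof -
    have "\<bar>a\<bar> * heat s y * 1 <= \<bar>a\<bar> * heat s y * (1 + (norm y)^2)"
      by (intro mult_left_mono mult_nonneg_nonneg heat_nonneg) auto
    thus ?thesis using coef[OF that] by simp
  qed
  have quad: "\<bar>(norm y)^2 / s^2 - m / s\<bar> <= m * e * (1 + (norm y)^2)" if s: "\<epsilon> <= s" and m: "1 <= m" for s m and y :: "real^'n"
  proof -
    have "\<bar>(norm y)^2 / s^2 - m / s\<bar> <= (norm y)^2 * (1 / s^2) + m * (1 / s)"
      using s \<epsilon> m abs_triangle_ineq4[of "(norm y)^2 / s^2" "m / s"] by simp
    also have "\<dots> <= (norm y)^2 * (1 / \<epsilon>^2) + m * (1 / \<epsilon>)" using inv[OF s] m by (intro add_mono mult_left_mono) auto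
    also have "\<dots> <= m * ((norm y)^2 * (1 / \<epsilon>^2)) + m * (1 / \<epsilon>)" using m mult_right_mono[of 1 m "(norm y)^2 * (1 / \<epsilon>^2)"] by simp
    also have "\<dots> <= m * e * (1 + (norm y)^2)" using m \<epsilon> by (simp add: e_def algebra_simps)
    finally show ?thesis .
  qed
  have nle: "norm y <= 1 + (norm y)^2" for y :: "real^'n"
  proof -
    have "2 * norm y <= 1 + (norm y)^2" using sum_squares_bound[of 1 "norm y"] by simp
    thus ?thesis using norm_ge_zero[of y] by linarith
  qed
  have eB: "e * B0 <= B" "n * e * B0 <= B" "B0 <= B" "4 * B0 <= B" "2 * e * B0 <= B"
  proof -
    have p: "0 <= e * B0" using e B0(1) by simp
    note p mult_right_mono[OF n p]
    moreover have "B = 4 * B0 + 2 * (n * (e * B0))" by (simp add: B_def algebra_simps)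
    ultimately show "e * B0 <= B" "n * e * B0 <= B" "B0 <= B" "4 * B0 <= B" "2 * e * B0 <= B"
      unfolding mult.assoc using B0(1) by linarith+
  qed
  show thesis
  proof (rule that[of B])
    show "0 <= B" using eB(3) B0(1) by simp
    fix s assume s: "\<epsilon> <= s" "s <= T"
    have s0: "0 < s" using s \<epsilon> by simp
    have dot: "\<bar>y \<bullet> v\<bar> <= norm y * norm v" for y v :: "real^'n" by (rule Cauchy_Schwarz_ineq2)
    show "heat s y * (1 + (norm y)^2) <= B" for y :: "real^'n" using h1[OF s, of y] eB(3) by simp
    show "\<bar>heat1 s i y\<bar> * (1 + (norm y)^2) <= B" for y :: "real^'n" and i
    proof -
      have "\<bar>y $ i / s\<bar> <= norm y * (1 / \<epsilon>)"
        using component_le_norm_cart[of y i] inv(1)[OF s(1)] s0 mult_mono[of "\<bar>y $ i\<bar>" "norm y" "1/s" "1/\<epsilon>"] by simp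
      also have "\<dots> <= (1 + (norm y)^2) * e" using nle[of y] \<epsilon> by (intro mult_mono) (auto simp: e_def)
      finally have "\<bar>y $ i / s\<bar> <= e * (1 + (norm y)^2)" by (simp add: mult.commute)
      from coef[OF s this] e have "\<bar>heat1 s i y\<bar> * (1 + (norm y)^2) <= e * B0"
        unfolding heat1_def by (simp add: abs_mult heat_nonneg)
      thus ?thesis using eB(1) by simp
    qed
    show "\<bar>heat_lap s y\<bar> * (1 + (norm y)^2) <= B" for y :: "real^'n"
      using coef[OF s quad[OF s(1) n, of y]] e n eB(2) unfolding heat_lap_def
      by (simp add: abs_mult heat_nonneg n_def)
    show "\<bar>heat_diff s x z\<bar> <= B" for x z :: "real^'n"
    proof -
      have "\<bar>heat_diff s x z\<bar> <= 2 * B0"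
        using h0[OF s, of x] h0[OF s, of "x - z"] h0[OF s, of "x + z"] heat_nonneg[of s x] heat_nonneg[of s "x - z"] heat_nonneg[of s "x + z"]
        unfolding heat_diff_def abs_le_iff by linarith
      thus ?thesis using eB(4) B0(1) by simp
    qed
    show "\<bar>heat_diff s x z\<bar> <= B * (norm z)^2" for x z :: "real^'n"
    proof -
      have d2: "\<bar>(((x + t *\<^sub>R z) \<bullet> z)^2 / s^2 - z \<bullet> z / s) * heat s (x + t *\<^sub>R z)\<bar> <= B * (norm z)^2" for t
      proof -
        define y where "y = x + t *\<^sub>R z"
        have "(y \<bullet> z)^2 <= (norm y * norm z)^2" using dot[of y z] by (metis abs_ge_zero power2_abs power_mono)
        hence "(y \<bullet> z)^2 * (1 / s^2) <= (norm y * norm z)^2 * (1 / \<epsilon>^2)" using inv(2)[OF s(1)] by (intro mult_mono) auto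
        moreover have "z \<bullet> z * (1 / s) <= (norm z)^2 * (1 / \<epsilon>)" using inv(1)[OF s(1)] s0 by (intro mult_mono) (auto simp: power2_norm_eq_inner)
        moreover have "\<bar>(y \<bullet> z)^2 / s^2 - z \<bullet> z / s\<bar> <= (y \<bullet> z)^2 * (1 / s^2) + z \<bullet> z * (1 / s)"
          using abs_triangle_ineq4[of "(y \<bullet> z)^2 / s^2" "z \<bullet> z / s"] s0 by simp
        ultimately have "\<bar>(y \<bullet> z)^2 / s^2 - z \<bullet> z / s\<bar> <= (norm y * norm z)^2 * (1 / \<epsilon>^2) + (norm z)^2 * (1 / \<epsilon>)" by linarith
        also have "\<dots> <= (e * (norm z)^2) * (1 + (norm y)^2)"
        proof -
          have "(e * (norm z)^2) * (1 + (norm y)^2) = (norm y * norm z)^2 * (1 / \<epsilon>^2) + (norm z)^2 * (1 / \<epsilon>)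
              + ((norm z)^2 * (1 / \<epsilon>^2) + (norm y * norm z)^2 * (1 / \<epsilon>))"
            by (simp add: e_def distrib_left distrib_right power_mult_distrib add_divide_distrib mult_ac)
          moreover have "0 <= (norm z)^2 * (1 / \<epsilon>^2)" "0 <= (norm y * norm z)^2 * (1 / \<epsilon>)" using \<epsilon> by auto
          ultimately show ?thesis by linarith
        qed
        finally have "\<bar>(y \<bullet> z)^2 / s^2 - z \<bullet> z / s\<bar> * heat s y <= e * (norm z)^2 * B0"
          by (intro coef' s) (use e in auto)
        also have "\<dots> <= B * (norm z)^2" using mult_right_mono[OF eB(1), of "(norm z)^2"] by (simp add: mult_ac)
        finally show ?thesis by (simp add: y_def abs_mult heat_nonneg)
      qed
      have l1: "((%t. heat s (x + t *\<^sub>R z)) has_real_derivative - ((x + t *\<^sub>R z) \<bullet> z / s) * heat s (x + t *\<^sub>R z)) (at t)" for t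
        by (rule heat_line[OF s0])
      have l2: "((%t. - ((x + t *\<^sub>R z) \<bullet> z / s) * heat s (x + t *\<^sub>R z)) has_real_derivative
          (((x + t *\<^sub>R z) \<bullet> z)^2 / s^2 - z \<bullet> z / s) * heat s (x + t *\<^sub>R z)) (at t)" for t
        by (rule heat_line2[OF s0])
      have lo: "- (B * (norm z)^2) <= (((x + t *\<^sub>R z) \<bullet> z)^2 / s^2 - z \<bullet> z / s) * heat s (x + t *\<^sub>R z)" for t using d2[of t] by linarith
      have up: "(((x + t *\<^sub>R z) \<bullet> z)^2 / s^2 - z \<bullet> z / s) * heat s (x + t *\<^sub>R z) <= B * (norm z)^2" for t using d2[of t] by linarith
      show ?thesis
        using second_difference_bound(1)[OF zero_less_one l1 l2 lo] second_difference_bound(2)[OF zero_less_one l1 l2 up]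
        by (simp add: heat_diff_def abs_le_iff)
    qed
    show "\<bar>heat1 s i (x - z) - heat1 s i (x + z)\<bar> <= B * norm z" for x z :: "real^'n" and i
    proof -
      have d: "\<bar>((x + t *\<^sub>R z) $ i * ((x + t *\<^sub>R z) \<bullet> z) / s^2 - z $ i / s) * heat s (x + t *\<^sub>R z)\<bar> <= e * B0 * norm z" for t
      proof -
        define y where "y = x + t *\<^sub>R z"
        have "\<bar>y $ i * (y \<bullet> z)\<bar> <= norm y * (norm y * norm z)"
          unfolding abs_mult by (intro mult_mono component_le_norm_cart dot) auto
        hence "\<bar>y $ i * (y \<bullet> z)\<bar> * (1 / s^2) <= (norm y * (norm y * norm z)) * (1 / \<epsilon>^2)" using inv(2)[OF s(1)] by (intro mult_mono) auto
        moreover have "\<bar>z $ i\<bar> * (1 / s) <= norm z * (1 / \<epsilon>)" using inv(1)[OF s(1)] s0 by (intro mult_mono component_le_norm_cart) auto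
        moreover have "\<bar>y $ i * (y \<bullet> z) / s^2 - z $ i / s\<bar> <= \<bar>y $ i * (y \<bullet> z)\<bar> * (1 / s^2) + \<bar>z $ i\<bar> * (1 / s)"
          using abs_triangle_ineq4[of "y $ i * (y \<bullet> z) / s^2" "z $ i / s"] s0 by simp
        ultimately have "\<bar>y $ i * (y \<bullet> z) / s^2 - z $ i / s\<bar> <= (norm y * (norm y * norm z)) * (1 / \<epsilon>^2) + norm z * (1 / \<epsilon>)" by linarith
        also have "\<dots> <= (e * norm z) * (1 + (norm y)^2)"
        proof -
          have "(e * norm z) * (1 + (norm y)^2) = (norm y * (norm y * norm z)) * (1 / \<epsilon>^2) + norm z * (1 / \<epsilon>)
              + (norm z * (1 / \<epsilon>^2) + (norm y * (norm y * norm z)) * (1 / \<epsilon>))"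
            by (simp add: e_def distrib_left distrib_right power2_eq_square add_divide_distrib mult_ac)
          moreover have "0 <= norm z * (1 / \<epsilon>^2)" "0 <= (norm y * (norm y * norm z)) * (1 / \<epsilon>)" using \<epsilon> by auto
          ultimately show ?thesis by linarith
        qed
        finally have "\<bar>y $ i * (y \<bullet> z) / s^2 - z $ i / s\<bar> * heat s y <= e * norm z * B0"
          by (intro coef' s) (use e in auto)
        thus ?thesis by (simp add: y_def abs_mult heat_nonneg mult_ac)
      qed
      have "\<exists>\<xi>>-1. \<xi> < 1 & heat1 s i (x + 1 *\<^sub>R z) - heat1 s i (x + (-1) *\<^sub>R z)
          = (1 - (-1)) * (((x + \<xi> *\<^sub>R z) $ i * ((x + \<xi> *\<^sub>R z) \<bullet> z) / s^2 - z $ i / s) * heat s (x + \<xi> *\<^sub>R z))"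
        by (rule MVT2[of "-1" 1 "%t. heat1 s i (x + t *\<^sub>R z)"]) (simp, rule heat1_line[OF s0])
      then obtain \<xi> where \<xi>: "heat1 s i (x + z) - heat1 s i (x - z)
          = 2 * (((x + \<xi> *\<^sub>R z) $ i * ((x + \<xi> *\<^sub>R z) \<bullet> z) / s^2 - z $ i / s) * heat s (x + \<xi> *\<^sub>R z))" by auto
      have "\<bar>heat1 s i (x - z) - heat1 s i (x + z)\<bar> <= 2 * (e * B0 * norm z)"
        using d[of \<xi>] \<xi> by linarith
      also have "\<dots> <= B * norm z" using mult_right_mono[OF eB(5), of "norm z"] by simp
      finally show ?thesis .
    qed
  qed
qed

lemma has_pd_shift: "has_pd i F D (x + z) ==> has_pd i (%z. F (x + z)) D z"
  unfolding has_pd_def by (simp add: add.assoc)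

lemma has_pd_reflect:
  assumes "has_pd i F D (x - z)"
  shows "has_pd i (%z. F (x - z)) (- D) z"
proof -
  have "((%t. F (x - z + (- t) *\<^sub>R axis i 1)) has_real_derivative - D) (at 0)"
    using DERIV_mirror[where f="%t. F (x - z + t *\<^sub>R axis i 1)" and x=0 and y=D] assms by (simp add: has_pd_def)
  thus ?thesis unfolding has_pd_def by (simp add: diff_diff_eq)
qed

lemma lborel_integral_uminus:
  fixes f :: "'a::euclidean_space => real"
  assumes "f \<in> borel_measurable borel"
  shows "(\<integral>x. f (- x) \<partial>lborel) = (\<integral>x. f x \<partial>lborel)"
proof -
  have "lborel = density (distr lborel borel (%x::'a. 0 + (-1) *\<^sub>R x)) (%_. ennreal (\<bar>-1\<bar>^DIM('a)))"
    by (rule lborel_affine) simp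
  hence d: "lborel = distr lborel borel (uminus :: 'a => 'a)" by (simp add: density_1)
  have "(\<integral>x. f x \<partial>lborel) = (\<integral>x. f x \<partial>distr lborel borel (uminus :: 'a => 'a))" using d by simp
  also have "\<dots> = (\<integral>x. f (- x) \<partial>lborel)" using assms by (intro integral_distr) auto
  finally show ?thesis ..
qed

lemma integrable_product:
  fixes f :: "'a => real" and g :: "'b => real"
  assumes "sigma_finite_measure M" "sigma_finite_measure N" and f: "integrable M f" and g: "integrable N g"
  shows "integrable (M \<Otimes>\<^sub>M N) (%(x, y). f x * g y)"
proof -
  interpret pair_sigma_finite M N using assms by (simp add: pair_sigma_finite_def)
  have [measurable]: "f \<in> borel_measurable M" "g \<in> borel_measurable N" using f g by auto
  show ?thesis
  proof (rule Fubini_integrable)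
    show "(%(x, y). f x * g y) \<in> borel_measurable (M \<Otimes>\<^sub>M N)" by measurable
    show "integrable M (%x. \<integral>y. norm (case (x, y) of (x, y) => f x * g y) \<partial>N)"
      using f by (simp add: abs_mult)
    show "AE x in M. integrable N (%y. case (x, y) of (x, y) => f x * g y)" using g by simp
  qed
qed

section \<open>Heat smoothing of a kernel\<close>

locale even_singular_kernel = singular_kernel +
  assumes w_even: "!!z. w (- z) = w z"
begin

lemma heat_coefficient_bounds:
  assumes \<epsilon>: "0 < \<epsilon>"
  obtains B where "0 <= B"
    "!!s x z. \<epsilon> <= s ==> s <= T ==> \<bar>w z * heat s (x - z)\<bar> <= B * (1 + (norm x)^2) * tp z \<or> z = 0"
    "!!s x z. \<epsilon> <= s ==> s <= T ==> \<bar>w z * heat_lap s (x - z)\<bar> <= B * (1 + (norm x)^2) * tp z \<or> z = 0"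
    "!!s x z. \<epsilon> <= s ==> s <= T ==> \<bar>laplacian w z * heat_diff s x z\<bar> <= B * tp z \<or> z = 0"
proof -
  obtain B where B: "0 <= B"
    "!!s (y::real^'a). \<epsilon> <= s ==> s <= T ==> heat s y * (1 + (norm y)^2) <= B"
    "!!s (y::real^'a) i. \<epsilon> <= s ==> s <= T ==> \<bar>heat1 s i y\<bar> * (1 + (norm y)^2) <= B"
    "!!s (y::real^'a). \<epsilon> <= s ==> s <= T ==> \<bar>heat_lap s y\<bar> * (1 + (norm y)^2) <= B"
    "!!s (x::real^'a) z. \<epsilon> <= s ==> s <= T ==> \<bar>heat_diff s x z\<bar> <= B * (norm z)^2"
    "!!s (x::real^'a) z. \<epsilon> <= s ==> s <= T ==> \<bar>heat_diff s x z\<bar> <= B"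
    by (rule heat_uniform_bounds[OF \<epsilon>, where T=T and 'n='a]) (rule that)
  have conv: "\<bar>w z * L\<bar> <= 2 * C * B * (1 + (norm x)^2) * tp z \<or> z = 0" if L: "\<bar>L\<bar> * (1 + (norm (x - z))^2) <= B" for L x z
  proof (cases "z = 0")
    case False
    define A where "A = 2 * B * (1 + (norm x)^2)"
    have A: "0 <= A" using B(1) by (simp add: A_def)
    have "\<bar>L\<bar> * (1 + (norm z)^2) <= \<bar>L\<bar> * (2 * (1 + (norm x)^2) * (1 + (norm (x - z))^2))"
      by (intro mult_left_mono one_plus_norm_sq_shift) simp
    also have "\<dots> = 2 * (1 + (norm x)^2) * (\<bar>L\<bar> * (1 + (norm (x - z))^2))" by simp
    also have "\<dots> <= 2 * (1 + (norm x)^2) * B" by (intro mult_left_mono L) simp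
    finally have LA: "\<bar>L\<bar> * (1 + (norm z)^2) <= A" by (simp add: A_def mult_ac)
    have "\<bar>L\<bar> * 1 <= \<bar>L\<bar> * (1 + (norm z)^2)" by (intro mult_left_mono) auto
    hence 1: "\<bar>L\<bar> <= A" using LA by simp
    have "\<bar>L\<bar> * (norm z)^2 <= \<bar>L\<bar> * (1 + (norm z)^2)" by (intro mult_left_mono) auto
    hence 2: "\<bar>L\<bar> <= A / (norm z)^2" using LA False by (simp add: field_simps)
    have "\<bar>w z * L\<bar> <= C * A * tp z"
      by (rule product_bounds(1)[OF False A, of 0 0 L]) (use A 1 2 in auto)
    thus ?thesis by (simp add: A_def mult_ac)
  qed simp
  have BB: "C * B <= 2 * C * B" using B(1) C by simp
  show thesis
  proof (rule that[of "2 * C * B"])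
    show "0 <= 2 * C * B" using B(1) C by simp
    fix s x z assume s: "\<epsilon> <= s" "s <= T"
    show "\<bar>w z * heat s (x - z)\<bar> <= 2 * C * B * (1 + (norm x)^2) * tp z \<or> z = 0"
      by (rule conv) (use B(2)[OF s, of "x - z"] in \<open>simp add: heat_nonneg\<close>)
    show "\<bar>w z * heat_lap s (x - z)\<bar> <= 2 * C * B * (1 + (norm x)^2) * tp z \<or> z = 0"
      by (rule conv) (rule B(4)[OF s])
    show "\<bar>laplacian w z * heat_diff s x z\<bar> <= 2 * C * B * tp z \<or> z = 0"
    proof (cases "z = 0")
      case False
      have tp0: "0 <= tp z" by (simp add: two_powers_def)
      have "\<bar>laplacian w z * heat_diff s x z\<bar> <= C * B * tp z"
        by (rule product_bounds(2)[OF False B(1), of "heat_diff s x z" 0 0]) (use B s in auto)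
      also have "\<dots> <= 2 * C * B * tp z" by (intro mult_right_mono BB tp0)
      finally show ?thesis by simp
    qed simp
  qed
qed

lemma off_0: "AE z in lborel. z ~= (0::real^'a)"
  by (rule AE_lborel_singleton)

lemma integrable_by_tp:
  assumes [measurable]: "f \<in> borel_measurable borel" and "!!z. \<bar>f z\<bar> <= K * tp z \<or> z = 0"
  shows "integrable lborel f"
proof (rule Bochner_Integration.integrable_bound)
  show "integrable lborel (%z. K * tp z)" using tp_integrable by simp
  show "AE z in lborel. norm (f z) <= norm (K * tp z)"
    using off_0 by eventually_elim (use assms(2) in force)
qed simp

text \<open>
Green's identity for the test function heat_diff, up to sign and the factor 2 coming from the evenness of w.
\<close>

lemma laplacian_of_smoothed_kernel:
  assumes s: "0 < s"
  shows "(\<integral>z. w z * heat_lap s (x - z) \<partial>lborel) = - (1/2) * (\<integral>z. laplacian w z * heat_diff s x z \<partial>lborel)"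
proof -
  obtain B where B: "0 <= B"
    "!!s' (y::real^'a). s <= s' ==> s' <= s ==> heat s' y * (1 + (norm y)^2) <= B"
    "!!s' (y::real^'a) i. s <= s' ==> s' <= s ==> \<bar>heat1 s' i y\<bar> * (1 + (norm y)^2) <= B"
    "!!s' (y::real^'a). s <= s' ==> s' <= s ==> \<bar>heat_lap s' y\<bar> * (1 + (norm y)^2) <= B"
    "!!s' (x::real^'a) z. s <= s' ==> s' <= s ==> \<bar>heat_diff s' x z\<bar> <= B * (norm z)^2"
    "!!s' (x::real^'a) z. s <= s' ==> s' <= s ==> \<bar>heat_diff s' x z\<bar> <= B"
    "!!s' (x::real^'a) z i. s <= s' ==> s' <= s ==> \<bar>heat1 s' i (x - z) - heat1 s' i (x + z)\<bar> <= B * norm z"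
    by (rule heat_uniform_bounds[OF s, where T=s and 'n='a]) (rule that)
  define A where "A = 4 * B * (1 + (norm x)^2)"
  have A: "0 <= A" using B(1) by (simp add: A_def)
  have BA: "4 * B <= A" using B(1) mult_left_mono[of 1 "1 + (norm x)^2" "4 * B"] by (simp add: A_def)
  have dec: "\<bar>a\<bar> <= (A / 2) / (1 + (norm z)^2)" if "\<bar>a\<bar> * (1 + (norm y)^2) <= B" "y = x - z \<or> y = x + z" for a y z
  proof -
    have "norm y = norm (x - z) \<or> norm y = norm (x - (- z))" using that(2) by auto
    hence "1 + (norm z)^2 <= 2 * (1 + (norm x)^2) * (1 + (norm y)^2)"
      using one_plus_norm_sq_shift[of z x] one_plus_norm_sq_shift[of "- z" x] by auto
    hence "\<bar>a\<bar> * (1 + (norm z)^2) <= \<bar>a\<bar> * (2 * (1 + (norm x)^2) * (1 + (norm y)^2))" by (intro mult_left_mono) auto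
    also have "\<dots> = 2 * (1 + (norm x)^2) * (\<bar>a\<bar> * (1 + (norm y)^2))" by simp
    also have "\<dots> <= 2 * (1 + (norm x)^2) * B" by (intro mult_left_mono that) simp
    also have "\<dots> = A / 2" by (simp add: A_def)
    finally show ?thesis by (subst pos_le_divide_eq) (simp_all add: add_pos_nonneg)
  qed
  have far: "A / (1 + (norm z)^2) <= A / (norm z)^2" "A / (1 + (norm z)^2) <= A / norm z" "A / (1 + (norm z)^2) <= A" if "1 <= norm z" for z :: "real^'a"
  proof -
    have "z ~= 0" using that by auto
    moreover have "norm z <= (norm z)^2" using self_le_power[of "norm z" 2] that by simp
    ultimately show "A / (1 + (norm z)^2) <= A / (norm z)^2" "A / (1 + (norm z)^2) <= A / norm z" "A / (1 + (norm z)^2) <= A"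
      using that A divide_left_mono[of "norm z" "1 + (norm z)^2" A] divide_left_mono[of "(norm z)^2" "1 + (norm z)^2" A] divide_left_mono[of 1 "1 + (norm z)^2" A]
      by (auto simp: zero_less_mult_iff add_pos_nonneg)
  qed
  let ?\<psi> = "heat_diff s x" and ?\<psi>1 = "%i z. heat1 s i (x - z) - heat1 s i (x + z)" and ?\<psi>2 = "%i z. - heat2 s i (x - z) - heat2 s i (x + z)"
  have sum2: "(\<Sum>i\<in>UNIV. ?\<psi>2 i z) = - heat_lap s (x - z) - heat_lap s (x + z)" for z
    by (simp add: sum_subtractf sum_negf sum_heat2)
  have pd1: "has_pd i ?\<psi> (?\<psi>1 i z) z" for i z
  proof -
    have "has_pd i (%z. 2 * heat s x - heat s (x - z) - heat s (x + z)) (0 - (- heat1 s i (x - z)) - heat1 s i (x + z)) z"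
      by (intro has_pd_diff has_pd_const has_pd_shift has_pd_reflect heat_pd s)
    thus ?thesis by (simp add: heat_diff_def[abs_def])
  qed
  have pd2: "has_pd i (?\<psi>1 i) (?\<psi>2 i z) z" for i z
    by (intro has_pd_diff has_pd_shift has_pd_reflect heat_pd s)
  have cr: "continuous_on UNIV (%z::real^'a. f (x - z))" "continuous_on UNIV (%z::real^'a. f (x + z))"
    if "continuous_on UNIV f" for f :: "real^'a => real"
    using that by (auto intro!: continuous_on_compose2[OF that] continuous_intros)
  have "(\<integral>z. w z * (\<Sum>i\<in>UNIV. ?\<psi>2 i z) \<partial>lborel) = (\<integral>z. laplacian w z * ?\<psi> z \<partial>lborel)"
  proof (rule laplacian_integration_by_parts(3)[OF pd1 pd2 _ _ _ A])
    show "continuous_on UNIV ?\<psi>" unfolding heat_diff_def[abs_def] by (intro continuous_intros cr heat_cont s)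
    show "continuous_on UNIV (?\<psi>1 i)" "continuous_on UNIV (?\<psi>2 i)" for i by (intro continuous_intros cr heat_cont s)+
    fix z :: "real^'a"
    have nz: "B * norm z <= A * norm z" "B * (norm z)^2 <= A * (norm z)^2" using BA B(1) by (auto intro!: mult_right_mono)
    show "\<bar>?\<psi> z\<bar> <= A * (norm z)^2" using B(5)[of s x z] nz by simp
    show "\<bar>?\<psi>1 i z\<bar> <= A * norm z" for i using B(7)[of s i x z] nz by simp
    have lap: "\<bar>\<Sum>i\<in>UNIV. ?\<psi>2 i z\<bar> <= A / (1 + (norm z)^2)"
    proof -
      have "\<bar>heat_lap s (x - z)\<bar> <= (A / 2) / (1 + (norm z)^2)" "\<bar>heat_lap s (x + z)\<bar> <= (A / 2) / (1 + (norm z)^2)"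
        using dec[OF B(4)[of s "x - z"]] dec[OF B(4)[of s "x + z"]] by auto
      moreover have "(A / 2) / (1 + (norm z)^2) + (A / 2) / (1 + (norm z)^2) = A / (1 + (norm z)^2)"
        by (subst add_divide_distrib[symmetric]) simp
      ultimately show ?thesis unfolding sum2 by linarith
    qed
    have "A / (1 + (norm z)^2) <= A" using A divide_left_mono[of 1 "1 + (norm z)^2" A] by (simp add: add_pos_nonneg)
    thus "\<bar>\<Sum>i\<in>UNIV. ?\<psi>2 i z\<bar> <= A" using lap by linarith
    assume z1: "1 <= norm z"
    show "\<bar>?\<psi> z\<bar> <= A" using B(6)[of s x z] BA B(1) by simp
    show "\<bar>\<Sum>i\<in>UNIV. ?\<psi>2 i z\<bar> <= A / (norm z)^2" using lap far(1)[OF z1] by linarith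
    show "\<bar>?\<psi>1 i z\<bar> <= A / norm z" for i
    proof -
      have "\<bar>heat1 s i (x - z)\<bar> <= (A / 2) / (1 + (norm z)^2)" "\<bar>heat1 s i (x + z)\<bar> <= (A / 2) / (1 + (norm z)^2)"
        using dec[OF B(3)[of s i "x - z"]] dec[OF B(3)[of s i "x + z"]] by auto
      moreover have "(A / 2) / (1 + (norm z)^2) + (A / 2) / (1 + (norm z)^2) = A / (1 + (norm z)^2)"
        by (subst add_divide_distrib[symmetric]) simp
      ultimately show ?thesis using far(2)[OF z1] by linarith
    qed
  qed
  also have "(\<integral>z. w z * (\<Sum>i\<in>UNIV. ?\<psi>2 i z) \<partial>lborel) = - (\<integral>z. w z * heat_lap s (x - z) \<partial>lborel) - (\<integral>z. w z * heat_lap s (x + z) \<partial>lborel)"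
  proof -
    obtain B' where B': "!!s' x z. s <= s' ==> s' <= s ==> \<bar>w z * heat_lap s' (x - z)\<bar> <= B' * (1 + (norm x)^2) * tp z \<or> z = 0"
      by (rule heat_coefficient_bounds[OF s, of s]) (rule that)
    have i: "integrable lborel (%z. w z * heat_lap s (x - z))" for x
      by (rule integrable_by_tp[OF _ B'[OF order_refl order_refl]]) measurable
    have "heat_lap s (x + z) = heat_lap s (- x - z)" for z using heat_lap_minus[of s "x + z"] by simp
    hence i2: "integrable lborel (%z. w z * heat_lap s (x + z))" using i[of "- x"] by simp
    show ?thesis unfolding sum2 using i[of x] i2 by (simp add: right_diff_distrib)
  qed
  also have "(\<integral>z. w z * heat_lap s (x + z) \<partial>lborel) = (\<integral>z. w z * heat_lap s (x - z) \<partial>lborel)"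
    using lborel_integral_uminus[of "%z. w z * heat_lap s (x - z)"] by (simp add: w_even)
  finally show ?thesis by simp
qed

definition smoothed :: "real => real^'a => real" where
  "smoothed s x = (\<integral>z. w z * heat s (x - z) \<partial>lborel)"

definition weight :: "real => real => real \<times> (real^'a) => real" where
  "weight \<epsilon> T = (%(s, z). indicator {\<epsilon>..T} s * laplacian w z)"

lemma weight_measurable[measurable]: "weight \<epsilon> T \<in> borel_measurable (lborel \<Otimes>\<^sub>M lborel)"
  unfolding weight_def by measurable

text \<open>
Integrate the time derivative of the smoothed kernel over [\<epsilon>, T]. The result writes the difference of two smoothings as a superposition, with the positive weights given by the Laplacian of w, of functions of positive type.
\<close>

lemma smoothed_difference:
  assumes \<epsilon>: "0 < \<epsilon>" "\<epsilon> <= T"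
  shows "integrable (lborel \<Otimes>\<^sub>M lborel) (%sz. weight \<epsilon> T sz * heat_diff (fst sz) x (snd sz))"
    and "smoothed \<epsilon> x - smoothed T x = (1/4) * (\<integral>sz. weight \<epsilon> T sz * heat_diff (fst sz) x (snd sz) \<partial>(lborel \<Otimes>\<^sub>M lborel))"
proof -
  obtain B where B: "0 <= B"
    "!!s x z. \<epsilon> <= s ==> s <= T ==> \<bar>w z * heat s (x - z)\<bar> <= B * (1 + (norm x)^2) * tp z \<or> z = 0"
    "!!s x z. \<epsilon> <= s ==> s <= T ==> \<bar>w z * heat_lap s (x - z)\<bar> <= B * (1 + (norm x)^2) * tp z \<or> z = 0"
    "!!s x z. \<epsilon> <= s ==> s <= T ==> \<bar>laplacian w z * heat_diff s x z\<bar> <= B * tp z \<or> z = 0"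
    by (rule heat_coefficient_bounds[OF \<epsilon>(1), of T]) (rule that)
  have dom: "integrable (lborel \<Otimes>\<^sub>M lborel) (%(s::real, z::real^'a). indicator {\<epsilon>..T} s * (K * tp z))" for K
    by (rule integrable_product) (use tp_integrable \<epsilon>(2) in \<open>auto simp: lborel.sigma_finite_measure_axioms intro!: integrable_real_indicator\<close>)
  have AE0: "AE sz in (lborel \<Otimes>\<^sub>M lborel). snd sz ~= (0::real^'a)"
    by (rule lborel_pair.AE_pair_measure) (measurable, use off_0 in simp)
  have tp0: "0 <= tp z" for z by (simp add: two_powers_def)
  have hdm[measurable]: "(%sz. heat_diff (fst sz) x (snd sz)) \<in> borel_measurable (lborel \<Otimes>\<^sub>M lborel)"
    unfolding heat_diff_def by measurable
  show int1: "integrable (lborel \<Otimes>\<^sub>M lborel) (%sz. weight \<epsilon> T sz * heat_diff (fst sz) x (snd sz))"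
  proof (rule Bochner_Integration.integrable_bound[OF dom[of B]])
    show "AE sz in lborel \<Otimes>\<^sub>M lborel. norm (weight \<epsilon> T sz * heat_diff (fst sz) x (snd sz)) <= norm (case sz of (s, z) => indicator {\<epsilon>..T} s * (B * tp z))"
      using AE0
    proof eventually_elim
      case (elim sz)
      thus ?case using B(4)[of "fst sz" "snd sz" x] B(1) tp0[of "snd sz"]
        by (cases sz) (auto simp: weight_def indicator_def abs_mult)
    qed
  qed measurable
  have int2: "integrable (lborel \<Otimes>\<^sub>M lborel) (%(s, z). indicator {\<epsilon>..T} s * (w z * heat_lap s (x - z)))"
  proof (rule Bochner_Integration.integrable_bound[OF dom[of "B * (1 + (norm x)^2)"]])
    show "AE sz in lborel \<Otimes>\<^sub>M lborel. norm (case sz of (s, z) => indicator {\<epsilon>..T} s * (w z * heat_lap s (x - z)))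
        <= norm (case sz of (s, z) => indicator {\<epsilon>..T} s * ((B * (1 + (norm x)^2)) * tp z))"
      using AE0
    proof eventually_elim
      case (elim sz)
      have "0 <= (B * (1 + (norm x)^2)) * tp (snd sz)" using B(1) tp0 by simp
      thus ?case using B(3)[of "fst sz" "snd sz" x] elim
        by (cases sz) (auto simp: indicator_def)
    qed
  qed measurable
  have i0: "integrable lborel (%z. w z * heat s (x - z))" if "\<epsilon> <= s" "s <= T" for s
    by (rule integrable_by_tp[OF _ B(2)[OF that]]) measurable
  have ftc: "heat T y - heat \<epsilon> y = (\<integral>s. indicator {\<epsilon>..T} s * (heat_lap s y / 2) \<partial>lborel)" for y :: "real^'a"
  proof -
    have "(\<integral>s. indicator {\<epsilon>..T} s *\<^sub>R (heat_lap s y / 2) \<partial>lborel) = heat T y - heat \<epsilon> y"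
    proof (rule integral_FTC_Icc)
      fix s assume "\<epsilon> <= s" "s <= T"
      hence s: "0 < s" using \<epsilon> by simp
      show "((%s. heat s y) has_vector_derivative heat_lap s y / 2) (at s within {\<epsilon>..T})"
        unfolding has_real_derivative_iff_has_vector_derivative[symmetric]
        by (rule has_field_derivative_at_within[OF heat_time_derivative[OF s]])
    next
      show "continuous_on {\<epsilon>..T} (%s. heat_lap s y / 2)" unfolding heat_lap_def heat_def
        using \<epsilon> by (intro continuous_intros) auto
    qed (use \<epsilon> in auto)
    thus ?thesis by simp
  qed
  have "smoothed T x - smoothed \<epsilon> x = (\<integral>z. w z * (heat T (x - z) - heat \<epsilon> (x - z)) \<partial>lborel)"
    unfolding smoothed_def using i0[of T] i0[of \<epsilon>] \<epsilon> by (simp add: right_diff_distrib)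
  also have "\<dots> = (\<integral>z. \<integral>s. indicator {\<epsilon>..T} s * (w z * heat_lap s (x - z)) / 2 \<partial>lborel \<partial>lborel)"
  proof (rule Bochner_Integration.integral_cong[OF refl])
    fix z
    have "w z * (heat T (x - z) - heat \<epsilon> (x - z)) = (\<integral>s. w z * (indicator {\<epsilon>..T} s * (heat_lap s (x - z) / 2)) \<partial>lborel)"
      unfolding ftc by simp
    also have "\<dots> = (\<integral>s. indicator {\<epsilon>..T} s * (w z * heat_lap s (x - z)) / 2 \<partial>lborel)"
      by (rule Bochner_Integration.integral_cong) auto
    finally show "w z * (heat T (x - z) - heat \<epsilon> (x - z)) = (\<integral>s. indicator {\<epsilon>..T} s * (w z * heat_lap s (x - z)) / 2 \<partial>lborel)" .
  qed
  also have "\<dots> = (\<integral>z. \<integral>s. indicator {\<epsilon>..T} s * (w z * heat_lap s (x - z)) \<partial>lborel \<partial>lborel) / 2" by simp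
  also have "(\<integral>z. \<integral>s. indicator {\<epsilon>..T} s * (w z * heat_lap s (x - z)) \<partial>lborel \<partial>lborel)
      = (\<integral>s. \<integral>z. indicator {\<epsilon>..T} s * (w z * heat_lap s (x - z)) \<partial>lborel \<partial>lborel)"
    by (rule lborel_pair.Fubini_integral[OF int2])
  also have "\<dots> = (\<integral>s. \<integral>z. - (1/2) * (weight \<epsilon> T (s, z) * heat_diff s x z) \<partial>lborel \<partial>lborel)"
  proof (rule Bochner_Integration.integral_cong[OF refl])
    fix s :: real
    show "(\<integral>z. indicator {\<epsilon>..T} s * (w z * heat_lap s (x - z)) \<partial>lborel) = (\<integral>z. - (1/2) * (weight \<epsilon> T (s, z) * heat_diff s x z) \<partial>lborel)"
    proof (cases "s \<in> {\<epsilon>..T}")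
      case True
      thus ?thesis using laplacian_of_smoothed_kernel[of s x] \<epsilon> by (simp add: weight_def)
    qed (simp add: weight_def)
  qed
  also have "\<dots> = - (1/2) * (\<integral>s. \<integral>z. weight \<epsilon> T (s, z) * heat_diff s x z \<partial>lborel \<partial>lborel)" by simp
  also have "(\<integral>s. \<integral>z. weight \<epsilon> T (s, z) * heat_diff s x z \<partial>lborel \<partial>lborel) = (\<integral>sz. weight \<epsilon> T sz * heat_diff (fst sz) x (snd sz) \<partial>(lborel \<Otimes>\<^sub>M lborel))"
    using lborel_pair.integral_fst'[OF int1] by simp
  finally show "smoothed \<epsilon> x - smoothed T x = (1/4) * (\<integral>sz. weight \<epsilon> T sz * heat_diff (fst sz) x (snd sz) \<partial>(lborel \<Otimes>\<^sub>M lborel))"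
    by simp
qed

end

section \<open>Positivity of smoothed interactions\<close>

definition gauss :: "real => 'a::euclidean_space => real" where
  "gauss c u = exp (- (c * (norm u)^2))"

lemma gauss_pos: "0 < gauss c u" by (simp add: gauss_def)

lemma gauss_le_1: "0 <= c ==> gauss c u <= 1" by (simp add: gauss_def)

lemma gauss_cont: "continuous_on UNIV (gauss c)"
  unfolding gauss_def[abs_def] by (intro continuous_intros)

lemma gauss_measurable[measurable]: "gauss c \<in> borel_measurable borel"
  by (rule borel_measurable_continuous_onI[OF gauss_cont])

lemma gauss_integrable:
  assumes c: "0 < c"
  shows "integrable lborel (gauss c :: real^'n::finite => real)"
proof (rule Bochner_Integration.integrable_bound)
  \<comment> \<open>The power N exceeds the dimension, so that the N-th inverse power is integrable at infinity.\<close>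
  define N where "N = Suc CARD('n)"
  define K where "K = max 1 ((real N / c) ^ N)"
  have "integrable lborel (two_powers 0 (- real N) :: real^'n => real)"
    by (rule integrable_two_powers) (simp_all add: N_def)
  thus "integrable lborel (%z::real^'n. K * two_powers 0 (- real N) z)" by simp
  show "AE u in lborel. norm (gauss c u :: real) <= norm (K * two_powers 0 (- real N) (u :: real^'n))"
    using AE_lborel_singleton[of "0::real^'n"]
  proof eventually_elim
    case (elim u)
    define r where "r = norm u"
    have r: "0 < r" using elim by (simp add: r_def)
    have "gauss c u <= K * two_powers 0 (- real N) u"
    proof (cases "r < 1")
      case True
      thus ?thesis using elim gauss_le_1[of c u] c by (simp add: two_powers_def r_def K_def)
    next
      case False
      define a where "a = c * r^2"
      have a: "0 < a" using c r by (simp add: a_def)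
      have N0: "0 < real N" by (simp add: N_def)
      have "(a / real N)^N <= (1 + a / real N)^N" using a by (intro power_mono) auto
      also have "\<dots> <= exp a" using exp_ge_one_plus_x_over_n_power_n[of N a] a N0 by simp
      finally have e: "(a / real N)^N <= exp a" .
      have one: "(real N / a)^N * (a / real N)^N = 1"
        unfolding power_mult_distrib[symmetric] using a N0 by simp
      have "exp (- a) = exp (- a) * ((real N / a)^N * (a / real N)^N)" unfolding one by simp
      also have "\<dots> <= exp (- a) * ((real N / a)^N * exp a)"
        using e a N0 by (intro mult_left_mono) auto
      also have "\<dots> = (exp (- a) * exp a) * (real N / a)^N" by (simp only: mult_ac)
      also have "\<dots> = (real N / a)^N" by (simp flip: exp_add)
      also have "\<dots> = (real N / c * (1 / r^2))^N" by (simp add: a_def)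
      also have "\<dots> = (real N / c)^N * (1 / r^2)^N" by (rule power_mult_distrib)
      also have "\<dots> <= K * r powr (- real N)"
      proof (rule mult_mono)
        have "1 / r^2 <= 1 / r" using False r by (intro divide_left_mono) (auto simp: power2_eq_square)
        hence "(1 / r^2)^N <= (1 / r)^N" using r by (intro power_mono) auto
        also have "\<dots> = r powr (- real N)" using r by (simp add: powr_minus powr_realpow power_one_over inverse_eq_divide)
        finally show "(1 / r^2)^N <= r powr (- real N)" .
      qed (auto simp: K_def)
      also have "exp (- a) = gauss c u" by (simp add: gauss_def a_def r_def)
      finally show ?thesis using False elim by (simp add: two_powers_def r_def)
    qed
    thus ?case using gauss_pos[of c u] by simp
  qed
qed simp

lemma not_AE_False_lborel: "\<not> (AE x::'a::euclidean_space in lborel. False)"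
  by (simp add: eventually_False ae_filter_eq_bot_iff)

lemma AE_witness: "\<not> (AE x in M. \<not> Q x) ==> AE x in M. R x ==> \<exists>x. Q x & R x"
  by (erule contrapos_np, erule eventually_mono) blast

lemma gauss_integral_pos:
  assumes c: "0 < c"
  shows "0 < (\<integral>u. gauss c (u :: real^'n::finite) \<partial>lborel)"
proof -
  have "0 <= (\<integral>u. gauss c (u :: real^'n) \<partial>lborel)" using gauss_pos by (intro Bochner_Integration.integral_nonneg less_imp_le)
  moreover have "(\<integral>u. gauss c (u :: real^'n) \<partial>lborel) ~= 0"
  proof
    assume "(\<integral>u. gauss c (u :: real^'n) \<partial>lborel) = 0"
    hence "AE u in lborel. gauss c (u :: real^'n) = 0"
      using integral_nonneg_eq_0_iff_AE[OF gauss_integrable[OF c]] gauss_pos by (metis (mono_tags, lifting) AE_I2 less_imp_le)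
    hence "AE u::real^'n in lborel. False"
    proof eventually_elim
      case (elim u) thus ?case using gauss_pos[of c u] by simp
    qed
    thus False using not_AE_False_lborel by blast
  qed
  ultimately show ?thesis by linarith
qed

lemma gauss_shift_product:
  fixes a b :: "real^'n::finite"
  assumes s: "0 < s"
  shows "integrable lborel (%u. gauss (1/s) (u - a) * gauss (1/s) (u - b))"
    and "(\<integral>u. gauss (1/s) (u - a) * gauss (1/s) (u - b) \<partial>lborel) = gauss (1 / (2 * s)) (a - b) * (\<integral>u. gauss (2/s) (u::real^'n) \<partial>lborel)"
proof -
  define m where "m = (1/2) *\<^sub>R (a + b)"
  have eq: "gauss (1/s) (u - a) * gauss (1/s) (u - b) = gauss (1 / (2 * s)) (a - b) * gauss (2/s) (u + (- m))" for u
  proof -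
    have "(norm (u - a))^2 + (norm (u - b))^2 = 2 * (norm (u + (- m)))^2 + (norm (a - b))^2 / 2"
      unfolding power2_norm_eq_inner m_def by (simp add: inner_simps inner_commute field_simps)
    hence "1/s * (norm (u - a))^2 + 1/s * (norm (u - b))^2 = 1 / (2 * s) * (norm (a - b))^2 + 2/s * (norm (u + (- m)))^2"
      using s by (simp add: field_simps)
    thus ?thesis unfolding gauss_def by (simp flip: exp_add)
  qed
  have i: "integrable lborel (gauss (2/s) :: real^'n => real)" using s by (intro gauss_integrable) simp
  show "integrable lborel (%u. gauss (1/s) (u - a) * gauss (1/s) (u - b))"
    unfolding eq using lborel_integral_translate(2)[OF i, of "- m"] by simp
  show "(\<integral>u. gauss (1/s) (u - a) * gauss (1/s) (u - b) \<partial>lborel) = gauss (1 / (2 * s)) (a - b) * (\<integral>u. gauss (2/s) (u::real^'n) \<partial>lborel)"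
    unfolding eq using lborel_integral_translate(1)[of "gauss (2/s)" "- m"] by simp
qed

text \<open>
The normalization in the identity that writes the heat kernel as the convolution square of a Gaussian.
\<close>

definition heat_norm :: "'n::finite itself => real => real" where
  "heat_norm _ s = s powr (- real CARD('n) / 2) / (\<integral>u. gauss (2/s) (u::real^'n) \<partial>lborel)"

lemma heat_norm_pos: "0 < s ==> 0 < heat_norm TYPE('n::finite) s"
  unfolding heat_norm_def using gauss_integral_pos[of "2/s", where 'n='n] by simp

lemma heat_eq_gauss: "heat s y = s powr (- real CARD('n) / 2) * gauss (1 / (2 * s)) (y :: real^'n::finite)"
  by (simp add: heat_def gauss_def)

text \<open>
This is the reason why the heat kernel is of positive type, without any Fourier analysis.
\<close>

lemma heat_as_convolution_square:
  fixes a b :: "real^'n::finite"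
  assumes s: "0 < s"
  shows "heat s (a - b) = heat_norm TYPE('n) s * (\<integral>u. gauss (1/s) (u - a) * gauss (1/s) (u - b) \<partial>lborel)"
  using gauss_shift_product(2)[OF s, of a b] gauss_integral_pos[of "2/s", where 'n='n] s
  by (simp add: heat_eq_gauss heat_norm_def)

lemma nn_integral_substitution:
  fixes f :: "'a::euclidean_space => ennreal"
  assumes c: "0 < c" and [measurable]: "f \<in> borel_measurable borel"
  shows "(\<integral>\<^sup>+z. f z \<partial>lborel) = ennreal (c ^ DIM('a)) * (\<integral>\<^sup>+u. f (x - c *\<^sub>R u) \<partial>lborel)"
proof -
  have "(\<integral>\<^sup>+z. f z \<partial>lborel) = (\<integral>\<^sup>+z. f z \<partial>density (distr lborel borel (%u. x + (- c) *\<^sub>R u)) (%_. ennreal (\<bar>- c\<bar>^DIM('a))))"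
    using c by (subst lborel_affine[of "- c" x]) auto
  also have "\<dots> = ennreal (c ^ DIM('a)) * (\<integral>\<^sup>+u. f (x - c *\<^sub>R u) \<partial>lborel)"
    using c by (simp add: nn_integral_density nn_integral_distr nn_integral_cmult)
  finally show ?thesis .
qed

text \<open>
Rescaling by the square root of the time turns the smoothing into an average against a fixed Gaussian.
\<close>

lemma heat_substitution:
  fixes f :: "real^'n::finite => ennreal"
  assumes s: "0 < s" and [measurable]: "f \<in> borel_measurable borel"
  shows "(\<integral>\<^sup>+z. f z * ennreal (heat s (x - z)) \<partial>lborel) = (\<integral>\<^sup>+u. f (x - sqrt s *\<^sub>R u) * ennreal (gauss (1/2) u) \<partial>lborel)"
proof -
  have pw: "(sqrt s) ^ CARD('n) * s powr (- real CARD('n) / 2) = 1"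
  proof -
    have "(sqrt s) ^ CARD('n) = s powr (real CARD('n) / 2)"
      using s by (simp add: powr_half_sqrt[symmetric] powr_realpow[symmetric] powr_powr)
    thus ?thesis using s by (simp flip: powr_add)
  qed
  have h: "heat s (sqrt s *\<^sub>R u) = s powr (- real CARD('n) / 2) * gauss (1/2) u" for u :: "real^'n"
    using s by (simp add: heat_def gauss_def power_mult_distrib)
  have "(\<integral>\<^sup>+z. f z * ennreal (heat s (x - z)) \<partial>lborel)
      = ennreal ((sqrt s) ^ CARD('n)) * (\<integral>\<^sup>+u. f (x - sqrt s *\<^sub>R u) * ennreal (heat s (x - (x - sqrt s *\<^sub>R u))) \<partial>lborel)"
    using s by (subst nn_integral_substitution[of "sqrt s" _ x]) auto
  also have "\<dots> = (\<integral>\<^sup>+u. ennreal ((sqrt s) ^ CARD('n)) * (f (x - sqrt s *\<^sub>R u) * ennreal (heat s (sqrt s *\<^sub>R u))) \<partial>lborel)"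
    by (subst nn_integral_cmult) auto
  also have "\<dots> = (\<integral>\<^sup>+u. f (x - sqrt s *\<^sub>R u) * ennreal (gauss (1/2) u) \<partial>lborel)"
  proof (rule nn_integral_cong)
    fix u :: "real^'n"
    have "ennreal ((sqrt s) ^ CARD('n)) * ennreal (heat s (sqrt s *\<^sub>R u)) = ennreal (gauss (1/2) u)"
      unfolding h using s pw by (simp flip: ennreal_mult' mult.assoc)
    thus "ennreal ((sqrt s) ^ CARD('n)) * (f (x - sqrt s *\<^sub>R u) * ennreal (heat s (sqrt s *\<^sub>R u))) = f (x - sqrt s *\<^sub>R u) * ennreal (gauss (1/2) u)"
      by (metis mult.left_commute)
  qed
  finally show ?thesis .
qed

text \<open>
For independent copies of the pair (X, Y), the mean of this expression is the energy of the signed measure law X - law Y with respect to f.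
\<close>

definition four_point :: "('b => 'c::ab_group_add) => ('b => 'c) => ('c => real) => 'b \<times> 'b => real" where
  "four_point X Y f = (%(\<omega>, \<omega>'). f (X \<omega> - X \<omega>') - f (X \<omega> - Y \<omega>') - f (Y \<omega> - X \<omega>') + f (Y \<omega> - Y \<omega>'))"

definition interaction_gap :: "'b measure => ('b => 'c::ab_group_add) => ('b => 'c) => ('c => real) => real" where
  "interaction_gap P X Y f = (\<integral>\<omega>\<omega>. four_point X Y f \<omega>\<omega> \<partial>(P \<Otimes>\<^sub>M P))"

definition gauss_dipole :: "('b => 'c::euclidean_space) => ('b => 'c) => real => 'c => 'c => 'b => real" where
  "gauss_dipole X Y s z u \<omega> = (gauss (1/s) (u - X \<omega>) - gauss (1/s) (u - (X \<omega> + z))) - (gauss (1/s) (u - Y \<omega>) - gauss (1/s) (u - (Y \<omega> + z)))"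

context even_singular_kernel
begin

lemma smoothed_measurable[measurable]: "smoothed s \<in> borel_measurable borel"
  unfolding smoothed_def[abs_def] by measurable

lemma smoothed_bound:
  assumes s: "0 < s" and R: "1 <= R"
  shows "\<bar>smoothed s x\<bar> <= s powr (- real CARD('a) / 2) * (\<integral>z. C * R^2 * tp z \<partial>lborel) + C * R powr q * (\<integral>u. gauss (1/2) (u::real^'a) \<partial>lborel)"
proof -
  let ?M = "s powr (- real CARD('a) / 2)"
  have h_int: "integrable lborel (%z. heat s (x - z))" and h_val: "(\<integral>z. heat s (x - z) \<partial>lborel) = (\<integral>u. gauss (1/2) (u::real^'a) \<partial>lborel)"
  proof -
    have "(\<integral>\<^sup>+z. ennreal (heat s (x - z)) \<partial>lborel) = (\<integral>\<^sup>+u. ennreal (gauss (1/2) (u::real^'a)) \<partial>lborel)"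
      using heat_substitution[OF s, of "%_. 1" x] by simp
    also have "\<dots> = ennreal (\<integral>u. gauss (1/2) (u::real^'a) \<partial>lborel)"
      by (rule nn_integral_eq_integral[OF gauss_integrable]) (auto intro: less_imp_le gauss_pos)
    finally have e: "(\<integral>\<^sup>+z. ennreal (heat s (x - z)) \<partial>lborel) = ennreal (\<integral>u. gauss (1/2) (u::real^'a) \<partial>lborel)" .
    show "integrable lborel (%z. heat s (x - z))"
      by (rule integrableI_nonneg) (use e in \<open>auto simp: heat_nonneg\<close>)
    show "(\<integral>z. heat s (x - z) \<partial>lborel) = (\<integral>u. gauss (1/2) (u::real^'a) \<partial>lborel)"
      using gauss_integral_pos[of "1/2", where 'n='a] by (subst integral_eq_nn_integral) (auto simp: heat_nonneg e)
  qed
  have tp0: "0 <= tp z" for z by (simp add: two_powers_def)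
  have ptw: "\<bar>w z * heat s (x - z)\<bar> <= ?M * (C * R^2 * tp z) + C * R powr q * heat s (x - z)" if z: "z ~= 0" for z
  proof (cases "norm z < R")
    case True
    have hM: "heat s (x - z) <= ?M" using s by (simp add: heat_def)
    have "\<bar>w z\<bar> <= C * R^2 * tp z"
    proof (cases "norm z < 1")
      case True
      have "\<bar>w z\<bar> <= C * 1 * tp z" using near(1)[of z] z True by (simp add: two_powers_def)
      also have "\<dots> <= C * R^2 * tp z" using C R tp0 by (intro mult_right_mono mult_left_mono) auto
      finally show ?thesis .
    next
      case False
      hence nz: "1 <= norm z" by simp
      have "\<bar>w z\<bar> <= C * norm z powr q" by (rule far(1)[OF nz])
      also have "norm z powr q = (norm z)^2 * tp z" using nz z by (simp add: two_powers_def powr_diff powr_numeral)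
      also have "C * ((norm z)^2 * tp z) <= C * (R^2 * tp z)"
        using C tp0 \<open>norm z < R\<close> by (intro mult_left_mono mult_right_mono power_mono) auto
      finally show ?thesis by (simp add: mult.assoc)
    qed
    hence "\<bar>w z\<bar> * heat s (x - z) <= (C * R^2 * tp z) * ?M" using hM heat_nonneg tp0 C by (intro mult_mono) auto
    moreover have "0 <= C * R powr q * heat s (x - z)" by (intro mult_nonneg_nonneg C heat_nonneg) simp
    ultimately show ?thesis by (simp add: abs_mult heat_nonneg mult_ac)
  next
    case False
    hence nz: "1 <= norm z" "R <= norm z" using R by auto
    have "\<bar>w z\<bar> <= C * norm z powr q" by (rule far(1)[OF nz(1)])
    also have "\<dots> <= C * R powr q" using nz R q C by (intro mult_left_mono powr_mono2') auto
    finally have "\<bar>w z\<bar> * heat s (x - z) <= C * R powr q * heat s (x - z)" by (rule mult_right_mono) (rule heat_nonneg)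
    moreover have "0 <= ?M * (C * R^2 * tp z)" by (intro mult_nonneg_nonneg C tp0) simp_all
    ultimately show ?thesis by (simp add: abs_mult heat_nonneg)
  qed
  have i: "integrable lborel (%z. ?M * (C * R^2 * tp z) + C * R powr q * heat s (x - z))"
    using tp_integrable h_int by simp
  have "\<bar>smoothed s x\<bar> <= (\<integral>z. \<bar>w z * heat s (x - z)\<bar> \<partial>lborel)" unfolding smoothed_def by (rule integral_abs_bound)
  also have "\<dots> <= (\<integral>z. ?M * (C * R^2 * tp z) + C * R powr q * heat s (x - z) \<partial>lborel)"
  proof (rule integral_mono_AE)
    show "AE z in lborel. \<bar>w z * heat s (x - z)\<bar> <= ?M * (C * R^2 * tp z) + C * R powr q * heat s (x - z)"
      using off_0 by eventually_elim (rule ptw)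
    show "integrable lborel (%z. \<bar>w z * heat s (x - z)\<bar>)"
      by (rule Bochner_Integration.integrable_bound[OF i]) (measurable, use off_0 in eventually_elim, use ptw in force)
  qed (rule i)
  also have "\<dots> = ?M * (\<integral>z. C * R^2 * tp z \<partial>lborel) + C * R powr q * (\<integral>u. gauss (1/2) (u::real^'a) \<partial>lborel)"
    using tp_integrable h_int h_val by simp
  finally show ?thesis .
qed

text \<open>
Large times smooth the kernel away uniformly: the part near the origin is damped by the maximum of the heat kernel, the far part by the decay of w.
\<close>

lemma smoothed_vanishes:
  assumes \<delta>: "0 < \<delta>"
  shows "\<exists>T\<ge>T0. 0 < T & (\<forall>x. \<bar>smoothed T x\<bar> <= \<delta>)"
proof -
  define c where "c = (\<integral>u. gauss (1/2) (u::real^'a) \<partial>lborel)"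
  have c: "0 < c" unfolding c_def by (rule gauss_integral_pos) simp
  have "((%R. C * R powr q * c) \<longlongrightarrow> C * 0 * c) at_top"
    by (intro tendsto_intros tendsto_neg_powr filterlim_ident q)
  hence "eventually (%R. C * R powr q * c < \<delta>/2) at_top" using \<delta> by (intro order_tendstoD(2)) auto
  then obtain R where R: "1 <= R" "C * R powr q * c < \<delta>/2"
    using eventually_conj[OF eventually_ge_at_top[of "1::real"]] by (metis (mono_tags, lifting) eventually_at_top_linorder order_refl)
  define J where "J = (\<integral>z. C * R^2 * tp z \<partial>lborel)"
  have "((%T. T powr (- real CARD('a) / 2) * J) \<longlongrightarrow> 0 * J) at_top"
    by (intro tendsto_intros tendsto_neg_powr filterlim_ident) simp
  hence "eventually (%T. T powr (- real CARD('a) / 2) * J < \<delta>/2) at_top" using \<delta> by (intro order_tendstoD(2)) auto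
  then obtain T where T: "max T0 1 <= T" "T powr (- real CARD('a) / 2) * J < \<delta>/2"
    using eventually_conj[OF eventually_ge_at_top[of "max T0 1"]] by (metis (mono_tags, lifting) eventually_at_top_linorder order_refl)
  have "\<bar>smoothed T x\<bar> <= \<delta>" for x
    using smoothed_bound[of T R x] T R unfolding c_def[symmetric] J_def[symmetric] by simp
  thus ?thesis using T by (intro exI[of _ T]) auto
qed

context
  fixes P :: "'b measure" and X Y :: "'b => real^'a"
  assumes P: "prob_space P" and X[measurable]: "X \<in> borel_measurable P" and Y[measurable]: "Y \<in> borel_measurable P"
begin

abbreviation D :: "(real^'a => real) => real" where
  "D \<equiv> interaction_gap P X Y"

interpretation P: prob_space P by (rule P)
interpretation PP: pair_prob_space P P ..

lemma four_point_measurable[measurable]: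
  assumes [measurable]: "f \<in> borel_measurable borel"
  shows "four_point X Y f \<in> borel_measurable (P \<Otimes>\<^sub>M P)"
  unfolding four_point_def by measurable

lemma four_point_bound: "(!!x. \<bar>f x\<bar> <= M) ==> \<bar>four_point X Y f \<omega>\<omega>\<bar> <= 4 * M"
proof -
  assume b: "!!x. \<bar>f x\<bar> <= M"
  show ?thesis
  proof (cases \<omega>\<omega>)
    case (Pair \<omega> \<omega>')
    show ?thesis unfolding Pair four_point_def
      using b[of "X \<omega> - X \<omega>'"] b[of "X \<omega> - Y \<omega>'"] b[of "Y \<omega> - X \<omega>'"] b[of "Y \<omega> - Y \<omega>'"] by simp
  qed
qed

lemma four_point_integrable:
  assumes "f \<in> borel_measurable borel" "!!x. \<bar>f x\<bar> <= M"
  shows "integrable (P \<Otimes>\<^sub>M P) (four_point X Y f)"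
  by (rule PP.integrable_const_bound[of _ "4 * M"]) (use assms four_point_bound[of f M] in auto)

lemma D_bound:
  assumes "f \<in> borel_measurable borel" "!!x. \<bar>f x\<bar> <= M"
  shows "\<bar>D f\<bar> <= 4 * M"
proof -
  have "\<bar>D f\<bar> <= (\<integral>\<omega>\<omega>. \<bar>four_point X Y f \<omega>\<omega>\<bar> \<partial>(P \<Otimes>\<^sub>M P))" unfolding interaction_gap_def by (rule integral_abs_bound)
  also have "\<dots> <= (\<integral>\<omega>\<omega>. 4 * M \<partial>(P \<Otimes>\<^sub>M P))"
    using four_point_integrable[OF assms] four_point_bound[of f M] assms(2) by (intro integral_mono) auto
  finally show ?thesis by (simp add: PP.prob_space)
qed

abbreviation dipole :: "real => real^'a => real^'a => 'b => real" where
  "dipole \<equiv> gauss_dipole X Y"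

lemma dipole_measurable[measurable]: "(%p. dipole s z (f p) (g p)) \<in> borel_measurable M"
  if [measurable]: "f \<in> borel_measurable M" "g \<in> measurable M P"
  unfolding gauss_dipole_def by measurable

text \<open>
Since heat kernels are convolution squares, the four-point mean of a second difference is an integral of squares.
\<close>

lemma D_heat_diff:
  assumes s: "0 < s"
  shows "D (%x. heat_diff s x z) = heat_norm TYPE('a) s * (\<integral>u. (\<integral>\<omega>. dipole s z u \<omega> \<partial>P)^2 \<partial>lborel)"
    and "integrable lborel (%u. (\<integral>\<omega>. dipole s z u \<omega> \<partial>P)^2)"
proof -
  interpret Q: pair_sigma_finite "P \<Otimes>\<^sub>M P" "lborel :: (real^'a) measure"
    by (simp add: pair_sigma_finite_def lborel.sigma_finite_measure_axioms PP.sigma_finite_measure_axioms)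
  let ?g = "%u a. gauss (1/s) (u - a) :: real"
  define \<beta> where "\<beta> = heat_norm TYPE('a) s"
  have g01: "0 <= ?g u a" "?g u a <= 1" for u a :: "real^'a" using gauss_pos[of "1/s" "u - a"] gauss_le_1[of "1/s" "u - a"] s by auto
  have gi: "integrable lborel (%u. ?g u a * ?g u b)" for a b :: "real^'a" by (rule gauss_shift_product(1)[OF s])
  have gi1: "integrable lborel (%u. ?g u a)" "(\<integral>u. ?g u a \<partial>lborel) = (\<integral>u. gauss (1/s) (u::real^'a) \<partial>lborel)" for a :: "real^'a"
    using lborel_integral_translate(2)[OF gauss_integrable[of "1/s", where 'n='a], of "- a"]
      lborel_integral_translate(1)[of "gauss (1/s)" "- a"] s by auto
  define \<Gamma> where "\<Gamma> = (\<integral>u. gauss (1/s) (u::real^'a) \<partial>lborel)"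
  have hg: "heat s (a - b) = \<beta> * (\<integral>u. ?g u a * ?g u b \<partial>lborel)" for a b :: "real^'a"
    unfolding \<beta>_def by (rule heat_as_convolution_square[OF s])
  let ?p = "%u a. ?g u a - ?g u (a + z)"
  have pp: "integrable lborel (%u. ?p u a * ?p u b)" "heat_diff s (a - b) z = \<beta> * (\<integral>u. ?p u a * ?p u b \<partial>lborel)" for a b :: "real^'a"
  proof -
    have e: "(%u. ?p u a * ?p u b) = (%u. ?g u a * ?g u b - ?g u a * ?g u (b + z) - ?g u (a + z) * ?g u b + ?g u (a + z) * ?g u (b + z))"
      by (simp add: algebra_simps)
    show "integrable lborel (%u. ?p u a * ?p u b)" unfolding e using gi by simp
    have "\<beta> * (\<integral>u. ?p u a * ?p u b \<partial>lborel) = heat s (a - b) - heat s (a - (b + z)) - heat s ((a + z) - b) + heat s ((a + z) - (b + z))"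
      unfolding e hg using gi by (simp add: algebra_simps)
    also have "\<dots> = heat_diff s (a - b) z" by (simp add: heat_diff_def algebra_simps)
    finally show "heat_diff s (a - b) z = \<beta> * (\<integral>u. ?p u a * ?p u b \<partial>lborel)" ..
  qed
  let ?V = "dipole s z"
  have VV: "integrable lborel (%u. ?V u \<omega> * ?V u \<omega>')" "four_point X Y (%x. heat_diff s x z) (\<omega>, \<omega>') = \<beta> * (\<integral>u. ?V u \<omega> * ?V u \<omega>' \<partial>lborel)" for \<omega> \<omega>'
  proof -
    have e: "(%u. ?V u \<omega> * ?V u \<omega>') = (%u. ?p u (X \<omega>) * ?p u (X \<omega>') - ?p u (X \<omega>) * ?p u (Y \<omega>') - ?p u (Y \<omega>) * ?p u (X \<omega>') + ?p u (Y \<omega>) * ?p u (Y \<omega>'))"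
      by (simp add: gauss_dipole_def algebra_simps)
    show "integrable lborel (%u. ?V u \<omega> * ?V u \<omega>')" unfolding e using pp(1) by (intro Bochner_Integration.integrable_add Bochner_Integration.integrable_diff)
    show "four_point X Y (%x. heat_diff s x z) (\<omega>, \<omega>') = \<beta> * (\<integral>u. ?V u \<omega> * ?V u \<omega>' \<partial>lborel)"
      unfolding e four_point_def using pp by (simp add: distrib_left right_diff_distrib)
  qed
  have V4: "\<bar>?V u \<omega>\<bar> <= 4" for u \<omega>
    using g01[of u "X \<omega>"] g01[of u "Y \<omega>"] g01[of u "X \<omega> + z"] g01[of u "Y \<omega> + z"] unfolding gauss_dipole_def by linarith
  have Vg: "\<bar>?V u \<omega>\<bar> <= ?g u (X \<omega>) + ?g u (X \<omega> + z) + ?g u (Y \<omega>) + ?g u (Y \<omega> + z)" for u \<omega>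
    using g01[of u "X \<omega>"] g01[of u "Y \<omega>"] g01[of u "X \<omega> + z"] g01[of u "Y \<omega> + z"] unfolding gauss_dipole_def by linarith
  have Vint: "(\<integral>u. \<bar>?V u \<omega> * ?V u \<omega>'\<bar> \<partial>lborel) <= 16 * \<Gamma>" for \<omega> \<omega>'
  proof -
    have "(\<integral>u. \<bar>?V u \<omega> * ?V u \<omega>'\<bar> \<partial>lborel) <= (\<integral>u. (?g u (X \<omega>) + ?g u (X \<omega> + z) + ?g u (Y \<omega>) + ?g u (Y \<omega> + z)) * 4 \<partial>lborel)"
      unfolding abs_mult using VV(1)[of \<omega> \<omega>'] gi1(1) g01
      by (intro integral_mono mult_mono Vg V4) (auto simp flip: abs_mult intro!: add_nonneg_nonneg)
    also have "\<dots> = 16 * \<Gamma>" using gi1 by (simp add: \<Gamma>_def)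
    finally show ?thesis .
  qed
  have int: "integrable ((P \<Otimes>\<^sub>M P) \<Otimes>\<^sub>M lborel) (%(\<omega>\<omega>, u). ?V u (fst \<omega>\<omega>) * ?V u (snd \<omega>\<omega>))"
  proof (rule Q.Fubini_integrable)
    show "(%(\<omega>\<omega>, u). ?V u (fst \<omega>\<omega>) * ?V u (snd \<omega>\<omega>)) \<in> borel_measurable ((P \<Otimes>\<^sub>M P) \<Otimes>\<^sub>M lborel)" by measurable
    show "integrable (P \<Otimes>\<^sub>M P) (%\<omega>\<omega>. \<integral>u. norm (case (\<omega>\<omega>, u) of (\<omega>\<omega>, u) => ?V u (fst \<omega>\<omega>) * ?V u (snd \<omega>\<omega>)) \<partial>lborel)"
      by (rule PP.integrable_const_bound[of _ "16 * \<Gamma>"]) (use Vint in \<open>auto\<close>)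
    show "AE \<omega>\<omega> in P \<Otimes>\<^sub>M P. integrable lborel (%u. case (\<omega>\<omega>, u) of (\<omega>\<omega>, u) => ?V u (fst \<omega>\<omega>) * ?V u (snd \<omega>\<omega>))"
      using VV(1) by simp
  qed
  have sq: "(\<integral>\<omega>\<omega>. ?V u (fst \<omega>\<omega>) * ?V u (snd \<omega>\<omega>) \<partial>(P \<Otimes>\<^sub>M P)) = (\<integral>\<omega>. ?V u \<omega> \<partial>P)^2" for u
  proof -
    have "integrable (P \<Otimes>\<^sub>M P) (%\<omega>\<omega>. ?V u (fst \<omega>\<omega>) * ?V u (snd \<omega>\<omega>))"
    proof (rule PP.integrable_const_bound[of _ "4 * 4"])
      have "\<bar>?V u \<omega> * ?V u \<omega>'\<bar> <= 4 * 4" for \<omega> \<omega>' unfolding abs_mult by (intro mult_mono V4) auto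
      thus "AE \<omega>\<omega> in P \<Otimes>\<^sub>M P. norm (?V u (fst \<omega>\<omega>) * ?V u (snd \<omega>\<omega>)) <= 4 * 4" by simp
    qed measurable
    from PP.integral_fst'[OF this] show ?thesis by (simp add: power2_eq_square)
  qed
  have "D (%x. heat_diff s x z) = (\<integral>\<omega>\<omega>. \<beta> * (\<integral>u. ?V u (fst \<omega>\<omega>) * ?V u (snd \<omega>\<omega>) \<partial>lborel) \<partial>(P \<Otimes>\<^sub>M P))"
    unfolding interaction_gap_def using VV(2) by (intro Bochner_Integration.integral_cong) auto
  also have "\<dots> = \<beta> * (\<integral>\<omega>\<omega>. \<integral>u. ?V u (fst \<omega>\<omega>) * ?V u (snd \<omega>\<omega>) \<partial>lborel \<partial>(P \<Otimes>\<^sub>M P))" by simp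
  also have "(\<integral>\<omega>\<omega>. \<integral>u. ?V u (fst \<omega>\<omega>) * ?V u (snd \<omega>\<omega>) \<partial>lborel \<partial>(P \<Otimes>\<^sub>M P)) = (\<integral>u. \<integral>\<omega>\<omega>. ?V u (fst \<omega>\<omega>) * ?V u (snd \<omega>\<omega>) \<partial>(P \<Otimes>\<^sub>M P) \<partial>lborel)"
    by (rule Q.Fubini_integral[symmetric, OF int])
  also have "\<dots> = (\<integral>u. (\<integral>\<omega>. ?V u \<omega> \<partial>P)^2 \<partial>lborel)" unfolding sq ..
  finally show "D (%x. heat_diff s x z) = heat_norm TYPE('a) s * (\<integral>u. (\<integral>\<omega>. dipole s z u \<omega> \<partial>P)^2 \<partial>lborel)" by (simp add: \<beta>_def)
  show "integrable lborel (%u. (\<integral>\<omega>. dipole s z u \<omega> \<partial>P)^2)"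
    using Q.integrable_snd[OF int] unfolding sq .
qed

lemma D_heat_diff_nonneg: "0 < s ==> 0 <= D (%x. heat_diff s x z)"
  unfolding D_heat_diff(1) using heat_norm_pos[of s, where 'n='a] by (intro mult_nonneg_nonneg Bochner_Integration.integral_nonneg) auto

text \<open>
Fubini applied to the representation of the difference of two smoothings.
\<close>

lemma D_smoothed_difference:
  assumes \<epsilon>: "0 < \<epsilon>" "\<epsilon> <= T"
  shows "D (smoothed \<epsilon>) - D (smoothed T) = (1/4) * (\<integral>sz. weight \<epsilon> T sz * D (%x. heat_diff (fst sz) x (snd sz)) \<partial>(lborel \<Otimes>\<^sub>M lborel))"
    and "integrable (lborel \<Otimes>\<^sub>M lborel) (%sz. weight \<epsilon> T sz * D (%x. heat_diff (fst sz) x (snd sz)))"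
proof -
  let ?L = "lborel \<Otimes>\<^sub>M lborel :: (real \<times> (real^'a)) measure"
  have sfL: "sigma_finite_measure ?L"
    by (rule sigma_finite_pair_measure) (simp_all add: lborel.sigma_finite_measure_axioms)
  interpret Q: pair_sigma_finite "P \<Otimes>\<^sub>M P" ?L
    by (simp add: pair_sigma_finite_def PP.sigma_finite_measure_axioms sfL)
  obtain B where B: "0 <= B"
    "!!s x z. \<epsilon> <= s ==> s <= T ==> \<bar>w z * heat s (x - z)\<bar> <= B * (1 + (norm x)^2) * tp z \<or> z = 0"
    "!!s x z. \<epsilon> <= s ==> s <= T ==> \<bar>w z * heat_lap s (x - z)\<bar> <= B * (1 + (norm x)^2) * tp z \<or> z = 0"
    "!!s x z. \<epsilon> <= s ==> s <= T ==> \<bar>laplacian w z * heat_diff s x z\<bar> <= B * tp z \<or> z = 0"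
    by (rule heat_coefficient_bounds[OF \<epsilon>(1), of T]) (rule that)
  have tp0: "0 <= tp z" for z by (simp add: two_powers_def)
  define q' where "q' sz x = weight \<epsilon> T sz * heat_diff (fst sz) x (snd sz)" for sz x
  have q_bd: "\<bar>q' sz x\<bar> <= indicator {\<epsilon>..T} (fst sz) * (B * tp (snd sz))" if "snd sz ~= 0" for sz x
    using B(4)[of "fst sz" "snd sz" x] that B(1) tp0[of "snd sz"]
    by (cases sz) (auto simp: q'_def weight_def indicator_def)
  have fq: "four_point X Y (q' sz) \<omega>\<omega> = weight \<epsilon> T sz * four_point X Y (%x. heat_diff (fst sz) x (snd sz)) \<omega>\<omega>" for sz \<omega>\<omega>
    by (cases \<omega>\<omega>) (simp add: four_point_def q'_def algebra_simps)
  have hdm[measurable]: "(%p. heat_diff (f p) (g p) (h p)) \<in> borel_measurable M"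
    if "f \<in> borel_measurable M" "g \<in> borel_measurable M" "h \<in> borel_measurable M" for f and g h :: "_ => real^'a" and M :: "'z measure"
    using that unfolding heat_diff_def by measurable
  have int: "integrable ((P \<Otimes>\<^sub>M P) \<Otimes>\<^sub>M ?L) (%(\<omega>\<omega>, sz). four_point X Y (q' sz) \<omega>\<omega>)"
  proof (rule Bochner_Integration.integrable_bound)
    have i1: "integrable lborel (%s. indicator {\<epsilon>..T} s :: real)"
      using \<epsilon> by (intro integrable_real_indicator) (auto simp: emeasure_lborel_Icc_eq)
    have i2: "integrable lborel (%z. 4 * (B * tp z))"
      using tp_integrable by (intro integrable_mult_right)
    have i3: "integrable ?L (%(s, z). indicator {\<epsilon>..T} s * (4 * (B * tp z)))"
      by (rule integrable_product[OF lborel.sigma_finite_measure_axioms lborel.sigma_finite_measure_axioms i1 i2])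
    have i4: "integrable (P \<Otimes>\<^sub>M P) (%_. 1 :: real)" by simp
    show "integrable ((P \<Otimes>\<^sub>M P) \<Otimes>\<^sub>M ?L) (%(\<omega>\<omega>, sz). 1 * (case sz of (s, z) => indicator {\<epsilon>..T} s * (4 * (B * tp z))))"
      by (rule integrable_product[OF PP.sigma_finite_measure_axioms sfL i4 i3])
    show "(%(\<omega>\<omega>, sz). four_point X Y (q' sz) \<omega>\<omega>) \<in> borel_measurable ((P \<Otimes>\<^sub>M P) \<Otimes>\<^sub>M ?L)"
    proof -
      have w1: "(%p. weight \<epsilon> T (snd p)) \<in> borel_measurable ((P \<Otimes>\<^sub>M P) \<Otimes>\<^sub>M ?L)"
        by (rule measurable_compose[OF measurable_snd weight_measurable])
      have h1: "(%p. weight \<epsilon> T (snd p) * heat_diff (fst (snd p)) (A (fst p)) (snd (snd p))) \<in> borel_measurable ((P \<Otimes>\<^sub>M P) \<Otimes>\<^sub>M ?L)"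
        if A: "A \<in> borel_measurable (P \<Otimes>\<^sub>M P)" for A
      proof (rule borel_measurable_times[OF w1 hdm])
        show "(%p. A (fst p)) \<in> borel_measurable ((P \<Otimes>\<^sub>M P) \<Otimes>\<^sub>M ?L)" by (rule measurable_compose[OF measurable_fst A])
        show "(%p. fst (snd p)) \<in> borel_measurable ((P \<Otimes>\<^sub>M P) \<Otimes>\<^sub>M ?L)"
          using measurable_compose[OF measurable_snd[of "P \<Otimes>\<^sub>M P" ?L] measurable_fst] by simp
        show "(%p. snd (snd p)) \<in> borel_measurable ((P \<Otimes>\<^sub>M P) \<Otimes>\<^sub>M ?L)"
          using measurable_compose[OF measurable_snd[of "P \<Otimes>\<^sub>M P" ?L] measurable_snd] by simp
      qed
      show ?thesis
        unfolding four_point_def q'_def case_prod_unfold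
        by (intro borel_measurable_add borel_measurable_diff h1) measurable
    qed
    have "AE sz in ?L. snd sz ~= 0" by (rule lborel_pair.AE_pair_measure) (measurable, use off_0 in simp)
    hence "AE \<omega>\<omega> in P \<Otimes>\<^sub>M P. AE sz in ?L. snd (snd (\<omega>\<omega>, sz)) ~= 0" by simp
    hence "AE p in (P \<Otimes>\<^sub>M P) \<Otimes>\<^sub>M ?L. snd (snd p) ~= 0"
    proof (intro Q.AE_pair_measure)
      have m: "(%p. snd (snd p)) \<in> measurable ((P \<Otimes>\<^sub>M P) \<Otimes>\<^sub>M ?L) borel"
        using measurable_compose[OF measurable_snd[of "P \<Otimes>\<^sub>M P" ?L] measurable_snd] by simp
      have "(%p. snd (snd p)) -` (- {0}) \<inter> space ((P \<Otimes>\<^sub>M P) \<Otimes>\<^sub>M ?L) \<in> sets ((P \<Otimes>\<^sub>M P) \<Otimes>\<^sub>M ?L)"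
        by (rule measurable_sets[OF m]) simp
      also have "(%p. snd (snd p)) -` (- {0}) \<inter> space ((P \<Otimes>\<^sub>M P) \<Otimes>\<^sub>M ?L) = {p \<in> space ((P \<Otimes>\<^sub>M P) \<Otimes>\<^sub>M ?L). snd (snd p) ~= 0}" by blast
      finally show "{p \<in> space ((P \<Otimes>\<^sub>M P) \<Otimes>\<^sub>M ?L). snd (snd p) ~= 0} \<in> sets ((P \<Otimes>\<^sub>M P) \<Otimes>\<^sub>M ?L)" .
    qed
    thus "AE p in (P \<Otimes>\<^sub>M P) \<Otimes>\<^sub>M ?L. norm (case p of (\<omega>\<omega>, sz) => four_point X Y (q' sz) \<omega>\<omega>)
        <= norm (case p of (\<omega>\<omega>, sz) => 1 * (case sz of (s, z) => indicator {\<epsilon>..T} s * (4 * (B * tp z))))"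
    proof eventually_elim
      case (elim p)
      obtain \<omega>\<omega> s z where p: "p = (\<omega>\<omega>, s, z)" by (rule prod_cases3)
      have n: "0 <= 1 * (indicator {\<epsilon>..T} s * (4 * (B * tp z)))" using B(1) tp0[of z] by (simp add: indicator_def)
      have e: "1 * (indicator {\<epsilon>..T} s * (4 * (B * tp z))) = 4 * (indicator {\<epsilon>..T} s * (B * tp z))" by simp
      have "\<bar>four_point X Y (q' (s, z)) \<omega>\<omega>\<bar> <= 4 * (indicator {\<epsilon>..T} s * (B * tp z))"
        using four_point_bound[of "q' (s, z)", OF q_bd] elim unfolding p by simp
      hence "norm (four_point X Y (q' (s, z)) \<omega>\<omega>) <= norm (1 * (indicator {\<epsilon>..T} s * (4 * (B * tp z))))"
        unfolding real_norm_def abs_of_nonneg[OF n] unfolding e .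
      thus ?case unfolding p prod.case .
    qed
  qed
  obtain M1 where M1: "!!x. \<bar>smoothed \<epsilon> x\<bar> <= M1" by (rule that[OF smoothed_bound[OF \<epsilon>(1) order_refl]])
  have T0: "0 < T" using \<epsilon> by simp
  obtain M2 where M2: "!!x. \<bar>smoothed T x\<bar> <= M2" by (rule that[OF smoothed_bound[OF T0 order_refl]])
  have "D (smoothed \<epsilon>) - D (smoothed T) = (\<integral>\<omega>\<omega>. four_point X Y (smoothed \<epsilon>) \<omega>\<omega> - four_point X Y (smoothed T) \<omega>\<omega> \<partial>(P \<Otimes>\<^sub>M P))"
    unfolding interaction_gap_def by (rule Bochner_Integration.integral_diff[OF four_point_integrable[OF smoothed_measurable M1] four_point_integrable[OF smoothed_measurable M2], symmetric])
  also have "\<dots> = (\<integral>\<omega>\<omega>. (1/4) * (\<integral>sz. four_point X Y (q' sz) \<omega>\<omega> \<partial>?L) \<partial>(P \<Otimes>\<^sub>M P))"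
  proof (rule Bochner_Integration.integral_cong[OF refl])
    fix \<omega>\<omega> :: "'b \<times> 'b"
    have d: "integrable ?L (%sz. q' sz x)" "smoothed \<epsilon> x - smoothed T x = (1/4) * (\<integral>sz. q' sz x \<partial>?L)" for x
      unfolding q'_def by (rule smoothed_difference[OF \<epsilon>])+
    obtain \<omega> \<omega>' where \<omega>: "\<omega>\<omega> = (\<omega>, \<omega>')" by (cases \<omega>\<omega>)
    have "(1/4) * (\<integral>sz. four_point X Y (q' sz) \<omega>\<omega> \<partial>?L) = (1/4) * (\<integral>sz. q' sz (X \<omega> - X \<omega>') \<partial>?L) - (1/4) * (\<integral>sz. q' sz (X \<omega> - Y \<omega>') \<partial>?L)
        - (1/4) * (\<integral>sz. q' sz (Y \<omega> - X \<omega>') \<partial>?L) + (1/4) * (\<integral>sz. q' sz (Y \<omega> - Y \<omega>') \<partial>?L)"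
      unfolding \<omega> four_point_def using d(1) by simp
    also have "\<dots> = four_point X Y (smoothed \<epsilon>) \<omega>\<omega> - four_point X Y (smoothed T) \<omega>\<omega>"
      unfolding d(2)[symmetric] by (simp add: \<omega> four_point_def)
    finally show "four_point X Y (smoothed \<epsilon>) \<omega>\<omega> - four_point X Y (smoothed T) \<omega>\<omega> = (1/4) * (\<integral>sz. four_point X Y (q' sz) \<omega>\<omega> \<partial>?L)" ..
  qed
  also have "\<dots> = (1/4) * (\<integral>\<omega>\<omega>. \<integral>sz. four_point X Y (q' sz) \<omega>\<omega> \<partial>?L \<partial>(P \<Otimes>\<^sub>M P))"
    by (rule integral_mult_right_zero)
  also have "(\<integral>\<omega>\<omega>. \<integral>sz. four_point X Y (q' sz) \<omega>\<omega> \<partial>?L \<partial>(P \<Otimes>\<^sub>M P)) = (\<integral>sz. \<integral>\<omega>\<omega>. four_point X Y (q' sz) \<omega>\<omega> \<partial>(P \<Otimes>\<^sub>M P) \<partial>?L)"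
    by (rule Q.Fubini_integral[symmetric, OF int])
  also have "\<dots> = (\<integral>sz. weight \<epsilon> T sz * D (%x. heat_diff (fst sz) x (snd sz)) \<partial>?L)" unfolding fq interaction_gap_def by simp
  finally show "D (smoothed \<epsilon>) - D (smoothed T) = (1/4) * (\<integral>sz. weight \<epsilon> T sz * D (%x. heat_diff (fst sz) x (snd sz)) \<partial>?L)" .
  show "integrable ?L (%sz. weight \<epsilon> T sz * D (%x. heat_diff (fst sz) x (snd sz)))"
    using Q.integrable_snd[OF int] unfolding fq interaction_gap_def by simp
qed

lemma weight_D_nonneg:
  assumes "0 < \<epsilon>"
  shows "AE sz in (lborel \<Otimes>\<^sub>M lborel). 0 <= weight \<epsilon> T sz * D (%x. heat_diff (fst sz) x (snd sz))"
proof -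
  have "AE sz in (lborel \<Otimes>\<^sub>M lborel). snd sz ~= (0::real^'a)" by (rule lborel_pair.AE_pair_measure) (measurable, use off_0 in simp)
  thus ?thesis
  proof eventually_elim
    case (elim sz)
    thus ?case using lap_pos[OF elim] D_heat_diff_nonneg[of "fst sz" "snd sz"] assms
      by (cases sz) (auto simp: weight_def indicator_def intro!: mult_nonneg_nonneg)
  qed
qed

lemma D_smoothed_antimono:
  assumes "0 < \<epsilon>" "\<epsilon> <= T"
  shows "D (smoothed T) <= D (smoothed \<epsilon>)"
proof -
  have "0 <= (\<integral>sz. weight \<epsilon> T sz * D (%x. heat_diff (fst sz) x (snd sz)) \<partial>(lborel \<Otimes>\<^sub>M lborel))"
    by (rule integral_nonneg_AE[OF weight_D_nonneg[OF assms(1)]])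
  thus ?thesis using D_smoothed_difference(1)[OF assms] by linarith
qed

text \<open>
The gap decreases in T and tends to 0 as T tends to infinity.
\<close>

lemma D_smoothed_nonneg:
  assumes T: "0 < T"
  shows "0 <= D (smoothed T)"
proof (rule field_le_epsilon)
  fix e :: real assume e: "0 < e"
  obtain T' where T': "T <= T'" "!!x. \<bar>smoothed T' x\<bar> <= e / 4" using smoothed_vanishes[of "e/4" T] e by auto
  have "\<bar>D (smoothed T')\<bar> <= e" using D_bound[OF smoothed_measurable T'(2)] by simp
  thus "0 <= D (smoothed T) + e" using D_smoothed_antimono[OF T T'(1)] by linarith
qed

text \<open>
If the gap is constant in T, the integral of nonnegative terms over the times in [T/2, T] is zero, so that for some time and some shift all squares vanish. The time can be taken arbitrarily small.
\<close>

lemma D_smoothed_zero_imp_dipole_zero: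
  assumes T: "0 < T" and zero: "!!T. 0 < T ==> D (smoothed T) = 0"
  obtains s z where "0 < s" "s <= T" "z ~= 0" "AE u in lborel. (\<integral>\<omega>. dipole s z u \<omega> \<partial>P) = 0"
proof -
  let ?f = "%sz. weight (T/2) T sz * D (%x. heat_diff (fst sz) x (snd sz))"
  have T2: "0 < T/2" "T/2 <= T" using T by auto
  have "(\<integral>sz. ?f sz \<partial>(lborel \<Otimes>\<^sub>M lborel)) = 0" using D_smoothed_difference(1)[OF T2] zero[of T] zero[of "T/2"] T by simp
  hence "AE sz in (lborel \<Otimes>\<^sub>M lborel). ?f sz = 0"
    using integral_nonneg_eq_0_iff_AE[OF D_smoothed_difference(2)[OF T2] weight_D_nonneg[OF T2(1)]] by simp
  hence "AE s in lborel. AE z in lborel. ?f (s, z) = 0" by (rule lborel_pair.AE_pair)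
  moreover have "\<not> (AE s in lborel. s \<notin> {T/2..T})"
  proof
    assume "AE s in lborel. s \<notin> {T/2..T}"
    hence "emeasure lborel {T/2..T} = 0" by (subst (asm) AE_iff_measurable[of "{T/2..T}"]) auto
    thus False using T by simp
  qed
  ultimately obtain s where s: "s \<in> {T/2..T}" "AE z in lborel. ?f (s, z) = 0"
    using AE_witness[where M=lborel and Q="%s. s \<in> {T/2..T}" and R="%s. AE z in lborel. ?f (s, z) = 0"] by blast
  have "AE z in lborel. z ~= 0 & ?f (s, z) = 0" using off_0 s(2) by eventually_elim simp
  moreover note not_AE_False_lborel[where 'a="real^'a"]
  ultimately obtain z where z: "z ~= 0" "?f (s, z) = 0"
    using AE_witness[where M=lborel and Q="%_. True" and R="%z. z ~= 0 & ?f (s, z) = 0"] by auto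
  have s0: "0 < s" using s(1) T by auto
  have "D (%x. heat_diff s x z) = 0" using z lap_pos[OF z(1)] s(1) by (simp add: weight_def)
  hence "(\<integral>u. (\<integral>\<omega>. dipole s z u \<omega> \<partial>P)^2 \<partial>lborel) = 0" using D_heat_diff(1)[OF s0] heat_norm_pos[OF s0, where 'n='a] by simp
  hence "AE u in lborel. (\<integral>\<omega>. dipole s z u \<omega> \<partial>P)^2 = 0"
    using integral_nonneg_eq_0_iff_AE[OF D_heat_diff(2)[OF s0]] by simp
  hence "AE u in lborel. (\<integral>\<omega>. dipole s z u \<omega> \<partial>P) = 0" by eventually_elim simp
  thus thesis using s s0 z(1) by (intro that[of s z]) auto
qed

end

end

section \<open>Measures with equal Gaussian averages\<close>

text \<open>
Gaussian averages along a sequence of widths tending to zero recover the values of a continuous function.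
\<close>

lemma equal_gauss_averages_imp_equal_integrals:
  fixes \<mu> \<nu> :: "(real^'n::finite) measure" and \<phi> :: "real^'n => real"
  assumes m: "borel_prob \<mu>" "borel_prob \<nu>"
    and eq: "!!T. 0 < T ==> \<exists>s. 0 < s & s <= T & (\<forall>u. (\<integral>x. gauss (1/s) (u - x) \<partial>\<mu>) = (\<integral>x. gauss (1/s) (u - x) \<partial>\<nu>))"
    and \<phi>: "continuous_on UNIV \<phi>" "!!x. 0 <= \<phi> x" "!!x. \<phi> x <= 1"
  shows "(\<integral>\<^sup>+x. ennreal (\<phi> x) \<partial>\<mu>) = (\<integral>\<^sup>+x. ennreal (\<phi> x) \<partial>\<nu>)"
proof -
  have "\<forall>j. \<exists>s. 0 < s & s <= inverse (real (Suc j)) & (\<forall>u. (\<integral>x. gauss (1/s) (u - x) \<partial>\<mu>) = (\<integral>x. gauss (1/s) (u - x) \<partial>\<nu>))"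
    using eq by simp
  then obtain s where s: "!!j. 0 < s j" "!!j. s j <= inverse (real (Suc j))"
    and avg: "!!j u. (\<integral>x. gauss (1/s j) (u - x) \<partial>\<mu>) = (\<integral>x. gauss (1/s j) (u - x) \<partial>\<nu>)"
    by (subst (asm) choice_iff) blast
  have "s \<longlonglongrightarrow> 0"
    by (rule tendsto_sandwich[OF _ _ tendsto_const LIMSEQ_inverse_real_of_nat]) (use s in \<open>auto intro!: always_eventually less_imp_le\<close>)
  hence sq: "(%j. sqrt (s j)) \<longlonglongrightarrow> 0" using tendsto_real_sqrt by fastforce
  have [measurable]: "\<phi> \<in> borel_measurable borel" using \<phi>(1) by (rule borel_measurable_continuous_onI)
  let ?g = "%v::real^'n. ennreal (gauss 1 v)"
  define c where "c = (\<integral>\<^sup>+v. ?g v \<partial>lborel)"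
  have ce: "c = ennreal (\<integral>v. gauss 1 (v::real^'n) \<partial>lborel)" unfolding c_def
    by (rule nn_integral_eq_integral[OF gauss_integrable]) (auto intro: less_imp_le gauss_pos)
  have c: "c ~= 0" "c ~= top" using gauss_integral_pos[of 1, where 'n='n] unfolding ce by auto
  define A where "A j \<alpha> = (\<integral>\<^sup>+x. \<integral>\<^sup>+v. ennreal (\<phi> (x - sqrt (s j) *\<^sub>R v)) * ?g v \<partial>lborel \<partial>\<alpha>)" for j and \<alpha> :: "(real^'n) measure"
  have fub: "ennreal ((sqrt (s j))^CARD('n)) * A j \<alpha> = (\<integral>\<^sup>+u. ennreal (\<phi> u) * ennreal (\<integral>x. gauss (1/s j) (u - x) \<partial>\<alpha>) \<partial>lborel)"
    if a: "borel_prob \<alpha>" for j \<alpha>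
  proof -
    interpret a: prob_space \<alpha> using a by (rule borel_probD)
    interpret pa: pair_sigma_finite \<alpha> "lborel :: (real^'n) measure"
      by (simp add: pair_sigma_finite_def lborel.sigma_finite_measure_axioms a.sigma_finite_measure_axioms)
    note [measurable_cong] = borel_probD(2)[OF a]
    have g: "gauss (1/s j) (- (sqrt (s j) *\<^sub>R v)) = gauss 1 v" for v :: "real^'n"
      using s(1)[of j] by (simp add: gauss_def power_mult_distrib)
    have inner: "(\<integral>\<^sup>+u. ennreal (\<phi> u) * ennreal (gauss (1/s j) (u - x)) \<partial>lborel)
        = ennreal ((sqrt (s j))^CARD('n)) * (\<integral>\<^sup>+v. ennreal (\<phi> (x - sqrt (s j) *\<^sub>R v)) * ?g v \<partial>lborel)" for x :: "real^'n"
      using nn_integral_substitution[of "sqrt (s j)" "%u. ennreal (\<phi> u) * ennreal (gauss (1/s j) (u - x))" x] s(1)[of j]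
      by (simp add: g)
    have int: "(\<integral>\<^sup>+x. ennreal (gauss (1/s j) (u - x)) \<partial>\<alpha>) = ennreal (\<integral>x. gauss (1/s j) (u - x) \<partial>\<alpha>)" for u
    proof (intro nn_integral_eq_integral a.integrable_const_bound[of _ 1])
      have "\<bar>gauss (1/s j) y\<bar> <= 1" for y :: "real^'n"
        using gauss_pos[of "1/s j" y] gauss_le_1[of "1/s j" y] s(1)[of j] by simp
      thus "AE x in \<alpha>. norm (gauss (1/s j) (u - x)) <= 1" by simp
      show "AE x in \<alpha>. 0 <= gauss (1/s j) (u - x)" by (simp add: less_imp_le gauss_pos)
    qed measurable
    have "ennreal ((sqrt (s j))^CARD('n)) * A j \<alpha> = (\<integral>\<^sup>+x. \<integral>\<^sup>+u. ennreal (\<phi> u) * ennreal (gauss (1/s j) (u - x)) \<partial>lborel \<partial>\<alpha>)"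
      unfolding inner A_def by (rule nn_integral_cmult[symmetric]) measurable
    also have "\<dots> = (\<integral>\<^sup>+u. \<integral>\<^sup>+x. ennreal (\<phi> u) * ennreal (gauss (1/s j) (u - x)) \<partial>\<alpha> \<partial>lborel)"
      by (rule pa.Fubini'[symmetric]) measurable
    also have "\<dots> = (\<integral>\<^sup>+u. ennreal (\<phi> u) * ennreal (\<integral>x. gauss (1/s j) (u - x) \<partial>\<alpha>) \<partial>lborel)"
      by (subst nn_integral_cmult) (auto simp: int)
    finally show ?thesis .
  qed
  have Aeq: "A j \<mu> = A j \<nu>" for j
  proof -
    have "ennreal ((sqrt (s j))^CARD('n)) * A j \<mu> = ennreal ((sqrt (s j))^CARD('n)) * A j \<nu>"
      unfolding fub[OF m(1)] fub[OF m(2)] avg ..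
    thus ?thesis using s(1)[of j] by (auto simp: ennreal_mult_cancel_left)
  qed
  have lim: "(%j. A j \<alpha>) \<longlonglongrightarrow> (\<integral>\<^sup>+x. ennreal (\<phi> x) \<partial>\<alpha>) * c" if a: "borel_prob \<alpha>" for \<alpha>
  proof -
    interpret a: prob_space \<alpha> using a by (rule borel_probD)
    note [measurable_cong] = borel_probD(2)[OF a]
    let ?u = "%j (x, v). ennreal (\<phi> (x - sqrt (s j) *\<^sub>R v)) * ?g v"
    have "(%j. \<integral>\<^sup>+p. ?u j p \<partial>(\<alpha> \<Otimes>\<^sub>M lborel)) \<longlonglongrightarrow> (\<integral>\<^sup>+p. (case p of (x, v) => ennreal (\<phi> x) * ?g v) \<partial>(\<alpha> \<Otimes>\<^sub>M lborel))"
    proof (rule nn_integral_dominated_convergence[where w="%(x, v). ?g v"])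
      have "(\<integral>\<^sup>+p. (case p of (x, v) => ?g v) \<partial>(\<alpha> \<Otimes>\<^sub>M lborel)) = c"
        by (subst lborel.nn_integral_fst[symmetric]) (auto simp: c_def a.emeasure_space_1)
      thus "(\<integral>\<^sup>+p. (case p of (x, v) => ?g v) \<partial>(\<alpha> \<Otimes>\<^sub>M lborel)) < \<infinity>" using c by (simp add: less_top)
      show "AE p in \<alpha> \<Otimes>\<^sub>M lborel. ?u j p <= (case p of (x, v) => ?g v)" for j
      proof (rule AE_I2)
        fix p :: "(real^'n) \<times> (real^'n)"
        have "ennreal (\<phi> x) * ?g v <= 1 * ?g v" for x v using \<phi>(3) by (intro mult_right_mono) (auto simp: ennreal_le_1)
        thus "?u j p <= (case p of (x, v) => ?g v)" by (cases p) simp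
      qed
      show "AE p in \<alpha> \<Otimes>\<^sub>M lborel. (%j. ?u j p) \<longlonglongrightarrow> (case p of (x, v) => ennreal (\<phi> x) * ?g v)"
      proof (rule AE_I2)
        fix p :: "(real^'n) \<times> (real^'n)"
        obtain x v where p: "p = (x, v)" by (cases p)
        have "(%j. x - sqrt (s j) *\<^sub>R v) \<longlonglongrightarrow> x - 0 *\<^sub>R v" by (intro tendsto_intros sq)
        hence "(%j. \<phi> (x - sqrt (s j) *\<^sub>R v)) \<longlonglongrightarrow> \<phi> x" using continuous_on_tendsto_compose[OF \<phi>(1)] by simp
        hence "(%j. ennreal (\<phi> (x - sqrt (s j) *\<^sub>R v) * gauss 1 v)) \<longlonglongrightarrow> ennreal (\<phi> x * gauss 1 v)"
          by (intro tendsto_ennrealI tendsto_mult tendsto_const)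
        thus "(%j. ?u j p) \<longlonglongrightarrow> (case p of (x, v) => ennreal (\<phi> x) * ?g v)"
          using \<phi>(2) by (simp add: p ennreal_mult')
      qed
    qed measurable
    moreover have "(\<integral>\<^sup>+p. ?u j p \<partial>(\<alpha> \<Otimes>\<^sub>M lborel)) = A j \<alpha>" for j
      unfolding A_def by (subst lborel.nn_integral_fst[symmetric]) auto
    moreover have "(\<integral>\<^sup>+p. (case p of (x, v) => ennreal (\<phi> x) * ?g v) \<partial>(\<alpha> \<Otimes>\<^sub>M lborel)) = (\<integral>\<^sup>+x. ennreal (\<phi> x) \<partial>\<alpha>) * c"
      by (subst lborel.nn_integral_fst[symmetric]) (auto simp: nn_integral_cmult nn_integral_multc c_def)
    ultimately show ?thesis by simp
  qed
  have "(\<integral>\<^sup>+x. ennreal (\<phi> x) \<partial>\<mu>) * c = (\<integral>\<^sup>+x. ennreal (\<phi> x) \<partial>\<nu>) * c"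
    using lim[OF m(1)] lim[OF m(2)] unfolding Aeq by (rule LIMSEQ_unique)
  hence "c * (\<integral>\<^sup>+x. ennreal (\<phi> x) \<partial>\<mu>) = c * (\<integral>\<^sup>+x. ennreal (\<phi> x) \<partial>\<nu>)" by (simp only: mult.commute)
  thus ?thesis using c by (auto simp: ennreal_mult_cancel_left)
qed

text \<open>
Indicators of closed sets are decreasing limits of continuous functions of the distance, and closed sets form a generator stable under intersection.
\<close>

lemma borel_prob_eqI_continuous:
  fixes \<mu> \<nu> :: "'a::euclidean_space measure"
  assumes m: "borel_prob \<mu>" "borel_prob \<nu>"
    and eq: "!!\<phi>. continuous_on UNIV \<phi> ==> (!!x. 0 <= \<phi> x) ==> (!!x. \<phi> x <= 1) ==> (\<integral>\<^sup>+x. ennreal (\<phi> x) \<partial>\<mu>) = (\<integral>\<^sup>+x. ennreal (\<phi> x) \<partial>\<nu>)"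
  shows "\<mu> = \<nu>"
proof (rule measure_eqI_generator_eq[where E="Collect closed" and \<Omega>=UNIV and A="%_. UNIV"])
  show "Int_stable (Collect (closed :: 'a set => bool))" by (auto simp: Int_stable_def)
  show "sets \<mu> = sigma_sets UNIV (Collect closed)" "sets \<nu> = sigma_sets UNIV (Collect closed)"
    using m by (auto simp: borel_prob_def borel_eq_closed)
  show "emeasure \<mu> UNIV ~= \<infinity>" using prob_space.emeasure_space_1[OF borel_probD(1)[OF m(1)]] borel_probD(4)[OF m(1)] by simp
  fix F :: "'a set" assume "F \<in> Collect closed"
  hence F: "closed F" by simp
  show "emeasure \<mu> F = emeasure \<nu> F"
  proof (cases "F = {}")
    case False
    define \<phi> where "\<phi> j x = max 0 (1 - real j * infdist x F)" for j x
    have \<phi>: "continuous_on UNIV (\<phi> j)" "0 <= \<phi> j x" "\<phi> j x <= 1" for j x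
      unfolding \<phi>_def by (intro continuous_intros, auto simp: infdist_nonneg)
    have pw: "(%j. ennreal (\<phi> j x)) \<longlonglongrightarrow> indicator F x" for x
    proof (cases "x \<in> F")
      case True thus ?thesis by (simp add: \<phi>_def)
    next
      case False
      hence d: "0 < infdist x F" using F \<open>F ~= {}\<close> infdist_pos_not_in_closed by blast
      then obtain N where N: "1 < real N * infdist x F" using reals_Archimedean3 by blast
      have "\<phi> j x = 0" if "N <= j" for j
      proof -
        have "real N * infdist x F <= real j * infdist x F" using that d by (intro mult_right_mono) auto
        thus ?thesis using N by (simp add: \<phi>_def)
      qed
      hence "eventually (%j. ennreal (\<phi> j x) = indicator F x) sequentially"
        using False by (intro eventually_sequentiallyI[of N]) simp
      thus ?thesis by (rule tendsto_eventually)
    qed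
    have lim: "(%j. \<integral>\<^sup>+x. ennreal (\<phi> j x) \<partial>\<alpha>) \<longlonglongrightarrow> emeasure \<alpha> F" if a: "borel_prob \<alpha>" for \<alpha>
    proof -
      interpret a: prob_space \<alpha> using a by (rule borel_probD)
      note [measurable_cong] = borel_probD(2)[OF a]
      have [measurable]: "\<phi> j \<in> borel_measurable borel" for j using \<phi>(1) by (rule borel_measurable_continuous_onI)
      have [measurable]: "F \<in> sets borel" using F by simp
      have "(%j. \<integral>\<^sup>+x. ennreal (\<phi> j x) \<partial>\<alpha>) \<longlonglongrightarrow> (\<integral>\<^sup>+x. indicator F x \<partial>\<alpha>)"
        by (rule nn_integral_dominated_convergence[where w="%_. 1"]) (use pw \<phi>(3) in \<open>auto simp: ennreal_le_1 a.emeasure_space_1\<close>)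
      thus ?thesis by simp
    qed
    have "(\<integral>\<^sup>+x. ennreal (\<phi> j x) \<partial>\<mu>) = (\<integral>\<^sup>+x. ennreal (\<phi> j x) \<partial>\<nu>)" for j by (rule eq[OF \<phi>])
    thus ?thesis using lim[OF m(1)] lim[OF m(2)] by (simp add: LIMSEQ_unique)
  qed simp
qed auto

lemma distr_marginals:
  fixes \<mu> \<nu> :: "'a::euclidean_space measure"
  assumes m: "borel_prob \<mu>" "borel_prob \<nu>"
  shows "fst \<in> borel_measurable (\<mu> \<Otimes>\<^sub>M \<nu>)" "snd \<in> borel_measurable (\<mu> \<Otimes>\<^sub>M \<nu>)" "prob_space (\<mu> \<Otimes>\<^sub>M \<nu>)"
    and "distr (\<mu> \<Otimes>\<^sub>M \<nu>) borel fst = \<mu>" "distr (\<mu> \<Otimes>\<^sub>M \<nu>) borel snd = \<nu>"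
proof -
  interpret a: prob_space \<mu> using m(1) by (rule borel_probD)
  interpret b: prob_space \<nu> using m(2) by (rule borel_probD)
  interpret pair_prob_space \<mu> \<nu> ..
  note [measurable_cong] = borel_probD(2)[OF m(1)] borel_probD(2)[OF m(2)]
  show f: "fst \<in> borel_measurable (\<mu> \<Otimes>\<^sub>M \<nu>)" and s: "snd \<in> borel_measurable (\<mu> \<Otimes>\<^sub>M \<nu>)" by measurable
  show "prob_space (\<mu> \<Otimes>\<^sub>M \<nu>)" by (rule P.prob_space_axioms)
  have sp: "space \<mu> = UNIV" "space \<nu> = UNIV" using m by (auto dest: borel_probD(4))
  have one: "emeasure \<mu> UNIV = 1" "emeasure \<nu> UNIV = 1" using a.emeasure_space_1 b.emeasure_space_1 sp by auto
  show "distr (\<mu> \<Otimes>\<^sub>M \<nu>) borel fst = \<mu>"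
  proof (rule measure_eqI)
    fix A assume "A \<in> sets (distr (\<mu> \<Otimes>\<^sub>M \<nu>) borel fst)"
    hence A: "A \<in> sets borel" by simp
    have "fst -` A \<inter> space (\<mu> \<Otimes>\<^sub>M \<nu>) = A \<times> UNIV" by (auto simp: space_pair_measure sp)
    thus "emeasure (distr (\<mu> \<Otimes>\<^sub>M \<nu>) borel fst) A = emeasure \<mu> A"
      using A m by (simp add: emeasure_distr[OF f] b.emeasure_pair_measure_Times borel_probD one)
  qed (use m in \<open>simp add: borel_probD\<close>)
  show "distr (\<mu> \<Otimes>\<^sub>M \<nu>) borel snd = \<nu>"
  proof (rule measure_eqI)
    fix A assume "A \<in> sets (distr (\<mu> \<Otimes>\<^sub>M \<nu>) borel snd)"
    hence A: "A \<in> sets borel" by simp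
    have "snd -` A \<inter> space (\<mu> \<Otimes>\<^sub>M \<nu>) = UNIV \<times> A" by (auto simp: space_pair_measure sp)
    thus "emeasure (distr (\<mu> \<Otimes>\<^sub>M \<nu>) borel snd) A = emeasure \<nu> A"
      using A m by (simp add: emeasure_distr[OF s] b.emeasure_pair_measure_Times borel_probD one)
  qed (use m in \<open>simp add: borel_probD\<close>)
qed

context even_singular_kernel
begin

text \<open>
The difference of the two Gaussian averages is continuous and periodic with period z, and vanishes along u - j z as j grows; so it is zero.
\<close>

lemma dipole_zero_imp_equal_averages:
  fixes X Y :: "'b => real^'a"
  assumes P: "prob_space P" and [measurable]: "X \<in> borel_measurable P" "Y \<in> borel_measurable P"
    and s: "0 < s" and z: "z ~= 0" and ae: "AE u in lborel. (\<integral>\<omega>. gauss_dipole X Y s z u \<omega> \<partial>P) = 0"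
  shows "(\<integral>\<omega>. gauss (1/s) (u - X \<omega>) \<partial>P) = (\<integral>\<omega>. gauss (1/s) (u - Y \<omega>) \<partial>P)"
proof -
  interpret P: prob_space P by (rule P)
  let ?g = "gauss (1/s) :: real^'a => real"
  define G where "G u = (\<integral>\<omega>. ?g (u - X \<omega>) \<partial>P) - (\<integral>\<omega>. ?g (u - Y \<omega>) \<partial>P)" for u
  have g1: "norm (?g y) <= 1" for y using gauss_pos[of "1/s" y] gauss_le_1[of "1/s" y] s by simp
  have gi: "integrable P (%\<omega>. ?g (u - Z \<omega>))" if [measurable]: "Z \<in> borel_measurable P" for u Z
    by (rule P.integrable_const_bound[of _ 1]) (use g1 in auto)
  have dom: "(%j. \<integral>\<omega>. ?g (u j - Z \<omega>) \<partial>P) \<longlonglongrightarrow> (\<integral>\<omega>. h \<omega> \<partial>P)"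
    if [measurable]: "Z \<in> borel_measurable P" "h \<in> borel_measurable P" and l: "!!\<omega>. (%j. ?g (u j - Z \<omega>)) \<longlonglongrightarrow> h \<omega>" for u Z h
    by (rule integral_dominated_convergence[where w="%_. 1"]) (use g1 l in auto)
  have cont: "continuous_on UNIV G"
  proof (rule continuous_at_imp_continuous_on, intro ballI continuous_at_sequentiallyI)
    fix u and v :: "nat => real^'a" assume v: "v \<longlonglongrightarrow> u"
    have "(%j. ?g (v j - a)) \<longlonglongrightarrow> ?g (u - a)" for a
      by (rule continuous_on_tendsto_compose[OF gauss_cont]) (intro tendsto_intros v, auto)
    thus "(%j. G (v j)) \<longlonglongrightarrow> G u" unfolding G_def by (intro tendsto_diff dom) auto
  qed
  have van: "(%j. ?g (u - real j *\<^sub>R z - a)) \<longlonglongrightarrow> 0" for u a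
  proof -
    have "filterlim (%j. - norm (u - a) + norm z * real j) at_top sequentially"
      by (intro filterlim_tendsto_add_at_top[OF tendsto_const] filterlim_tendsto_pos_mult_at_top[OF tendsto_const] filterlim_real_sequentially) (use z in auto)
    moreover have "- norm (u - a) + norm z * real j <= norm (u - real j *\<^sub>R z - a)" for j
      using norm_triangle_ineq2[of "real j *\<^sub>R z" "u - a"] norm_minus_commute[of "real j *\<^sub>R z" "u - a"] by (simp add: algebra_simps)
    hence "eventually (%j. - norm (u - a) + norm z * real j <= norm (u - real j *\<^sub>R z - a)) sequentially"
      by (intro always_eventually allI)
    ultimately have "filterlim (%j. norm (u - real j *\<^sub>R z - a)) at_top sequentially"
      by (rule filterlim_at_top_mono)
    hence "filterlim (%j. 1/s * (norm (u - real j *\<^sub>R z - a))^2) at_top sequentially"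
      using s by (intro filterlim_tendsto_pos_mult_at_top[OF tendsto_const] filterlim_pow_at_top) auto
    hence "filterlim (%j. - (1/s * (norm (u - real j *\<^sub>R z - a))^2)) at_bot sequentially" by (simp add: filterlim_uminus_at_top)
    thus ?thesis unfolding gauss_def by (rule filterlim_compose[OF exp_at_bot])
  qed
  have per: "G u = G (u - z)" for u
  proof -
    \<comment> \<open>An open null set is empty.\<close>
    define N where "N = {u. G u ~= G (u - z)}"
    have "continuous_on UNIV (%u. G (u - z))" by (rule continuous_on_compose2[OF cont]) (auto intro!: continuous_intros)
    hence oN: "open N" unfolding N_def using cont by (intro open_Collect_neq)
    have "(\<integral>\<omega>. gauss_dipole X Y s z u \<omega> \<partial>P) = G u - G (u - z)" for u
    proof -
      have e: "u - (a + z) = (u - z) - a" for a by simp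
      show ?thesis unfolding gauss_dipole_def G_def e using gi by simp
    qed
    hence "AE u in lborel. u \<notin> N" using ae by (simp add: N_def)
    hence "emeasure lborel N = 0" using oN by (subst (asm) AE_iff_measurable[of N]) auto
    hence "N \<in> null_sets lborel" using oN by auto
    hence "negligible N" by (simp add: negligible_iff_null_sets null_sets_completionI)
    hence "N = {}" using open_not_negligible[OF oN] by blast
    thus ?thesis by (auto simp: N_def)
  qed
  have "G u = G (u - real j *\<^sub>R z)" for j u
  proof (induction j)
    case (Suc j)
    have "G (u - real (Suc j) *\<^sub>R z) = G ((u - real j *\<^sub>R z) - z)" by (simp add: algebra_simps)
    thus ?case using Suc per by metis
  qed simp
  moreover have "(%j. G (u - real j *\<^sub>R z)) \<longlonglongrightarrow> (\<integral>\<omega>. 0 \<partial>P) - (\<integral>\<omega>. 0 \<partial>P)"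
    unfolding G_def by (intro tendsto_diff dom van) auto
  ultimately have "(%j::nat. G u) \<longlonglongrightarrow> 0" by simp
  hence "G u = 0" by (simp add: LIMSEQ_const_iff)
  thus ?thesis by (simp add: G_def)
qed

lemma D_smoothed_zero_imp_equal:
  fixes \<mu> \<nu> :: "(real^'a) measure"
  assumes m: "borel_prob \<mu>" "borel_prob \<nu>" and zero: "!!T. 0 < T ==> interaction_gap (\<mu> \<Otimes>\<^sub>M \<nu>) fst snd (smoothed T) = 0"
  shows "\<mu> = \<nu>"
proof (rule borel_prob_eqI_continuous[OF m], rule equal_gauss_averages_imp_equal_integrals[OF m])
  fix T :: real assume T: "0 < T"
  note M = distr_marginals[OF m]
  obtain s z where sz: "0 < s" "s <= T" "z ~= 0" "AE u in lborel. (\<integral>\<omega>. gauss_dipole fst snd s z u \<omega> \<partial>(\<mu> \<Otimes>\<^sub>M \<nu>)) = 0"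
    by (rule D_smoothed_zero_imp_dipole_zero[OF M(3,1,2) T zero]) (assumption, rule that)
  have "(\<integral>x. gauss (1/s) (u - x) \<partial>\<mu>) = (\<integral>x. gauss (1/s) (u - x) \<partial>\<nu>)" for u
  proof -
    have "(\<integral>x. gauss (1/s) (u - x) \<partial>(distr (\<mu> \<Otimes>\<^sub>M \<nu>) borel fst)) = (\<integral>x. gauss (1/s) (u - x) \<partial>(distr (\<mu> \<Otimes>\<^sub>M \<nu>) borel snd))"
      using dipole_zero_imp_equal_averages[OF M(3,1,2) sz(1,3,4), of u]
      by (simp add: integral_distr[OF M(1)] integral_distr[OF M(2)])
    thus ?thesis unfolding M(4,5) .
  qed
  thus "\<exists>s. 0 < s & s <= T & (\<forall>u. (\<integral>x. gauss (1/s) (u - x) \<partial>\<mu>) = (\<integral>x. gauss (1/s) (u - x) \<partial>\<nu>))" using sz by blast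
qed

end

section \<open>Removing the smoothing\<close>

lemma ball_borel[measurable]: "ball (x::'a::metric_space) r \<in> sets borel"
  by simp

lemma ball_indicator_measurable:
  fixes F :: "'a::euclidean_space => ennreal"
  assumes [measurable]: "F \<in> borel_measurable borel"
  shows "(%(u, v). F u * (ennreal (exp (- v)) * indicator (ball 0 (sqrt (2 * v))) u)) \<in> borel_measurable (borel \<Otimes>\<^sub>M borel)"
    and "(%(v, u). F u * indicator (ball 0 (sqrt (2 * v))) u) \<in> borel_measurable (borel \<Otimes>\<^sub>M borel)"
proof -
  have i: "indicator (ball 0 (sqrt (2 * v))) u = (if norm u < sqrt (2 * v) then 1 else 0 :: ennreal)" for u :: 'a and v
    by (simp add: indicator_def)
  show "(%(u, v). F u * (ennreal (exp (- v)) * indicator (ball 0 (sqrt (2 * v))) u)) \<in> borel_measurable (borel \<Otimes>\<^sub>M borel)"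
    unfolding i by measurable
  show "(%(v, u). F u * indicator (ball 0 (sqrt (2 * v))) u) \<in> borel_measurable (borel \<Otimes>\<^sub>M borel)"
    unfolding i by measurable
qed

lemma ball_integral_measurable:
  fixes F :: "'a::euclidean_space => ennreal"
  assumes "F \<in> borel_measurable borel"
  shows "(%v. \<integral>\<^sup>+u\<in>ball 0 (sqrt (2 * v)). F u \<partial>lborel) \<in> borel_measurable borel"
  using lborel.borel_measurable_nn_integral_fst[of "%(v, u). F u * indicator (ball 0 (sqrt (2 * v))) u" borel] ball_indicator_measurable(2)[OF assms]
  by (simp cong: measurable_cong_sets)

text \<open>
The layer-cake formula: a Gaussian average is a superposition of integrals over centred balls. It transfers bounds on ball averages of the kernel to its heat averages.
\<close>

lemma gauss_layers:
  fixes F :: "real^'n::finite => ennreal"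
  assumes F[measurable]: "F \<in> borel_measurable borel"
  shows "(\<integral>\<^sup>+u. F u * ennreal (gauss (1/2) u) \<partial>lborel) = (\<integral>\<^sup>+v. ennreal (exp (- v)) * (\<integral>\<^sup>+u\<in>ball 0 (sqrt (2 * v)). F u \<partial>lborel) \<partial>lborel)"
proof -
  have g: "ennreal (gauss (1/2) u) = (\<integral>\<^sup>+v. ennreal (exp (- v)) * indicator (ball 0 (sqrt (2 * v))) u \<partial>lborel)" for u :: "real^'n"
  proof -
    define a where "a = (norm u)^2 / 2"
    have ia: "norm u < sqrt (2 * v) \<longleftrightarrow> a < v" for v
      using real_sqrt_less_iff[of "(norm u)^2" "2 * v"] by (simp add: a_def) linarith
    have "((%v::real. - exp (- v)) \<longlongrightarrow> - 0) at_top"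
      by (intro tendsto_minus filterlim_compose[OF exp_at_bot] filterlim_uminus_at_bot_at_top)
    hence "(\<integral>\<^sup>+v. ennreal (exp (- v)) * indicator {a..} v \<partial>lborel) = ennreal (- 0 - - exp (- a))"
      by (intro nn_integral_FTC_atLeast) (auto intro!: derivative_eq_intros)
    also have "- 0 - - exp (- a) = gauss (1/2) u" by (simp add: gauss_def a_def)
    finally have "ennreal (gauss (1/2) u) = (\<integral>\<^sup>+v. ennreal (exp (- v)) * indicator {a..} v \<partial>lborel)" ..
    also have "\<dots> = (\<integral>\<^sup>+v. ennreal (exp (- v)) * indicator (ball 0 (sqrt (2 * v))) u \<partial>lborel)"
    proof (rule nn_integral_cong_AE)
      show "AE v in lborel. ennreal (exp (- v)) * indicator {a..} v = ennreal (exp (- v)) * indicator (ball 0 (sqrt (2 * v))) u"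
        using AE_lborel_singleton[of a] by eventually_elim (auto simp: indicator_def ia)
    qed
    finally show ?thesis .
  qed
  have "(\<integral>\<^sup>+u. F u * ennreal (gauss (1/2) u) \<partial>lborel) = (\<integral>\<^sup>+u. \<integral>\<^sup>+v. F u * (ennreal (exp (- v)) * indicator (ball 0 (sqrt (2 * v))) u) \<partial>lborel \<partial>lborel)"
    unfolding g
  proof (rule nn_integral_cong, rule nn_integral_cmult[symmetric])
    fix u :: "real^'n"
    have i: "indicator (ball 0 (sqrt (2 * v))) u = (if norm u < sqrt (2 * v) then 1 else 0 :: ennreal)" for v
      by (simp add: indicator_def)
    show "(%v. ennreal (exp (- v)) * indicator (ball 0 (sqrt (2 * v))) u) \<in> borel_measurable lborel" unfolding i by measurable
  qed
  also have "\<dots> = (\<integral>\<^sup>+v. \<integral>\<^sup>+u. F u * (ennreal (exp (- v)) * indicator (ball 0 (sqrt (2 * v))) u) \<partial>lborel \<partial>lborel)"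
    using ball_indicator_measurable(1)[OF F]
    by (intro lborel_pair.Fubini'[symmetric]) (simp cong: measurable_cong_sets)
  also have "\<dots> = (\<integral>\<^sup>+v. ennreal (exp (- v)) * (\<integral>\<^sup>+u\<in>ball 0 (sqrt (2 * v)). F u \<partial>lborel) \<partial>lborel)"
  proof (rule nn_integral_cong)
    fix v :: real
    have "(\<integral>\<^sup>+u. F u * (ennreal (exp (- v)) * indicator (ball 0 (sqrt (2 * v))) u) \<partial>lborel) = (\<integral>\<^sup>+u. ennreal (exp (- v)) * (F u * indicator (ball 0 (sqrt (2 * v))) u) \<partial>lborel)"
      by (simp only: mult.left_commute)
    also have "\<dots> = ennreal (exp (- v)) * (\<integral>\<^sup>+u\<in>ball 0 (sqrt (2 * v)). F u \<partial>lborel)" by (rule nn_integral_cmult) measurable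
    finally show "(\<integral>\<^sup>+u. F u * (ennreal (exp (- v)) * indicator (ball 0 (sqrt (2 * v))) u) \<partial>lborel) = ennreal (exp (- v)) * (\<integral>\<^sup>+u\<in>ball 0 (sqrt (2 * v)). F u \<partial>lborel)" .
  qed
  finally show ?thesis .
qed

lemma mutual_eq_product_integral:
  fixes k :: "'a::euclidean_space => ennreal"
  assumes [measurable]: "k \<in> borel_measurable borel" and m: "borel_prob \<mu>" "borel_prob \<nu>"
  shows "mutual k \<mu> \<nu> = (\<integral>\<^sup>+p. k (fst p - snd p) \<partial>(\<nu> \<Otimes>\<^sub>M \<mu>))"
proof -
  interpret sigma_finite_measure \<mu> using m(1) by (rule borel_probD)
  note [measurable_cong] = borel_probD(2)[OF m(1)] borel_probD(2)[OF m(2)]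
  show ?thesis unfolding mutual_def pot_def by (subst nn_integral_fst[symmetric]) auto
qed

text \<open>
The final assumption is the control of ball averages by point values. It dominates the smoothed kernels when the smoothing is removed.
\<close>

locale repulsive_kernel = even_singular_kernel w p q C for w :: "real^'a::finite => real" and p q C :: real +
  fixes k :: "real^'a => ennreal"
  assumes k_cont: "continuous_on UNIV k" and k_even: "k (- x) = k x"
    and k_eq: "x ~= 0 ==> k x = ennreal (w x)" and w_nonneg: "x ~= 0 ==> 0 <= w x"
    and ball_average: "\<exists>K. \<forall>x r. norm x < R --> 0 < r --> r < 1 -->
      (\<integral>\<^sup>+y\<in>ball x r. k y \<partial>lborel) <= ennreal K * (1 + k x) * emeasure lborel (ball x r)"
begin

lemma k_meas[measurable]: "k \<in> borel_measurable borel"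
  using k_cont by (rule borel_measurable_continuous_onI)

lemma k_far: "1 <= norm x ==> k x <= ennreal C"
proof -
  assume x: "1 <= norm x"
  hence x0: "x ~= 0" by auto
  have "norm x powr q <= norm x powr 0" using x q by (intro powr_mono) auto
  hence "C * norm x powr q <= C * 1" using C x0 by (intro mult_left_mono) auto
  thus ?thesis using far(1)[OF x] by (simp add: k_eq[OF x0] ennreal_leI)
qed

text \<open>
Radii above one cause no trouble: away from the unit ball the kernel is bounded, and its integral over the unit ball is finite.
\<close>

lemma ball_average_all:
  "\<exists>K. \<forall>x r. norm x < R --> 0 < r --> (\<integral>\<^sup>+y\<in>ball x r. k y \<partial>lborel) <= ennreal K * (1 + k x) * emeasure lborel (ball x r)"
proof -
  obtain K where K: "!!x r. norm x < R ==> 0 < r ==> r < 1 ==> (\<integral>\<^sup>+y\<in>ball x r. k y \<partial>lborel) <= ennreal K * (1 + k x) * emeasure lborel (ball x r)"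
    using ball_average[of R] by blast
  define i where "i = (\<integral>z. C * tp z \<partial>lborel)"
  have tp0: "0 <= tp z" for z by (simp add: two_powers_def)
  have i0: "0 <= i" unfolding i_def using tp0 C by (intro Bochner_Integration.integral_nonneg) auto
  have I: "(\<integral>\<^sup>+y\<in>ball 0 1. k y \<partial>lborel) <= ennreal i"
  proof -
    have "(\<integral>\<^sup>+y\<in>ball 0 1. k y \<partial>lborel) <= (\<integral>\<^sup>+y. ennreal (C * tp y) \<partial>lborel)"
    proof (rule nn_integral_mono_AE)
      show "AE y in lborel. k y * indicator (ball 0 1) y <= ennreal (C * tp y)"
        using off_0
      proof eventually_elim
        case (elim y)
        thus ?case using near(1)[of y] by (auto simp: indicator_def k_eq two_powers_def intro!: ennreal_leI)
      qed
    qed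
    also have "\<dots> = ennreal i" unfolding i_def using tp0 C tp_integrable by (intro nn_integral_eq_integral) auto
    finally show ?thesis .
  qed
  define b where "b = measure lborel (ball (0::real^'a) 1)"
  have b: "0 < b" unfolding b_def by (rule content_ball_pos) simp
  have be: "emeasure lborel (ball x 1) = ennreal b" for x :: "real^'a"
  proof -
    have "measure lborel (ball x 1) = b" unfolding b_def by (simp add: content_ball)
    thus ?thesis using emeasure_eq_ennreal_measure[of lborel "ball x 1"] emeasure_lborel_ball_finite[of x 1] by (simp add: less_top)
  qed
  define K' where "K' = max K (i / b + C)"
  have "(\<integral>\<^sup>+y\<in>ball x r. k y \<partial>lborel) <= ennreal K' * (1 + k x) * emeasure lborel (ball x r)" if "norm x < R" "0 < r" for x r
  proof (cases "r < 1")
    case True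
    have "ennreal K * (1 + k x) * emeasure lborel (ball x r) <= ennreal K' * (1 + k x) * emeasure lborel (ball x r)"
      by (intro mult_right_mono ennreal_leI) (auto simp: K'_def)
    thus ?thesis using K[OF that True] by (rule order_trans[rotated])
  next
    case False
    let ?E = "emeasure lborel (ball x r)"
    have "(\<integral>\<^sup>+y\<in>ball x r. k y \<partial>lborel) <= (\<integral>\<^sup>+y. k y * indicator (ball 0 1) y + ennreal C * indicator (ball x r) y \<partial>lborel)"
      using k_far by (intro nn_integral_mono) (auto simp: indicator_def)
    also have "\<dots> = (\<integral>\<^sup>+y\<in>ball 0 1. k y \<partial>lborel) + ennreal C * ?E"
      by (subst nn_integral_add) (auto simp: nn_integral_cmult_indicator)
    also have "\<dots> <= ennreal (i / b) * ?E + ennreal C * ?E"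
    proof (rule add_right_mono)
      have "ennreal i = ennreal (i / b) * ennreal b" using b i0 by (simp flip: ennreal_mult)
      also have "\<dots> <= ennreal (i / b) * ?E" unfolding be[of x, symmetric] using False by (intro mult_left_mono emeasure_mono subset_ball) auto
      finally show "(\<integral>\<^sup>+y\<in>ball 0 1. k y \<partial>lborel) <= ennreal (i / b) * ?E" using I by (rule order_trans[rotated])
    qed
    also have "\<dots> = ennreal (i / b + C) * ?E" using i0 b C by (simp add: distrib_right)
    also have "\<dots> <= ennreal K' * (1 + k x) * ?E"
    proof (rule mult_right_mono)
      have "ennreal (i / b + C) * 1 <= ennreal K' * (1 + k x)" by (intro mult_mono ennreal_leI) (auto simp: K'_def)
      thus "ennreal (i / b + C) <= ennreal K' * (1 + k x)" by simp
    qed simp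
    finally show ?thesis .
  qed
  thus ?thesis by blast
qed

text \<open>
The unnormalized heat average of k; it converges to k times the total mass of the Gaussian as the time tends to 0.
\<close>

definition heated :: "real => real^'a => ennreal" where
  "heated s x = (\<integral>\<^sup>+u. k (x - sqrt s *\<^sub>R u) * ennreal (gauss (1/2) u) \<partial>lborel)"

definition gmass :: real where
  "gmass = (\<integral>u. gauss (1/2) (u::real^'a) \<partial>lborel)"

lemma gmass_pos: "0 < gmass" unfolding gmass_def by (rule gauss_integral_pos) simp

lemma nn_gmass: "(\<integral>\<^sup>+u. ennreal (gauss (1/2) (u::real^'a)) \<partial>lborel) = ennreal gmass"
  unfolding gmass_def by (rule nn_integral_eq_integral[OF gauss_integrable]) (auto intro: less_imp_le gauss_pos)

lemma heated_eq_smoothed: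
  assumes s: "0 < s"
  shows "heated s x = ennreal (smoothed s x)" and "0 <= smoothed s x"
proof -
  obtain B where B: "0 <= B"
    "!!s' x z. s <= s' ==> s' <= s ==> \<bar>w z * heat s' (x - z)\<bar> <= B * (1 + (norm x)^2) * tp z \<or> z = 0"
    "!!s' x z. s <= s' ==> s' <= s ==> \<bar>w z * heat_lap s' (x - z)\<bar> <= B * (1 + (norm x)^2) * tp z \<or> z = 0"
    "!!s' x z. s <= s' ==> s' <= s ==> \<bar>laplacian w z * heat_diff s' x z\<bar> <= B * tp z \<or> z = 0"
    by (rule heat_coefficient_bounds[OF s, of s]) (rule that)
  have i: "integrable lborel (%z. w z * heat s (x - z))"
    by (rule integrable_by_tp[OF _ B(2)[OF order_refl order_refl]]) measurable
  have n: "AE z in lborel. 0 <= w z * heat s (x - z)" using off_0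
  proof eventually_elim
    case (elim z) thus ?case by (intro mult_nonneg_nonneg w_nonneg heat_nonneg)
  qed
  have "heated s x = (\<integral>\<^sup>+z. k z * ennreal (heat s (x - z)) \<partial>lborel)" unfolding heated_def by (rule heat_substitution[OF s k_meas, symmetric])
  also have "\<dots> = (\<integral>\<^sup>+z. ennreal (w z * heat s (x - z)) \<partial>lborel)"
  proof (rule nn_integral_cong_AE)
    show "AE z in lborel. k z * ennreal (heat s (x - z)) = ennreal (w z * heat s (x - z))" using off_0
    proof eventually_elim
      case (elim z) thus ?case using w_nonneg[OF elim] by (simp add: k_eq ennreal_mult heat_nonneg)
    qed
  qed
  also have "\<dots> = ennreal (smoothed s x)" unfolding smoothed_def by (rule nn_integral_eq_integral[OF i n])
  finally show "heated s x = ennreal (smoothed s x)" .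
  show "0 <= smoothed s x" unfolding smoothed_def by (rule integral_nonneg_AE[OF n])
qed

lemma heated_measurable: "0 < s ==> heated s \<in> borel_measurable borel"
proof -
  assume "0 < s"
  hence "heated s = (%x. ennreal (smoothed s x))" using heated_eq_smoothed(1) by blast
  thus ?thesis by simp
qed

lemma layer_bound:
  "\<exists>K. \<forall>x s v. norm x < R --> 0 < s --> (\<integral>\<^sup>+u\<in>ball 0 (sqrt (2 * v)). k (x - sqrt s *\<^sub>R u) \<partial>lborel) <= ennreal K * (1 + k x) * (\<integral>\<^sup>+u\<in>ball 0 (sqrt (2 * v)). 1 \<partial>(lborel::(real^'a) measure))"
proof -
  obtain K where K: "!!x r. norm x < R ==> 0 < r ==> (\<integral>\<^sup>+y\<in>ball x r. k y \<partial>lborel) <= ennreal K * (1 + k x) * emeasure lborel (ball x r)"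
    using ball_average_all[of R] by blast
  have "(\<integral>\<^sup>+u\<in>ball 0 (sqrt (2 * v)). k (x - sqrt s *\<^sub>R u) \<partial>lborel) <= ennreal K * (1 + k x) * (\<integral>\<^sup>+u\<in>ball 0 (sqrt (2 * v)). 1 \<partial>(lborel::(real^'a) measure))"
    if x: "norm x < R" and s: "0 < s" for x s v
  proof (cases "0 < v")
    case False
    hence e: "ball 0 (sqrt (2 * v)) = ({} :: (real^'a) set)" by simp
    show ?thesis unfolding e by simp
  next
    case True
    define \<rho> where "\<rho> = sqrt (2 * v)"
    have \<rho>: "0 < \<rho>" using True by (simp add: \<rho>_def)
    let ?c = "ennreal ((sqrt s) ^ CARD('a))"
    have c: "?c ~= 0" "?c ~= top" using s by auto
    have bi: "indicator (ball x (sqrt s * \<rho>)) (x - sqrt s *\<^sub>R u) = (indicator (ball 0 \<rho>) u :: ennreal)" for u :: "real^'a"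
      using s by (simp add: indicator_def dist_norm)
    have sub: "(\<integral>\<^sup>+y\<in>ball x (sqrt s * \<rho>). f y \<partial>lborel) = ?c * (\<integral>\<^sup>+u\<in>ball 0 \<rho>. f (x - sqrt s *\<^sub>R u) \<partial>lborel)"
      if [measurable]: "f \<in> borel_measurable borel" for f :: "real^'a => ennreal"
      using nn_integral_substitution[of "sqrt s" "%y. f y * indicator (ball x (sqrt s * \<rho>)) y" x] s by (simp add: bi)
    have "?c * (\<integral>\<^sup>+u\<in>ball 0 \<rho>. k (x - sqrt s *\<^sub>R u) \<partial>lborel) <= ennreal K * (1 + k x) * emeasure lborel (ball x (sqrt s * \<rho>))"
      using K[OF x, of "sqrt s * \<rho>"] s \<rho> by (simp add: sub)
    also have "emeasure lborel (ball x (sqrt s * \<rho>)) = ?c * (\<integral>\<^sup>+u\<in>ball 0 \<rho>. 1 \<partial>(lborel::(real^'a) measure))"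
      using sub[of "%_. 1"] by simp
    also have "ennreal K * (1 + k x) * (?c * (\<integral>\<^sup>+u\<in>ball 0 \<rho>. 1 \<partial>(lborel::(real^'a) measure))) = ?c * (ennreal K * (1 + k x) * (\<integral>\<^sup>+u\<in>ball 0 \<rho>. 1 \<partial>(lborel::(real^'a) measure)))"
      by (rule mult.left_commute)
    finally have "?c * (\<integral>\<^sup>+u\<in>ball 0 \<rho>. k (x - sqrt s *\<^sub>R u) \<partial>lborel) <= ?c * (ennreal K * (1 + k x) * (\<integral>\<^sup>+u\<in>ball 0 \<rho>. 1 \<partial>(lborel::(real^'a) measure)))" .
    thus ?thesis using c unfolding \<rho>_def by (simp add: ennreal_mult_le_mult_iff)
  qed
  thus ?thesis by blast
qed

lemma gmass_layers:
  "(\<integral>\<^sup>+v. ennreal (exp (- v)) * (a * (\<integral>\<^sup>+u\<in>ball 0 (sqrt (2 * v)). 1 \<partial>(lborel::(real^'a) measure))) \<partial>lborel) = a * ennreal gmass"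
proof -
  have m: "(%v. \<integral>\<^sup>+u\<in>ball 0 (sqrt (2 * v)). 1 \<partial>(lborel::(real^'a) measure)) \<in> borel_measurable borel" by (rule ball_integral_measurable) simp
  have m2: "(%v. ennreal (exp (- v)) * (\<integral>\<^sup>+u\<in>ball 0 (sqrt (2 * v)). 1 \<partial>(lborel::(real^'a) measure))) \<in> borel_measurable lborel"
    using m by (intro borel_measurable_times_ennreal) auto
  have "(\<integral>\<^sup>+v. ennreal (exp (- v)) * (a * (\<integral>\<^sup>+u\<in>ball 0 (sqrt (2 * v)). 1 \<partial>(lborel::(real^'a) measure))) \<partial>lborel)
      = a * (\<integral>\<^sup>+v. ennreal (exp (- v)) * (\<integral>\<^sup>+u\<in>ball 0 (sqrt (2 * v)). 1 \<partial>(lborel::(real^'a) measure)) \<partial>lborel)"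
    unfolding mult.left_commute[of _ a] by (rule nn_integral_cmult[OF m2])
  also have "(\<integral>\<^sup>+v. ennreal (exp (- v)) * (\<integral>\<^sup>+u\<in>ball 0 (sqrt (2 * v)). 1 \<partial>(lborel::(real^'a) measure)) \<partial>lborel) = ennreal gmass"
    using gauss_layers[of "%_::real^'a. 1"] nn_gmass by simp
  finally show ?thesis .
qed

lemma shifted_k_measurable: "(%u. k (x - sqrt s *\<^sub>R u)) \<in> borel_measurable borel" by measurable

lemma heated_bound:
  "\<exists>K. \<forall>x s. norm x < R --> 0 < s --> heated s x <= ennreal K * (1 + k x)"
proof -
  obtain K where K: "!!x s v. norm x < R ==> 0 < s ==> (\<integral>\<^sup>+u\<in>ball 0 (sqrt (2 * v)). k (x - sqrt s *\<^sub>R u) \<partial>lborel) <= ennreal K * (1 + k x) * (\<integral>\<^sup>+u\<in>ball 0 (sqrt (2 * v)). 1 \<partial>(lborel::(real^'a) measure))"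
    using layer_bound[of R] by blast
  have "heated s x <= ennreal (K * gmass) * (1 + k x)" if "norm x < R" "0 < s" for x s
  proof -
    have "heated s x = (\<integral>\<^sup>+v. ennreal (exp (- v)) * (\<integral>\<^sup>+u\<in>ball 0 (sqrt (2 * v)). k (x - sqrt s *\<^sub>R u) \<partial>lborel) \<partial>lborel)"
      unfolding heated_def by (rule gauss_layers[OF shifted_k_measurable])
    also have "\<dots> <= (\<integral>\<^sup>+v. ennreal (exp (- v)) * (ennreal K * (1 + k x) * (\<integral>\<^sup>+u\<in>ball 0 (sqrt (2 * v)). 1 \<partial>(lborel::(real^'a) measure))) \<partial>lborel)"
      by (intro nn_integral_mono mult_left_mono K that) simp
    also have "\<dots> = ennreal K * (1 + k x) * ennreal gmass" by (rule gmass_layers)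
    also have "\<dots> = ennreal (K * gmass) * (1 + k x)" using gmass_pos by (simp add: ennreal_mult'' mult_ac)
    finally show ?thesis .
  qed
  thus ?thesis by blast
qed

text \<open>
By continuity of k the ball averages converge on every layer; the bound on ball averages permits Fatou's lemma from above.
\<close>

lemma heated_limsup:
  assumes s: "!!j::nat. 0 < s j" "s \<longlonglongrightarrow> 0" and fin: "k x < \<infinity>"
  shows "limsup (%j. heated (s j) x) <= k x * ennreal gmass"
proof (rule ennreal_le_epsilon)
  fix e :: real assume e: "0 < e"
  \<comment> \<open>An error d in the values of k becomes an error d * gmass = e in the averages.\<close>
  define d where "d = e / gmass"
  have d: "0 < d" using e gmass_pos by (simp add: d_def)
  let ?m = "%v. \<integral>\<^sup>+u\<in>ball 0 (sqrt (2 * v)). 1 \<partial>(lborel::(real^'a) measure)"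
  let ?A = "%j v. \<integral>\<^sup>+u\<in>ball 0 (sqrt (2 * v)). k (x - sqrt (s j) *\<^sub>R u) \<partial>lborel"
  obtain K where K0: "\<forall>y s v. norm y < norm x + 1 --> 0 < s --> (\<integral>\<^sup>+u\<in>ball 0 (sqrt (2 * v)). k (y - sqrt s *\<^sub>R u) \<partial>lborel) <= ennreal K * (1 + k y) * ?m v"
    using layer_bound[of "norm x + 1"] by (rule exE)
  have K: "?A j v <= ennreal K * (1 + k x) * ?m v" for j v
    using K0[rule_format, of x "s j" v] s(1)[of j] by simp
  have less: "k x < k x + ennreal d"
  proof (cases "k x" rule: ennreal_cases)
    case (real r)
    have "ennreal r < ennreal (r + d)" using real d by (intro ennreal_lessI) auto
    thus ?thesis using real d by simp
  qed (use fin in simp)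
  have "(k \<longlongrightarrow> k x) (nhds x)" using k_cont by (simp add: continuous_on_eq_continuous_at isCont_def tendsto_at_iff_tendsto_nhds)
  from order_tendstoD(2)[OF this less] have "eventually (%y. k y < k x + ennreal d) (nhds x)" .
  then obtain \<delta> where \<delta>: "0 < \<delta>" "!!y. dist y x < \<delta> ==> k y < k x + ennreal d" by (auto simp: eventually_nhds_metric)
  have layer: "limsup (%j. ennreal (exp (- v)) * ?A j v) <= ennreal (exp (- v)) * ((k x + ennreal d) * ?m v)" for v
  proof (rule Limsup_bounded)
    have "(%j. sqrt (s j) * sqrt (2 * v)) \<longlonglongrightarrow> sqrt 0 * sqrt (2 * v)" by (intro tendsto_intros s(2))
    hence "eventually (%j. sqrt (s j) * sqrt (2 * v) < \<delta>) sequentially" using \<delta>(1) by (intro order_tendstoD(2)) auto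
    thus "eventually (%j. ennreal (exp (- v)) * ?A j v <= ennreal (exp (- v)) * ((k x + ennreal d) * ?m v)) sequentially"
    proof eventually_elim
      case (elim j)
      have "?A j v <= (\<integral>\<^sup>+u. (k x + ennreal d) * (1 * indicator (ball 0 (sqrt (2 * v))) u) \<partial>(lborel::(real^'a) measure))"
      proof (rule nn_integral_mono)
        fix u :: "real^'a"
        show "k (x - sqrt (s j) *\<^sub>R u) * indicator (ball 0 (sqrt (2 * v))) u <= (k x + ennreal d) * (1 * indicator (ball 0 (sqrt (2 * v))) u)"
        proof (cases "norm u < sqrt (2 * v)")
          case True
          have "sqrt (s j) * norm u <= sqrt (s j) * sqrt (2 * v)" using True s(1)[of j] by (intro mult_left_mono) auto
          hence "sqrt (s j) * norm u < \<delta>" using elim by linarith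
          hence "dist (x - sqrt (s j) *\<^sub>R u) x < \<delta>" using s(1)[of j] by (simp add: dist_norm)
          thus ?thesis using \<delta>(2) True by (simp add: indicator_def less_imp_le)
        qed (simp add: indicator_def)
      qed
      also have "\<dots> = (k x + ennreal d) * ?m v" by (rule nn_integral_cmult) simp
      finally show ?case by (intro mult_left_mono) auto
    qed
  qed
  have "limsup (%j. heated (s j) x) = limsup (%j. \<integral>\<^sup>+v. ennreal (exp (- v)) * ?A j v \<partial>lborel)"
    unfolding heated_def gauss_layers[OF shifted_k_measurable] ..
  also have "\<dots> <= (\<integral>\<^sup>+v. limsup (%j. ennreal (exp (- v)) * ?A j v) \<partial>lborel)"
  proof (rule nn_integral_limsup[where w="%v. ennreal (exp (- v)) * (ennreal K * (1 + k x) * ?m v)"])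
    show "(%v. ennreal (exp (- v)) * ?A j v) \<in> borel_measurable lborel" for j
      using ball_integral_measurable[OF shifted_k_measurable, of x "s j"] by (intro borel_measurable_times_ennreal) auto
    show "(%v. ennreal (exp (- v)) * (ennreal K * (1 + k x) * ?m v)) \<in> borel_measurable lborel"
      using ball_integral_measurable[of "%_::real^'a. 1"] by (intro borel_measurable_times_ennreal) auto
    show "AE v in lborel. ennreal (exp (- v)) * ?A j v <= ennreal (exp (- v)) * (ennreal K * (1 + k x) * ?m v)" for j
      by (intro AE_I2 mult_left_mono K) simp
    show "(\<integral>\<^sup>+v. ennreal (exp (- v)) * (ennreal K * (1 + k x) * ?m v) \<partial>lborel) < \<infinity>"
      unfolding gmass_layers using fin by (simp add: ennreal_mult_less_top)
  qed
  also have "\<dots> <= (\<integral>\<^sup>+v. ennreal (exp (- v)) * ((k x + ennreal d) * ?m v) \<partial>lborel)" by (intro nn_integral_mono layer)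
  also have "\<dots> = (k x + ennreal d) * ennreal gmass" by (rule gmass_layers)
  also have "\<dots> = k x * ennreal gmass + ennreal e" using d e gmass_pos by (simp add: distrib_right d_def flip: ennreal_mult)
  finally show "limsup (%j. heated (s j) x) <= k x * ennreal gmass + ennreal e" .
qed

lemma heated_liminf:
  assumes s: "s \<longlonglongrightarrow> 0"
  shows "k x * ennreal gmass <= liminf (%j. heated (s j) x)"
proof -
  have "(%j. ennreal (gauss (1/2) u) * k (x - sqrt (s j) *\<^sub>R u)) \<longlonglongrightarrow> ennreal (gauss (1/2) u) * k x" for u :: "real^'a"
  proof (rule ennreal_tendsto_cmult)
    have "(%j. x - sqrt (s j) *\<^sub>R u) \<longlonglongrightarrow> x - sqrt 0 *\<^sub>R u" by (intro tendsto_intros s)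
    thus "(%j. k (x - sqrt (s j) *\<^sub>R u)) \<longlonglongrightarrow> k x" using continuous_on_tendsto_compose[OF k_cont] by simp
  qed simp
  hence l: "liminf (%j. ennreal (gauss (1/2) u) * k (x - sqrt (s j) *\<^sub>R u)) = ennreal (gauss (1/2) u) * k x" for u :: "real^'a"
    by (intro lim_imp_Liminf) auto
  have "k x * ennreal gmass = (\<integral>\<^sup>+u. ennreal (gauss (1/2) (u::real^'a)) * k x \<partial>lborel)"
    by (subst nn_integral_multc) (auto simp: nn_gmass mult.commute)
  also have "\<dots> <= liminf (%j. \<integral>\<^sup>+u. ennreal (gauss (1/2) u) * k (x - sqrt (s j) *\<^sub>R u) \<partial>lborel)"
    unfolding l[symmetric] by (rule nn_integral_liminf) measurable
  finally show ?thesis unfolding heated_def by (simp only: mult.commute)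
qed

context
  fixes \<mu> \<nu> :: "(real^'a) measure" and s :: "nat => real"
  assumes m: "borel_prob \<mu>" "borel_prob \<nu>" and s: "!!j. 0 < s j" "s \<longlonglongrightarrow> 0"
begin

lemma difference_measurable:
  assumes [measurable]: "f \<in> borel_measurable borel"
  shows "(%p. f (fst p - snd p) :: ennreal) \<in> borel_measurable (\<nu> \<Otimes>\<^sub>M \<mu>)"
proof -
  note [measurable_cong] = borel_probD(2)[OF m(1)] borel_probD(2)[OF m(2)]
  show ?thesis by measurable
qed

text \<open>
Fatou's lemma; it holds even if the mutual energy is infinite.
\<close>

lemma mutual_heated_liminf: "mutual k \<mu> \<nu> * ennreal gmass <= liminf (%j. mutual (heated (s j)) \<mu> \<nu>)"
proof -
  have "mutual k \<mu> \<nu> * ennreal gmass = (\<integral>\<^sup>+p. k (fst p - snd p) * ennreal gmass \<partial>(\<nu> \<Otimes>\<^sub>M \<mu>))"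
    unfolding mutual_eq_product_integral[OF k_meas m] by (rule nn_integral_multc[symmetric]) (rule difference_measurable[OF k_meas])
  also have "\<dots> <= (\<integral>\<^sup>+p. liminf (%j. heated (s j) (fst p - snd p)) \<partial>(\<nu> \<Otimes>\<^sub>M \<mu>))" by (intro nn_integral_mono heated_liminf s)
  also have "\<dots> <= liminf (%j. \<integral>\<^sup>+p. heated (s j) (fst p - snd p) \<partial>(\<nu> \<Otimes>\<^sub>M \<mu>))"
    by (rule nn_integral_liminf) (rule difference_measurable[OF heated_measurable[OF s(1)]])
  finally show ?thesis unfolding mutual_eq_product_integral[OF heated_measurable[OF s(1)] m] .
qed

text \<open>
Fatou's lemma from above, with the majorant supplied by the ball averages on the bounded set of differences.
\<close>

lemma mutual_heated_limsup:
  assumes fin: "mutual k \<mu> \<nu> < \<infinity>" and bd: "AE x in \<mu>. norm x < R" "AE x in \<nu>. norm x < R"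
  shows "limsup (%j. mutual (heated (s j)) \<mu> \<nu>) <= mutual k \<mu> \<nu> * ennreal gmass"
proof -
  interpret a: prob_space \<mu> using m(1) by (rule borel_probD)
  interpret b: prob_space \<nu> using m(2) by (rule borel_probD)
  interpret pair_prob_space \<nu> \<mu> ..
  note [measurable_cong] = borel_probD(2)[OF m(1)] borel_probD(2)[OF m(2)]
  obtain K where K: "!!x s. norm x < 2 * R ==> 0 < s ==> heated s x <= ennreal K * (1 + k x)" using heated_bound[of "2 * R"] by blast
  have one: "emeasure (\<nu> \<Otimes>\<^sub>M \<mu>) (space (\<nu> \<Otimes>\<^sub>M \<mu>)) = 1" by (rule P.emeasure_space_1)
  have kfin: "AE p in \<nu> \<Otimes>\<^sub>M \<mu>. k (fst p - snd p) ~= \<infinity>"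
    using fin unfolding mutual_eq_product_integral[OF k_meas m] by (intro nn_integral_PInf_AE difference_measurable[OF k_meas]) auto
  have near: "AE p in \<nu> \<Otimes>\<^sub>M \<mu>. norm (fst p - snd p) < 2 * R"
  proof (rule AE_pair_measure)
    show "{p \<in> space (\<nu> \<Otimes>\<^sub>M \<mu>). norm (fst p - snd p) < 2 * R} \<in> sets (\<nu> \<Otimes>\<^sub>M \<mu>)" by measurable
    show "AE x in \<nu>. AE y in \<mu>. norm (fst (x, y) - snd (x, y)) < 2 * R"
      using bd(2)
    proof eventually_elim
      case (elim x)
      from bd(1) show ?case
      proof eventually_elim
        case (elim y) thus ?case using \<open>norm x < R\<close> norm_triangle_ineq4[of x y] by simp
      qed
    qed
  qed
  have "limsup (%j. \<integral>\<^sup>+p. heated (s j) (fst p - snd p) \<partial>(\<nu> \<Otimes>\<^sub>M \<mu>)) <= (\<integral>\<^sup>+p. limsup (%j. heated (s j) (fst p - snd p)) \<partial>(\<nu> \<Otimes>\<^sub>M \<mu>))"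
  proof (rule nn_integral_limsup[where w="%p. ennreal K * (1 + k (fst p - snd p))"])
    show "(%p. heated (s j) (fst p - snd p)) \<in> borel_measurable (\<nu> \<Otimes>\<^sub>M \<mu>)" for j
      by (rule difference_measurable[OF heated_measurable[OF s(1)]])
    show "(%p. ennreal K * (1 + k (fst p - snd p))) \<in> borel_measurable (\<nu> \<Otimes>\<^sub>M \<mu>)" by measurable
    show "AE p in \<nu> \<Otimes>\<^sub>M \<mu>. heated (s j) (fst p - snd p) <= ennreal K * (1 + k (fst p - snd p))" for j
      using near by eventually_elim (rule K[OF _ s(1)])
    have "(\<integral>\<^sup>+p. ennreal K * (1 + k (fst p - snd p)) \<partial>(\<nu> \<Otimes>\<^sub>M \<mu>)) = ennreal K * (1 + mutual k \<mu> \<nu>)"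
      by (simp add: nn_integral_cmult nn_integral_add one mutual_eq_product_integral[OF k_meas m])
    thus "(\<integral>\<^sup>+p. ennreal K * (1 + k (fst p - snd p)) \<partial>(\<nu> \<Otimes>\<^sub>M \<mu>)) < \<infinity>" using fin by (simp add: ennreal_mult_less_top)
  qed
  also have "\<dots> <= (\<integral>\<^sup>+p. k (fst p - snd p) * ennreal gmass \<partial>(\<nu> \<Otimes>\<^sub>M \<mu>))"
  proof (rule nn_integral_mono_AE)
    show "AE p in \<nu> \<Otimes>\<^sub>M \<mu>. limsup (%j. heated (s j) (fst p - snd p)) <= k (fst p - snd p) * ennreal gmass"
      using kfin by eventually_elim (rule heated_limsup[OF s], simp add: less_top)
  qed
  also have "\<dots> = mutual k \<mu> \<nu> * ennreal gmass"
    unfolding mutual_eq_product_integral[OF k_meas m] by (rule nn_integral_multc) (rule difference_measurable[OF k_meas])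
  finally show ?thesis unfolding mutual_eq_product_integral[OF heated_measurable[OF s(1)] m] .
qed

end

lemma mutual_heated:
  assumes s: "0 < s" and m: "borel_prob \<mu>" "borel_prob \<nu>"
  shows "mutual (heated s) \<mu> \<nu> = ennreal (\<integral>x. \<integral>y. smoothed s (x - y) \<partial>\<mu> \<partial>\<nu>)" and "0 <= (\<integral>x. \<integral>y. smoothed s (x - y) \<partial>\<mu> \<partial>\<nu>)"
proof -
  obtain M where M: "!!x. \<bar>smoothed s x\<bar> <= M" by (rule that[OF smoothed_bound[OF s order_refl]])
  have "heated s = (%x. ennreal (smoothed s x))" using heated_eq_smoothed(1)[OF s] by blast
  thus "mutual (heated s) \<mu> \<nu> = ennreal (\<integral>x. \<integral>y. smoothed s (x - y) \<partial>\<mu> \<partial>\<nu>)"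
    using mutual_bounded_kernel[OF smoothed_measurable[of s] heated_eq_smoothed(2)[OF s] _ m, of M] M by (simp add: abs_le_iff)
  show "0 <= (\<integral>x. \<integral>y. smoothed s (x - y) \<partial>\<mu> \<partial>\<nu>)"
    using heated_eq_smoothed(2)[OF s] by (intro Bochner_Integration.integral_nonneg)
qed

lemma D_as_mutual:
  assumes s: "0 < s" and m: "borel_prob \<mu>" "borel_prob \<nu>"
  shows "interaction_gap (\<mu> \<Otimes>\<^sub>M \<nu>) fst snd (smoothed s) = enn2real (mutual (heated s) \<mu> \<mu>) - enn2real (mutual (heated s) \<nu> \<mu>)
    - enn2real (mutual (heated s) \<mu> \<nu>) + enn2real (mutual (heated s) \<nu> \<nu>)"
proof -
  note M = distr_marginals[OF m]
  let ?P = "\<mu> \<Otimes>\<^sub>M \<nu>" and ?f = "smoothed s"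
  interpret P: prob_space ?P by (rule M(3))
  interpret PP: pair_prob_space ?P ?P ..
  note [measurable] = M(1,2)
  obtain B where B: "!!x. \<bar>?f x\<bar> <= B" by (rule that[OF smoothed_bound[OF s order_refl]])
  have i: "integrable (?P \<Otimes>\<^sub>M ?P) (%\<omega>. ?f (a (fst \<omega>) - b (snd \<omega>)))"
    if [measurable]: "a \<in> borel_measurable ?P" "b \<in> borel_measurable ?P" for a b
    by (rule PP.integrable_const_bound[of _ B]) (use B in auto)
  have v: "(\<integral>\<omega>. ?f (a (fst \<omega>) - b (snd \<omega>)) \<partial>(?P \<Otimes>\<^sub>M ?P)) = (\<integral>x. \<integral>y. ?f (x - y) \<partial>\<beta> \<partial>\<alpha>)"
    if ab[measurable]: "a \<in> borel_measurable ?P" "b \<in> borel_measurable ?P" and d: "distr ?P borel a = \<alpha>" "distr ?P borel b = \<beta>" for a b \<alpha> \<beta>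
  proof -
    interpret B: prob_space \<beta> unfolding d(2)[symmetric] by (rule P.prob_space_distr[OF ab(2)])
    have [measurable_cong]: "sets \<beta> = sets borel" unfolding d(2)[symmetric] by simp
    have in1: "(\<integral>\<omega>'. ?f (x - b \<omega>') \<partial>?P) = (\<integral>y. ?f (x - y) \<partial>\<beta>)" for x
      unfolding d(2)[symmetric] by (rule integral_distr[symmetric]) measurable
    have "(\<integral>\<omega>. ?f (a (fst \<omega>) - b (snd \<omega>)) \<partial>(?P \<Otimes>\<^sub>M ?P)) = (\<integral>\<omega>. \<integral>\<omega>'. ?f (a \<omega> - b \<omega>') \<partial>?P \<partial>?P)"
      using PP.integral_fst'[OF i[OF ab]] by simp
    also have "\<dots> = (\<integral>\<omega>. \<integral>y. ?f (a \<omega> - y) \<partial>\<beta> \<partial>?P)" unfolding in1 ..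
    also have "\<dots> = (\<integral>x. \<integral>y. ?f (x - y) \<partial>\<beta> \<partial>\<alpha>)"
    proof -
      have "(%x. \<integral>y. ?f (x - y) \<partial>\<beta>) \<in> borel_measurable borel" by measurable
      thus ?thesis unfolding d(1)[symmetric] by (rule integral_distr[OF ab(1), symmetric])
    qed
    finally show ?thesis .
  qed
  have e: "four_point fst snd ?f = (%\<omega>. ?f (fst (fst \<omega>) - fst (snd \<omega>)) - ?f (fst (fst \<omega>) - snd (snd \<omega>)) - ?f (snd (fst \<omega>) - fst (snd \<omega>)) + ?f (snd (fst \<omega>) - snd (snd \<omega>)))"
    by (simp add: four_point_def case_prod_unfold)
  note F = M(1) and S = M(2)
  have "interaction_gap ?P fst snd ?f = (\<integral>\<omega>. ?f (fst (fst \<omega>) - fst (snd \<omega>)) \<partial>(?P \<Otimes>\<^sub>M ?P)) - (\<integral>\<omega>. ?f (fst (fst \<omega>) - snd (snd \<omega>)) \<partial>(?P \<Otimes>\<^sub>M ?P))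
      - (\<integral>\<omega>. ?f (snd (fst \<omega>) - fst (snd \<omega>)) \<partial>(?P \<Otimes>\<^sub>M ?P)) + (\<integral>\<omega>. ?f (snd (fst \<omega>) - snd (snd \<omega>)) \<partial>(?P \<Otimes>\<^sub>M ?P))"
    unfolding interaction_gap_def e using i[OF F F] i[OF F S] i[OF S F] i[OF S S] by simp
  also have "\<dots> = enn2real (mutual (heated s) \<mu> \<mu>) - enn2real (mutual (heated s) \<nu> \<mu>)
    - enn2real (mutual (heated s) \<mu> \<nu>) + enn2real (mutual (heated s) \<nu> \<nu>)"
    unfolding v[OF F F M(4,4)] v[OF F S M(4,5)] v[OF S F M(5,4)] v[OF S S M(5,5)]
    using mutual_heated[OF s m(1) m(1)] mutual_heated[OF s m(1) m(2)] mutual_heated[OF s m(2) m(1)] mutual_heated[OF s m(2) m(2)] by simp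
  finally show ?thesis .
qed

text \<open>
Expand the gap at a small time into self and mixed energies and let the time tend to 0. A real number c below the mixed energy is used in place of the energy itself, because finiteness of the latter is one of the consequences.
\<close>

lemma gap_plus_mixed_energy_le:
  assumes m: "borel_prob \<mu>" "borel_prob \<nu>" and bd: "AE x in \<mu>. norm x < R" "AE x in \<nu>. norm x < R"
    and fin: "mutual k \<mu> \<mu> < \<infinity>" "mutual k \<nu> \<nu> < \<infinity>" and T: "0 < T" and c: "0 <= c" "ennreal c <= mutual k \<mu> \<nu>"
  shows "interaction_gap (\<mu> \<Otimes>\<^sub>M \<nu>) fst snd (smoothed T) + 2 * (gmass * c) <= gmass * (enn2real (mutual k \<mu> \<mu>) + enn2real (mutual k \<nu> \<nu>))"
proof (rule field_le_epsilon)
  fix e :: real assume e: "0 < e"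
  define s where "s j = T * inverse (real (Suc j))" for j
  have s0: "0 < s j" for j using T by (simp add: s_def)
  have sT: "s j <= T" for j using T by (simp add: s_def inverse_eq_divide divide_le_eq mult_le_cancel_left1)
  have sl: "s \<longlonglongrightarrow> 0" unfolding s_def using tendsto_mult_left[OF LIMSEQ_inverse_real_of_nat, of T] by simp
  have g: "0 < gmass" by (rule gmass_pos)
  have low: "eventually (%j. gmass * c - e/4 <= enn2real (mutual (heated (s j)) \<alpha> \<beta>)) sequentially"
    if ab: "borel_prob \<alpha>" "borel_prob \<beta>" and c': "ennreal c <= mutual k \<alpha> \<beta>" for \<alpha> \<beta>
  proof (cases "c = 0")
    case True
    have "gmass * c = 0" using True by simp
    hence "gmass * c - e/4 <= enn2real (mutual (heated (s j)) \<alpha> \<beta>)" for j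
      using e enn2real_nonneg[of "mutual (heated (s j)) \<alpha> \<beta>"] by linarith
    thus ?thesis by (simp add: always_eventually)
  next
    case False
    hence pos: "0 < gmass * c" using g c(1) by simp
    have "ennreal (gmass * c - e/4) < ennreal (gmass * c)" using e pos by (intro ennreal_lessI) auto
    also have "ennreal (gmass * c) = ennreal c * ennreal gmass" using c(1) g by (simp add: ennreal_mult mult.commute)
    also have "\<dots> <= mutual k \<alpha> \<beta> * ennreal gmass" by (intro mult_right_mono c') simp
    also have "\<dots> <= liminf (%j. mutual (heated (s j)) \<alpha> \<beta>)" by (rule mutual_heated_liminf[OF ab s0 sl])
    finally have "eventually (%j. ennreal (gmass * c - e/4) < mutual (heated (s j)) \<alpha> \<beta>) sequentially" by (rule less_LiminfD)
    thus ?thesis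
    proof eventually_elim
      case (elim j)
      show ?case
      proof (rule ccontr)
        assume "\<not> gmass * c - e/4 <= enn2real (mutual (heated (s j)) \<alpha> \<beta>)"
        hence "ennreal (enn2real (mutual (heated (s j)) \<alpha> \<beta>)) <= ennreal (gmass * c - e/4)" by (intro ennreal_leI) simp
        moreover have "ennreal (enn2real (mutual (heated (s j)) \<alpha> \<beta>)) = mutual (heated (s j)) \<alpha> \<beta>" using mutual_heated[OF s0 ab] by simp
        ultimately show False using elim by simp
      qed
    qed
  qed
  have upp: "eventually (%j. enn2real (mutual (heated (s j)) \<alpha> \<alpha>) <= gmass * enn2real (mutual k \<alpha> \<alpha>) + e/4) sequentially"
    if a: "borel_prob \<alpha>" and f: "mutual k \<alpha> \<alpha> < \<infinity>" and b: "AE x in \<alpha>. norm x < R" for \<alpha>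
  proof -
    have "limsup (%j. mutual (heated (s j)) \<alpha> \<alpha>) <= mutual k \<alpha> \<alpha> * ennreal gmass" by (rule mutual_heated_limsup[OF a a s0 sl f b b])
    also have "\<dots> = ennreal (gmass * enn2real (mutual k \<alpha> \<alpha>))" using f g by (simp add: ennreal_mult mult.commute less_top)
    also have "\<dots> < ennreal (gmass * enn2real (mutual k \<alpha> \<alpha>) + e/4)" using e g by (intro ennreal_lessI) (auto intro: add_nonneg_pos)
    finally have "eventually (%j. mutual (heated (s j)) \<alpha> \<alpha> < ennreal (gmass * enn2real (mutual k \<alpha> \<alpha>) + e/4)) sequentially" by (rule Limsup_lessD)
    thus ?thesis
    proof eventually_elim
      case (elim j)
      have "enn2real (mutual (heated (s j)) \<alpha> \<alpha>) <= enn2real (ennreal (gmass * enn2real (mutual k \<alpha> \<alpha>) + e/4))"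
        using elim by (intro enn2real_mono) auto
      moreover have "enn2real (ennreal (gmass * enn2real (mutual k \<alpha> \<alpha>) + e/4)) = gmass * enn2real (mutual k \<alpha> \<alpha>) + e/4"
        using e g by (intro enn2real_ennreal add_nonneg_nonneg mult_nonneg_nonneg) auto
      ultimately show ?case by simp
    qed
  qed
  have c'': "ennreal c <= mutual k \<nu> \<mu>"
    using c(2) mutual_sym[OF k_meas k_even borel_probD(3,2)[OF m(1)] borel_probD(3,2)[OF m(2)]] by simp
  have "eventually (%j. gmass * c - e/4 <= enn2real (mutual (heated (s j)) \<mu> \<nu>) & gmass * c - e/4 <= enn2real (mutual (heated (s j)) \<nu> \<mu>)
      & enn2real (mutual (heated (s j)) \<mu> \<mu>) <= gmass * enn2real (mutual k \<mu> \<mu>) + e/4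
      & enn2real (mutual (heated (s j)) \<nu> \<nu>) <= gmass * enn2real (mutual k \<nu> \<nu>) + e/4) sequentially"
    by (intro eventually_conj low[OF m c(2)] low[OF m(2,1) c''] upp[OF m(1) fin(1) bd(1)] upp[OF m(2) fin(2) bd(2)])
  then obtain j where j: "gmass * c - e/4 <= enn2real (mutual (heated (s j)) \<mu> \<nu>)" "gmass * c - e/4 <= enn2real (mutual (heated (s j)) \<nu> \<mu>)"
      "enn2real (mutual (heated (s j)) \<mu> \<mu>) <= gmass * enn2real (mutual k \<mu> \<mu>) + e/4"
      "enn2real (mutual (heated (s j)) \<nu> \<nu>) <= gmass * enn2real (mutual k \<nu> \<nu>) + e/4"
    by (auto simp: eventually_sequentially)
  have "interaction_gap (\<mu> \<Otimes>\<^sub>M \<nu>) fst snd (smoothed T) <= interaction_gap (\<mu> \<Otimes>\<^sub>M \<nu>) fst snd (smoothed (s j))"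
    by (rule D_smoothed_antimono[OF distr_marginals(3,1,2)[OF m] s0 sT])
  also have "\<dots> = enn2real (mutual (heated (s j)) \<mu> \<mu>) - enn2real (mutual (heated (s j)) \<nu> \<mu>)
    - enn2real (mutual (heated (s j)) \<mu> \<nu>) + enn2real (mutual (heated (s j)) \<nu> \<nu>)" by (rule D_as_mutual[OF s0 m])
  finally show "interaction_gap (\<mu> \<Otimes>\<^sub>M \<nu>) fst snd (smoothed T) + 2 * (gmass * c) <= gmass * (enn2real (mutual k \<mu> \<mu>) + enn2real (mutual k \<nu> \<nu>)) + e"
    using j by (simp add: distrib_left)
qed

text \<open>
Positivity of the gap gives finiteness of the mixed energy; if the energy of \<mu> - \<nu> is not positive, the gap vanishes at all times, which forces \<mu> = \<nu>.
\<close>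

theorem interaction_strictly_positive_definite:
  assumes m: "borel_prob \<mu>" "borel_prob \<nu>" and bd: "AE x in \<mu>. norm x < R" "AE x in \<nu>. norm x < R"
    and fin: "mutual k \<mu> \<mu> < \<infinity>" "mutual k \<nu> \<nu> < \<infinity>"
  shows "mutual k \<mu> \<nu> < \<infinity>"
    and "enn2real (mutual k \<mu> \<mu>) + enn2real (mutual k \<nu> \<nu>) <= 2 * enn2real (mutual k \<mu> \<nu>) ==> \<mu> = \<nu>"
proof -
  let ?E = "enn2real (mutual k \<mu> \<mu>) + enn2real (mutual k \<nu> \<nu>)"
  note Dn = D_smoothed_nonneg[OF distr_marginals(3,1,2)[OF m]]
  show f: "mutual k \<mu> \<nu> < \<infinity>"
  proof (rule ccontr)
    assume "\<not> mutual k \<mu> \<nu> < \<infinity>"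
    hence top: "mutual k \<mu> \<nu> = top" by (metis top.not_eq_extremum infinity_ennreal_def)
    \<comment> \<open>The gap inequality holds for all numbers below the mixed energy, here for one that is too large.\<close>
    have E: "0 <= ?E" by (simp add: enn2real_nonneg)
    have "interaction_gap (\<mu> \<Otimes>\<^sub>M \<nu>) fst snd (smoothed 1) + 2 * (gmass * (?E + 1)) <= gmass * ?E"
      by (rule gap_plus_mixed_energy_le[OF m bd fin]) (use E in \<open>auto simp: top\<close>)
    moreover have "gmass * ?E < 2 * (gmass * (?E + 1))" using gmass_pos E by (simp add: distrib_left add_pos_nonneg add_strict_increasing2)
    ultimately show False using Dn[of 1] by simp
  qed
  assume le: "?E <= 2 * enn2real (mutual k \<mu> \<nu>)"
  show "\<mu> = \<nu>"
  proof (rule D_smoothed_zero_imp_equal[OF m])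
    fix T :: real assume T: "0 < T"
    have "interaction_gap (\<mu> \<Otimes>\<^sub>M \<nu>) fst snd (smoothed T) + 2 * (gmass * enn2real (mutual k \<mu> \<nu>)) <= gmass * ?E"
      by (rule gap_plus_mixed_energy_le[OF m bd fin T]) (use f in \<open>auto simp: enn2real_nonneg less_top\<close>)
    moreover have "gmass * ?E <= gmass * (2 * enn2real (mutual k \<mu> \<nu>))" using le gmass_pos by (intro mult_left_mono) auto
    ultimately show "interaction_gap (\<mu> \<Otimes>\<^sub>M \<nu>) fst snd (smoothed T) = 0" using Dn[OF T] by simp
  qed
qed

end

section \<open>Minimizers in the presence of an attractive island\<close>

definition minimizes :: "('a::euclidean_space => ennreal) => ('a => real) => 'a set => 'a measure => bool" where
  "minimizes k U A \<mu> \<longleftrightarrow> borel_prob \<mu> & (AE x in \<mu>. x \<in> A) \<and>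
     (\<forall>\<sigma>. borel_prob \<sigma> --> (AE x in \<sigma>. x \<in> A) --> ext_energy k U \<mu> <= ext_energy k U \<sigma>)"

lemma minimizesD:
  assumes "minimizes k U A \<mu>"
  shows "borel_prob \<mu>" "AE x in \<mu>. x \<in> A"
    "borel_prob \<sigma> ==> AE x in \<sigma>. x \<in> A ==> ext_energy k U \<mu> <= ext_energy k U \<sigma>"
  using assms by (auto simp: minimizes_def)

lemma nn_integral_le_of_AE_le:
  assumes "borel_prob \<mu>" "AE x in \<mu>. g x <= c"
  shows "(\<integral>\<^sup>+x. g x \<partial>\<mu>) <= c"
proof -
  interpret prob_space \<mu> using assms(1) by (rule borel_probD)
  have "(\<integral>\<^sup>+x. g x \<partial>\<mu>) <= (\<integral>\<^sup>+x. c \<partial>\<mu>)" using assms(2) by (rule nn_integral_mono_AE)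
  thus ?thesis by (simp add: emeasure_space_1)
qed

text \<open>
The measure with density f is the reference configuration: on its support K the generated potential stays below the value of U at infinity by the margin e, so it is favourable to bring mass from infinity to K.
\<close>

locale attractive_island = kernel k for k :: "'a::euclidean_space => ennreal" +
  fixes U :: "'a => real" and B Uinf e :: real and K D :: "'a set" and f :: "'a => real"
  assumes U_cont: "continuous_on UNIV U" and U_bd: "!!x. \<bar>U x\<bar> <= B" and U_lim: "(U \<longlongrightarrow> Uinf) at_infinity"
    and e: "0 < e" and K: "compact K" and KD: "K \<subseteq> D" and D: "closed D"
    and f_meas: "f \<in> borel_measurable borel" and \<rho>: "borel_prob (dens f)" "AE x in dens f. x \<in> K"
    and island: "!!x. x \<in> K ==> pot k (dens f) x < \<infinity>" "!!x. x \<in> K ==> enn2real (pot k (dens f) x) + U x <= Uinf - e"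
    and pos_def: "!!\<mu> \<nu> R. borel_prob \<mu> ==> borel_prob \<nu> ==> AE x in \<mu>. norm x < R ==> AE x in \<nu>. norm x < R ==>
      mutual k \<mu> \<mu> < \<infinity> ==> mutual k \<nu> \<nu> < \<infinity> ==> mutual k \<mu> \<nu> < \<infinity>"
      "!!\<mu> \<nu> R. borel_prob \<mu> ==> borel_prob \<nu> ==> AE x in \<mu>. norm x < R ==> AE x in \<nu>. norm x < R ==>
      mutual k \<mu> \<mu> < \<infinity> ==> mutual k \<nu> \<nu> < \<infinity> ==>
      enn2real (mutual k \<mu> \<mu>) + enn2real (mutual k \<nu> \<nu>) <= 2 * enn2real (mutual k \<mu> \<nu>) ==> \<mu> = \<nu>"
begin

lemma U_meas[measurable]: "U \<in> borel_measurable borel"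
  using U_cont by (rule borel_measurable_continuous_onI)

lemma K_borel: "K \<in> sets borel" using K by (simp add: borel_closed compact_imp_closed)

lemma U_integrable: "borel_prob \<mu> ==> integrable \<mu> U"
proof -
  assume m: "borel_prob \<mu>"
  interpret prob_space \<mu> using m by (rule borel_probD)
  show ?thesis by (rule integrable_const_bound[of _ B]) (use U_bd borel_prob_meas[OF m U_meas] in auto)
qed

definition M :: real where "M = max 1 (Uinf - e + B)"

lemma M: "1 <= M" by (simp add: M_def)

lemma pot_le_M: "x \<in> K ==> pot k (dens f) x <= ennreal M"
proof -
  assume x: "x \<in> K"
  have "enn2real (pot k (dens f) x) <= M" using island(2)[OF x] U_bd[of x] unfolding M_def by linarith
  hence "ennreal (enn2real (pot k (dens f) x)) <= ennreal M" by (rule ennreal_leI)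
  thus ?thesis using island(1)[OF x] by (simp add: less_top)
qed

lemma mutual_self_finite: "mutual k (dens f) (dens f) < \<infinity>"
proof -
  have "AE x in dens f. pot k (dens f) x <= ennreal M" using \<rho>(2) by eventually_elim (rule pot_le_M)
  hence "mutual k (dens f) (dens f) <= ennreal M" unfolding mutual_def by (rule nn_integral_le_of_AE_le[OF \<rho>(1)])
  thus ?thesis by (rule le_less_trans) simp
qed

lemma minimizer_finite:
  assumes m: "minimizes k U A \<mu>" and A: "K \<subseteq> A"
  shows "mutual k \<mu> \<mu> < \<infinity>"
proof (rule ccontr)
  assume "\<not> mutual k \<mu> \<mu> < \<infinity>"
  hence "ext_energy k U \<mu> = \<infinity>" by (intro ext_energy_infinite) (metis top.not_eq_extremum infinity_ennreal_def)
  moreover have "AE x in dens f. x \<in> A" using \<rho>(2) by eventually_elim (use A in blast)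
  ultimately show False using minimizesD(3)[OF m \<rho>(1)] by (simp add: ext_energy_real[OF mutual_self_finite])
qed

text \<open>
The approximate equilibrium density scaled to mass one, with m its mass before scaling.
\<close>

lemma normalized_equilibrium:
  assumes \<kappa>: "0 < \<kappa>" "\<kappa> <= 1/2"
  obtains \<eta> m where "borel_prob \<eta>" "AE x in \<eta>. x \<in> K" "0 < m" "!!x. pot k \<eta> x <= ennreal ((1 + \<kappa>) / m)"
    "ennreal ((1 - \<kappa>) / m) <= mutual k \<eta> (dens f)"
proof -
  note [measurable] = f_meas
  have "(\<integral>\<^sup>+x\<in>K. ennreal (f x) \<partial>lborel) = emeasure (dens f) K" using K_borel by (subst emeasure_density) auto
  also have "\<dots> = 1"
  proof -
    interpret prob_space "dens f" by (rule borel_probD(1)[OF \<rho>(1)])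
    show ?thesis using \<rho>(2) K_borel by (intro emeasure_eq_1_AE) auto
  qed
  finally have f1: "(\<integral>\<^sup>+x\<in>K. ennreal (f x) \<partial>lborel) = 1" .
  obtain h Bh where h: "density_on Bh K h" "!!x. pot k (dens h) x <= ennreal (1 + \<kappa>)"
    "1 <= (\<integral>\<^sup>+x. pot k (dens h) x * ennreal (f x) \<partial>lborel) + ennreal \<kappa>"
    by (rule approximate_equilibrium[OF K f_meas f1 \<kappa>(1)]) (use \<kappa> in simp, rule that)
  note hD = density_onD[OF h(1)]
  note [measurable] = hD(1)
  define I where "I = (\<integral>\<^sup>+x. ennreal (h x) \<partial>lborel)"
  have "I <= (\<integral>\<^sup>+x. ennreal Bh * indicator K x \<partial>lborel)"
    unfolding I_def by (intro nn_integral_mono) (auto simp: indicator_def hD(4) intro!: ennreal_leI hD(3))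
  also have "\<dots> = ennreal Bh * emeasure lborel K" using K_borel by (intro nn_integral_cmult_indicator) simp
  also have "\<dots> < \<infinity>" using emeasure_bounded_finite[OF compact_imp_bounded[OF K]] by (simp add: ennreal_mult_less_top)
  finally have If: "I < \<infinity>" .
  have I0: "I ~= 0"
  proof
    assume "I = 0"
    hence z: "AE x in lborel. ennreal (h x) = 0" unfolding I_def by (subst (asm) nn_integral_0_iff_AE) auto
    have "pot k (dens h) x = 0" for x
    proof -
      have "AE y in lborel. ennreal (h y) * k (x - y) = 0" using z by eventually_elim simp
      thus ?thesis by (subst pot_dens) (auto simp: nn_integral_0_iff_AE)
    qed
    hence "1 <= ennreal \<kappa>" using h(3) by simp
    thus False using \<kappa> by (simp add: ennreal_ge_1)
  qed
  define m where "m = enn2real I"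
  have Im: "I = ennreal m" using If by (simp add: m_def less_top)
  have m: "0 < m" using I0 If by (simp add: m_def enn2real_positive_iff less_top zero_less_iff_neq_zero)
  let ?\<eta> = "dens (%x. h x / m)"
  have hm: "ennreal (h x / m) = ennreal (1 / m) * ennreal (h x)" for x
    using m hD(2)[of x] by (simp flip: ennreal_mult)
  have pot\<eta>: "pot k ?\<eta> x = ennreal (1 / m) * pot k (dens h) x" for x
  proof -
    have "pot k ?\<eta> x = (\<integral>\<^sup>+y. ennreal (1/m) * (ennreal (h y) * k (x - y)) \<partial>lborel)"
      by (subst pot_dens) (auto simp: hm mult.assoc)
    also have "\<dots> = ennreal (1/m) * pot k (dens h) x" by (subst nn_integral_cmult) (auto simp: pot_dens)
    finally show ?thesis .
  qed
  have "emeasure ?\<eta> (space ?\<eta>) = (\<integral>\<^sup>+x. ennreal (1 / m) * ennreal (h x) \<partial>lborel)" by (subst emeasure_density) (auto simp: hm)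
  also have "\<dots> = ennreal (1/m) * ennreal m" unfolding Im[symmetric] I_def by (rule nn_integral_cmult) measurable
  also have "\<dots> = 1" using m by (simp flip: ennreal_mult)
  finally have \<eta>: "borel_prob ?\<eta>" unfolding borel_prob_def by (auto intro: prob_spaceI)
  moreover have "AE x in ?\<eta>. x \<in> K"
  proof -
    have meas: "(%x. ennreal (h x / m)) \<in> borel_measurable lborel" by measurable
    have "0 < ennreal (h x / m) --> x \<in> K" for x using hD(4)[of x] by (cases "x \<in> K") auto
    thus ?thesis unfolding AE_density[OF meas] by (rule AE_I2)
  qed
  moreover have "pot k ?\<eta> x <= ennreal ((1 + \<kappa>) / m)" for x
  proof -
    have "ennreal (1/m) * pot k (dens h) x <= ennreal (1/m) * ennreal (1 + \<kappa>)" by (intro mult_left_mono h(2)) simp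
    also have "\<dots> = ennreal ((1 + \<kappa>) / m)" using m \<kappa> by (subst ennreal_mult[symmetric]) simp_all
    finally show ?thesis unfolding pot\<eta> .
  qed
  moreover have "ennreal ((1 - \<kappa>) / m) <= mutual k ?\<eta> (dens f)"
  proof -
    have pm: "pot k (dens h) \<in> borel_measurable borel"
    proof -
      have "(%x. ennreal m * pot k ?\<eta> x) \<in> borel_measurable borel"
        by (intro borel_measurable_times_ennreal borel_measurable_const pot_measurable[OF k_meas borel_probD(3,2)[OF \<eta>]])
      moreover have "ennreal m * pot k ?\<eta> x = pot k (dens h) x" for x
      proof -
        have "ennreal m * ennreal (1 / m) = 1" using m by (simp flip: ennreal_mult)
        thus ?thesis unfolding pot\<eta> mult.assoc[symmetric] by simp
      qed
      ultimately show ?thesis by simp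
    qed
    note [measurable] = pm
    have "ennreal (1 - \<kappa>) <= (\<integral>\<^sup>+x. pot k (dens h) x * ennreal (f x) \<partial>lborel)"
    proof -
      have "ennreal (1 - \<kappa>) + ennreal \<kappa> = ennreal 1" using \<kappa> by (subst ennreal_plus[symmetric]) simp_all
      hence "ennreal (1 - \<kappa>) + ennreal \<kappa> <= (\<integral>\<^sup>+x. pot k (dens h) x * ennreal (f x) \<partial>lborel) + ennreal \<kappa>"
        using h(3) by simp
      thus ?thesis unfolding add.commute[of _ "ennreal \<kappa>"] ennreal_add_left_cancel_le by simp
    qed
    hence fl: "ennreal (1 - \<kappa>) <= (\<integral>\<^sup>+x. ennreal (f x) * pot k (dens h) x \<partial>lborel)" by (simp only: mult.commute)
    have "ennreal ((1 - \<kappa>) / m) = ennreal (1/m) * ennreal (1 - \<kappa>)" using m \<kappa> by (subst ennreal_mult[symmetric]) simp_all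
    also have "\<dots> <= ennreal (1/m) * (\<integral>\<^sup>+x. ennreal (f x) * pot k (dens h) x \<partial>lborel)"
      by (rule mult_left_mono[OF fl]) simp
    also have "\<dots> = (\<integral>\<^sup>+x. ennreal (1/m) * (ennreal (f x) * pot k (dens h) x) \<partial>lborel)"
      by (rule nn_integral_cmult[symmetric]) measurable
    also have "\<dots> = (\<integral>\<^sup>+x. ennreal (f x) * pot k ?\<eta> x \<partial>lborel)"
      unfolding pot\<eta> by (simp only: mult.left_commute)
    also have "\<dots> = mutual k ?\<eta> (dens f)"
    proof -
      have "pot k ?\<eta> \<in> borel_measurable lborel" using pot_measurable[OF k_meas borel_probD(3,2)[OF \<eta>]] by simp
      moreover have "(%x. ennreal (f x)) \<in> borel_measurable lborel" by measurable
      ultimately show ?thesis unfolding mutual_def by (simp add: nn_integral_density)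
    qed
    finally show ?thesis .
  qed
  ultimately show thesis using m by (intro that[of ?\<eta> m])
qed

text \<open>
Compare \<mu> with an approximate equilibrium measure \<eta> of K. The potential of \<eta> is nearly the constant 1 / m, at most everywhere and at least in the mean over the reference measure. Hence the mean over \<eta> of the potential of \<mu> exceeds that of the reference potential by at most 2 \<kappa> / m, and the latter together with U is at most Uinf - e. The choice of \<kappa> makes the excess smaller than e / 2.
\<close>

lemma minimizer_constant_bound:
  assumes min: "minimizes k U A \<mu>" and A: "K \<subseteq> A" "A \<in> sets borel"
  shows "enn2real (mutual k \<mu> \<mu>) + (\<integral>x. U x \<partial>\<mu>) <= Uinf - e/2"
proof -
  \<comment> \<open>M bounds the reference potential on K, which gives 1/m <= 2 M and hence an excess of at most 4 \<kappa> M.\<close>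
  define \<kappa> where "\<kappa> = min (1/2) (e / (8 * M))"
  have \<kappa>: "0 < \<kappa>" "\<kappa> <= 1/2" "\<kappa> <= e / (8 * M)" using e M by (auto simp: \<kappa>_def)
  obtain \<eta> m where \<eta>: "borel_prob \<eta>" "AE x in \<eta>. x \<in> K" and m: "0 < m" and up: "!!x. pot k \<eta> x <= ennreal ((1 + \<kappa>) / m)"
    and lo: "ennreal ((1 - \<kappa>) / m) <= mutual k \<eta> (dens f)"
    by (rule normalized_equilibrium[OF \<kappa>(1,2)]) (rule that)
  note \<mu> = minimizesD(1,2)[OF min]
  have sym: "mutual k \<alpha> \<beta> = mutual k \<beta> \<alpha>" if "borel_prob \<alpha>" "borel_prob \<beta>" for \<alpha> \<beta>
    using that by (intro mutual_sym k_meas k_even borel_probD)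
  have mu: "mutual k \<eta> \<beta> <= ennreal ((1 + \<kappa>) / m)" if "borel_prob \<beta>" for \<beta>
    unfolding mutual_def by (rule nn_integral_le_of_AE_le[OF that]) (simp add: up)
  have \<mu>\<eta>: "mutual k \<mu> \<eta> <= ennreal ((1 + \<kappa>) / m)" using mu[OF \<mu>(1)] sym[OF \<mu>(1) \<eta>(1)] by simp
  have "enn2real (mutual k \<mu> \<mu>) + (\<integral>x. U x \<partial>\<mu>) <= enn2real (mutual k \<mu> \<eta>) + (\<integral>x. U x \<partial>\<eta>)"
  proof (rule minimizer_first_variation[OF k_meas k_even U_meas U_bd \<mu>(1) \<eta>(1) minimizer_finite[OF min A(1)]])
    show "mutual k \<eta> \<eta> < \<infinity>" by (rule le_less_trans[OF mu[OF \<eta>(1)]]) simp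
    show "mutual k \<mu> \<eta> < \<infinity>" by (rule le_less_trans[OF \<mu>\<eta>]) simp
    fix t :: real assume t: "0 < t" "t < 1"
    have "AE x in \<eta>. x \<in> A" using \<eta>(2) by eventually_elim (use A in blast)
    thus "ext_energy k U \<mu> <= ext_energy k U (mixture t \<mu> \<eta>)"
      using t by (intro minimizesD(3)[OF min] borel_prob_mixture AE_mixture \<mu> \<eta>(1) A(2)) auto
  qed
  moreover have "enn2real (mutual k \<mu> \<eta>) <= (1 + \<kappa>) / m"
    using enn2real_mono[OF \<mu>\<eta>] m \<kappa> by simp
  moreover
  define r where "r = enn2real (mutual k (dens f) \<eta>)"
  have fM: "mutual k (dens f) \<eta> <= ennreal M" unfolding mutual_def
    by (rule nn_integral_le_of_AE_le[OF \<eta>(1)]) (use \<eta>(2) in eventually_elim, rule pot_le_M)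
  have re: "mutual k (dens f) \<eta> = ennreal r" unfolding r_def using le_less_trans[OF fM] by (simp add: less_top)
  have r: "r <= M" "0 <= r" using enn2real_mono[OF fM] M by (auto simp: r_def)
  have rl: "(1 - \<kappa>) / m <= r" using lo r(2) unfolding sym[OF \<eta>(1) \<rho>(1)] re by (simp add: ennreal_le_iff)
  have "(\<integral>x. U x \<partial>\<eta>) <= Uinf - e - r"
  proof -
    interpret \<eta>: prob_space \<eta> using \<eta>(1) by (rule borel_probD)
    have pm: "pot k (dens f) \<in> borel_measurable \<eta>"
      by (rule borel_prob_meas[OF \<eta>(1) pot_measurable[OF k_meas borel_probD(3,2)[OF \<rho>(1)]]])
    have ip: "integrable \<eta> (%x. enn2real (pot k (dens f) x))"
    proof (rule \<eta>.integrable_const_bound[of _ M])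
      show "AE x in \<eta>. norm (enn2real (pot k (dens f) x)) <= M" using \<eta>(2)
      proof eventually_elim
        case (elim x) thus ?case using enn2real_mono[OF pot_le_M[OF elim]] M by simp
      qed
    qed (use pm in measurable)
    have "ennreal (\<integral>x. enn2real (pot k (dens f) x) \<partial>\<eta>) = (\<integral>\<^sup>+x. ennreal (enn2real (pot k (dens f) x)) \<partial>\<eta>)"
      by (rule nn_integral_eq_integral[OF ip, symmetric]) simp
    also have "\<dots> = ennreal r" unfolding re[symmetric] mutual_def
    proof (rule nn_integral_cong_AE)
      show "AE x in \<eta>. ennreal (enn2real (pot k (dens f) x)) = pot k (dens f) x" using \<eta>(2)
        by eventually_elim (use island(1) in \<open>simp add: less_top\<close>)
    qed
    finally have ir: "(\<integral>x. enn2real (pot k (dens f) x) \<partial>\<eta>) = r" using r(2) by (simp add: Bochner_Integration.integral_nonneg)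
    have "(\<integral>x. U x \<partial>\<eta>) <= (\<integral>x. (Uinf - e) - enn2real (pot k (dens f) x) \<partial>\<eta>)"
    proof (rule integral_mono_AE[OF U_integrable[OF \<eta>(1)]])
      show "AE x in \<eta>. U x <= (Uinf - e) - enn2real (pot k (dens f) x)" using \<eta>(2)
        by eventually_elim (use island(2) in \<open>simp add: algebra_simps\<close>)
    qed (use ip in simp)
    also have "\<dots> = Uinf - e - r" using ip by (simp add: ir \<eta>.prob_space)
    finally show ?thesis .
  qed
  moreover have "2 * \<kappa> / m <= e / 2"
  proof -
    have "1 / 2 <= 1 - \<kappa>" using \<kappa> by simp
    hence "(1/2) / m <= (1 - \<kappa>) / m" using m by (intro divide_right_mono) auto
    hence "1 / m <= 2 * M" using rl r(1) by simp
    hence "2 * \<kappa> * (1 / m) <= 2 * \<kappa> * (2 * M)" using \<kappa> by (intro mult_left_mono) auto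
    also have "\<dots> <= 2 * (e / (8 * M)) * (2 * M)" using \<kappa> M by (intro mult_right_mono mult_left_mono) auto
    also have "\<dots> = e / 2" using M by simp
    finally show ?thesis by simp
  qed
  moreover have "(1 + \<kappa>) / m - (1 - \<kappa>) / m = 2 * \<kappa> / m" by (simp flip: diff_divide_distrib)
  ultimately show ?thesis using rl by linarith
qed

text \<open>
Almost everywhere U is at most Uinf - e/2, which fails near infinity. The radius is the same for minimizers over all domains containing K.
\<close>

lemma minimizers_uniformly_bounded:
  obtains R where "!!A \<mu>. minimizes k U A \<mu> ==> K \<subseteq> A ==> A \<in> sets borel ==> AE x in \<mu>. norm x < R"
proof -
  have "eventually (%x. Uinf - e/2 < U x) at_infinity" by (rule order_tendstoD(1)[OF U_lim]) (use e in simp)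
  then obtain R where R: "!!x. R <= norm x ==> Uinf - e/2 < U x" by (auto simp: eventually_at_infinity)
  have "AE x in \<mu>. norm x < R" if min: "minimizes k U A \<mu>" and A: "K \<subseteq> A" "A \<in> sets borel" for A \<mu>
  proof -
    have "AE x in \<mu>. U x <= enn2real (mutual k \<mu> \<mu>) + (\<integral>x. U x \<partial>\<mu>)"
      by (rule minimizer_external_potential_bound[OF k_meas k_even U_meas U_bd A(2) minimizesD(1,2)[OF min] minimizer_finite[OF min A(1)]])
        (rule minimizesD(3)[OF min])
    thus ?thesis
    proof eventually_elim
      case (elim x)
      hence "U x <= Uinf - e/2" using minimizer_constant_bound[OF min A] by linarith
      thus ?case using R[of x] by (meson not_le)
    qed
  qed
  thus thesis by (rule that)
qed

text \<open>
Conditioning on a ball of measure t multiplies the interaction energy by at most t^(-2); the external energy is compared after adding B to make U nonnegative.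
\<close>

lemma energy_truncation:
  assumes \<sigma>: "borel_prob \<sigma>" and fin: "mutual k \<sigma> \<sigma> < \<infinity>" and t: "0 < measure \<sigma> (cball 0 R)"
  defines "\<tau> \<equiv> uniform_measure \<sigma> (cball 0 R)" and "t \<equiv> measure \<sigma> (cball 0 R)"
  shows "borel_prob \<tau>" "AE x in \<sigma>. x \<in> A ==> AE x in \<tau>. x \<in> A \<inter> cball 0 R"
    and "ext_energy k U \<tau> <= ereal (enn2real (mutual k \<sigma> \<sigma>) / t / t / 2 + (((\<integral>x. U x \<partial>\<sigma>) + B) / t - B))"
proof -
  interpret prob_space \<sigma> using \<sigma> by (rule borel_probD)
  note [measurable_cong] = borel_probD(2)[OF \<sigma>]
  let ?Q = "cball (0::'a) R"
  have [measurable]: "?Q \<in> sets borel" by simp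
  have Q: "?Q \<in> sets \<sigma>" using borel_probD(2)[OF \<sigma>] by simp
  have t0: "0 < t" using t by (simp add: t_def)
  have et: "emeasure \<sigma> ?Q = ennreal t" by (simp add: t_def emeasure_eq_measure)
  have ne: "emeasure \<sigma> ?Q ~= 0" "emeasure \<sigma> ?Q ~= \<infinity>" using t0 by (auto simp: et)
  show bp: "borel_prob \<tau>" unfolding borel_prob_def \<tau>_def using prob_space_uniform_measure[OF ne] borel_probD(2)[OF \<sigma>] by simp
  show "AE x in \<tau>. x \<in> A \<inter> cball 0 R" if "AE x in \<sigma>. x \<in> A"
    unfolding \<tau>_def using that ne Q by (intro AE_uniform_measureI) auto
  have nn: "(\<integral>\<^sup>+x. g x \<partial>\<tau>) <= ennreal (1 / t) * (\<integral>\<^sup>+x. g x \<partial>\<sigma>)" if g: "g \<in> borel_measurable borel" for g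
  proof -
    have "(\<integral>\<^sup>+x. g x \<partial>\<tau>) = (\<integral>\<^sup>+x. g x * indicator ?Q x \<partial>\<sigma>) / ennreal t"
      unfolding \<tau>_def using nn_integral_uniform_measure[OF borel_prob_meas[OF \<sigma> g] Q] by (simp add: et)
    also have "\<dots> <= (\<integral>\<^sup>+x. g x \<partial>\<sigma>) / ennreal t" by (intro divide_right_mono_ennreal nn_integral_mono) (simp add: indicator_def)
    also have "\<dots> = ennreal (1 / t) * (\<integral>\<^sup>+x. g x \<partial>\<sigma>)"
      using t0 by (simp add: divide_ennreal_def inverse_ennreal inverse_eq_divide mult.commute)
    finally show ?thesis .
  qed
  have pm: "pot k \<alpha> \<in> borel_measurable borel" if "borel_prob \<alpha>" for \<alpha> using that by (intro pot_measurable k_meas borel_probD)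
  have "mutual k \<tau> \<tau> <= ennreal (1/t) * (\<integral>\<^sup>+x. pot k \<tau> x \<partial>\<sigma>)" unfolding mutual_def by (rule nn[OF pm[OF bp]])
  also have "\<dots> <= ennreal (1/t) * (\<integral>\<^sup>+x. ennreal (1/t) * pot k \<sigma> x \<partial>\<sigma>)"
    by (intro mult_left_mono nn_integral_mono) (auto simp: pot_def intro!: nn)
  also have "\<dots> = ennreal (1/t) * (ennreal (1/t) * mutual k \<sigma> \<sigma>)"
    unfolding mutual_def by (subst nn_integral_cmult) (auto intro: borel_prob_meas[OF \<sigma> pm[OF \<sigma>]])
  also have "\<dots> = ennreal (1/t) * (ennreal (1/t) * ennreal (enn2real (mutual k \<sigma> \<sigma>)))" using fin by (simp add: less_top)
  also have "\<dots> = ennreal (enn2real (mutual k \<sigma> \<sigma>) / t / t)" using t0 by (simp flip: ennreal_mult add: divide_simps)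
  finally have mt: "mutual k \<tau> \<tau> <= ennreal (enn2real (mutual k \<sigma> \<sigma>) / t / t)" .
  have mtf: "mutual k \<tau> \<tau> < \<infinity>" by (rule le_less_trans[OF mt]) simp
  have mr: "enn2real (mutual k \<tau> \<tau>) <= enn2real (mutual k \<sigma> \<sigma>) / t / t" using enn2real_mono[OF mt] t0 by simp
  have sh: "(\<integral>\<^sup>+x. ennreal (U x + B) \<partial>\<alpha>) = ennreal ((\<integral>x. U x \<partial>\<alpha>) + B)" "0 <= (\<integral>x. U x \<partial>\<alpha>) + B" if a: "borel_prob \<alpha>" for \<alpha>
  proof -
    interpret a: prob_space \<alpha> using a by (rule borel_probD)
    have n: "0 <= U x + B" for x using U_bd[of x] by linarith
    have i: "(\<integral>x. U x + B \<partial>\<alpha>) = (\<integral>x. U x \<partial>\<alpha>) + B" using U_integrable[OF a] by (simp add: a.prob_space)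
    show "(\<integral>\<^sup>+x. ennreal (U x + B) \<partial>\<alpha>) = ennreal ((\<integral>x. U x \<partial>\<alpha>) + B)"
      unfolding i[symmetric] using U_integrable[OF a] n by (intro nn_integral_eq_integral) auto
    show "0 <= (\<integral>x. U x \<partial>\<alpha>) + B" unfolding i[symmetric] using n by (intro Bochner_Integration.integral_nonneg)
  qed
  have "ennreal ((\<integral>x. U x \<partial>\<tau>) + B) <= ennreal (1/t) * ennreal ((\<integral>x. U x \<partial>\<sigma>) + B)"
    unfolding sh(1)[OF bp, symmetric] sh(1)[OF \<sigma>, symmetric] by (rule nn) measurable
  also have "\<dots> = ennreal (((\<integral>x. U x \<partial>\<sigma>) + B) / t)" using t0 sh(2)[OF \<sigma>] by (simp flip: ennreal_mult)
  finally have "(\<integral>x. U x \<partial>\<tau>) + B <= ((\<integral>x. U x \<partial>\<sigma>) + B) / t" using t0 sh(2)[OF \<sigma>] by (subst (asm) ennreal_le_iff) auto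
  thus "ext_energy k U \<tau> <= ereal (enn2real (mutual k \<sigma> \<sigma>) / t / t / 2 + (((\<integral>x. U x \<partial>\<sigma>) + B) / t - B))"
    unfolding ext_energy_real[OF mtf] using mr by simp
qed

text \<open>
A minimizer over the part of D in a ball does not see the radius of the ball once this is large, because its support stays bounded. It therefore beats all competitors with bounded support, and by truncation all others.
\<close>

theorem minimizer_exists: "\<exists>\<mu>. minimizes k U D \<mu>"
proof -
  obtain R0 where R0: "!!A \<mu>. minimizes k U A \<mu> ==> K \<subseteq> A ==> A \<in> sets borel ==> AE x in \<mu>. norm x < R0"
    by (rule minimizers_uniformly_bounded) (rule that)
  obtain RK where RK: "!!x. x \<in> K ==> norm x <= RK" using compact_imp_bounded[OF K] by (auto simp: bounded_iff)
  define R1 where "R1 = max R0 RK"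
  define A where "A R = D \<inter> cball 0 R" for R
  have KA: "K \<subseteq> A R" if "R1 <= R" for R using that KD RK by (force simp: A_def R1_def)
  have Ab: "A R \<in> sets borel" for R using D by (simp add: A_def borel_closed)
  have ne: "K ~= {}"
  proof
    assume "K = {}"
    hence "AE x in dens f. False" using \<rho>(2) by simp
    thus False using prob_space.AE_False[OF borel_probD(1)[OF \<rho>(1)]] by simp
  qed
  have ex: "\<exists>\<mu>. minimizes k U (A R) \<mu>" if R: "R1 <= R" for R
    using energy_minimizer_on_compact_exists[OF _ _ k_cont U_cont, of "A R"] KA[OF R] ne D
    unfolding minimizes_def by (auto simp: A_def closed_Int_compact)
  obtain \<mu> where \<mu>: "minimizes k U (A R1) \<mu>" using ex[of R1] by blast
  have mf: "mutual k \<mu> \<mu> < \<infinity>" by (rule minimizer_finite[OF \<mu> KA]) simp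
  have bounded_case: "ext_energy k U \<mu> <= ext_energy k U \<sigma>" if \<sigma>: "borel_prob \<sigma>" "AE x in \<sigma>. x \<in> A R" and R: "R1 <= R" for \<sigma> R
  proof -
    obtain \<nu> where \<nu>: "minimizes k U (A R) \<nu>" using ex[OF R] by blast
    have "AE x in \<nu>. x \<in> A R1" using R0[OF \<nu> KA[OF R] Ab] minimizesD(2)[OF \<nu>]
      by eventually_elim (auto simp: A_def R1_def)
    hence "ext_energy k U \<mu> <= ext_energy k U \<nu>" by (rule minimizesD(3)[OF \<mu> minimizesD(1)[OF \<nu>]])
    also have "\<dots> <= ext_energy k U \<sigma>" by (rule minimizesD(3)[OF \<nu> \<sigma>])
    finally show ?thesis .
  qed
  have "ext_energy k U \<mu> <= ext_energy k U \<sigma>" if \<sigma>: "borel_prob \<sigma>" "AE x in \<sigma>. x \<in> D" for \<sigma>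
  proof (cases "mutual k \<sigma> \<sigma> < \<infinity>")
    case False
    hence "ext_energy k U \<sigma> = \<infinity>" by (intro ext_energy_infinite) (metis top.not_eq_extremum infinity_ennreal_def)
    thus ?thesis by simp
  next
    case fin: True
    interpret prob_space \<sigma> using \<sigma>(1) by (rule borel_probD)
    define t where "t n = measure \<sigma> (cball 0 (real n))" for n :: nat
    have "(%n. measure \<sigma> (cball 0 (real n))) \<longlonglongrightarrow> measure \<sigma> (\<Union>n. cball 0 (real n))"
    proof (rule finite_Lim_measure_incseq)
      show "range (%n. cball 0 (real n)) \<subseteq> sets \<sigma>" unfolding borel_probD(2)[OF \<sigma>(1)] by auto
      show "incseq (%n. cball (0::'a) (real n))" by (intro incseq_SucI subset_cball) simp
    qed
    moreover have "(\<Union>n. cball 0 (real n)) = (UNIV :: 'a set)"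
    proof -
      have "\<exists>n. x \<in> cball 0 (real n)" for x :: 'a
      proof -
        obtain n where "norm x <= real n" using real_arch_simple by blast
        thus ?thesis by (intro exI[of _ n]) simp
      qed
      thus ?thesis by blast
    qed
    moreover have "measure \<sigma> UNIV = 1" using prob_space unfolding borel_probD(4)[OF \<sigma>(1)] .
    ultimately have tl: "t \<longlonglongrightarrow> 1" unfolding t_def[abs_def] by simp
    define c u where "c = enn2real (mutual k \<sigma> \<sigma>)" and "u = (\<integral>x. U x \<partial>\<sigma>)"
    have lim: "(%n. c / t n / t n / 2 + ((u + B) / t n - B)) \<longlonglongrightarrow> c / 1 / 1 / 2 + ((u + B) / 1 - B)"
      by (intro tendsto_intros tl) auto
    have "eventually (%n. 0 < t n) sequentially" using tl by (intro order_tendstoD(1)) auto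
    moreover have "eventually (%n. nat \<lceil>R1\<rceil> <= n) sequentially" by (rule eventually_ge_at_top)
    ultimately have "eventually (%n. enn2real (mutual k \<mu> \<mu>) / 2 + (\<integral>x. U x \<partial>\<mu>) <= c / t n / t n / 2 + ((u + B) / t n - B)) sequentially"
    proof eventually_elim
      case (elim n)
      hence R: "R1 <= real n" by linarith
      note E = energy_truncation[OF \<sigma>(1) fin elim(1)[unfolded t_def]]
      have "ext_energy k U \<mu> <= ext_energy k U (uniform_measure \<sigma> (cball 0 (real n)))"
        by (rule bounded_case[OF E(1) _ R]) (use E(2)[OF \<sigma>(2)] in \<open>simp add: A_def\<close>)
      also note E(3)
      finally show ?case unfolding ext_energy_real[OF mf] by (simp add: t_def c_def u_def)
    qed
    hence "enn2real (mutual k \<mu> \<mu>) / 2 + (\<integral>x. U x \<partial>\<mu>) <= c / 1 / 1 / 2 + ((u + B) / 1 - B)"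
      by (intro tendsto_lowerbound[OF lim]) auto
    thus ?thesis unfolding ext_energy_real[OF mf] ext_energy_real[OF fin] by (simp add: c_def u_def)
  qed
  moreover have "AE x in \<mu>. x \<in> D" using minimizesD(2)[OF \<mu>] by eventually_elim (simp add: A_def)
  ultimately show ?thesis using minimizesD(1)[OF \<mu>] unfolding minimizes_def by blast
qed

text \<open>
The midpoint of two minimizers has an energy below the average of theirs, by the energy of their difference; so this must vanish.
\<close>

theorem minimizer_unique:
  assumes \<mu>: "minimizes k U D \<mu>" and \<nu>: "minimizes k U D \<nu>"
  shows "\<mu> = \<nu>"
proof -
  obtain R where R: "!!A \<mu>. minimizes k U A \<mu> ==> K \<subseteq> A ==> A \<in> sets borel ==> AE x in \<mu>. norm x < R"
    by (rule minimizers_uniformly_bounded) (rule that)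
  have Db: "D \<in> sets borel" using D by (rule borel_closed)
  note bd = R[OF \<mu> KD Db] R[OF \<nu> KD Db]
  note m = minimizesD(1)[OF \<mu>] minimizesD(1)[OF \<nu>]
  note fin = minimizer_finite[OF \<mu> KD] minimizer_finite[OF \<nu> KD]
  note mf = pos_def(1)[OF m bd fin]
  define a b c u v where "a = enn2real (mutual k \<mu> \<mu>)" and "b = enn2real (mutual k \<mu> \<nu>)" and "c = enn2real (mutual k \<nu> \<nu>)"
    and "u = (\<integral>x. U x \<partial>\<mu>)" and "v = (\<integral>x. U x \<partial>\<nu>)"
  have nn: "0 <= a" "0 <= b" "0 <= c" by (simp_all add: a_def b_def c_def)
  have e: "mutual k \<mu> \<mu> = ennreal a" "mutual k \<mu> \<nu> = ennreal b" "mutual k \<nu> \<nu> = ennreal c"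
    using fin mf by (simp_all add: a_def b_def c_def less_top)
  let ?mid = "mixture (1/2) \<mu> \<nu>"
  have mid: "borel_prob ?mid" "AE x in ?mid. x \<in> D"
    using m minimizesD(2)[OF \<mu>] minimizesD(2)[OF \<nu>] Db by (auto intro!: borel_prob_mixture AE_mixture)
  have "mutual k ?mid ?mid = ennreal (1/4 * a + 1/2 * b + 1/4 * c)"
  proof -
    have q: "ennreal ((1 - 1/2)^2) * ennreal a = ennreal (1/4 * a)" "ennreal (2 * (1/2) * (1 - 1/2)) * ennreal b = ennreal (1/2 * b)"
      "ennreal ((1/2)^2) * ennreal c = ennreal (1/4 * c)"
      using nn by (subst ennreal_mult[symmetric]; simp add: power2_eq_square)+
    have "mutual k ?mid ?mid = ennreal (1/4 * a) + ennreal (1/2 * b) + ennreal (1/4 * c)"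
      unfolding q[symmetric] e[symmetric] by (rule mutual_mixture[OF k_meas k_even m]) auto
    also have "\<dots> = ennreal (1/4 * a + 1/2 * b + 1/4 * c)" using nn by (subst ennreal_plus[symmetric]; simp)+
    finally show ?thesis .
  qed
  hence mm: "mutual k ?mid ?mid = ennreal (1/4 * a + 1/2 * b + 1/4 * c)" .
  have "mutual k ?mid ?mid < \<infinity>" unfolding mm by simp
  moreover have "enn2real (mutual k ?mid ?mid) = 1/4 * a + 1/2 * b + 1/4 * c"
    unfolding mm by (rule enn2real_ennreal) (use nn in simp)
  moreover have "(\<integral>x. U x \<partial>?mid) = (1 - 1/2) * u + 1/2 * v"
    unfolding u_def v_def by (rule integral_mixture[OF m _ _ U_meas U_bd]) auto
  ultimately have "ext_energy k U ?mid = ereal ((1/4 * a + 1/2 * b + 1/4 * c) / 2 + ((1 - 1/2) * u + 1/2 * v))"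
    by (simp add: ext_energy_real)
  moreover have "ext_energy k U \<mu> = ereal (a / 2 + u)" "ext_energy k U \<nu> = ereal (c / 2 + v)"
    using fin by (simp_all add: ext_energy_real a_def c_def u_def v_def)
  ultimately have "a / 2 + u <= (1/4 * a + 1/2 * b + 1/4 * c) / 2 + ((1 - 1/2) * u + 1/2 * v)"
      "c / 2 + v <= (1/4 * a + 1/2 * b + 1/4 * c) / 2 + ((1 - 1/2) * u + 1/2 * v)"
    using minimizesD(3)[OF \<mu> mid] minimizesD(3)[OF \<nu> mid] by simp_all
  hence "a + c <= 2 * b" by (simp add: field_simps)
  thus ?thesis using pos_def(2)[OF m bd fin] by (simp add: a_def b_def c_def)
qed

end

section \<open>Translation from extended-real energies\<close>

text \<open>
By the Lindelof property the union of all open null sets is null.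
\<close>

lemma AE_measure_support:
  fixes \<mu> :: "'a::euclidean_space measure"
  assumes m: "borel_prob \<mu>"
  shows "AE x in \<mu>. x \<in> measure_support \<mu>"
proof -
  define \<F> where "\<F> = {A :: 'a set. open A & emeasure \<mu> A = 0}"
  obtain \<G> where G: "\<G> \<subseteq> \<F>" "countable \<G>" "\<Union>\<G> = \<Union>\<F>"
    by (rule Lindelof[of \<F>]) (auto simp: \<F>_def)
  have "(\<Union>A\<in>\<G>. A) \<in> null_sets \<mu>"
  proof (rule null_sets_UN'[OF G(2)])
    fix A assume "A \<in> \<G>"
    hence "open A" "emeasure \<mu> A = 0" using G(1) by (auto simp: \<F>_def)
    thus "A \<in> null_sets \<mu>" using borel_probD(2)[OF m] by (intro null_setsI) auto
  qed
  hence "AE x in \<mu>. x \<notin> \<Union>\<F>" using G(3) by (intro AE_not_in) simp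
  thus ?thesis by eventually_elim (auto simp: measure_support_def \<F>_def zero_less_iff_neq_zero)
qed

lemma measure_support_subset:
  fixes \<mu> :: "'a::euclidean_space measure"
  assumes m: "borel_prob \<mu>" and A: "closed A" "AE x in \<mu>. x \<in> A"
  shows "measure_support \<mu> \<subseteq> A"
proof
  fix x assume x: "x \<in> measure_support \<mu>"
  have "emeasure \<mu> (- A) = 0"
    using A borel_probD(2,4)[OF m] by (subst AE_iff_measurable[of "- A" \<mu> "%x. x \<in> A", symmetric]) auto
  thus "x \<in> A" using x A(1) open_Compl[of A] by (force simp: measure_support_def)
qed

lemma closed_measure_support: "closed (measure_support \<mu>)"
  unfolding closed_def
proof (subst open_subopen, rule ballI)
  fix x assume "x \<in> - measure_support \<mu>"
  thus "\<exists>T. open T & x \<in> T & T \<subseteq> - measure_support \<mu>" unfolding measure_support_def by blast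
qed

lemma compact_measure_support:
  fixes \<mu> :: "'a::euclidean_space measure"
  assumes m: "borel_prob \<mu>" and A: "AE x in \<mu>. norm x < R"
  shows "compact (measure_support \<mu>)"
proof -
  have "AE x in \<mu>. x \<in> cball 0 R" using A by eventually_elim simp
  hence "measure_support \<mu> \<subseteq> cball 0 R" by (intro measure_support_subset[OF m]) auto
  hence "bounded (measure_support \<mu>)" by (rule bounded_subset[OF bounded_cball])
  thus ?thesis using closed_measure_support by (simp add: compact_eq_bounded_closed)
qed

lemma prob_measures_on_iff:
  fixes D :: "'a::euclidean_space set"
  assumes "closed D"
  shows "\<mu> \<in> prob_measures_on D \<longleftrightarrow> borel_prob \<mu> & (AE x in \<mu>. x \<in> D)"
proof
  assume l: "\<mu> \<in> prob_measures_on D"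
  hence m: "borel_prob \<mu>" by (simp add: prob_measures_on_def borel_prob_def)
  have "AE x in \<mu>. x \<in> D" using AE_measure_support[OF m] by eventually_elim (use l in \<open>auto simp: prob_measures_on_def\<close>)
  thus "borel_prob \<mu> & (AE x in \<mu>. x \<in> D)" using m by simp
next
  assume "borel_prob \<mu> & (AE x in \<mu>. x \<in> D)"
  thus "\<mu> \<in> prob_measures_on D" using measure_support_subset[OF _ assms] by (auto simp: prob_measures_on_def borel_prob_def)
qed

text \<open>
In the epigraph case the boundary function is continuous along the projection to the remaining coordinates.
\<close>

lemma closed_domain:
  fixes D :: "(real^'n::{finite,linorder}) set"
  assumes "D = UNIV \<or> half_line_domain D \<or> epigraph_domain D"
  shows "closed D"
proof -
  have "closed D" if ep: "epigraph_domain D"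
  proof -
    have "\<exists>\<Phi>. continuous_map hat_space euclideanreal \<Phi> & D = {x. x $ last_index >= \<Phi> (hat x)}"
      using ep unfolding epigraph_domain_def by (rule conjunct2)
    then obtain \<Phi> where \<Phi>: "continuous_map hat_space euclideanreal \<Phi>" and D: "D = {x. x $ last_index >= \<Phi> (hat x)}"
      by (elim exE conjE) (rule that)
    have "continuous_map euclidean hat_space (hat :: real^'n::{finite,linorder} => _)"
      unfolding hat_space_def continuous_map_componentwise
      by (auto simp: hat_def extensional_def restrict_def intro!: continuous_intros)
    hence "continuous_map euclidean euclideanreal (\<Phi> \<circ> hat)" using \<Phi> by (rule continuous_map_compose)
    hence "continuous_on UNIV (%x. \<Phi> (hat x))" by (simp add: o_def)
    thus ?thesis unfolding D by (intro closed_Collect_le continuous_intros)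
  qed
  moreover have "closed D" if "half_line_domain D"
    using that unfolding half_line_domain_def by (auto intro!: closed_Collect_le continuous_intros)
  ultimately show ?thesis using assms by auto
qed

lemma eintegral_nonneg: "(!!x. 0 <= g x) ==> eintegral \<mu> g = enn2ereal (\<integral>\<^sup>+x. e2ennreal (g x) \<partial>\<mu>)"
  by (simp add: eintegral_def e2ennreal_neg zero_ennreal.rep_eq)

text \<open>
For bounded integrands both parts are finite and the extended integral is the ordinary one.
\<close>

lemma eintegral_bounded:
  assumes m: "borel_prob \<mu>" and U: "U \<in> borel_measurable borel" "!!x. \<bar>U x\<bar> <= B"
  shows "eintegral \<mu> (%x. ereal (U x)) = ereal (\<integral>x. U x \<partial>\<mu>)"
proof -
  interpret prob_space \<mu> using m by (rule borel_probD)
  have i: "integrable \<mu> U" by (rule integrable_const_bound[of _ B]) (use U borel_prob_meas[OF m U(1)] in auto)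
  have fin: "(\<integral>\<^sup>+x. ennreal (g x) \<partial>\<mu>) < \<infinity>" if "!!x. g x <= B" for g
    by (rule le_less_trans[OF nn_integral_le_of_AE_le[OF m, of _ "ennreal B"]]) (auto intro: ennreal_leI that)
  have "(\<integral>\<^sup>+x. ennreal (U x) \<partial>\<mu>) < \<infinity>" "(\<integral>\<^sup>+x. ennreal (- U x) \<partial>\<mu>) < \<infinity>"
    using fin[of U] fin[of "%x. - U x"] U(2) by (simp_all add: abs_le_iff)
  moreover define a b where "a = enn2real (\<integral>\<^sup>+x. ennreal (U x) \<partial>\<mu>)" and "b = enn2real (\<integral>\<^sup>+x. ennreal (- U x) \<partial>\<mu>)"
  ultimately have "(\<integral>\<^sup>+x. ennreal (U x) \<partial>\<mu>) = ennreal a" "(\<integral>\<^sup>+x. ennreal (- U x) \<partial>\<mu>) = ennreal b" "0 <= a" "0 <= b"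
    by (simp_all add: less_top)
  thus ?thesis unfolding eintegral_def real_lebesgue_integral_def[OF i] by (simp add: enn2ereal_ennreal)
qed

lemma potential_conv_eq_pot:
  assumes "!!x. 0 <= W x"
  shows "potential_conv W \<mu> x = enn2ereal (pot (%x. e2ennreal (W x)) \<mu> x)"
  unfolding potential_conv_def pot_def by (rule eintegral_nonneg) (rule assms)

lemma energy_eq_ext_energy:
  assumes W: "!!x. 0 <= W x" and m: "borel_prob \<mu>" and U: "U \<in> borel_measurable borel" "!!x. \<bar>U x\<bar> <= B"
  shows "energy W (%x. ereal (U x)) \<mu> = ext_energy (%x. e2ennreal (W x)) U \<mu>"
proof -
  have "eintegral \<mu> (%x. eintegral \<mu> (%y. W (x - y))) = enn2ereal (mutual (%x. e2ennreal (W x)) \<mu> \<mu>)"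
    unfolding potential_conv_def[symmetric] potential_conv_eq_pot[OF W] mutual_def by (subst eintegral_nonneg) simp_all
  thus ?thesis unfolding energy_def ext_energy_def eintegral_bounded[OF m U] by simp
qed

lemma bounded_of_limit_at_infinity:
  fixes U :: "'a::euclidean_space => real"
  assumes U: "continuous_on UNIV U" and lim: "(U \<longlongrightarrow> l) at_infinity"
  obtains B where "!!x. \<bar>U x\<bar> <= B"
proof -
  have "eventually (%x. dist (U x) l < 1) at_infinity" using lim by (rule tendstoD) simp
  then obtain r where r: "!!x. r <= norm x ==> dist (U x) l < 1" by (auto simp: eventually_at_infinity)
  have "compact (U ` cball 0 r)" by (intro compact_continuous_image continuous_on_subset[OF U]) auto
  from compact_imp_bounded[OF this] obtain b where "\<forall>y\<in>U ` cball 0 r. norm y <= b" unfolding bounded_iff by blast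
  hence b: "!!x. x \<in> cball 0 r ==> \<bar>U x\<bar> <= b" by auto
  have "\<bar>U x\<bar> <= max b (\<bar>l\<bar> + 1)" for x
  proof (cases "norm x <= r")
    case True thus ?thesis using b[of x] by simp
  next
    case False thus ?thesis using r[of x] by (simp add: dist_real_def)
  qed
  thus thesis by (rule that)
qed

lemma power_bounds_constant:
  assumes "power_bounds S p w"
  obtains C where "0 <= C" "!!C' x. C <= C' ==> x \<in> S ==> \<bar>w x\<bar> <= C' * norm x powr p"
    "!!C' x i. C <= C' ==> x \<in> S ==> \<bar>partial_deriv i w x\<bar> <= C' * norm x powr (p - 1)"
    "!!C' x. C <= C' ==> x \<in> S ==> \<bar>laplacian w x\<bar> <= C' * norm x powr (p - 2)"
proof -
  obtain C where C: "!!x. x \<in> S ==> \<bar>w x\<bar> <= C * norm x powr p"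
    "!!x. x \<in> S ==> norm (gradient w x) <= C * norm x powr (p - 1)"
    "!!x. x \<in> S ==> \<bar>laplacian w x\<bar> <= C * norm x powr (p - 2)"
    using assms unfolding power_bounds_def by blast
  have up: "C * norm x powr r <= C' * norm x powr r" if "max 0 C <= C'" for C' x r
    using that by (intro mult_right_mono) auto
  have "\<bar>partial_deriv i w x\<bar> <= norm (gradient w x)" for i x
    using component_le_norm_cart[of "gradient w x" i] by (simp add: gradient_def)
  thus thesis using C up by (intro that[of "max 0 C"]) (simp, blast intro: order_trans, blast intro: order_trans, blast intro: order_trans)
qed

text \<open>
Since W is nonnegative, one constant serves for both C1 and C2; taking it positive covers the points where W is infinite.
\<close>

lemma ball_average_bound:
  fixes W :: "'a::euclidean_space => ereal"
  assumes W1: "W1 W" and W: "!!x. 0 <= W x"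
  shows "\<exists>K. \<forall>x r. norm x < R --> 0 < r --> r < 1 -->
    (\<integral>\<^sup>+y\<in>ball x r. e2ennreal (W y) \<partial>lborel) <= ennreal K * (1 + e2ennreal (W x)) * emeasure lborel (ball x r)"
proof -
  have "0 < max R 1" by simp
  then obtain C1 C2 where C: "!!x r. norm x < max R 1 ==> 0 < r ==> r < 1 ==>
      eintegral (restrict_space lborel (ball x r)) W / ereal (measure lborel (ball x r)) <= ereal C1 + ereal C2 * W x"
    using W1 unfolding W1_def by meson
  define K where "K = max 1 (max C1 C2)"
  have "(\<integral>\<^sup>+y\<in>ball x r. e2ennreal (W y) \<partial>lborel) <= ennreal K * (1 + e2ennreal (W x)) * emeasure lborel (ball x r)"
    if x: "norm x < R" and r: "0 < r" "r < 1" for x r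
  proof -
    define b where "b = measure lborel (ball x r)"
    have b: "0 < b" unfolding b_def using r by (simp add: content_ball_pos)
    have be: "emeasure lborel (ball x r) = ennreal b"
      unfolding b_def using emeasure_lborel_ball_finite[of x r] by (intro emeasure_eq_ennreal_measure) (simp add: less_top)
    define I where "I = (\<integral>\<^sup>+y\<in>ball x r. e2ennreal (W y) \<partial>lborel)"
    have "eintegral (restrict_space lborel (ball x r)) W = enn2ereal I"
      unfolding I_def by (subst eintegral_nonneg[OF W]) (simp add: nn_integral_restrict_space)
    hence "enn2ereal I / ereal b <= ereal C1 + ereal C2 * W x" using C[of x r] x r by (simp add: b_def)
    hence I: "enn2ereal I <= ereal b * (ereal C1 + ereal C2 * W x)" using b by (subst (asm) ereal_divide_le_pos) auto
    show ?thesis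
    proof (cases "W x")
      case (real v)
      have v: "0 <= v" using W[of x] real by simp
      have "C1 + C2 * v <= K + K * v" using v by (intro add_mono mult_right_mono) (auto simp: K_def)
      hence "b * (C1 + C2 * v) <= b * (K * (1 + v))" using b by (intro mult_left_mono) (auto simp: distrib_left)
      moreover have "enn2ereal I <= ereal (b * (C1 + C2 * v))" using I real by simp
      ultimately have "enn2ereal I <= ereal (b * (K * (1 + v)))" by (meson ereal_less_eq(3) order_trans)
      hence "e2ennreal (enn2ereal I) <= e2ennreal (ereal (b * (K * (1 + v))))" by (rule e2ennreal_mono)
      hence "I <= ennreal (b * (K * (1 + v)))" by simp
      also have "ennreal (b * (K * (1 + v))) = ennreal b * ennreal (K * (1 + v))"
        by (rule ennreal_mult) (use b v in \<open>auto simp: K_def\<close>)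
      also have "ennreal (K * (1 + v)) = ennreal K * ennreal (1 + v)"
        by (rule ennreal_mult) (use v in \<open>auto simp: K_def\<close>)
      also have "ennreal b * (ennreal K * ennreal (1 + v)) = ennreal K * ennreal (1 + v) * ennreal b" by (rule mult.commute)
      also have "ennreal (1 + v) = 1 + ennreal v" using v by simp
      finally show ?thesis by (simp add: I_def be real)
    next
      case PInf
      have "ennreal K * top * ennreal b = top" using b by (simp add: K_def ennreal_mult_top ennreal_top_mult)
      thus ?thesis by (simp add: be PInf)
    qed (use W[of x] in simp)
  qed
  thus ?thesis by blast
qed

text \<open>
Everything needed about W is collected here; the two constants of the power bounds are replaced by their maximum.
\<close>

lemma essentially_convex_kernel:
  fixes W :: "real^'n::finite => ereal"
  assumes ec: "essentially_convex W" and W: "!!x. 0 <= W x"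
  obtains w b a C where "repulsive_kernel w b a C (%x. e2ennreal (W x))" "kernel (%x. e2ennreal (W x))"
proof -
  let ?k = "%x. e2ennreal (W x)"
  obtain w b a where w: "!!x. x ~= 0 ==> W x = ereal (w x)" and C2: "C2_on (- {0}) w"
    and lap: "!!x. x ~= 0 ==> laplacian w x > 0"
    and b: "- real CARD('n) < b" "power_bounds {x. 0 < norm x & norm x < 1} b w"
    and a: "a < min (2 - real CARD('n)) 0" "power_bounds {x. 1 <= norm x} a w"
    and W0: "W0 W" and W1: "W1 W"
    using ec unfolding essentially_convex_def by blast
  obtain Cb where Cb: "0 <= Cb" "!!C' x. Cb <= C' ==> x \<in> {x. 0 < norm x & norm x < 1} ==> \<bar>w x\<bar> <= C' * norm x powr b"
    "!!C' x i. Cb <= C' ==> x \<in> {x. 0 < norm x & norm x < 1} ==> \<bar>partial_deriv i w x\<bar> <= C' * norm x powr (b - 1)"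
    "!!C' x. Cb <= C' ==> x \<in> {x. 0 < norm x & norm x < 1} ==> \<bar>laplacian w x\<bar> <= C' * norm x powr (b - 2)"
    by (rule power_bounds_constant[OF b(2)]) (rule that)
  obtain Ca where Ca: "0 <= Ca" "!!C' x. Ca <= C' ==> x \<in> {x. 1 <= norm x} ==> \<bar>w x\<bar> <= C' * norm x powr a"
    "!!C' x i. Ca <= C' ==> x \<in> {x. 1 <= norm x} ==> \<bar>partial_deriv i w x\<bar> <= C' * norm x powr (a - 1)"
    "!!C' x. Ca <= C' ==> x \<in> {x. 1 <= norm x} ==> \<bar>laplacian w x\<bar> <= C' * norm x powr (a - 2)"
    by (rule power_bounds_constant[OF a(2)]) (rule that)
  define C where "C = max Cb Ca"
  have C: "0 <= C" "Cb <= C" "Ca <= C" using Ca(1) by (auto simp: C_def)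
  have kw: "?k x = ennreal (w x)" if "x ~= 0" for x using w[OF that] by simp
  have w0: "0 <= w x" if "x ~= 0" for x using W[of x] w[OF that] by simp
  have even: "W (- x) = W x" for x using W0 unfolding W0_def by metis
  have w_even: "w (- z) = w z" for z
  proof (cases "z = 0")
    case False
    hence "ereal (w (- z)) = ereal (w z)" using w[of z] w[of "- z"] even[of z] by simp
    thus ?thesis by simp
  qed simp
  have contW: "continuous_on UNIV W"
  proof (rule continuous_at_imp_continuous_on, rule ballI)
    fix x :: "real^'n"
    show "isCont W x"
    proof (cases "x = 0")
      case True thus ?thesis using W1 by (simp add: isCont_def W1_def)
    next
      case False
      have "continuous_on (- {0}) W" using W1 by (simp add: W1_def)
      thus ?thesis using False by (simp add: continuous_on_eq_continuous_at open_Compl)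
    qed
  qed
  have kc: "continuous_on UNIV ?k" by (rule continuous_on_compose2[OF continuous_on_e2ennreal[of UNIV] contW]) simp
  have km: "?k \<in> borel_measurable borel" using kc by (rule borel_measurable_continuous_onI)
  interpret S: singular_kernel w b a C
  proof unfold_locales
    show "C2_on (- {0}) w" "!!x. x ~= 0 ==> 0 < laplacian w x" by (rule C2, rule lap)
    show "- real CARD('n) < b" "a < 2 - real CARD('n)" "a < 0" "0 <= C" using a b C by auto
    show "\<bar>w z\<bar> <= C * norm z powr b" "\<bar>partial_deriv i w z\<bar> <= C * norm z powr (b - 1)" "\<bar>laplacian w z\<bar> <= C * norm z powr (b - 2)"
      if "0 < norm z" "norm z < 1" for z i using Cb(2-4)[OF C(2), of z] that by auto
    show "\<bar>w z\<bar> <= C * norm z powr a" "\<bar>partial_deriv i w z\<bar> <= C * norm z powr (a - 1)" "\<bar>laplacian w z\<bar> <= C * norm z powr (a - 2)"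
      if "1 <= norm z" for z i using Ca(2-4)[OF C(3), of z] that by auto
  qed
  have rk: "repulsive_kernel w b a C ?k"
  proof unfold_locales
    show "w (- z) = w z" for z by (rule w_even)
    show "continuous_on UNIV ?k" by (rule kc)
    show "?k (- x) = ?k x" for x by (simp add: even)
    show "?k x = ennreal (w x)" "0 <= w x" if "x ~= 0" for x using that by (auto intro: kw w0)
    show "\<exists>K. \<forall>x r. norm x < R --> 0 < r --> r < 1 -->
      (\<integral>\<^sup>+y\<in>ball x r. ?k y \<partial>lborel) <= ennreal K * (1 + ?k x) * emeasure lborel (ball x r)" for R
      by (rule ball_average_bound[OF W1 W])
  qed
  have kb: "kernel_base ?k"
  proof unfold_locales
    show "continuous_on UNIV ?k" by (rule kc)
    show "?k (- x) = ?k x" for x by (simp add: even)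
    show "(\<integral>\<^sup>+x\<in>cball 0 R. ?k x \<partial>lborel) < \<infinity>" for R
    proof -
      have "(\<integral>\<^sup>+x\<in>cball 0 R. e2ennreal \<bar>W x\<bar> \<partial>lborel) < \<infinity>"
        using W0 unfolding W0_def locally_integrable_def by (meson compact_cball)
      thus ?thesis using W by simp
    qed
    show "(\<integral>\<^sup>+x\<in>cball 0 1. ?k x \<partial>lborel) > 0" by (rule S.not_locally_zero[OF km kc kw w0])
    show "(?k \<longlongrightarrow> 0) at_infinity"
    proof (rule tendsto_sandwich[where f="%_. 0" and h="%x. ennreal (C * norm x powr a)"])
      have "((%x::real^'n. C * norm x powr a) \<longlongrightarrow> C * 0) at_infinity"
        using S.q by (intro tendsto_mult tendsto_const tendsto_neg_powr filterlim_at_infinity_imp_norm_at_top filterlim_ident)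
      thus "((%x::real^'n. ennreal (C * norm x powr a)) \<longlongrightarrow> 0) at_infinity" using tendsto_ennrealI by fastforce
      show "eventually (%x. ?k x <= ennreal (C * norm x powr a)) at_infinity"
        unfolding eventually_at_infinity
      proof (intro exI[of _ 1] allI impI)
        fix x :: "real^'n" assume x: "1 <= norm x"
        hence "x ~= 0" by auto
        thus "?k x <= ennreal (C * norm x powr a)" using S.far(1)[OF x] by (simp add: kw ennreal_leI)
      qed
    qed auto
  qed
  have "kernel ?k"
  proof (intro kernel.intro kb kernel_axioms.intro)
    fix P B h x0
    assume P: "compact P" "density_on B P h" "x0 \<notin> P" "!!x. pot ?k (dens h) x <= pot ?k (dens h) x0"
    show "pot ?k (dens h) x0 = 0"
      by (rule S.potential_no_exterior_maximum[OF km kw w0 kernel_base.pot_dens_finite[OF kb P(2) compact_imp_bounded[OF P(1)]] P])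
  qed
  thus thesis using rk by (intro that)
qed

theorem theorem1p15:
  fixes W :: "real^'n::{finite,linorder} \<Rightarrow> ereal"
    and U :: "real^'n::{finite,linorder} \<Rightarrow> real"
    and Uinf :: real
    and D S :: "(real^'n::{finite,linorder}) set"
    and \<rho> :: "(real^'n::{finite,linorder}) measure"
  assumes "essentially_convex W"
    and "\<forall>x. W x \<ge> 0"
    and "U0 (\<lambda>x. ereal (U x))"
    and "continuous_on UNIV U"
    and "(U \<longlongrightarrow> Uinf) at_infinity"
    and "D = UNIV \<or> half_line_domain D \<or> epigraph_domain D"
    and "\<rho> \<in> prob_measures_on D"
    and "compact (measure_support \<rho>)"
    and "is_locally_integrable_function \<rho>"
    and "open S"
    and "frontier S \<in> null_sets lborel"
    and "measure_support \<rho> = closure S"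
    and "continuous_on UNIV (potential_conv W \<rho>)"
    and "(SUP x\<in>S. generated_potential W (\<lambda>x. ereal (U x)) \<rho> x) < ereal Uinf"
  shows "(\<exists>!\<mu>. is_energy_minimizer W (\<lambda>x. ereal (U x)) D \<mu>) \<and>
         (\<forall>\<mu>. is_energy_minimizer W (\<lambda>x. ereal (U x)) D \<mu> \<longrightarrow> compact (measure_support \<mu>))"
proof -
  note ec = assms(1) and Ucont = assms(4) and Ulim = assms(5) and \<rho>D = assms(7) and compK = assms(8)
    and dens\<rho> = assms(9) and supp = assms(12) and contV = assms(13) and V = assms(14)
  have W: "0 <= W x" for x using assms(2) by simp
  define k where "k = (%x. e2ennreal (W x))"
  obtain w b a C where rk: "repulsive_kernel w b a C k" and kk: "kernel k"
    by (rule essentially_convex_kernel[OF ec W, folded k_def]) (rule that)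
  interpret R: repulsive_kernel w b a C k by (rule rk)
  have Dc: "closed D" by (rule closed_domain[OF assms(6)])
  obtain B where B: "!!x. \<bar>U x\<bar> <= B" using bounded_of_limit_at_infinity[OF Ucont Ulim] by blast
  have Um: "U \<in> borel_measurable borel" using Ucont by (rule borel_measurable_continuous_onI)
  obtain f where f: "!!x. 0 <= f x" "locally_integrable (%x. ereal (f x))" "\<rho> = dens f"
    using dens\<rho> unfolding is_locally_integrable_function_def by blast
  have fm: "f \<in> borel_measurable borel"
  proof -
    have "(%x. real_of_ereal (ereal (f x))) \<in> borel_measurable borel"
      using f(2) unfolding locally_integrable_def by (intro borel_measurable_real_of_ereal) simp
    thus ?thesis by simp
  qed
  have bp: "borel_prob \<rho>" using \<rho>D prob_measures_on_iff[OF Dc] by blast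
  obtain z where z: "(SUP x\<in>S. generated_potential W (%x. ereal (U x)) \<rho> x) < ereal z" "ereal z < ereal Uinf"
    using ereal_dense2[OF V] by blast
  define K where "K = measure_support \<rho>"
  have pc: "potential_conv W \<rho> x = enn2ereal (pot k \<rho> x)" for x unfolding k_def by (rule potential_conv_eq_pot[OF W])
  have "closed {x. potential_conv W \<rho> x <= ereal (z - U x)}"
    by (intro closed_Collect_le contV continuous_on_ereal continuous_intros Ucont)
  moreover have "S \<subseteq> {x. potential_conv W \<rho> x <= ereal (z - U x)}"
  proof
    fix x assume "x \<in> S"
    hence "potential_conv W \<rho> x + ereal (U x) <= (SUP x\<in>S. generated_potential W (%x. ereal (U x)) \<rho> x)"
      by (intro SUP_upper2[of x]) (simp_all add: generated_potential_def)
    hence "potential_conv W \<rho> x + ereal (U x) <= ereal z" using z(1) by (meson le_less_trans less_imp_le)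
    thus "x \<in> {x. potential_conv W \<rho> x <= ereal (z - U x)}" by (cases "potential_conv W \<rho> x") auto
  qed
  ultimately have "K \<subseteq> {x. potential_conv W \<rho> x <= ereal (z - U x)}" unfolding K_def supp by (intro closure_minimal)
  hence low: "enn2ereal (pot k \<rho> x) <= ereal (z - U x)" if "x \<in> K" for x using that by (auto simp: pc)
  interpret P: attractive_island k U B Uinf "Uinf - z" K D f
  proof (intro attractive_island.intro kk attractive_island_axioms.intro)
    show "continuous_on UNIV U" "!!x. \<bar>U x\<bar> <= B" "(U \<longlongrightarrow> Uinf) at_infinity" by (rule Ucont, rule B, rule Ulim)
    show "0 < Uinf - z" using z(2) by simp
    show "compact K" "K \<subseteq> D" "closed D" "f \<in> borel_measurable borel"
      using compK \<rho>D Dc fm by (auto simp: K_def prob_measures_on_def)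
    show "borel_prob (dens f)" "AE x in dens f. x \<in> K"
      using bp AE_measure_support[OF bp] unfolding K_def f(3) by auto
    show "pot k (dens f) x < \<infinity>" "enn2real (pot k (dens f) x) + U x <= Uinf - (Uinf - z)" if x: "x \<in> K" for x
    proof -
      have l: "enn2ereal (pot k (dens f) x) <= ereal (z - U x)" using low[OF x] by (simp add: f(3))
      show "pot k (dens f) x < \<infinity>" "enn2real (pot k (dens f) x) + U x <= Uinf - (Uinf - z)"
        using l by (cases "pot k (dens f) x" rule: ennreal_cases; simp add: enn2ereal_ennreal)+
    qed
  qed (rule R.interaction_strictly_positive_definite; assumption)+
  have eq: "is_energy_minimizer W (%x. ereal (U x)) D \<mu> \<longleftrightarrow> minimizes k U D \<mu>" for \<mu>
    unfolding is_energy_minimizer_def minimizes_def k_def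
    using energy_eq_ext_energy[OF W _ Um B] by (auto simp: prob_measures_on_iff[OF Dc] Ball_def)
  obtain R where R: "!!A \<mu>. minimizes k U A \<mu> ==> K \<subseteq> A ==> A \<in> sets borel ==> AE x in \<mu>. norm x < R"
    by (rule P.minimizers_uniformly_bounded) (rule that)
  have "compact (measure_support \<mu>)" if "minimizes k U D \<mu>" for \<mu>
    using R[OF that P.KD borel_closed[OF Dc]] by (rule compact_measure_support[OF minimizesD(1)[OF that]])
  thus ?thesis unfolding eq using P.minimizer_exists P.minimizer_unique by blast
qed

end
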